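(* For every $h\in\Gamma(Herm^+(E))$, the exponential map $Exp_h:\Gamma(Herm(E))\to\Gamma(Herm^+(E))$ of the $L^2$ metric $(\cdot,\cdot)^\alpha$ is a diffeomorphism.
   Context: $M$ is a closed, oriented, smooth manifold, $E\to M$ a smooth complex vector bundle of rank $r$, $g$ a fixed smooth Riemannian metric on $M$ with volume form $\mu_g$, and $\alpha:M\to\mathbb{R}$ a fixed smooth function with $\alpha>-1/r$. $Herm(E)$ is the real vector bundle whose fiber at $x$ is the space $Herm(E_x)$ of Hermitian sesquilinear forms on $E_x$ (linear in the first, conjugate-linear in the second argument), and $Herm^+(E)$ the open subbundle of positive definite forms; $\Gamma(\cdot)$ denotes smooth sections. For $h\in\Gamma(Herm^+(E))$, $v\in\Gamma(Herm(E))$, $h^{-1}v\in\Gamma(End(E))$ is defined by $v(a,b)=h(a,(h^{-1}v)b)$. $\Gamma(Herm(E))$ is a Fréchet space with the $C^\infty$ topology and $\Gamma(Herm^+(E))$ is an open convex cone in it, with tangent spaces identified with $\Gamma(Herm(E))$. The $L^2$ metric is the weak Riemannian metric $(v,w)_h^\alpha=\int_M\big(tr(h^{-1}vh^{-1}w)+\alpha\,tr(h^{-1}v)\,tr(h^{-1}w)\big)\mu_g$. Geodesics are solutions of $\ddot\gamma=B_\gamma(\dot\gamma,\dot\gamma)$ where the metric spray $B$ is the smooth map, symmetric bilinear in $(v,w)$, determined by $(B_h(v,v),l)_h^\alpha=\frac12D(v,v)_h^\alpha(l)-D(v,l)_h^\alpha(v)$ for all $l$ ($D(\cdot,\cdot)_h^\alpha(l)$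 is the derivative in $h$ in direction $l$); the geodesic equation reads $\frac{d}{dt}(\gamma^{-1}\dot\gamma)=0$. $Exp_h(v)=\gamma(1)$ where $\gamma$ is the geodesic with $\gamma(0)=h$, $\dot\gamma(0)=v$. Smoothness and diffeomorphism are in the sense of Michal–Bastiani calculus on Fréchet spaces. *)

theory Defs
  imports "HOL-Analysis.Analysis" "HOL-Library.Function_Algebras"
begin

section \<open>Pointwise real vector space structure on functions\<close>

instantiation "fun" :: (type, scaleR) scaleR
begin
definition scaleR_fun_def: "c *\<^sub>R f = (\<lambda>x. c *\<^sub>R f x)"
instance ..
end

lemma scaleR_fun_apply [simp]: "(c *\<^sub>R f) x = c *\<^sub>R f x"
  by (simp add: scaleR_fun_def)

instance "fun" :: (type, real_vector) real_vector
  by standard (simp_all add: fun_eq_iff scaleR_add_right scaleR_add_left)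


section \<open>Michal--Bastiani calculus\<close>

text \<open>
  A locally convex space is given by a topology \<open>X\<close> on a linear subspace \<open>topspace X\<close> of a real
  vector space type; maps are considered on open subsets \<open>U\<close> of \<open>X\<close>.
\<close>

definition has_mb_deriv ::
  "'b topology \<Rightarrow> ('a::real_vector \<Rightarrow> 'b::real_vector) \<Rightarrow> 'a \<Rightarrow> 'a \<Rightarrow> 'b \<Rightarrow> bool" where
  "has_mb_deriv Y f x v d \<longleftrightarrow> limitin Y (\<lambda>t::real. (f (x + t *\<^sub>R v) - f x) /\<^sub>R t) d (at 0)"

definition mb_deriv ::
  "'b topology \<Rightarrow> ('a::real_vector \<Rightarrow> 'b::real_vector) \<Rightarrow> 'a \<Rightarrow> 'a \<Rightarrow> 'b" where
  "mb_deriv Y f x v = (THE d. has_mb_deriv Y f x v d)"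

primrec mb_iter ::
  "'b topology \<Rightarrow> ('a::real_vector \<Rightarrow> 'b::real_vector) \<Rightarrow> 'a list \<Rightarrow> 'a \<Rightarrow> 'b" where
  "mb_iter Y f [] = f"
| "mb_iter Y f (v # vs) = (\<lambda>x. mb_deriv Y (mb_iter Y f vs) x v)"

text \<open>
  All iterated directional derivatives \<open>d\<^sup>k f (x; v\<^sub>1, \<dots>, v\<^sub>k)\<close> exist and are jointly continuous on
  \<open>U \<times> X\<^sup>k\<close>.
\<close>

definition mb_smooth ::
  "'a topology \<Rightarrow> 'b topology \<Rightarrow> 'a set \<Rightarrow> ('a::real_vector \<Rightarrow> 'b::real_vector) \<Rightarrow> bool" where
  "mb_smooth X Y U f \<longleftrightarrow>
     f \<in> U \<rightarrow> topspace Y \<and>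
     (\<forall>vs. set vs \<subseteq> topspace X \<longrightarrow>
        (\<forall>x\<in>U. \<forall>v\<in>topspace X. \<exists>d. has_mb_deriv Y (mb_iter Y f vs) x v d)) \<and>
     (\<forall>k. continuous_map
        (prod_topology (subtopology X U) (product_topology (\<lambda>_. X) {..<k})) Y
        (\<lambda>(x, v). mb_iter Y f (map v [0..<k]) x))"

definition mb_diffeomorphism ::
  "'a topology \<Rightarrow> 'b topology \<Rightarrow> 'a set \<Rightarrow> 'b set \<Rightarrow> ('a::real_vector \<Rightarrow> 'b::real_vector) \<Rightarrow> bool"
where
  "mb_diffeomorphism X Y U V f \<longleftrightarrow>
     openin X U \<and> openin Y V \<and> bij_betw f U V \<and>
     mb_smooth X Y U f \<and> mb_smooth Y X V (inv_into U f)"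


section \<open>Calculus in coordinates\<close>

text \<open>
  Real \<open>n\<close>-space, for a number \<open>n \<ge> 0\<close>, is \<^term>\<open>Euclidean_space n\<close>, i.e. the sequences
  vanishing from index \<open>n\<close> on, with the topology induced by the one of the type
  \<^typ>\<open>nat \<Rightarrow> real\<close>; the coordinates are numbered \<open>0, \<dots>, n - 1\<close>.
\<close>

definition partial_deriv :: "nat \<Rightarrow> ((nat \<Rightarrow> real) \<Rightarrow> 'b::real_normed_vector) \<Rightarrow> (nat \<Rightarrow> real) \<Rightarrow> 'b" where
  "partial_deriv i f x = vector_derivative (\<lambda>t. f (x(i := t))) (at (x i))"

primrec partial_derivs ::
  "nat list \<Rightarrow> ((nat \<Rightarrow> real) \<Rightarrow> 'b::real_normed_vector) \<Rightarrow> (nat \<Rightarrow> real) \<Rightarrow> 'b" where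
  "partial_derivs [] f = f"
| "partial_derivs (i # is) f = partial_deriv i (partial_derivs is f)"

text \<open>For \<open>W\<close> open in \<^term>\<open>Euclidean_space n\<close>:\<close>

definition smooth_coord :: "nat \<Rightarrow> (nat \<Rightarrow> real) set \<Rightarrow> ((nat \<Rightarrow> real) \<Rightarrow> 'b::real_normed_vector) \<Rightarrow> bool"
where
  "smooth_coord n W f \<longleftrightarrow>
     (\<forall>is. set is \<subseteq> {..<n} \<longrightarrow>
        continuous_on W (partial_derivs is f) \<and>
        (\<forall>i<n. \<forall>x\<in>W. (\<lambda>t. partial_derivs is f (x(i := t))) differentiable at (x i)))"

text \<open>The Leibniz formula, as in the library definition of \<^const>\<open>det\<close>, for a size that is a number.\<close>

definition det_nat :: "nat \<Rightarrow> (nat \<Rightarrow> nat \<Rightarrow> real) \<Rightarrow> real" where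
  "det_nat n A = (\<Sum>p | p permutes {..<n}. of_int (sign p) * (\<Prod>i<n. A i (p i)))"

text \<open>Lebesgue measure of \<open>n\<close>-space (the unit point mass if \<open>n = 0\<close>).\<close>

definition lborel_coord :: "nat \<Rightarrow> (nat \<Rightarrow> real) measure" where
  "lborel_coord n = distr (\<Pi>\<^sub>M i\<in>{..<n}. lborel) borel (\<lambda>y i. if i < n then y i else 0)"


section \<open>Closed oriented manifolds\<close>

type_synonym 'm chart = "'m set \<times> ('m \<Rightarrow> nat \<Rightarrow> real)"

record 'm manifold =
  mdim :: nat
  atlas :: "'m chart set"

definition is_chart :: "nat \<Rightarrow> 'm::topological_space chart \<Rightarrow> bool" where
  "is_chart n = (\<lambda>(U, \<phi>). open U \<and> openin (Euclidean_space n) (\<phi> ` U) \<and>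
     homeomorphism U (\<phi> ` U) \<phi> (inv_into U \<phi>))"

definition transition :: "'m chart \<Rightarrow> 'm chart \<Rightarrow> (nat \<Rightarrow> real) \<Rightarrow> nat \<Rightarrow> real" where
  "transition c c' y = snd c' (inv_into (fst c) (snd c) y)"

text \<open>
  The manifold is the whole type; second countability follows from compactness. The smooth
  structure and the orientation are both given by an oriented atlas, which need not be maximal.
\<close>

definition closed_oriented_manifold :: "'m::t2_space manifold \<Rightarrow> bool" where
  "closed_oriented_manifold M \<longleftrightarrow>
     compact (UNIV :: 'm set) \<and>
     (\<forall>c\<in>atlas M. is_chart (mdim M) c) \<and>
     (\<Union>c\<in>atlas M. fst c) = UNIV \<and>
     (\<forall>c\<in>atlas M. \<forall>c'\<in>atlas M.
        (\<forall>k<mdim M. smooth_coord (mdim M) (snd c ` (fst c \<inter> fst c')) (\<lambda>y. transition c c' y k)) \<and>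
        (\<forall>y\<in>snd c ` (fst c \<inter> fst c').
           0 < det_nat (mdim M) (\<lambda>k i. partial_deriv i (\<lambda>y. transition c c' y k) y)))"

definition smooth_fun_on ::
  "'m manifold \<Rightarrow> 'm set \<Rightarrow> ('m \<Rightarrow> 'b::real_normed_vector) \<Rightarrow> bool" where
  "smooth_fun_on M S f \<longleftrightarrow>
     (\<forall>(U, \<phi>)\<in>atlas M. smooth_coord (mdim M) (\<phi> ` (S \<inter> U)) (f \<circ> inv_into U \<phi>))"

text \<open>
  A Riemannian metric as a symmetric, positive definite covariant tensor field of rank two:
  \<open>g c x i j\<close> is \<open>g\<^sub>x(\<partial>\<^sub>i, \<partial>\<^sub>j)\<close> for the coordinate vector fields of the chart \<open>c\<close>. The last condition
  is the tensor transformation law.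
\<close>

type_synonym 'm metric_coeffs = "'m chart \<Rightarrow> 'm \<Rightarrow> nat \<Rightarrow> nat \<Rightarrow> real"

definition riemannian_metric :: "'m manifold \<Rightarrow> 'm metric_coeffs \<Rightarrow> bool" where
  "riemannian_metric M g \<longleftrightarrow>
     (\<forall>c\<in>atlas M.
        (\<forall>i<mdim M. \<forall>j<mdim M. smooth_fun_on M (fst c) (\<lambda>x. g c x i j)) \<and>
        (\<forall>x\<in>fst c. \<forall>i<mdim M. \<forall>j<mdim M. g c x i j = g c x j i) \<and>
        (\<forall>x\<in>fst c. \<forall>\<xi>. (\<exists>i<mdim M. \<xi> i \<noteq> 0) \<longrightarrow>
           0 < (\<Sum>i<mdim M. \<Sum>j<mdim M. g c x i j * \<xi> i * \<xi> j))) \<and>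
     (\<forall>c\<in>atlas M. \<forall>c'\<in>atlas M. \<forall>x\<in>fst c \<inter> fst c'. \<forall>i<mdim M. \<forall>j<mdim M.
        g c x i j = (\<Sum>k<mdim M. \<Sum>l<mdim M.
          partial_deriv i (\<lambda>y. transition c c' y k) (snd c x) *
          partial_deriv j (\<lambda>y. transition c c' y l) (snd c x) * g c' x k l))"

text \<open>
  Partitions of unity are only required to be continuous, which is enough to integrate
  \<open>n\<close>-forms with continuous coefficients and gives the same integral as smooth ones.
\<close>

definition partition_of_unity ::
  "'m::topological_space manifold \<Rightarrow> nat \<Rightarrow> (nat \<Rightarrow> 'm chart) \<Rightarrow> (nat \<Rightarrow> 'm \<Rightarrow> real) \<Rightarrow> bool" where
  "partition_of_unity M N c \<rho> \<longleftrightarrow>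
     (\<forall>k<N. c k \<in> atlas M \<and> continuous_on UNIV (\<rho> k) \<and> (\<forall>x. 0 \<le> \<rho> k x) \<and>
        closure {x. \<rho> k x \<noteq> 0} \<subseteq> fst (c k)) \<and>
     (\<forall>x. (\<Sum>k<N. \<rho> k x) = 1)"

text \<open>
  The integral of \<open>f \<mu>\<^sub>g\<close>: in a positively oriented chart \<open>\<mu>\<^sub>g\<close> is \<open>sqrt (det g\<^sub>i\<^sub>j) dy\<^sub>0 \<and> \<dots> \<and> dy\<^sub>n\<^sub>-\<^sub>1\<close>. For
  continuous \<open>f\<close> the value does not depend on the chosen partition of unity.
\<close>

definition chart_integral :: "'m manifold \<Rightarrow> 'm metric_coeffs \<Rightarrow> 'm chart \<Rightarrow> ('m \<Rightarrow> real) \<Rightarrow> real" where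
  "chart_integral M g c f =
     (LINT y : snd c ` fst c | lborel_coord (mdim M).
        (let x = inv_into (fst c) (snd c) y in f x * sqrt (det_nat (mdim M) (g c x))))"

definition vol_integral ::
  "'m::topological_space manifold \<Rightarrow> 'm metric_coeffs \<Rightarrow> ('m \<Rightarrow> real) \<Rightarrow> real" where
  "vol_integral M g f =
     (let (N, c, \<rho>) = (SOME (N, c, \<rho>). partition_of_unity M N c \<rho>)
      in \<Sum>k<N. chart_integral M g (c k) (\<lambda>x. \<rho> k x * f x))"


section \<open>Complex vector bundles\<close>

text \<open>
  The fibers \<open>fiber E x\<close> are linear subspaces of one complex vector space, with scalar
  multiplication \<open>cscale E\<close> (no generality is lost: take the direct sum of all fibers). A local
  trivialization \<open>(W, \<tau>)\<close> consists of linear isomorphisms \<open>\<tau> x\<close> of \<open>fiber E x\<close>, \<open>x \<in> W\<close>, with the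
  standard complex space of dimension \<open>CARD('r)\<close>, the rank of the bundle.
\<close>

record ('m, 'v, 'r::finite) vector_bundle =
  cscale :: "complex \<Rightarrow> 'v \<Rightarrow> 'v"
  fiber :: "'m \<Rightarrow> 'v set"
  trivs :: "('m set \<times> ('m \<Rightarrow> 'v \<Rightarrow> complex ^ 'r)) set"

definition triv_frame ::
  "('m, 'v, 'r::finite) vector_bundle \<Rightarrow> ('m \<Rightarrow> 'v \<Rightarrow> complex ^ 'r) \<Rightarrow> 'r \<Rightarrow> 'm \<Rightarrow> 'v" where
  "triv_frame E \<tau> i x = inv_into (fiber E x) (\<tau> x) (axis i 1)"

definition complex_vector_bundle ::
  "'m::topological_space manifold \<Rightarrow> ('m, 'v::ab_group_add, 'r::finite) vector_bundle \<Rightarrow> bool" where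
  "complex_vector_bundle M E \<longleftrightarrow>
     vector_space (cscale E) \<and>
     (\<forall>x. module.subspace (cscale E) (fiber E x)) \<and>
     (\<Union>(W, \<tau>)\<in>trivs E. W) = UNIV \<and>
     (\<forall>(W, \<tau>)\<in>trivs E. open W \<and>
        (\<forall>x\<in>W. bij_betw (\<tau> x) (fiber E x) UNIV \<and>
          (\<forall>a\<in>fiber E x. \<forall>b\<in>fiber E x. \<tau> x (a + b) = \<tau> x a + \<tau> x b) \<and>
          (\<forall>z. \<forall>a\<in>fiber E x. \<tau> x (cscale E z a) = z *s \<tau> x a))) \<and>
     (\<forall>(W, \<tau>)\<in>trivs E. \<forall>(W', \<tau>')\<in>trivs E. \<forall>i j.
        smooth_fun_on M (W \<inter> W') (\<lambda>x. \<tau>' x (triv_frame E \<tau> j x) $ i))"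


section \<open>Sections of Hermitian forms\<close>

text \<open>
  Forms on \<open>fiber E x\<close> are extended by \<open>0\<close> to the type of vectors. Conjugate-linearity in the
  second argument follows from the first three conditions.
\<close>

definition herm_form :: "('m, 'v::ab_group_add, 'r::finite) vector_bundle \<Rightarrow> 'm \<Rightarrow> ('v \<Rightarrow> 'v \<Rightarrow> complex) set"
where
  "herm_form E x = {v.
     (\<forall>a\<in>fiber E x. \<forall>a'\<in>fiber E x. \<forall>b\<in>fiber E x. v (a + a') b = v a b + v a' b) \<and>
     (\<forall>z. \<forall>a\<in>fiber E x. \<forall>b\<in>fiber E x. v (cscale E z a) b = z * v a b) \<and>
     (\<forall>a\<in>fiber E x. \<forall>b\<in>fiber E x. v b a = cnj (v a b)) \<and>
     (\<forall>a b. a \<notin> fiber E x \<or> b \<notin> fiber E x \<longrightarrow> v a b = 0)}"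

definition pos_herm_form :: "('m, 'v::ab_group_add, 'r::finite) vector_bundle \<Rightarrow> 'm \<Rightarrow> ('v \<Rightarrow> 'v \<Rightarrow> complex) set"
where
  "pos_herm_form E x = {h\<in>herm_form E x. \<forall>a\<in>fiber E x. a \<noteq> 0 \<longrightarrow> 0 < Re (h a a)}"

type_synonym ('m, 'v) form_section = "'m \<Rightarrow> 'v \<Rightarrow> 'v \<Rightarrow> complex"

definition form_entry ::
  "('m, 'v, 'r::finite) vector_bundle \<Rightarrow> ('m \<Rightarrow> 'v \<Rightarrow> complex ^ 'r) \<Rightarrow> 'r \<Rightarrow> 'r \<Rightarrow>
   ('m, 'v) form_section \<Rightarrow> 'm \<Rightarrow> complex" where
  "form_entry E \<tau> i j v x = v x (triv_frame E \<tau> i x) (triv_frame E \<tau> j x)"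

definition Herm_sections ::
  "'m manifold \<Rightarrow> ('m, 'v::ab_group_add, 'r::finite) vector_bundle \<Rightarrow> ('m, 'v) form_section set" where
  "Herm_sections M E = {v. (\<forall>x. v x \<in> herm_form E x) \<and>
     (\<forall>(W, \<tau>)\<in>trivs E. \<forall>i j. smooth_fun_on M W (form_entry E \<tau> i j v))}"

definition pos_Herm_sections ::
  "'m manifold \<Rightarrow> ('m, 'v::ab_group_add, 'r::finite) vector_bundle \<Rightarrow> ('m, 'v) form_section set" where
  "pos_Herm_sections M E = {h\<in>Herm_sections M E. \<forall>x. h x \<in> pos_herm_form E x}"

text \<open>
  The \<open>C\<^sup>\<infinity>\<close> topology: generated by the seminorms that take the supremum over a compact set \<open>K\<close>,
  contained in the domains of a chart and a trivialization, of one partial derivative of one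
  matrix entry.
\<close>

definition Cinf_seminorms ::
  "'m::topological_space manifold \<Rightarrow> ('m, 'v, 'r::finite) vector_bundle \<Rightarrow> (('m, 'v) form_section \<Rightarrow> real) set"
where
  "Cinf_seminorms M E =
     {(\<lambda>v. SUP x\<in>K. norm (partial_derivs is (form_entry E \<tau> i j v \<circ> inv_into U \<phi>) (\<phi> x)))
      | U \<phi> W \<tau> K is i j.
        (U, \<phi>) \<in> atlas M \<and> (W, \<tau>) \<in> trivs E \<and> compact K \<and> K \<noteq> {} \<and> K \<subseteq> U \<inter> W \<and>
        set is \<subseteq> {..<mdim M}}"

definition Cinf_topology ::
  "'m::topological_space manifold \<Rightarrow> ('m, 'v::ab_group_add, 'r::finite) vector_bundle \<Rightarrow>
   ('m, 'v) form_section topology" where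
  "Cinf_topology M E = topology_generated_by
     {{w\<in>Herm_sections M E. p (w - v) < \<epsilon>} | v p \<epsilon>.
        v \<in> Herm_sections M E \<and> p \<in> Cinf_seminorms M E \<and> 0 < \<epsilon>}"


section \<open>The \<open>L\<^sup>2\<close> metric, its spray and its exponential map\<close>

text \<open>\<open>inv_mult E h v\<close> is \<open>h\<^sup>-\<^sup>1 v\<close>.\<close>

definition inv_mult ::
  "('m, 'v, 'r::finite) vector_bundle \<Rightarrow> ('m, 'v) form_section \<Rightarrow> ('m, 'v) form_section \<Rightarrow> 'm \<Rightarrow> 'v \<Rightarrow> 'v" where
  "inv_mult E h v x b = (THE c. c \<in> fiber E x \<and> (\<forall>a\<in>fiber E x. v x a b = h x a c))"

definition fiber_trace ::
  "('m, 'v::ab_group_add, 'r::finite) vector_bundle \<Rightarrow> 'm \<Rightarrow> ('v \<Rightarrow> 'v) \<Rightarrow> complex" where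
  "fiber_trace E x T =
     (let B = (SOME B. \<not> module.dependent (cscale E) B \<and> module.span (cscale E) B = fiber E x)
      in \<Sum>b\<in>B. module.representation (cscale E) B (T b) b)"

text \<open>
  The expression under \<open>Re\<close> is real, because \<open>h\<^sup>-\<^sup>1 v\<close> and \<open>h\<^sup>-\<^sup>1 w\<close> are self-adjoint with respect to \<open>h\<close>.
\<close>

definition L2_metric ::
  "'m::topological_space manifold \<Rightarrow> ('m, 'v::ab_group_add, 'r::finite) vector_bundle \<Rightarrow>
   'm metric_coeffs \<Rightarrow> ('m \<Rightarrow> real) \<Rightarrow>
   ('m, 'v) form_section \<Rightarrow> ('m, 'v) form_section \<Rightarrow> ('m, 'v) form_section \<Rightarrow> real" where
  "L2_metric M E g \<alpha> h v w = vol_integral M g (\<lambda>x.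
     Re (fiber_trace E x (inv_mult E h v x \<circ> inv_mult E h w x) +
         complex_of_real (\<alpha> x) *
           fiber_trace E x (inv_mult E h v x) * fiber_trace E x (inv_mult E h w x)))"

definition is_metric_spray ::
  "'m::topological_space manifold \<Rightarrow> ('m, 'v::ab_group_add, 'r::finite) vector_bundle \<Rightarrow>
   'm metric_coeffs \<Rightarrow> ('m \<Rightarrow> real) \<Rightarrow>
   (('m, 'v) form_section \<Rightarrow> ('m, 'v) form_section \<Rightarrow> ('m, 'v) form_section \<Rightarrow> ('m, 'v) form_section)
   \<Rightarrow> bool" where
  "is_metric_spray M E g \<alpha> B \<longleftrightarrow>
     (let X = Cinf_topology M E; \<Gamma> = Herm_sections M E; \<Gamma>p = pos_Herm_sections M E in
      mb_smooth (prod_topology X (prod_topology X X)) X (\<Gamma>p \<times> \<Gamma> \<times> \<Gamma>) (\<lambda>(h, v, w). B h v w) \<and>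
      (\<forall>h\<in>\<Gamma>p. \<forall>v\<in>\<Gamma>. \<forall>w\<in>\<Gamma>. B h v w = B h w v) \<and>
      (\<forall>h\<in>\<Gamma>p. \<forall>v\<in>\<Gamma>. \<forall>v'\<in>\<Gamma>. \<forall>w\<in>\<Gamma>. B h (v + v') w = B h v w + B h v' w) \<and>
      (\<forall>h\<in>\<Gamma>p. \<forall>v\<in>\<Gamma>. \<forall>w\<in>\<Gamma>. \<forall>c. B h (c *\<^sub>R v) w = c *\<^sub>R B h v w) \<and>
      (\<forall>h\<in>\<Gamma>p. \<forall>v\<in>\<Gamma>. \<forall>l\<in>\<Gamma>.
         L2_metric M E g \<alpha> h (B h v v) l =
           1 / 2 * mb_deriv euclideanreal (\<lambda>k. L2_metric M E g \<alpha> k v v) h l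
           - mb_deriv euclideanreal (\<lambda>k. L2_metric M E g \<alpha> k v l) h v))"

definition is_geodesic ::
  "'m::topological_space manifold \<Rightarrow> ('m, 'v::ab_group_add, 'r::finite) vector_bundle \<Rightarrow>
   'm metric_coeffs \<Rightarrow> ('m \<Rightarrow> real) \<Rightarrow> real set \<Rightarrow> (real \<Rightarrow> ('m, 'v) form_section) \<Rightarrow> bool" where
  "is_geodesic M E g \<alpha> I \<gamma> \<longleftrightarrow>
     open I \<and> is_interval I \<and> (\<forall>t\<in>I. \<gamma> t \<in> pos_Herm_sections M E) \<and>
     (\<exists>B \<gamma>'. is_metric_spray M E g \<alpha> B \<and>
        (\<forall>t\<in>I. has_mb_deriv (Cinf_topology M E) \<gamma> t 1 (\<gamma>' t) \<and>
               has_mb_deriv (Cinf_topology M E) \<gamma>' t 1 (B (\<gamma> t) (\<gamma>' t) (\<gamma>' t))))"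

definition geodesic_endpoint ::
  "'m::topological_space manifold \<Rightarrow> ('m, 'v::ab_group_add, 'r::finite) vector_bundle \<Rightarrow>
   'm metric_coeffs \<Rightarrow> ('m \<Rightarrow> real) \<Rightarrow>
   ('m, 'v) form_section \<Rightarrow> ('m, 'v) form_section \<Rightarrow> ('m, 'v) form_section \<Rightarrow> bool" where
  "geodesic_endpoint M E g \<alpha> h v k \<longleftrightarrow>
     (\<exists>I \<gamma>. {0..1} \<subseteq> I \<and> is_geodesic M E g \<alpha> I \<gamma> \<and>
        \<gamma> 0 = h \<and> has_mb_deriv (Cinf_topology M E) \<gamma> 0 1 v \<and> \<gamma> 1 = k)"

definition L2_exp ::
  "'m::topological_space manifold \<Rightarrow> ('m, 'v::ab_group_add, 'r::finite) vector_bundle \<Rightarrow>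
   'm metric_coeffs \<Rightarrow> ('m \<Rightarrow> real) \<Rightarrow>
   ('m, 'v) form_section \<Rightarrow> ('m, 'v) form_section \<Rightarrow> ('m, 'v) form_section" where
  "L2_exp M E g \<alpha> h v = (THE k. geodesic_endpoint M E g \<alpha> h v k)"

definition L2_exp_domain ::
  "'m::topological_space manifold \<Rightarrow> ('m, 'v::ab_group_add, 'r::finite) vector_bundle \<Rightarrow>
   'm metric_coeffs \<Rightarrow> ('m \<Rightarrow> real) \<Rightarrow> ('m, 'v) form_section \<Rightarrow> ('m, 'v) form_section set" where
  "L2_exp_domain M E g \<alpha> h = {v\<in>Herm_sections M E. \<exists>!k. geodesic_endpoint M E g \<alpha> h v k}"

end

theory Submission
  imports "Jordan_Normal_Form.Determinant" "HOL-Complex_Analysis.Complex_Analysis" Defs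
begin

text \<open>
  Geodesics satisfy \<open>h\<^sup>-\<^sup>1 h' = const\<close> in each fiber, so \<open>Exp\<^sub>h(v) = h exp(h\<^sup>-\<^sup>1v)\<close>, with inverse
  \<open>k \<mapsto> h log(h\<^sup>-\<^sup>1k)\<close>; simultaneous diagonalization shows that both are well defined and bijective. For
  \<open>k\<close> near a fixed point both are integrals of \<open>f(z) h(zh - k)\<^sup>-\<^sup>1h\<close> over a circle that encloses
  all eigenvalues of \<open>h\<^sup>-\<^sup>1k\<close>. Smoothness thus reduces to integrals of noncommutative rational
  expressions, a class that is closed under differentiation. The metric spray is \<open>vh\<^sup>-\<^sup>1v\<close> on the
  diagonal because the weak metric is nondegenerate for \<open>\<alpha> > - 1 / r\<close>.
\<close>

text \<open>Eigenvectors cannot in general be chosen smoothly where eigenvalues collide, so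
  diagonalization is only used at single points, for algebraic identities, positivity and
  bijectivity. Smoothness needs a formula without eigenvectors, and the resolvent provides one. One
  circle must serve all points of \<open>M\<close> at once; compactness of \<open>M\<close> allows
  this: positivity is an open condition on sections, so h + sv stays positive for small s > 0. This
  traps the spectrum of h^-1 v between -R and R, and that of h^-1 k for positive k between t and
  1/t. The exponential is entire, while for the logarithm the circle over [t, 1/t] avoids the slit
  of \<open>Ln\<close>. Existence of directional derivatives and their joint continuity are both
  limits along filters in the same topology; hence one notion of convergence, \<open>clim\<close>,
  stable under sums, products, inverses and integrals, settles both. The bound on \<alpha> enters
  through Cauchy-Schwarz for eigenvalues, (tr A)^2 \<le> r tr(A^2). Uniqueness of geodesics needs no
  theory of differential equations: the quotient of a geodesic by the explicit curve has derivative
  zero.\<close>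

unbundle no fps_syntax


section \<open>Positivity of determinants\<close>

text \<open>A permutation of the index set never leaves it, so only genuine matrix entries occur.
  This makes the kernel criterion for singular matrices available.\<close>

lemma det_nat_eq_det: "det_nat n A = Determinant.det (Matrix.mat n n (\<lambda>(i, j). A i j))"
proof -
  have "(\<Prod>i<n. A i (p i)) = (\<Prod>i = 0..<n. Matrix.mat n n (\<lambda>(i, j). A i j) $$ (i, p i))" if "p permutes {..<n}" for p
  proof -
    have "p i < n" if "i < n" for i
      using permutes_in_image[OF \<open>p permutes {..<n}\<close>, of i] that by simp
    then show ?thesis
      by (intro prod.cong) (auto simp: atLeast0LessThan)
  qed
  then show ?thesis
    unfolding det_nat_def Determinant.det_def by (simp add: atLeast0LessThan)
qed

text \<open>A vanishing determinant would give a nonzero kernel vector, and the quadratic form would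
  be 0 on it.\<close>

lemma det_nat_nonzero:
  assumes pos: "\<And>\<xi>. \<exists>i<n. \<xi> i \<noteq> 0 \<Longrightarrow> 0 < (\<Sum>i<n. \<Sum>j<n. A i j * \<xi> i * \<xi> j)"
  shows "det_nat n A \<noteq> 0"
proof
  let ?A = "Matrix.mat n n (\<lambda>(i, j). A i j)"
  assume "det_nat n A = 0"
  then obtain v where v: "v \<in> carrier_vec n" "v \<noteq> 0\<^sub>v n" "?A *\<^sub>v v = 0\<^sub>v n"
    using det_0_iff_vec_prod_zero[of ?A n] by (auto simp: det_nat_eq_det)
  then have "\<exists>i<n. vec_index v i \<noteq> 0"
    by (metis carrier_vecD eq_vecI index_zero_vec(1) index_zero_vec(2))
  from pos[OF this] have "0 < (\<Sum>i<n. vec_index v i * (\<Sum>j<n. A i j * vec_index v j))"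
    by (simp add: sum_distrib_left mult_ac)
  moreover have "(\<Sum>j<n. A i j * vec_index v j) = 0" if "i < n" for i
  proof -
    have "vec_index (?A *\<^sub>v v) i = (\<Sum>j<n. A i j * vec_index v j)"
      using that v(1) by (simp add: scalar_prod_def atLeast0LessThan)
    then show ?thesis
      using v(3) that by simp
  qed
  ultimately show False
    by simp
qed

text \<open>The segment from the identity to A consists of positive matrices, so the determinant has
  no zero on it. It starts at 1, and the intermediate value theorem forbids a sign change. This is
  what makes the volume density positive.\<close>

lemma det_nat_pos:
  assumes pos: "\<And>\<xi>. \<exists>i<n. \<xi> i \<noteq> 0 \<Longrightarrow> 0 < (\<Sum>i<n. \<Sum>j<n. A i j * \<xi> i * \<xi> j)"
  shows "0 < det_nat n A"
proof (rule ccontr)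
  define B where "B = (\<lambda>t i j. (1 - t) * (if i = j then 1 else 0) + t * A i j)"
  have nz: "det_nat n (B t) \<noteq> 0" if "0 \<le> t" "t \<le> 1" for t :: real
  proof (rule det_nat_nonzero)
    fix \<xi> :: "nat \<Rightarrow> real" assume \<xi>: "\<exists>i<n. \<xi> i \<noteq> 0"
    then obtain k where "k < n" "\<xi> k \<noteq> 0" by blast
    then have "0 < (\<Sum>i<n. \<xi> i * \<xi> i)"
      by (intro sum_pos2[of _ k]) (auto simp: zero_less_mult_iff)
    moreover have "(\<Sum>i<n. \<Sum>j<n. B t i j * \<xi> i * \<xi> j)
        = (1 - t) * (\<Sum>i<n. \<xi> i * \<xi> i) + t * (\<Sum>i<n. \<Sum>j<n. A i j * \<xi> i * \<xi> j)"
    proof -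
      have "(\<Sum>j<n. (if i = j then 1 else 0) * \<xi> i * \<xi> j) = \<xi> i * \<xi> i" if "i < n" for i
      proof -
        have "(\<Sum>j<n. (if i = j then 1 else 0) * \<xi> i * \<xi> j) = (\<Sum>j<n. if i = j then \<xi> i * \<xi> j else 0)"
          by (intro sum.cong) auto
        with that show ?thesis by simp
      qed
      then have "(\<Sum>i<n. \<Sum>j<n. (if i = j then 1 else 0) * \<xi> i * \<xi> j) = (\<Sum>i<n. \<xi> i * \<xi> i)"
        by simp
      then show ?thesis
        by (simp only: B_def distrib_right sum.distrib mult.assoc sum_distrib_left [symmetric])
    qed
    moreover have "0 < (\<Sum>i<n. \<Sum>j<n. A i j * \<xi> i * \<xi> j)"
      by (rule pos[OF \<xi>])
    ultimately show "0 < (\<Sum>i<n. \<Sum>j<n. B t i j * \<xi> i * \<xi> j)"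
      using that by (cases "t = 0") (simp_all add: add_nonneg_pos)
  qed
  assume "\<not> 0 < det_nat n A"
  moreover have "B 1 = A"
    by (simp add: B_def)
  moreover have "det_nat n (B 0) = 1"
  proof -
    have "Matrix.mat n n (\<lambda>(i, j). B 0 i j) = 1\<^sub>m n"
      by (auto simp: B_def)
    then show ?thesis
      by (simp add: det_nat_eq_det)
  qed
  moreover have "continuous_on {0..1} (\<lambda>t. det_nat n (B t))"
    unfolding det_nat_def B_def by (intro continuous_intros)
  ultimately obtain t where "0 \<le> t" "t \<le> 1" "det_nat n (B t) = 0"
    using IVT2'[of "\<lambda>t. det_nat n (B t)" 1 0 0] by auto
  then show False
    using nz by blast
qed

hide_const (open) Matrix.mat

no_notation Matrix.vec_index (infixl "$" 100)


section \<open>Hermitian matrices\<close>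

type_synonym 'r cmat = "complex ^ 'r ^ 'r"

definition adj :: "complex ^ 'n ^ 'm \<Rightarrow> complex ^ 'm ^ 'n" where
  "adj A = (\<chi> i j. cnj (A $ j $ i))"

definition diag :: "('r::finite \<Rightarrow> real) \<Rightarrow> 'r cmat" where
  "diag d = (\<chi> i j. if i = j then complex_of_real (d i) else 0)"

lemma adj_nth [simp]: "adj A $ i $ j = cnj (A $ j $ i)"
  by (simp add: adj_def)

lemma diag_nth: "diag d $ i $ j = (if i = j then complex_of_real (d i) else 0)"
  by (simp add: diag_def)

lemma adj_adj [simp]: "adj (adj A) = A"
  by (simp add: vec_eq_iff)

lemma adj_mult: "adj (A ** B) = adj B ** adj (A :: 'r::finite cmat)"
  by (simp add: vec_eq_iff matrix_matrix_mult_def mult.commute)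

lemma adj_mat_1 [simp]: "adj (mat 1) = (mat 1 :: 'r::finite cmat)"
  by (simp add: vec_eq_iff mat_def)

lemma adj_diag [simp]: "adj (diag d) = diag d"
  by (auto simp: vec_eq_iff diag_nth)

text \<open>The interpretation that follows supplies continuity, limits, derivatives and norm bounds
  of matrix products.\<close>

lemma bounded_bilinear_matrix_mult:
  "bounded_bilinear ((**) :: complex^'n^'m \<Rightarrow> complex^'k^'n \<Rightarrow> complex^'k^'m)"
  unfolding bilinear_conv_bounded_bilinear [symmetric] bilinear_def
  by (auto intro!: linearI simp: vec_eq_iff matrix_matrix_mult_def sum.distrib algebra_simps
      scaleR_sum_right)

interpretation matrix_mult: bounded_bilinear
  "(**) :: complex^'n^'m \<Rightarrow> complex^'k^'n \<Rightarrow> complex^'k^'m"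
  by (rule bounded_bilinear_matrix_mult)

lemma matrix_inv_ex: "invertible A \<Longrightarrow> A ** matrix_inv A = mat 1 \<and> matrix_inv A ** A = mat 1"
  unfolding matrix_inv_def invertible_def by (rule someI_ex)

lemma matrix_inv_right [simp]: "invertible A \<Longrightarrow> A ** matrix_inv A = mat 1"
  and matrix_inv_left [simp]: "invertible A \<Longrightarrow> matrix_inv A ** A = mat 1"
  using matrix_inv_ex by auto

lemma matrix_inv_right_mult [simp]:
    "invertible A \<Longrightarrow> A ** (matrix_inv A ** X) = X"
  and matrix_inv_left_mult [simp]:
    "invertible A \<Longrightarrow> matrix_inv A ** (A ** X) = X"
  by (simp_all add: matrix_mul_assoc)

text \<open>A one-sided inverse of a square matrix is two-sided, so every inverse below can be
  certified by a single product.\<close>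

lemma matrix_inv_eqI:
  fixes A :: "'r::finite cmat"
  assumes "A ** B = mat 1"
  shows "invertible A" "matrix_inv A = B"
proof -
  show "invertible A"
    using assms matrix_left_right_inverse[of A B] unfolding invertible_def by blast
  then have "matrix_inv A = matrix_inv A ** (A ** B)"
    using assms by simp
  also have "\<dots> = B"
    using \<open>invertible A\<close> by simp
  finally show "matrix_inv A = B" .
qed

lemma invertible_matrix_inv [simp]:
  fixes A :: "'r::finite cmat"
  shows "invertible A \<Longrightarrow> invertible (matrix_inv A)"
  using matrix_inv_eqI(1)[OF matrix_inv_left] .

lemma invertible_adj [simp]:
  fixes A :: "'r::finite cmat"
  assumes "invertible A"
  shows "invertible (adj A)"
  using matrix_inv_eqI(1)[of "adj A" "adj (matrix_inv A)"] assms
  by (simp flip: adj_mult)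

lemma adj_matrix_inv:
  fixes A :: "'r::finite cmat"
  assumes "invertible A"
  shows "matrix_inv (adj A) = adj (matrix_inv A)"
  using matrix_inv_eqI(2)[of "adj A" "adj (matrix_inv A)"] assms
  by (simp flip: adj_mult)

section \<open>Sesquilinear forms and positive definiteness\<close>

definition sesq :: "'r::finite cmat \<Rightarrow> complex ^ 'r \<Rightarrow> complex ^ 'r \<Rightarrow> complex" where
  "sesq A x y = (\<Sum>i\<in>UNIV. \<Sum>j\<in>UNIV. x $ i * cnj (y $ j) * A $ i $ j)"

definition posdef :: "'r::finite cmat \<Rightarrow> bool" where
  "posdef A \<longleftrightarrow> adj A = A \<and> (\<forall>x. x \<noteq> 0 \<longrightarrow> 0 < Re (sesq A x x))"

lemma sesq_add_left: "sesq A (x + x') y = sesq A x y + sesq A x' y"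
  and sesq_diff_left: "sesq A (x - x') y = sesq A x y - sesq A x' y"
  and sesq_diff_right: "sesq A x (y - y') = sesq A x y - sesq A x y'"
  and sesq_add_right: "sesq A x (y + y') = sesq A x y + sesq A x y'"
  and sesq_scale_left: "sesq A (c *s x) y = c * sesq A x y"
  and sesq_scale_right: "sesq A x (c *s y) = cnj c * sesq A x y"
  and sesq_diff_mat: "sesq (A - B) x y = sesq A x y - sesq B x y"
  by (simp_all add: sesq_def sum.distrib algebra_simps sum_distrib_left sum_subtractf scaleR_sum_right)

lemma sesq_adj: "sesq (adj A) x y = cnj (sesq A y x)"
  unfolding sesq_def by (subst sum.swap) (simp add: mult_ac)

text \<open>Congruence evaluates the form on the rows of P, because in \<open>sesq\<close> the row
  index of the matrix belongs to the linear argument. In particular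
  \<open>P ** adj P = mat 1\<close> says that the rows of P are orthonormal.\<close>

lemma mult_adj_nth: "(P ** A ** adj P) $ i $ j = sesq A (P $ i) (P $ j)"
proof -
  have "(P ** A ** adj P) $ i $ j = (\<Sum>l\<in>UNIV. \<Sum>k\<in>UNIV. P $ i $ k * A $ k $ l * cnj (P $ j $ l))"
    by (simp add: matrix_matrix_mult_def sum_distrib_right)
  also have "\<dots> = (\<Sum>k\<in>UNIV. \<Sum>l\<in>UNIV. P $ i $ k * A $ k $ l * cnj (P $ j $ l))"
    by (rule sum.swap)
  finally show ?thesis
    by (simp add: sesq_def mult_ac)
qed

lemma sesq_congr: "sesq (P ** A ** adj P) x y = sesq A (x v* P) (y v* P)"
proof -
  have "sesq (P ** A ** adj P) x y =
      (\<Sum>i\<in>UNIV. \<Sum>j\<in>UNIV. \<Sum>k\<in>UNIV. \<Sum>l\<in>UNIV. x $ i * P $ i $ k * cnj (y $ j * P $ j $ l) * A $ k $ l)"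
    by (simp add: sesq_def mult_adj_nth sum_distrib_left mult_ac)
  also have "\<dots> = (\<Sum>i\<in>UNIV. \<Sum>k\<in>UNIV. \<Sum>j\<in>UNIV. \<Sum>l\<in>UNIV. x $ i * P $ i $ k * cnj (y $ j * P $ j $ l) * A $ k $ l)"
    by (intro sum.cong refl, rule sum.swap)
  also have "\<dots> = (\<Sum>k\<in>UNIV. \<Sum>i\<in>UNIV. \<Sum>l\<in>UNIV. \<Sum>j\<in>UNIV. x $ i * P $ i $ k * cnj (y $ j * P $ j $ l) * A $ k $ l)"
    by (subst sum.swap, intro sum.cong refl, rule sum.swap)
  also have "\<dots> = (\<Sum>k\<in>UNIV. \<Sum>l\<in>UNIV. \<Sum>i\<in>UNIV. \<Sum>j\<in>UNIV. x $ i * P $ i $ k * cnj (y $ j * P $ j $ l) * A $ k $ l)"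
    by (intro sum.cong refl, rule sum.swap)
  also have "\<dots> = sesq A (x v* P) (y v* P)"
  proof -
    have "(\<Sum>i\<in>UNIV. \<Sum>j\<in>UNIV. x $ i * P $ i $ k * cnj (y $ j * P $ j $ l) * A $ k $ l)
        = (x v* P) $ k * cnj ((y v* P) $ l) * A $ k $ l" for k l
      by (simp only: vector_matrix_mult_def vec_lambda_beta cnj_sum sum_product sum_distrib_right)
        (simp add: mult_ac sum_distrib_left)
    then show ?thesis
      by (simp only: sesq_def)
  qed
  finally show ?thesis .
qed

lemma posdef_congr:
  fixes A P :: "'r::finite cmat"
  assumes "posdef A" "invertible P"
  shows "posdef (P ** A ** adj P)"
  unfolding posdef_def
proof (intro conjI allI impI)
  show "adj (P ** A ** adj P) = P ** A ** adj P"
    using assms(1) by (auto simp: posdef_def adj_mult matrix_mul_assoc)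
  fix x :: "complex ^ 'r" assume "x \<noteq> 0"
  have "x v* P \<noteq> 0"
  proof
    assume "x v* P = 0"
    then have "x v* (P ** matrix_inv P) = 0"
      by (simp flip: vector_matrix_mul_assoc)
    with assms(2) \<open>x \<noteq> 0\<close> show False
      by simp
  qed
  then show "0 < Re (sesq (P ** A ** adj P) x x)"
    using assms(1) by (simp add: sesq_congr posdef_def)
qed

text \<open>A nonzero x in the left kernel would give \<open>sesq A x x = 0\<close>. The transpose
  turns the left kernel into the usual one.\<close>

lemma posdef_invertible:
  assumes "posdef A"
  shows "invertible A"
proof -
  have "x = 0" if "x v* A = 0" for x
  proof (rule ccontr)
    assume "x \<noteq> 0"
    have "sesq A x x = (\<Sum>j\<in>UNIV. cnj (x $ j) * (x v* A) $ j)"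
      unfolding sesq_def by (subst sum.swap) (simp add: vector_matrix_mult_def sum_distrib_left mult_ac)
    with that assms \<open>x \<noteq> 0\<close> show False
      by (auto simp: posdef_def)
  qed
  then have "\<exists>B. B ** transpose A = mat 1"
    unfolding matrix_left_invertible_ker by simp
  then obtain B where "B ** transpose A = mat 1" ..
  then have "transpose (B ** transpose A) = mat 1"
    by simp
  then have "A ** transpose B = mat 1"
    by (simp add: matrix_transpose_mul)
  then show ?thesis
    by (rule matrix_inv_eqI)
qed

section \<open>Diagonalization of Hermitian matrices\<close>

lemma compact_unitary: "compact {P :: 'r::finite cmat. P ** adj P = mat 1}"
proof -
  have "bounded {P :: 'r cmat. P ** adj P = mat 1}"
    unfolding bounded_iff
  proof (intro exI ballI)
    fix P :: "'r cmat" assume P: "P \<in> {P. P ** adj P = mat 1}"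
    have "norm (P $ i) = 1" for i
    proof -
      have "(\<Sum>k\<in>UNIV. P $ i $ k * cnj (P $ i $ k)) = 1"
        using P by (simp add: vec_eq_iff matrix_matrix_mult_def mat_def)
      then have "complex_of_real (\<Sum>k\<in>UNIV. (norm (P $ i $ k))\<^sup>2) = 1"
        by (simp add: complex_norm_square[symmetric])
      then have "(\<Sum>k\<in>UNIV. (norm (P $ i $ k))\<^sup>2) = 1"
        by (simp only: of_real_eq_1_iff)
      then show ?thesis
        by (simp add: norm_vec_def L2_set_def)
    qed
    then have "norm P = sqrt (real CARD('r))"
      by (simp add: norm_vec_def[of P] L2_set_def)
    then show "norm P \<le> sqrt (real CARD('r))"
      by simp
  qed
  moreover have "closed {P :: 'r cmat. P ** adj P = mat 1}"
  proof -
    have "continuous_on UNIV (\<lambda>P :: 'r cmat. P ** adj P)"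
      unfolding adj_def by (intro matrix_mult.continuous_on continuous_intros)
    from continuous_closed_preimage[OF this closed_UNIV closed_singleton, of "mat 1"]
    show ?thesis by (simp add: vimage_def)
  qed
  ultimately show ?thesis
    by (simp add: compact_eq_bounded_closed)
qed

lemma mat_one_nth: "(mat 1 :: 'r::finite cmat) $ k $ l = (if k = l then 1 else 0)"
  by (simp add: mat_def)

text \<open>Rows i and j are mixed by the block with rows (cos, \<omega> sin) and (-cnj \<omega>
  sin, cos), a unitary matrix of determinant 1; the conjugate and the sign in its second row keep
  the new rows orthogonal.\<close>

lemma rotate_frame_orthonormal:
  fixes P :: "'r::finite cmat"
  assumes "P ** adj P = mat 1" "i \<noteq> j" "norm \<omega> = 1"
  defines "Q \<equiv> \<lambda>\<theta>. \<chi> k. if k = i then complex_of_real (cos \<theta>) *s P $ i + (\<omega> * complex_of_real (sin \<theta>)) *s P $ j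
        else if k = j then (- cnj \<omega> * complex_of_real (sin \<theta>)) *s P $ i + complex_of_real (cos \<theta>) *s P $ j
        else P $ k"
  shows "Q \<theta> ** adj (Q \<theta>) = mat 1"
proof -
  have on: "sesq (mat 1) (P $ k) (P $ l) = (if k = l then 1 else 0)" for k l
  proof -
    have "sesq (mat 1) (P $ k) (P $ l) = (P ** mat 1 ** adj P) $ k $ l"
      by (simp only: mult_adj_nth)
    also have "\<dots> = mat 1 $ k $ l"
      by (simp add: assms(1))
    finally show ?thesis
      by (simp add: mat_def)
  qed
  have \<omega>: "\<omega> * cnj \<omega> = 1" "cnj \<omega> * \<omega> = 1"
    using assms(3) by (simp_all add: complex_norm_square[symmetric] mult.commute)
  have cs: "complex_of_real (cos \<theta>) * complex_of_real (cos \<theta>) + complex_of_real (sin \<theta>) * complex_of_real (sin \<theta>) = 1"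
    by (metis of_real_add of_real_mult of_real_1 power2_eq_square sin_cos_squared_add2)
  have \<omega>s: "complex_of_real (cos \<theta>) * complex_of_real (cos \<theta>)
      + (\<omega> * cnj \<omega>) * (complex_of_real (sin \<theta>) * complex_of_real (sin \<theta>)) = 1"
    "complex_of_real (cos \<theta>) * complex_of_real (cos \<theta>)
      + (cnj \<omega> * \<omega>) * (complex_of_real (sin \<theta>) * complex_of_real (sin \<theta>)) = 1"
    using cs unfolding \<omega> by simp_all
  have "(Q \<theta> ** mat 1 ** adj (Q \<theta>)) $ k $ l = mat 1 $ k $ l" for k l
    unfolding mult_adj_nth
    using assms(2)
    apply (auto simp: Q_def sesq_add_left sesq_add_right sesq_diff_left sesq_diff_right sesq_scale_left sesq_scale_right on mat_one_nth)
    subgoal using \<omega>s(1) by (simp add: mult_ac)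
    subgoal using \<omega>s(2) by (simp add: mult_ac)
    done
  then show ?thesis
    by (simp add: vec_eq_iff)
qed

text \<open>
  Maximise \<open>\<Sum>\<^sub>i c\<^sub>i D\<^sub>i\<^sub>i\<close> for \<open>D = P A P\<^sup>*\<close> over all unitary \<open>P\<close>, for pairwise different weights \<open>c\<^sub>i\<close>:
  rotating two rows of a maximiser into each other shows that the off-diagonal entries vanish.
\<close>

theorem hermitian_diagonalization:
  fixes A :: "'r::finite cmat"
  assumes A: "adj A = A"
  obtains P :: "'r cmat" and d where "P ** adj P = mat 1" "P ** A ** adj P = diag d"
proof -
  obtain c0 :: "'r \<Rightarrow> nat" where "inj c0"
    using finite_imp_inj_to_nat_seg[of "UNIV :: 'r set"] by auto
  define c where "c = real \<circ> c0"
  have c: "c i \<noteq> c j" if "i \<noteq> j" for i j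
    using \<open>inj c0\<close> that by (auto simp: c_def inj_def)
  define F where "F = (\<lambda>P :: 'r cmat. \<Sum>i\<in>UNIV. c i * Re (sesq A (P $ i) (P $ i)))"
  have "continuous_on {P. P ** adj P = mat 1} F"
    unfolding F_def sesq_def by (intro continuous_intros)
  moreover have "mat 1 \<in> {P :: 'r cmat. P ** adj P = mat 1}"
    by simp
  ultimately obtain P where P: "P ** adj P = mat 1"
    and max: "\<And>Q. Q ** adj Q = mat 1 \<Longrightarrow> F Q \<le> F P"
    using continuous_attains_sup[OF compact_unitary, of F] by blast
  have swap: "sesq A x y = cnj (sesq A y x)" for x y
    using sesq_adj[of A x y] A by simp
  have off: "sesq A (P $ i) (P $ j) = 0" if "i \<noteq> j" for i j
  proof (rule ccontr)
    define z where "z = sesq A (P $ i) (P $ j)"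
    assume nz: "sesq A (P $ i) (P $ j) \<noteq> 0"
    \<comment> \<open>The phase turns the off-diagonal entry real: both cross terms become the norm
      of z, so the first-order effect of the rotation on F is 2 (c i - c j) times that norm, which
      is nonzero.\<close>
    define \<omega> where "\<omega> = sgn z"
    have \<omega>: "norm \<omega> = 1"
      using nz by (simp add: \<omega>_def z_def norm_sgn)
    define a b where "a = Re (sesq A (P $ i) (P $ i))" and "b = Re (sesq A (P $ j) (P $ j))"
    define Q where "Q = (\<lambda>\<theta>. \<chi> k. if k = i then complex_of_real (cos \<theta>) *s P $ i + (\<omega> * complex_of_real (sin \<theta>)) *s P $ j
        else if k = j then (- cnj \<omega> * complex_of_real (sin \<theta>)) *s P $ i + complex_of_real (cos \<theta>) *s P $ j
        else P $ k)"
    have Q: "Q \<theta> ** adj (Q \<theta>) = mat 1" for \<theta>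
      unfolding Q_def using rotate_frame_orthonormal[OF P \<open>i \<noteq> j\<close> \<omega>] by blast
    have z': "sesq A (P $ j) (P $ i) = cnj z"
      using swap z_def by blast
    have \<omega>z: "cnj \<omega> * z = norm z"
    proof -
      have "cnj \<omega> * z = z * cnj z / of_real (norm z)"
        by (simp add: \<omega>_def sgn_eq)
      also have "\<dots> = of_real (norm z) ^ 2 / of_real (norm z)"
        by (simp add: complex_norm_square [symmetric])
      finally show ?thesis
        using nz by (simp add: z_def power2_eq_square)
    qed
    then have \<omega>z': "\<omega> * cnj z = norm z"
      by (metis complex_cnj_cnj complex_cnj_complex_of_real complex_cnj_mult)
    have \<omega>1: "Re \<omega> * Re \<omega> + Im \<omega> * Im \<omega> = 1"
      using \<omega> by (metis cmod_power2 one_power2 power2_eq_square)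
    have Rz: "Re \<omega> * Re z + Im \<omega> * Im z = norm z"
      using arg_cong[OF \<omega>z, of Re] by simp
    have qi: "Re (sesq A (Q \<theta> $ i) (Q \<theta> $ i)) = (cos \<theta>)\<^sup>2 * a + (sin \<theta>)\<^sup>2 * b + 2 * sin \<theta> * cos \<theta> * norm z" for \<theta>
    proof -
      have "sesq A (Q \<theta> $ i) (Q \<theta> $ i) = (cos \<theta>)\<^sup>2 * sesq A (P $ i) (P $ i)
          + (\<omega> * cnj \<omega>) * (sin \<theta>)\<^sup>2 * sesq A (P $ j) (P $ j)
          + sin \<theta> * cos \<theta> * (cnj \<omega> * z) + sin \<theta> * cos \<theta> * (\<omega> * cnj z)"
        by (simp add: Q_def sesq_add_left sesq_add_right sesq_diff_left sesq_diff_right sesq_scale_left sesq_scale_right z' z_def[symmetric]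
          algebra_simps power2_eq_square)
      then show ?thesis
        using \<omega> by (simp add: \<omega>z \<omega>z' complex_norm_square[symmetric] a_def b_def flip: of_real_power)
    qed
    have qj: "Re (sesq A (Q \<theta> $ j) (Q \<theta> $ j)) = (sin \<theta>)\<^sup>2 * a + (cos \<theta>)\<^sup>2 * b - 2 * sin \<theta> * cos \<theta> * norm z" for \<theta>
    proof -
      have "sesq A (Q \<theta> $ j) (Q \<theta> $ j) = (cos \<theta>)\<^sup>2 * sesq A (P $ j) (P $ j)
          + (\<omega> * cnj \<omega>) * (sin \<theta>)\<^sup>2 * sesq A (P $ i) (P $ i)
          - sin \<theta> * cos \<theta> * (cnj \<omega> * z) - sin \<theta> * cos \<theta> * (\<omega> * cnj z)"
        using \<open>i \<noteq> j\<close>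
        by (simp add: Q_def sesq_add_left sesq_add_right sesq_diff_left sesq_diff_right sesq_scale_left sesq_scale_right z' z_def[symmetric]
          algebra_simps power2_eq_square)
      then show ?thesis
        using \<omega> by (simp add: \<omega>z \<omega>z' complex_norm_square[symmetric] a_def b_def flip: of_real_power)
    qed
    define \<phi> where "\<phi> = (\<lambda>\<theta>. c i * ((cos \<theta>)\<^sup>2 * a + (sin \<theta>)\<^sup>2 * b + 2 * sin \<theta> * cos \<theta> * norm z)
      + c j * ((sin \<theta>)\<^sup>2 * a + (cos \<theta>)\<^sup>2 * b - 2 * sin \<theta> * cos \<theta> * norm z))"
    have F_split: "F R = c i * Re (sesq A (R $ i) (R $ i)) + c j * Re (sesq A (R $ j) (R $ j))
        + (\<Sum>k\<in>UNIV-{i,j}. c k * Re (sesq A (R $ k) (R $ k)))" for R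
    proof -
      have "F R = (\<Sum>k\<in>{i,j}. c k * Re (sesq A (R $ k) (R $ k))) + (\<Sum>k\<in>UNIV-{i,j}. c k * Re (sesq A (R $ k) (R $ k)))"
        unfolding F_def by (subst sum.subset_diff[of "{i,j}" UNIV]) (auto simp: add.commute)
      with \<open>i \<noteq> j\<close> show ?thesis by simp
    qed
    have "(\<Sum>k\<in>UNIV-{i,j}. c k * Re (sesq A (Q \<theta> $ k) (Q \<theta> $ k))) = (\<Sum>k\<in>UNIV-{i,j}. c k * Re (sesq A (P $ k) (P $ k)))" for \<theta>
      by (intro sum.cong) (auto simp: Q_def)
    then have "F (Q \<theta>) - F P = \<phi> \<theta> - \<phi> 0" for \<theta>
      by (simp add: F_split qi qj \<phi>_def a_def b_def)
    then have le: "\<phi> \<theta> \<le> \<phi> 0" for \<theta>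
      using max[OF Q, of \<theta>] by (metis diff_le_0_iff_le)
    have "(\<phi> has_real_derivative 2 * (c i - c j) * norm z) (at 0)"
      unfolding \<phi>_def by (auto intro!: derivative_eq_intros simp: algebra_simps)
    then have "2 * (c i - c j) * norm z = 0"
      by (rule DERIV_local_max[of \<phi> _ 0 1]) (use le in auto)
    with c[OF \<open>i \<noteq> j\<close>] nz show False
      by (simp add: z_def)
  qed
  have "sesq A (P $ i) (P $ i) = complex_of_real (Re (sesq A (P $ i) (P $ i)))" for i
    using swap[of "P $ i" "P $ i"] by (simp add: complex_eq_iff)
  then have "P ** A ** adj P = diag (\<lambda>i. Re (sesq A (P $ i) (P $ i)))"
    using off by (auto simp: vec_eq_iff mult_adj_nth diag_nth)
  with P that show thesis by blast
qed

lemma posdef_congr_iff: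
  fixes A P :: "'r::finite cmat"
  assumes "invertible P"
  shows "posdef (P ** A ** adj P) \<longleftrightarrow> posdef A"
proof
  assume *: "posdef (P ** A ** adj P)"
  have "matrix_inv P ** (P ** A ** adj P) ** adj (matrix_inv P)
      = (matrix_inv P ** P) ** A ** adj (matrix_inv P ** P)"
    by (simp only: matrix_mul_assoc adj_mult)
  also have "\<dots> = A"
    using assms by simp
  finally show "posdef A"
    using posdef_congr[OF * invertible_matrix_inv[OF assms]] by simp
qed (rule posdef_congr[OF _ assms])

lemma sesq_diag: "sesq (diag d) x x = complex_of_real (\<Sum>i\<in>UNIV. d i * (norm (x $ i))\<^sup>2)"
proof -
  have "sesq (diag d) x x = (\<Sum>i\<in>UNIV. \<Sum>j\<in>UNIV. if i = j then d i * (x $ i * cnj (x $ i)) else 0)"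
    unfolding sesq_def by (intro sum.cong) (auto simp: diag_nth)
  then show ?thesis
    by (simp add: complex_norm_square [symmetric])
qed

lemma posdef_diag_iff: "posdef (diag d) \<longleftrightarrow> (\<forall>i. 0 < d i)"
proof
  assume *: "posdef (diag d)"
  show "\<forall>i. 0 < d i"
  proof
    fix i
    have "axis i (1::complex) \<noteq> (0 :: complex ^ 'a)"
      by (simp add: axis_eq_0_iff)
    then have "0 < (\<Sum>k\<in>UNIV. d k * (norm ((axis i 1 :: complex ^ 'a) $ k))\<^sup>2)"
      using * unfolding posdef_def sesq_diag by (metis Re_complex_of_real)
    also have "\<dots> = (\<Sum>k\<in>UNIV. if k = i then d k else 0)"
      by (intro sum.cong) (auto simp: axis_def)
    finally show "0 < d i"
      by simp
  qed
next
  assume *: "\<forall>i. 0 < d i"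
  show "posdef (diag d)"
    unfolding posdef_def sesq_diag
  proof (intro conjI allI impI)
    fix x :: "complex ^ 'a" assume "x \<noteq> 0"
    then obtain i where "x $ i \<noteq> 0"
      by (auto simp: vec_eq_iff)
    then have "0 < d i * (norm (x $ i))\<^sup>2"
      using * by simp
    also have "\<dots> \<le> (\<Sum>i\<in>UNIV. d i * (norm (x $ i))\<^sup>2)"
      using * by (intro member_le_sum) (auto intro!: mult_nonneg_nonneg intro: less_imp_le)
    finally show "0 < Re (complex_of_real (\<Sum>i\<in>UNIV. d i * (norm (x $ i))\<^sup>2))"
      by simp
  qed simp
qed

lemma diag_mult_nth: "(diag d ** A) $ i $ j = d i * A $ i $ j"
proof -
  have "(diag d ** A) $ i $ j = (\<Sum>k\<in>UNIV. if i = k then d i * A $ i $ j else 0)"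
    unfolding matrix_matrix_mult_def vec_lambda_beta by (intro sum.cong refl) (auto simp: diag_nth)
  then show ?thesis by simp
qed

lemma mult_diag_nth: "(A ** diag d) $ i $ j = A $ i $ j * d j"
proof -
  have "(A ** diag d) $ i $ j = (\<Sum>k\<in>UNIV. if k = j then A $ i $ j * d j else 0)"
    unfolding matrix_matrix_mult_def vec_lambda_beta by (intro sum.cong refl) (auto simp: diag_nth)
  then show ?thesis by simp
qed

lemma diag_mult: "diag d ** diag e = diag (\<lambda>i. d i * e i)"
  by (simp add: vec_eq_iff diag_mult_nth) (simp add: diag_nth)

lemma diag_one: "diag (\<lambda>_. 1) = (mat 1 :: 'r::finite cmat)"
  by (simp add: vec_eq_iff diag_nth mat_one_nth)

lemma unitary_invertible: "P ** adj P = mat 1 \<Longrightarrow> invertible (P :: 'r::finite cmat)"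
  by (rule matrix_inv_eqI)

text \<open>The rows of P form a basis that is orthonormal for H and orthogonal for K, and d lists
  the eigenvalues of H^-1 K.\<close>

definition diagonalizes :: "'r::finite cmat \<Rightarrow> ('r \<Rightarrow> real) \<Rightarrow> 'r cmat \<Rightarrow> 'r cmat \<Rightarrow> bool" where
  "diagonalizes P d H K \<longleftrightarrow> invertible P \<and> P ** H ** adj P = mat 1 \<and> P ** K ** adj P = diag d"

text \<open>A unitary matrix makes H diagonal with positive entries, and rescaling by their inverse
  square roots turns H into the identity. The transformed K is still Hermitian; diagonalizing it by
  a second unitary matrix leaves the identity alone.\<close>

theorem simultaneous_diagonalization:
  fixes H K :: "'r::finite cmat"
  assumes "posdef H" "adj K = K"
  obtains P :: "'r cmat" and d where "diagonalizes P d H K"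
proof -
  have "adj H = H"
    using assms(1) by (simp add: posdef_def)
  then obtain P :: "'r cmat" and d where P: "P ** adj P = mat 1" "P ** H ** adj P = diag d"
    using hermitian_diagonalization by blast
  have "posdef (diag d)"
    using posdef_congr[OF assms(1) unitary_invertible[OF P(1)]] P(2) by simp
  then have d: "0 < d i" for i
    by (simp add: posdef_diag_iff)
  define S where "S = diag (\<lambda>i. 1 / sqrt (d i))"
  have S: "invertible S"
    using matrix_inv_eqI(1)[of S "diag (\<lambda>i. sqrt (d i))"] d
    by (simp add: S_def diag_mult diag_one less_imp_neq[symmetric])
  have "S ** diag d ** adj S = mat 1"
    using d by (simp add: S_def diag_mult diag_one[symmetric] real_sqrt_mult_self less_imp_le
      order_less_imp_not_eq2)
  define R where "R = S ** P"
  have R: "invertible R"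
    unfolding R_def using S unitary_invertible[OF P(1)] by (rule invertible_mult)
  have "R ** H ** adj R = S ** (P ** H ** adj P) ** adj S"
    by (simp add: R_def adj_mult matrix_mul_assoc)
  then have RH: "R ** H ** adj R = mat 1"
    using P(2) \<open>S ** diag d ** adj S = mat 1\<close> by simp
  have "adj (R ** K ** adj R) = R ** K ** adj R"
    using assms(2) by (simp add: adj_mult matrix_mul_assoc)
  then obtain Q :: "'r cmat" and e where Q: "Q ** adj Q = mat 1" "Q ** (R ** K ** adj R) ** adj Q = diag e"
    using hermitian_diagonalization by blast
  have "(Q ** R) ** H ** adj (Q ** R) = Q ** (R ** H ** adj R) ** adj Q"
    by (simp add: adj_mult matrix_mul_assoc)
  moreover have "(Q ** R) ** K ** adj (Q ** R) = Q ** (R ** K ** adj R) ** adj Q"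
    by (simp add: adj_mult matrix_mul_assoc)
  ultimately have "diagonalizes (Q ** R) e H K"
    unfolding diagonalizes_def using Q RH invertible_mult[OF unitary_invertible[OF Q(1)] R] by simp
  then show thesis
    by (rule that)
qed


section \<open>Functional calculus\<close>

text \<open>Functional calculus: \<open>hfun f H K\<close> is \<open>H f(H\<^sup>-\<^sup>1K)\<close>, the form with eigenvalues \<open>f d\<^sub>i\<close> relative to
  \<open>H\<close> in a common diagonalizing frame of \<open>H\<close> and \<open>K\<close>.\<close>

definition hfun :: "(real \<Rightarrow> real) \<Rightarrow> 'r::finite cmat \<Rightarrow> 'r cmat \<Rightarrow> 'r cmat" where
  "hfun f H K = (THE F. \<exists>P d. diagonalizes P d H K \<and> P ** F ** adj P = diag (f \<circ> d))"

lemma invertible_congr_cancel: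
  fixes P F G :: "'r::finite cmat"
  assumes "invertible P" "P ** F ** adj P = P ** G ** adj P"
  shows "F = G"
proof -
  have *: "matrix_inv P ** (P ** X ** adj P) ** matrix_inv (adj P) = X" for X
    using assms(1) by (simp add: matrix_mul_assoc[symmetric])
  show ?thesis
    by (metis * assms(2))
qed

text \<open>The change of frame T is unitary and intertwines \<open>diag d\<close> with
  \<open>diag e\<close>. Hence an entry of T at (i, j) can be nonzero only if e i = d j, so T also
  intertwines the diagonals of \<open>f \<circ> d\<close> and \<open>f \<circ> e\<close>. Repeated
  eigenvalues cause no ambiguity.\<close>

lemma hfun_unique:
  fixes P Q :: "'r::finite cmat"
  assumes P: "diagonalizes P d H K" "P ** F ** adj P = diag (f \<circ> d)"
    and Q: "diagonalizes Q e H K" "Q ** G ** adj Q = diag (f \<circ> e)"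
  shows "F = G"
proof -
  define T where "T = Q ** matrix_inv P"
  have iP: "invertible P" and iQ: "invertible Q"
    using P Q by (auto simp: diagonalizes_def)
  have QT: "Q = T ** P"
    using iP by (simp add: T_def matrix_mul_assoc[symmetric])
  have TT: "T ** X ** adj T = Q ** Y ** adj Q" if "X = P ** Y ** adj P" for X Y
    unfolding that by (simp add: QT adj_mult matrix_mul_assoc)
  have T1: "T ** adj T = mat 1"
    using TT[of "mat 1" H] P(1) Q(1) by (simp add: diagonalizes_def)
  then have T1': "adj T ** T = mat 1"
    by (simp add: matrix_left_right_inverse)
  have "T ** diag d ** adj T = diag e"
    using TT[of "diag d" K] P(1) Q(1) by (simp add: diagonalizes_def)
  then have "T ** diag d ** adj T ** T = diag e ** T"
    by simp
  then have comm: "T ** diag d = diag e ** T"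
    by (simp add: matrix_mul_assoc[symmetric] T1')
  then have "T $ i $ j * d j = e i * T $ i $ j" for i j
    by (metis diag_mult_nth mult_diag_nth)
  then have "T $ i $ j = 0 \<or> d j = e i" for i j
    by (metis mult.commute mult_cancel_left of_real_eq_iff)
  then have "T ** diag (f \<circ> d) = diag (f \<circ> e) ** T"
    unfolding vec_eq_iff diag_mult_nth mult_diag_nth
    by (metis comp_apply mult.commute mult_zero_left mult_zero_right)
  then have "T ** diag (f \<circ> d) ** adj T = diag (f \<circ> e)"
    by (simp add: matrix_mul_assoc[symmetric] T1)
  then have "Q ** F ** adj Q = Q ** G ** adj Q"
    using TT[OF P(2)[symmetric]] Q(2) by simp
  then show ?thesis
    using invertible_congr_cancel[OF iQ] by blast
qed

lemma hfun_eq: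
  fixes P :: "'r::finite cmat"
  assumes "diagonalizes P d H K"
  shows "P ** hfun f H K ** adj P = diag (f \<circ> d)"
proof -
  define F where "F = matrix_inv P ** diag (f \<circ> d) ** matrix_inv (adj P)"
  have P: "invertible P"
    using assms by (simp add: diagonalizes_def)
  then have F: "P ** F ** adj P = diag (f \<circ> d)"
    by (simp add: F_def matrix_mul_assoc[symmetric])
  have "hfun f H K = F"
    unfolding hfun_def
    by (rule the_equality) (use assms F hfun_unique in blast)+
  with F show ?thesis by simp
qed

lemma hfun_eqI:
  assumes "diagonalizes P d H K" "P ** F ** adj P = diag (f \<circ> d)"
  shows "hfun f H K = F"
  using assms hfun_eq hfun_unique by blast

lemma hfun_hermitian:
  fixes H :: "'r::finite cmat"
  assumes "posdef H" "adj K = K"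
  shows "adj (hfun f H K) = hfun f H K"
proof -
  obtain P d where P: "diagonalizes P d H K"
    using simultaneous_diagonalization[OF assms] .
  then have "adj (P ** hfun f H K ** adj P) = P ** hfun f H K ** adj P"
    by (simp add: hfun_eq)
  then have "P ** adj (hfun f H K) ** adj P = P ** hfun f H K ** adj P"
    by (simp add: adj_mult matrix_mul_assoc)
  then show ?thesis
    using P by (auto simp: diagonalizes_def dest: invertible_congr_cancel)
qed

lemma diagonalizes_hfun: "diagonalizes P d H K \<Longrightarrow> diagonalizes P (f \<circ> d) H (hfun f H K)"
  using hfun_eq[of P d H K f] by (simp add: diagonalizes_def)

lemma diagonalizes_scaleR: "diagonalizes P d H K \<Longrightarrow> diagonalizes P (\<lambda>i. t * d i) H (t *\<^sub>R K)"
proof -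
  have "diag (\<lambda>i. t * d i) = t *\<^sub>R diag d"
    by (auto simp: vec_eq_iff diag_nth complex_eq_iff)
  then show "diagonalizes P d H K \<Longrightarrow> diagonalizes P (\<lambda>i. t * d i) H (t *\<^sub>R K)"
    by (auto simp: diagonalizes_def matrix_mult.scaleR_left matrix_mult.scaleR_right)
qed

lemma hfun_hfun:
  fixes H :: "'r::finite cmat"
  assumes "posdef H" "adj K = K"
  shows "hfun f H (hfun g H K) = hfun (f \<circ> g) H K"
proof -
  obtain P d where P: "diagonalizes P d H K"
    using simultaneous_diagonalization[OF assms] .
  show ?thesis
    by (rule hfun_eqI[OF diagonalizes_hfun[OF P]]) (simp add: hfun_eq[OF P] comp_assoc)
qed

lemma hfun_id:
  fixes H :: "'r::finite cmat"
  assumes "posdef H" "adj K = K"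
  shows "hfun (\<lambda>x. x) H K = K"
proof -
  obtain P d where P: "diagonalizes P d H K"
    using simultaneous_diagonalization[OF assms] .
  show ?thesis
    by (rule hfun_eqI[OF P]) (use P in \<open>simp add: diagonalizes_def comp_def\<close>)
qed

text \<open>If K is positive, all eigenvalues relative to H are positive, so only the values of f on
  positive reals enter. This lets exp after ln be replaced by the identity.\<close>

lemma hfun_cong_posdef:
  fixes H :: "'r::finite cmat"
  assumes "posdef H" "posdef K" "\<And>x. 0 < x \<Longrightarrow> f x = g x"
  shows "hfun f H K = hfun g H K"
proof -
  have "adj K = K"
    using assms(2) by (simp add: posdef_def)
  then obtain P d where P: "diagonalizes P d H K"
    using simultaneous_diagonalization[OF assms(1)] by blast
  then have "posdef (diag d)"
    using posdef_congr[OF assms(2)] by (metis diagonalizes_def)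
  then have "f \<circ> d = g \<circ> d"
    by (auto simp: posdef_diag_iff assms(3))
  then show ?thesis
    by (intro hfun_eqI[OF P]) (simp add: hfun_eq[OF P])
qed

lemma posdef_hfun:
  fixes H :: "'r::finite cmat"
  assumes "posdef H" "adj K = K" "\<And>x. 0 < f x"
  shows "posdef (hfun f H K)"
proof -
  obtain P d where P: "diagonalizes P d H K"
    using simultaneous_diagonalization[OF assms(1,2)] .
  have "posdef (P ** hfun f H K ** adj P)"
    using assms(3) by (simp add: hfun_eq[OF P] posdef_diag_iff)
  with P show ?thesis
    by (simp add: diagonalizes_def posdef_congr_iff)
qed

lemma diagonalizes_congr:
  fixes S :: "'r::finite cmat"
  assumes "diagonalizes P d H K" "invertible S"
  shows "diagonalizes (P ** matrix_inv S) d (S ** H ** adj S) (S ** K ** adj S)"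
proof -
  have "P ** matrix_inv S ** (S ** X ** adj S) ** adj (P ** matrix_inv S)
      = P ** (matrix_inv S ** S) ** X ** adj (P ** (matrix_inv S ** S))" for X
    by (simp only: adj_mult matrix_mul_assoc)
  with assms show ?thesis
    by (simp add: diagonalizes_def invertible_mult)
qed

text \<open>The frame \<open>P ** matrix_inv S\<close> diagonalizes the transformed pair with the
  same eigenvalues. This naturality makes the functional calculus independent of the
  trivialization.\<close>

lemma hfun_congr:
  fixes S :: "'r::finite cmat"
  assumes "posdef H" "adj K = K" "invertible S"
  shows "hfun f (S ** H ** adj S) (S ** K ** adj S) = S ** hfun f H K ** adj S"
proof -
  obtain P d where P: "diagonalizes P d H K"
    using simultaneous_diagonalization[OF assms(1,2)] .
  have "P ** matrix_inv S ** (S ** hfun f H K ** adj S) ** adj (P ** matrix_inv S)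
      = P ** (matrix_inv S ** S) ** hfun f H K ** adj (P ** (matrix_inv S ** S))"
    by (simp only: adj_mult matrix_mul_assoc)
  then show ?thesis
    by (intro hfun_eqI[OF diagonalizes_congr[OF P assms(3)]]) (simp add: assms(3) hfun_eq[OF P])
qed

section \<open>Resolvents and the Cauchy integral formula\<close>

definition cdiag :: "('r::finite \<Rightarrow> complex) \<Rightarrow> 'r cmat" where
  "cdiag d = (\<chi> i j. if i = j then d i else 0)"

lemma cdiag_nth: "cdiag d $ i $ j = (if i = j then d i else 0)"
  by (simp add: cdiag_def)

lemma diag_eq_cdiag: "diag d = cdiag (\<lambda>i. complex_of_real (d i))"
  by (simp add: vec_eq_iff diag_nth cdiag_nth)

lemma mat_mult_nth: "(mat z ** A) $ i $ j = z * (A :: 'r::finite cmat) $ i $ j"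
proof -
  have "(mat z ** A) $ i $ j = (\<Sum>k\<in>UNIV. if i = k then z * A $ i $ j else 0)"
    unfolding matrix_matrix_mult_def mat_def vec_lambda_beta by (intro sum.cong refl) auto
  then show ?thesis by simp
qed

lemma mat_mult_commute: "A ** mat z = mat z ** (A :: 'r::finite cmat)"
proof -
  have "(A ** mat z) $ i $ j = z * A $ i $ j" for i j
  proof -
    have "(A ** mat z) $ i $ j = (\<Sum>k\<in>UNIV. if k = j then z * A $ i $ j else 0)"
      unfolding matrix_matrix_mult_def mat_def vec_lambda_beta by (intro sum.cong refl) auto
    then show ?thesis by simp
  qed
  then show ?thesis
    by (simp add: vec_eq_iff mat_mult_nth)
qed

lemma mat_mult_cdiag: "mat z ** cdiag d = cdiag (\<lambda>i. z * d i)"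
  by (simp add: vec_eq_iff mat_mult_nth cdiag_nth)

lemma cdiag_mult: "cdiag d ** cdiag e = cdiag (\<lambda>i. d i * e i)"
proof -
  have "(cdiag d ** cdiag e) $ i $ j = (\<Sum>k\<in>UNIV. if i = k then d i * cdiag e $ i $ j else 0)" for i j
    unfolding matrix_matrix_mult_def vec_lambda_beta by (intro sum.cong refl) (auto simp: cdiag_nth)
  then show ?thesis
    by (simp add: vec_eq_iff) (simp add: cdiag_nth)
qed

lemma cdiag_diff: "cdiag d - cdiag e = cdiag (\<lambda>i. d i - e i)"
  by (simp add: vec_eq_iff cdiag_nth)

lemma cdiag_one: "cdiag (\<lambda>_. 1) = (mat 1 :: 'r::finite cmat)"
  by (simp add: vec_eq_iff cdiag_nth mat_one_nth)

lemma mat_mult_conj: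
  fixes P A Q :: "'r::finite cmat"
  shows "P ** (mat z ** A) ** Q = mat z ** (P ** A ** Q)"
proof -
  have "P ** (mat z ** A) = mat z ** (P ** A)"
    unfolding matrix_mul_assoc mat_mult_commute [of P] ..
  then show ?thesis
    by (simp only: matrix_mul_assoc)
qed

lemma has_integral_cdiag:
  fixes d :: "'r::finite \<Rightarrow> real \<Rightarrow> complex"
  assumes "\<And>i. (d i has_integral e i) S"
  shows "((\<lambda>s. cdiag (\<lambda>i. d i s)) has_integral cdiag e) S"
proof -
  define E where "E = (\<lambda>i (z::complex). cdiag (\<lambda>k. if k = i then z else 0) :: 'r cmat)"
  have "bounded_linear (E i)" for i
    unfolding linear_conv_bounded_linear [symmetric]
    by (auto intro!: linearI simp: E_def vec_eq_iff cdiag_nth)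
  then have "((\<lambda>s. \<Sum>i\<in>UNIV. E i (d i s)) has_integral (\<Sum>i\<in>UNIV. E i (e i))) S"
    using has_integral_linear[OF assms] by (intro has_integral_sum) (auto simp: comp_def)
  moreover have "(\<Sum>i\<in>UNIV. E i (f i)) = cdiag f" for f
    by (auto simp: vec_eq_iff E_def cdiag_nth)
  ultimately show ?thesis
    by simp
qed

text \<open>In the diagonalizing frame the two forms have the diagonal entries c + \<rho> - d i and
  d i - (c - \<rho>). Positivity of two forms thus locates the spectrum without mentioning
  eigenvalues, and for sections it is an open condition.\<close>

lemma diagonalizes_spectrum:
  fixes P :: "'r::finite cmat"
  assumes "diagonalizes P d H K"
    and "posdef ((c + \<rho>) *\<^sub>R H - K)" "posdef (K - (c - \<rho>) *\<^sub>R H)"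
  shows "\<bar>d i - c\<bar> < \<rho>"
proof -
  have P: "invertible P" "P ** H ** adj P = mat 1" "P ** K ** adj P = diag d"
    using assms(1) by (auto simp: diagonalizes_def)
  note bl = matrix_mult.diff_left matrix_mult.diff_right matrix_mult.scaleR_left matrix_mult.scaleR_right
  have "P ** ((c + \<rho>) *\<^sub>R H - K) ** adj P = (c + \<rho>) *\<^sub>R mat 1 - diag d"
    "P ** (K - (c - \<rho>) *\<^sub>R H) ** adj P = diag d - (c - \<rho>) *\<^sub>R mat 1"
    by (simp_all add: bl P)
  moreover have "(c + \<rho>) *\<^sub>R mat 1 - diag d = diag (\<lambda>i. c + \<rho> - d i)"
    "diag d - (c - \<rho>) *\<^sub>R mat 1 = diag (\<lambda>i. d i - (c - \<rho>))"
    by (auto simp: vec_eq_iff diag_nth mat_one_nth complex_eq_iff)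
  ultimately have "posdef (diag (\<lambda>i. c + \<rho> - d i))" "posdef (diag (\<lambda>i. d i - (c - \<rho>)))"
    using assms(2,3) P(1) by (metis posdef_congr)+
  then have "0 < c + \<rho> - d i" "0 < d i - (c - \<rho>)"
    unfolding posdef_diag_iff by auto
  then show ?thesis by linarith
qed

text \<open>The inverse of zH - K transforms by the dual law under a change of frame; the factors H
  on both sides turn it back into a form, which becomes diagonal in the frame of H and K.\<close>

lemma resolvent_diagonal:
  fixes P :: "'r::finite cmat"
  assumes P: "diagonalizes P d H K" and z: "\<And>i. z \<noteq> complex_of_real (d i)"
  shows "invertible (mat z ** H - K)"
    and "P ** (H ** matrix_inv (mat z ** H - K) ** H) ** adj P = cdiag (\<lambda>i. 1 / (z - d i))"
proof -
  have P: "invertible P" "P ** H ** adj P = mat 1" "P ** K ** adj P = diag d"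
    using P by (auto simp: diagonalizes_def)
  define Q where "Q = matrix_inv P"
  have Q: "P ** Q = mat 1" "Q ** P = mat 1" "adj P ** adj Q = mat 1" "adj Q ** adj P = mat 1"
    using P(1) by (simp_all add: Q_def flip: adj_mult)
  have PX: "Q ** (P ** X ** adj P) ** adj Q = X" for X
  proof -
    have "Q ** (P ** X ** adj P) ** adj Q = (Q ** P) ** X ** (adj P ** adj Q)"
      by (simp only: matrix_mul_assoc)
    then show ?thesis
      by (simp add: Q)
  qed
  have H: "H = Q ** adj Q"
    using PX[of H] by (simp add: P)
  have "P ** (mat z ** H - K) ** adj P = cdiag (\<lambda>i. z - d i)"
    by (simp add: matrix_mult.diff_left matrix_mult.diff_right mat_mult_conj P diag_eq_cdiag
        cdiag_one [symmetric] mat_mult_cdiag cdiag_diff del: matrix_mul_rid)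
  then have A: "mat z ** H - K = Q ** cdiag (\<lambda>i. z - d i) ** adj Q"
    using PX[of "mat z ** H - K"] by simp
  have C: "cdiag (\<lambda>i. z - d i) ** cdiag (\<lambda>i. 1 / (z - d i)) = mat 1"
    using z by (simp add: cdiag_mult cdiag_one)
  \<comment> \<open>Since zH - K is Q C \<open>adj Q\<close> with C diagonal and Q inverse to P, its
    inverse has to be \<open>adj P\<close> C^-1 P.\<close>
  have "(mat z ** H - K) ** (adj P ** cdiag (\<lambda>i. 1 / (z - d i)) ** P)
      = Q ** cdiag (\<lambda>i. z - d i) ** (adj Q ** adj P) ** cdiag (\<lambda>i. 1 / (z - d i)) ** P"
    unfolding A by (simp only: matrix_mul_assoc)
  also have "\<dots> = Q ** (cdiag (\<lambda>i. z - d i) ** cdiag (\<lambda>i. 1 / (z - d i))) ** P"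
    by (simp add: Q matrix_mul_assoc)
  also have "\<dots> = mat 1"
    by (simp add: C Q)
  finally have *: "(mat z ** H - K) ** (adj P ** cdiag (\<lambda>i. 1 / (z - d i)) ** P) = mat 1" .
  show "invertible (mat z ** H - K)"
    by (rule matrix_inv_eqI[OF *])
  have "P ** (H ** matrix_inv (mat z ** H - K) ** H) ** adj P
     = (P ** H ** adj P) ** cdiag (\<lambda>i. 1 / (z - d i)) ** (P ** H ** adj P)"
    unfolding matrix_inv_eqI(2)[OF *] by (simp only: matrix_mul_assoc)
  then show "P ** (H ** matrix_inv (mat z ** H - K) ** H) ** adj P = cdiag (\<lambda>i. 1 / (z - d i))"
    by (simp add: P)
qed

text \<open>The derivative of \<open>circlepath\<close> is 2 pi i (z - c). It cancels the constant
  of Cauchy's formula and leaves the factor z - c, so that an ordinary integral over [0, 1]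
  remains.\<close>

lemma cauchy_circle_integral:
  assumes "F holomorphic_on S" "open S" "cball c \<rho> \<subseteq> S" "norm (w - c) < \<rho>"
  shows "((\<lambda>s. F (circlepath c \<rho> s) * (circlepath c \<rho> s - c) / (circlepath c \<rho> s - w)) has_integral F w) {0..1}"
proof -
  have "continuous_on (cball c \<rho>) F" "F holomorphic_on ball c \<rho>"
    using assms(1,3) holomorphic_on_subset holomorphic_on_imp_continuous_on ball_subset_cball
    by (meson order_trans continuous_on_subset)+
  then have "((\<lambda>u. F u / (u - w)) has_contour_integral (2 * of_real pi * \<i> * F w)) (circlepath c \<rho>)"
    using assms(4) by (intro Cauchy_integral_circlepath) auto
  then have "((\<lambda>s. F (circlepath c \<rho> s) / (circlepath c \<rho> s - w) *
      vector_derivative (circlepath c \<rho>) (at s within {0..1})) has_integral (2 * of_real pi * \<i> * F w)) {0..1}"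
    by (simp only: has_contour_integral_def)
  then have "((\<lambda>s. (F (circlepath c \<rho> s) / (circlepath c \<rho> s - w) *
      vector_derivative (circlepath c \<rho>) (at s within {0..1})) / (2 * of_real pi * \<i>)) has_integral
      (2 * of_real pi * \<i> * F w) / (2 * of_real pi * \<i>)) {0..1}"
    by (rule has_integral_divide)
  then have I: "((\<lambda>s. (F (circlepath c \<rho> s) / (circlepath c \<rho> s - w) *
      vector_derivative (circlepath c \<rho>) (at s within {0..1})) / (2 * of_real pi * \<i>)) has_integral F w) {0..1}"
    by simp
  have vd: "vector_derivative (circlepath c \<rho>) (at s within {0..1}) = 2 * of_real pi * \<i> * (circlepath c \<rho> s - c)"
    if "s \<in> {0..1}" for s
    using that by (simp add: vector_derivative_circlepath01) (simp add: circlepath)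
  show ?thesis
    by (rule has_integral_eq[OF _ I]) (simp add: vd divide_simps)
qed

text \<open>Congruence with P reduces the claim to one scalar Cauchy formula for each eigenvalue;
  congruence with the inverse Q undoes it after integration. F is a holomorphic extension of f to a
  neighborhood of the closed disc.\<close>

theorem hfun_circle_integral:
  fixes H K :: "'r::finite cmat" and c \<rho> :: real
  assumes H: "posdef H" and K: "adj K = K"
    and spec: "posdef ((c + \<rho>) *\<^sub>R H - K)" "posdef (K - (c - \<rho>) *\<^sub>R H)" and "0 < \<rho>"
    and F: "F holomorphic_on S" "open S" "cball (of_real c) \<rho> \<subseteq> S"
    and Ff: "\<And>x. \<bar>x - c\<bar> < \<rho> \<Longrightarrow> F (of_real x) = of_real (f x)"
  shows "invertible (mat (circlepath (of_real c) \<rho> s) ** H - K)"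
    and "((\<lambda>s. mat (F (circlepath (of_real c) \<rho> s) * (circlepath (of_real c) \<rho> s - of_real c)) **
           (H ** matrix_inv (mat (circlepath (of_real c) \<rho> s) ** H - K) ** H)) has_integral hfun f H K) {0..1}"
proof -
  obtain P :: "'r cmat" and d where P: "diagonalizes P d H K"
    using simultaneous_diagonalization[OF H K] .
  have d: "\<bar>d i - c\<bar> < \<rho>" for i
    using diagonalizes_spectrum[OF P spec] .
  let ?z = "circlepath (of_real c) \<rho>"
  have nz: "?z s \<noteq> complex_of_real (d i)" for i s
  proof
    assume "?z s = complex_of_real (d i)"
    then have "norm (?z s - of_real c) = \<bar>d i - c\<bar>"
      by (metis norm_of_real of_real_diff)
    moreover have "norm (?z s - of_real c) = \<rho>"
      using \<open>0 < \<rho>\<close> by (simp add: circlepath norm_mult)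
    ultimately show False
      using d[of i] by simp
  qed
  show "invertible (mat (?z s) ** H - K)"
    by (rule resolvent_diagonal(1)[OF P nz])
  let ?G = "\<lambda>s. mat (F (?z s) * (?z s - of_real c)) ** (H ** matrix_inv (mat (?z s) ** H - K) ** H)"
  define Q where "Q = matrix_inv P"
  have iP: "invertible P"
    using P by (simp add: diagonalizes_def)
  have PX: "Q ** (P ** X ** adj P) ** adj Q = X" for X
  proof -
    have "Q ** (P ** X ** adj P) ** adj Q = (Q ** P) ** X ** adj (Q ** P)"
      by (simp only: adj_mult matrix_mul_assoc)
    then show ?thesis
      by (simp add: Q_def iP)
  qed
  have "((\<lambda>s. F (?z s) * (?z s - of_real c) / (?z s - of_real (d i))) has_integral of_real (f (d i))) {0..1}" for i
    using cauchy_circle_integral[OF F, of "of_real (d i)"] d[of i]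
    by (simp add: Ff norm_of_real flip: of_real_diff)
  then have "((\<lambda>s. cdiag (\<lambda>i. F (?z s) * (?z s - of_real c) / (?z s - of_real (d i)))) has_integral
      cdiag (\<lambda>i. of_real (f (d i)))) {0..1}"
    by (rule has_integral_cdiag)
  moreover have "cdiag (\<lambda>i. F (?z s) * (?z s - of_real c) / (?z s - of_real (d i))) = P ** ?G s ** adj P" for s
    unfolding mat_mult_conj resolvent_diagonal(2)[OF P nz] by (simp add: mat_mult_cdiag)
  ultimately have "((\<lambda>s. P ** ?G s ** adj P) has_integral P ** hfun f H K ** adj P) {0..1}"
    by (simp add: hfun_eq[OF P] diag_eq_cdiag)
  from has_integral_linear[OF this bounded_linear_compose[OF matrix_mult.bounded_linear_left[of "adj Q"]
      matrix_mult.bounded_linear_right[of Q]]]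
  have "((\<lambda>s. Q ** (P ** ?G s ** adj P) ** adj Q) has_integral Q ** (P ** hfun f H K ** adj P) ** adj Q) {0..1}"
    by (simp only: comp_def)
  then show "(?G has_integral hfun f H K) {0..1}"
    by (simp only: PX)
qed


section \<open>Convergence of all derivatives\<close>

definition has_pderiv ::
  "(nat \<Rightarrow> real) set \<Rightarrow> nat \<Rightarrow> (real \<Rightarrow> (nat \<Rightarrow> real) \<Rightarrow> 'b::real_normed_vector) \<Rightarrow> (real \<Rightarrow> (nat \<Rightarrow> real) \<Rightarrow> 'b) \<Rightarrow> bool"
where
  "has_pderiv W i f f' \<longleftrightarrow>
     (\<forall>s\<in>{0..1}. \<forall>y\<in>W. ((\<lambda>t. f s (y(i := t))) has_vector_derivative f' s y) (at (y i)))"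

definition jcont :: "(nat \<Rightarrow> real) set \<Rightarrow> (real \<Rightarrow> (nat \<Rightarrow> real) \<Rightarrow> 'b::real_normed_vector) \<Rightarrow> bool" where
  "jcont W f \<longleftrightarrow> continuous_on ({0..1} \<times> W) (\<lambda>(s, y). f s y)"

text \<open>Continuity of \<open>f j\<close> is asked only eventually, because a matrix inverse, for
  instance, is controlled only once the argument has come close to its limit.\<close>

definition lulim ::
  "(nat \<Rightarrow> real) set \<Rightarrow> ('i \<Rightarrow> real \<Rightarrow> (nat \<Rightarrow> real) \<Rightarrow> 'b::real_normed_vector) \<Rightarrow>
    (real \<Rightarrow> (nat \<Rightarrow> real) \<Rightarrow> 'b) \<Rightarrow> 'i filter \<Rightarrow> bool" where
  "lulim W f g \<FF> \<longleftrightarrow> (\<forall>\<^sub>F j in \<FF>. jcont W (f j)) \<and> jcont W g \<and>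
     (\<forall>K. compact K \<longrightarrow> K \<subseteq> W \<longrightarrow>
       uniform_limit ({0..1} \<times> K) (\<lambda>j (s, y). f j s y) (\<lambda>(s, y). g s y) \<FF>)"

text \<open>
  Convergence of \<open>f j\<close> to \<open>g\<close> with all partial derivatives in \<open>y\<close> up to order \<open>m\<close>, uniformly in the
  parameter \<open>s \<in> [0, 1]\<close> and locally uniformly in \<open>y\<close>. For constant \<open>f\<close> this is differentiability of class
  \<open>C\<^sup>m\<close>, so that each closure property is proved only once.
\<close>

primrec clim ::
  "nat \<Rightarrow> (nat \<Rightarrow> real) set \<Rightarrow> nat \<Rightarrow> ('i \<Rightarrow> real \<Rightarrow> (nat \<Rightarrow> real) \<Rightarrow> 'b::real_normed_vector) \<Rightarrow>
    (real \<Rightarrow> (nat \<Rightarrow> real) \<Rightarrow> 'b) \<Rightarrow> 'i filter \<Rightarrow> bool" where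
  "clim n W 0 f g \<FF> \<longleftrightarrow> lulim W f g \<FF>"
| "clim n W (Suc m) f g \<FF> \<longleftrightarrow> lulim W f g \<FF> \<and>
     (\<forall>i<n. \<exists>f' g'. (\<forall>\<^sub>F j in \<FF>. has_pderiv W i (f j) (f' j)) \<and> has_pderiv W i g g' \<and> clim n W m f' g' \<FF>)"

lemma clim_lulim: "clim n W m f g \<FF> \<Longrightarrow> lulim W f g \<FF>"
  by (cases m) auto

lemma clim_Suc: "clim n W (Suc m) f g \<FF> \<Longrightarrow> clim n W m f g \<FF>"
proof (induction m arbitrary: f g)
  case (Suc m)
  then show ?case by (subst clim.simps) (metis clim.simps(2))
qed auto

lemma jcont_cong:
  assumes "\<And>s y. s \<in> {0..1} \<Longrightarrow> y \<in> W \<Longrightarrow> f s y = g s y"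
  shows "jcont W f \<longleftrightarrow> jcont W g"
  unfolding jcont_def by (intro continuous_on_cong) (use assms in auto)

lemma lulim_cong:
  assumes "\<forall>\<^sub>F j in \<FF>. \<forall>s\<in>{0..1}. \<forall>y\<in>W. f j s y = f' j s y"
    and g: "\<And>s y. s \<in> {0..1} \<Longrightarrow> y \<in> W \<Longrightarrow> g s y = g' s y"
    and "lulim W f g \<FF>"
  shows "lulim W f' g' \<FF>"
  unfolding lulim_def
proof (intro conjI allI impI)
  show "\<forall>\<^sub>F j in \<FF>. jcont W (f' j)"
    using assms(1) assms(3)[unfolded lulim_def, THEN conjunct1]
    by eventually_elim (metis jcont_cong)
  show "jcont W g'"
    using assms(3) g jcont_cong unfolding lulim_def by metis
  fix K assume K: "compact K" "K \<subseteq> W"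
  then have "uniform_limit ({0..1} \<times> K) (\<lambda>j (s, y). f j s y) (\<lambda>(s, y). g s y) \<FF>"
    using assms(3) unfolding lulim_def by blast
  moreover have E: "\<forall>\<^sub>F j in \<FF>. \<forall>x\<in>{0..1} \<times> K. (\<lambda>(s, y). f j s y) x = (\<lambda>(s, y). f' j s y) x"
    using assms(1) by eventually_elim (use K in auto)
  moreover have "(\<lambda>(s, y). g s y) x = (\<lambda>(s, y). g' s y) x" if "x \<in> {0..1} \<times> K" for x
    using that K g by auto
  ultimately show "uniform_limit ({0..1} \<times> K) (\<lambda>j (s, y). f' j s y) (\<lambda>(s, y). g' s y) \<FF>"
    using uniform_limit_cong[of "{0..1} \<times> K" "\<lambda>j (s, y). f j s y" "\<lambda>j (s, y). f' j s y" \<FF>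
        "\<lambda>(s, y). g s y" "\<lambda>(s, y). g' s y"] by blast
qed

locale coord_open =
  fixes n :: nat and W :: "(nat \<Rightarrow> real) set"
  assumes W_open: "openin (Euclidean_space n) W"
begin

text \<open>\<open>W\<close> is open only within the subspace of sequences that vanish from n on;
  changing a coordinate i < n does not leave that subspace.\<close>

lemma eventually_line:
  assumes "y \<in> W" "i < n"
  shows "\<exists>e>0. \<forall>t\<in>ball (y i) e. y(i := t) \<in> W"
proof -
  have W0: "x \<in> W \<Longrightarrow> \<forall>k\<ge>n. x k = 0" for x
    using openin_subset[OF W_open] by (auto simp: topspace_Euclidean_space)
  obtain U where U: "open U" "W = U \<inter> {x. \<forall>i\<ge>n. x i = 0}"
    using W_open unfolding Euclidean_space_def openin_subtopology euclidean_product_topology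
      open_openin [symmetric] by blast
  have "continuous_on UNIV (\<lambda>t. y(i := t))"
  proof (rule continuous_on_coordinatewise_then_product)
    fix k show "continuous_on UNIV (\<lambda>t. (y(i := t)) k)"
      by (cases "k = i") auto
  qed
  then have "open ((\<lambda>t. y(i := t)) -` U)"
    using U(1) by (intro open_vimage)
  moreover have "y i \<in> (\<lambda>t. y(i := t)) -` U"
    using assms(1) U(2) by auto
  ultimately obtain e where e: "e > 0" "ball (y i) e \<subseteq> (\<lambda>t. y(i := t)) -` U"
    unfolding open_contains_ball by blast
  moreover have "y(i := t) \<in> {x. \<forall>i\<ge>n. x i = 0}" for t
    using W0[OF assms(1)] assms(2) by auto
  ultimately show ?thesis
    using U(2) by blast
qed

lemma eventually_line_at:
  assumes "y \<in> W" "i < n"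
  shows "\<forall>\<^sub>F t in nhds (y i). y(i := t) \<in> W"
  using eventually_line[OF assms] unfolding eventually_nhds_metric by (auto simp: dist_commute)

lemma has_pderiv_cong:
  assumes "i < n" "has_pderiv W i f f'"
    and "\<And>s y. s \<in> {0..1} \<Longrightarrow> y \<in> W \<Longrightarrow> f s y = g s y"
    and "\<And>s y. s \<in> {0..1} \<Longrightarrow> y \<in> W \<Longrightarrow> f' s y = g' s y"
  shows "has_pderiv W i g g'"
  unfolding has_pderiv_def
proof (intro ballI)
  fix s :: real and y assume sy: "s \<in> {0..1}" "y \<in> W"
  have "\<forall>\<^sub>F t in nhds (y i). f s (y(i := t)) = g s (y(i := t))"
    using eventually_line_at[OF sy(2) assms(1)] by eventually_elim (use assms(3) sy in auto)
  moreover have "((\<lambda>t. f s (y(i := t))) has_vector_derivative g' s y) (at (y i))"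
    using assms(2,4) sy by (metis has_pderiv_def)
  ultimately show "((\<lambda>t. g s (y(i := t))) has_vector_derivative g' s y) (at (y i))"
    using has_vector_derivative_cong_ev[of UNIV "\<lambda>t. f s (y(i := t))" "\<lambda>t. g s (y(i := t))" "y i"]
      assms(3)[OF sy] by simp
qed

lemma clim_cong:
  assumes "\<forall>\<^sub>F j in \<FF>. \<forall>s\<in>{0..1}. \<forall>y\<in>W. f j s y = f' j s y"
    and "\<And>s y. s \<in> {0..1} \<Longrightarrow> y \<in> W \<Longrightarrow> g s y = g' s y"
    and "clim n W m f g \<FF>"
  shows "clim n W m f' g' \<FF>"
proof (cases m)
  case 0
  have "lulim W f' g' \<FF>"
    by (rule lulim_cong[OF assms(1,2) clim_lulim[OF assms(3)]])
  with 0 show ?thesis by simp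
next
  case (Suc k)
  show ?thesis
    unfolding Suc clim.simps
  proof (intro conjI allI impI)
    show "lulim W f' g' \<FF>"
      by (rule lulim_cong[OF assms(1,2) clim_lulim[OF assms(3)]])
    fix i assume i: "i < n"
    then obtain F G where FG: "\<forall>\<^sub>F j in \<FF>. has_pderiv W i (f j) (F j)" "has_pderiv W i g G" "clim n W k F G \<FF>"
      using assms(3) unfolding Suc clim.simps by blast
    have "\<forall>\<^sub>F j in \<FF>. has_pderiv W i (f' j) (F j)"
      using FG(1) assms(1) by eventually_elim (rule has_pderiv_cong[OF i], assumption, auto)
    moreover have "has_pderiv W i g' G"
      by (rule has_pderiv_cong[OF i FG(2)]) (use assms(2) in auto)
    ultimately show "\<exists>F G. (\<forall>\<^sub>F j in \<FF>. has_pderiv W i (f' j) (F j)) \<and> has_pderiv W i g' G \<and> clim n W k F G \<FF>"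
      using FG(3) by blast
  qed
qed

section \<open>Stability of C^m convergence under sums and products\<close>

lemma jcont_bounded:
  assumes "jcont W g" "compact K" "K \<subseteq> W"
  shows "bounded ((\<lambda>(s, y). g s y) ` ({0..1} \<times> K))"
proof -
  have "continuous_on ({0..1} \<times> K) (\<lambda>(s, y). g s y)"
    using assms(1) unfolding jcont_def by (rule continuous_on_subset) (use assms(3) in auto)
  then show ?thesis
    by (intro compact_imp_bounded compact_continuous_image compact_Times assms compact_Icc)
qed

lemma clim_linear:
  assumes "bounded_linear L" "clim n W m f g \<FF>"
  shows "clim n W m (\<lambda>j s y. L (f j s y)) (\<lambda>s y. L (g s y)) \<FF>"
  using assms(2)
proof (induction m arbitrary: f g)
  have jc: "jcont W (\<lambda>s y. L (g s y))" if "jcont W g" for g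
    using bounded_linear.continuous_on[OF assms(1) that[unfolded jcont_def]]
    by (simp add: jcont_def case_prod_unfold)
  have lu: "lulim W (\<lambda>j s y. L (f j s y)) (\<lambda>s y. L (g s y)) \<FF>" if "lulim W f g \<FF>" for f g
    using that jc unfolding lulim_def
    by (auto elim!: eventually_mono dest!: bounded_linear.uniform_limit[OF assms(1)] simp: case_prod_unfold)
  {
    case 0
    then show ?case using lu by simp
  next
    case (Suc m)
    have pd: "has_pderiv W i (\<lambda>s y. L (f s y)) (\<lambda>s y. L (f' s y))" if "has_pderiv W i f f'" for f f' i
      using that unfolding has_pderiv_def
      by (auto intro!: bounded_linear.has_vector_derivative[OF assms(1)])
    show ?case
      unfolding clim.simps
    proof (intro conjI allI impI)
      show "lulim W (\<lambda>j s y. L (f j s y)) (\<lambda>s y. L (g s y)) \<FF>"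
        by (rule lu[OF clim_lulim[OF Suc.prems]])
      fix i assume "i < n"
      then obtain F G where FG: "\<forall>\<^sub>F j in \<FF>. has_pderiv W i (f j) (F j)" "has_pderiv W i g G" "clim n W m F G \<FF>"
        using Suc.prems unfolding clim.simps by blast
      have "\<forall>\<^sub>F j in \<FF>. has_pderiv W i (\<lambda>s y. L (f j s y)) (\<lambda>s y. L (F j s y))"
        using FG(1) by eventually_elim (rule pd)
      with pd[OF FG(2)] Suc.IH[OF FG(3)]
      show "\<exists>f' g'. (\<forall>\<^sub>F j in \<FF>. has_pderiv W i (\<lambda>s y. L (f j s y)) (f' j)) \<and>
          has_pderiv W i (\<lambda>s y. L (g s y)) g' \<and> clim n W m f' g' \<FF>"
        by (intro exI conjI)
    qed
  }
qed

lemma clim_add: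
  assumes "clim n W m f g \<FF>" "clim n W m f' g' \<FF>"
  shows "clim n W m (\<lambda>j s y. f j s y + f' j s y) (\<lambda>s y. g s y + g' s y) \<FF>"
  using assms
proof (induction m arbitrary: f g f' g')
  have jc: "jcont W (\<lambda>s y. f s y + g s y)" if "jcont W f" "jcont W g" for f g
    using continuous_on_add[OF that[unfolded jcont_def]] by (simp add: jcont_def case_prod_unfold)
  have lu: "lulim W (\<lambda>j s y. f j s y + f' j s y) (\<lambda>s y. g s y + g' s y) \<FF>"
    if "lulim W f g \<FF>" "lulim W f' g' \<FF>" for f g f' g'
    unfolding lulim_def
  proof (intro conjI allI impI)
    from that have "\<forall>\<^sub>F j in \<FF>. jcont W (f j)" "\<forall>\<^sub>F j in \<FF>. jcont W (f' j)"
      by (auto simp: lulim_def)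
    then show "\<forall>\<^sub>F j in \<FF>. jcont W (\<lambda>s y. f j s y + f' j s y)"
      by eventually_elim (rule jc)
    show "jcont W (\<lambda>s y. g s y + g' s y)"
      using that jc by (auto simp: lulim_def)
    fix K assume "compact K" "K \<subseteq> W"
    then have "uniform_limit ({0..1} \<times> K) (\<lambda>j (s, y). f j s y) (\<lambda>(s, y). g s y) \<FF>"
      "uniform_limit ({0..1} \<times> K) (\<lambda>j (s, y). f' j s y) (\<lambda>(s, y). g' s y) \<FF>"
      using that by (auto simp: lulim_def)
    from uniform_limit_add[OF this]
    show "uniform_limit ({0..1} \<times> K) (\<lambda>j (s, y). f j s y + f' j s y) (\<lambda>(s, y). g s y + g' s y) \<FF>"
      by (simp add: case_prod_unfold)
  qed
  {
    case 0
    then show ?case using lu by simp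
  next
    case (Suc m)
    have pd: "has_pderiv W i (\<lambda>s y. f s y + g s y) (\<lambda>s y. f' s y + g' s y)"
      if "has_pderiv W i f f'" "has_pderiv W i g g'" for f f' g g' i
      using that unfolding has_pderiv_def by (auto intro!: has_vector_derivative_add)
    show ?case
      unfolding clim.simps
    proof (intro conjI allI impI)
      show "lulim W (\<lambda>j s y. f j s y + f' j s y) (\<lambda>s y. g s y + g' s y) \<FF>"
        by (rule lu[OF clim_lulim[OF Suc.prems(1)] clim_lulim[OF Suc.prems(2)]])
      fix i assume "i < n"
      obtain F G where FG: "\<forall>\<^sub>F j in \<FF>. has_pderiv W i (f j) (F j)" "has_pderiv W i g G" "clim n W m F G \<FF>"
        using Suc.prems(1) \<open>i < n\<close> unfolding clim.simps by blast
      obtain F' G' where FG': "\<forall>\<^sub>F j in \<FF>. has_pderiv W i (f' j) (F' j)" "has_pderiv W i g' G'" "clim n W m F' G' \<FF>"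
        using Suc.prems(2) \<open>i < n\<close> unfolding clim.simps by blast
      have "\<forall>\<^sub>F j in \<FF>. has_pderiv W i (\<lambda>s y. f j s y + f' j s y) (\<lambda>s y. F j s y + F' j s y)"
        using FG(1) FG'(1) by eventually_elim (rule pd)
      with pd[OF FG(2) FG'(2)] Suc.IH[OF FG(3) FG'(3)]
      show "\<exists>F G. (\<forall>\<^sub>F j in \<FF>. has_pderiv W i (\<lambda>s y. f j s y + f' j s y) (F j)) \<and>
          has_pderiv W i (\<lambda>s y. g s y + g' s y) G \<and> clim n W m F G \<FF>"
        by (intro exI conjI)
    qed
  }
qed

lemma lulim_const: "jcont W f \<Longrightarrow> lulim W (\<lambda>_. f) f \<FF>"
  by (auto simp: lulim_def intro: uniform_limit_const)

lemma clim_const_fun: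
  fixes c :: "real \<Rightarrow> 'b::real_normed_vector"
  assumes "continuous_on {0..1} c"
  shows "clim n W m (\<lambda>_ s _. c s) (\<lambda>s _. c s) \<FF>"
  using assms
proof (induction m arbitrary: c)
  have jc: "jcont W (\<lambda>s _. c s)" if "continuous_on {0..1} c" for c
    unfolding jcont_def case_prod_unfold
    by (intro continuous_on_compose2[OF that] continuous_intros) auto
  {
    case 0
    show ?case
      unfolding clim.simps by (rule lulim_const[OF jc[OF 0]])
  next
    case (Suc m)
    have z: "clim n W m (\<lambda>_ s _. 0 :: 'b) (\<lambda>s _. 0) \<FF>"
      by (rule Suc.IH) simp
    have pd: "has_pderiv W i (\<lambda>s _. c s) (\<lambda>_ _. 0)" for i
      by (simp add: has_pderiv_def)
    show ?case
      unfolding clim.simps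
    proof (intro conjI allI impI lulim_const[OF jc[OF Suc.prems]])
      fix i
      show "\<exists>f' g'. (\<forall>\<^sub>F j in \<FF>. has_pderiv W i (\<lambda>s _. c s) (f' j)) \<and> has_pderiv W i (\<lambda>s _. c s) g'
          \<and> clim n W m f' g' \<FF>"
        using z pd[of i] by (intro exI[of _ "\<lambda>_ _ _. 0"] exI[of _ "\<lambda>_ _. 0"] conjI always_eventually) auto
    qed
  }
qed

lemma clim_sum:
  assumes "finite I" "\<And>i. i \<in> I \<Longrightarrow> clim n W m (f i) (g i) \<FF>"
  shows "clim n W m (\<lambda>j s y. \<Sum>i\<in>I. f i j s y) (\<lambda>s y. \<Sum>i\<in>I. g i s y) \<FF>"
  using assms
proof (induction I)
  case empty
  then show ?case using clim_const_fun[of "\<lambda>_. 0"] by simp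
next
  case (insert x F)
  have "clim n W m (\<lambda>j s y. f x j s y + (\<Sum>i\<in>F. f i j s y)) (\<lambda>s y. g x s y + (\<Sum>i\<in>F. g i s y)) \<FF>"
    by (rule clim_add) (use insert in auto)
  then show ?case
    using insert.hyps by simp
qed

end

context bounded_bilinear
begin

text \<open>Uniform convergence passes to products because the limits are bounded on compact sets.
  In the product rule one factor stays undifferentiated; \<open>clim_Suc\<close> lowers its order to
  match the derivative of the other.\<close>

lemma clim_bilinear:
  assumes "coord_open n W" "clim n W m f g \<FF>" "clim n W m f' g' \<FF>"
  shows "clim n W m (\<lambda>j s y. prod (f j s y) (f' j s y)) (\<lambda>s y. prod (g s y) (g' s y)) \<FF>"
  using assms(2,3)
proof (induction m arbitrary: f g f' g')
  interpret coord_open n W by fact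
  have jc: "jcont W (\<lambda>s y. prod (f s y) (g s y))" if "jcont W f" "jcont W g" for f g
    using continuous_on[OF that[unfolded jcont_def]] by (simp add: jcont_def case_prod_unfold)
  have lu: "lulim W (\<lambda>j s y. prod (f j s y) (f' j s y)) (\<lambda>s y. prod (g s y) (g' s y)) \<FF>"
    if "lulim W f g \<FF>" "lulim W f' g' \<FF>" for f g f' g'
    unfolding lulim_def
  proof (intro conjI allI impI)
    from that have jj: "jcont W g" "jcont W g'" and "\<forall>\<^sub>F j in \<FF>. jcont W (f j)" "\<forall>\<^sub>F j in \<FF>. jcont W (f' j)"
      by (auto simp: lulim_def)
    from this(3-) show "\<forall>\<^sub>F j in \<FF>. jcont W (\<lambda>s y. prod (f j s y) (f' j s y))"
      by eventually_elim (rule jc)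
    show "jcont W (\<lambda>s y. prod (g s y) (g' s y))"
      by (rule jc[OF jj])
    fix K assume K: "compact K" "K \<subseteq> W"
    then have "uniform_limit ({0..1} \<times> K) (\<lambda>j (s, y). f j s y) (\<lambda>(s, y). g s y) \<FF>"
      "uniform_limit ({0..1} \<times> K) (\<lambda>j (s, y). f' j s y) (\<lambda>(s, y). g' s y) \<FF>"
      using that by (auto simp: lulim_def)
    from bounded_uniform_limit[OF this jcont_bounded[OF jj(2) K] jcont_bounded[OF jj(1) K]]
    show "uniform_limit ({0..1} \<times> K) (\<lambda>j (s, y). prod (f j s y) (f' j s y)) (\<lambda>(s, y). prod (g s y) (g' s y)) \<FF>"
      by (simp add: case_prod_unfold)
  qed
  {
    case 0
    then show ?case using lu by simp
  next
    case (Suc m)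
    have pd: "has_pderiv W i (\<lambda>s y. prod (f s y) (g s y)) (\<lambda>s y. prod (f s y) (g' s y) + prod (f' s y) (g s y))"
      if "has_pderiv W i f f'" "has_pderiv W i g g'" for f f' g g' i
      unfolding has_pderiv_def
    proof (intro ballI)
      fix s :: real and y assume sy: "s \<in> {0..1}" "y \<in> W"
      from has_vector_derivative[OF that(1)[unfolded has_pderiv_def, rule_format, OF sy]
          that(2)[unfolded has_pderiv_def, rule_format, OF sy]]
      show "((\<lambda>t. prod (f s (y(i := t))) (g s (y(i := t)))) has_vector_derivative
          prod (f s y) (g' s y) + prod (f' s y) (g s y)) (at (y i))"
        by simp
    qed
    show ?case
      unfolding clim.simps
    proof (intro conjI allI impI)
      show "lulim W (\<lambda>j s y. prod (f j s y) (f' j s y)) (\<lambda>s y. prod (g s y) (g' s y)) \<FF>"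
        by (rule lu[OF clim_lulim[OF Suc.prems(1)] clim_lulim[OF Suc.prems(2)]])
      fix i assume "i < n"
      obtain F G where FG: "\<forall>\<^sub>F j in \<FF>. has_pderiv W i (f j) (F j)" "has_pderiv W i g G" "clim n W m F G \<FF>"
        using Suc.prems(1) \<open>i < n\<close> unfolding clim.simps by blast
      obtain F' G' where FG': "\<forall>\<^sub>F j in \<FF>. has_pderiv W i (f' j) (F' j)" "has_pderiv W i g' G'" "clim n W m F' G' \<FF>"
        using Suc.prems(2) \<open>i < n\<close> unfolding clim.simps by blast
      have "\<forall>\<^sub>F j in \<FF>. has_pderiv W i (\<lambda>s y. prod (f j s y) (f' j s y))
          (\<lambda>s y. prod (f j s y) (F' j s y) + prod (F j s y) (f' j s y))"
        using FG(1) FG'(1) by eventually_elim (rule pd)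
      with pd[OF FG(2) FG'(2)]
        clim_add[OF Suc.IH[OF clim_Suc[OF Suc.prems(1)] FG'(3)] Suc.IH[OF FG(3) clim_Suc[OF Suc.prems(2)]]]
      show "\<exists>F G. (\<forall>\<^sub>F j in \<FF>. has_pderiv W i (\<lambda>s y. prod (f j s y) (f' j s y)) (F j)) \<and>
          has_pderiv W i (\<lambda>s y. prod (g s y) (g' s y)) G \<and> clim n W m F G \<FF>"
        by (intro exI conjI)
    qed
  }
qed

end

section \<open>Inversion of matrices under limits and derivatives\<close>

lemma has_vector_derivative_iff_quotient:
  fixes f :: "real \<Rightarrow> 'b::real_normed_vector"
  shows "(f has_vector_derivative d) (at x) \<longleftrightarrow> ((\<lambda>t. (f (x + t) - f x) /\<^sub>R t) \<longlongrightarrow> d) (at 0)"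
proof -
  have "norm (f (x + h) - f x - h *\<^sub>R d) / norm h = norm ((f (x + h) - f x) /\<^sub>R h - d)" if "h \<noteq> 0" for h
  proof -
    have "norm ((f (x + h) - f x) /\<^sub>R h - d) = norm ((f (x + h) - f x - h *\<^sub>R d) /\<^sub>R h)"
      using that by (simp add: scaleR_diff_right)
    then show ?thesis
      by (simp add: divide_inverse mult.commute)
  qed
  then have "((\<lambda>h. norm (f (x + h) - f x - h *\<^sub>R d) / norm h) \<longlongrightarrow> 0) (at 0)
      \<longleftrightarrow> ((\<lambda>h. norm ((f (x + h) - f x) /\<^sub>R h - d)) \<longlongrightarrow> 0) (at 0)"
    by (intro Lim_cong_within) auto
  also have "\<dots> \<longleftrightarrow> ((\<lambda>h. (f (x + h) - f x) /\<^sub>R h) \<longlongrightarrow> d) (at 0)"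
    by (simp only: tendsto_norm_zero_iff LIM_zero_iff)
  finally show ?thesis
    by (simp add: has_vector_derivative_def has_derivative_at bounded_linear_scaleR_left)
qed

text \<open>Everything follows from A^-1 - B^-1 = A^-1 (B - A) B^-1. Only B^-1 is bounded by
  assumption; for A close to B the identity first bounds A^-1 and then the difference.\<close>

lemma uniform_limit_matrix_inv:
  fixes A :: "'i \<Rightarrow> 'x \<Rightarrow> 'r::finite cmat"
  assumes lim: "uniform_limit S A B \<FF>"
    and invB: "\<And>x. x \<in> S \<Longrightarrow> invertible (B x)"
    and bdd: "bounded ((\<lambda>x. matrix_inv (B x)) ` S)"
    and invA: "\<forall>\<^sub>F j in \<FF>. \<forall>x\<in>S. invertible (A j x)"
  shows "uniform_limit S (\<lambda>j x. matrix_inv (A j x)) (\<lambda>x. matrix_inv (B x)) \<FF>"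
proof (rule uniform_limitI)
  fix e :: real assume "e > 0"
  obtain C where C: "C > 0" "\<And>(X :: 'r cmat) (Y :: 'r cmat). norm (X ** Y) \<le> norm X * norm Y * C"
    using matrix_mult.pos_bounded by blast
  obtain D where D: "D > 0" "\<And>x. x \<in> S \<Longrightarrow> norm (matrix_inv (B x)) \<le> D"
    using bdd unfolding bounded_pos by auto
  have C3: "norm (X ** Y ** Z) \<le> norm X * norm Y * norm Z * C\<^sup>2" for X Y Z :: "'r cmat"
  proof -
    have "norm (X ** Y ** Z) \<le> norm (X ** Y) * norm Z * C"
      by (rule C(2))
    also have "\<dots> \<le> (norm X * norm Y * C) * norm Z * C"
      using C(1) C(2)[of X Y] by (intro mult_right_mono) auto
    finally show ?thesis
      by (simp add: power2_eq_square mult_ac)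
  qed
  \<comment> \<open>The first bound makes the norm of a - b at most half that of a, so a has norm at
    most 2D. The second then makes the difference smaller than e. C is the constant of the product,
    squared because three factors occur.\<close>
  define \<delta> where "\<delta> = min (1 / (2 * C\<^sup>2 * D)) (e / (4 * C\<^sup>2 * D\<^sup>2))"
  have \<delta>: "\<delta> > 0" "C\<^sup>2 * D * \<delta> \<le> 1 / 2" "2 * C\<^sup>2 * D\<^sup>2 * \<delta> < e"
  proof -
    show "\<delta> > 0"
      using C(1) D(1) \<open>e > 0\<close> by (simp add: \<delta>_def)
    have "\<delta> \<le> 1 / (2 * C\<^sup>2 * D)" "\<delta> \<le> e / (4 * C\<^sup>2 * D\<^sup>2)"
      by (simp_all add: \<delta>_def)
    then show "C\<^sup>2 * D * \<delta> \<le> 1 / 2" "2 * C\<^sup>2 * D\<^sup>2 * \<delta> < e"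
      using C(1) D(1) \<open>e > 0\<close> by (simp_all add: field_simps)
  qed
  from uniform_limitD[OF lim \<delta>(1)] invA
  show "\<forall>\<^sub>F j in \<FF>. \<forall>x\<in>S. dist (matrix_inv (A j x)) (matrix_inv (B x)) < e"
  proof eventually_elim
    case (elim j)
    show ?case
    proof
      fix x assume x: "x \<in> S"
      define a b where "a = matrix_inv (A j x)" and "b = matrix_inv (B x)"
      have AB: "invertible (A j x)" "invertible (B x)" "norm (B x - A j x) \<le> \<delta>"
        using elim invB x by (auto simp: dist_norm norm_minus_commute less_imp_le)
      have "a ** (B x - A j x) ** b = a ** B x ** b - (a ** A j x) ** b"
        by (simp add: matrix_mult.diff_left matrix_mult.diff_right)
      also have "\<dots> = a - b"
        using AB by (simp add: a_def b_def matrix_mul_assoc [symmetric])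
      finally have ab: "a - b = a ** (B x - A j x) ** b" ..
      have "norm (a - b) \<le> norm a * norm (B x - A j x) * norm b * C\<^sup>2"
        unfolding ab by (rule C3)
      also have "\<dots> \<le> norm a * \<delta> * D * C\<^sup>2"
        using AB D(2)[OF x] D(1) \<delta>(1) by (intro mult_right_mono mult_mono) (auto simp: b_def)
      finally have n: "norm (a - b) \<le> norm a * (C\<^sup>2 * D * \<delta>)"
        by (simp add: mult_ac)
      also have "\<dots> \<le> norm a * (1 / 2)"
        using \<delta>(2) by (intro mult_left_mono) auto
      finally have "norm a \<le> 2 * D"
        using D(2)[OF x] norm_triangle_ineq2[of a b] by (simp add: b_def)
      then have "norm a * (C\<^sup>2 * D * \<delta>) \<le> 2 * D * (C\<^sup>2 * D * \<delta>)"
        using C(1) D(1) \<delta>(1) by (intro mult_right_mono) auto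
      with n \<delta>(3) show "dist (matrix_inv (A j x)) (matrix_inv (B x)) < e"
        by (simp add: dist_norm a_def b_def power2_eq_square mult_ac)
    qed
  qed
qed

lemma tendsto_matrix_inv:
  fixes A :: "'i \<Rightarrow> 'r::finite cmat"
  assumes "(A \<longlongrightarrow> B) \<FF>" "invertible B" "\<forall>\<^sub>F j in \<FF>. invertible (A j)"
  shows "((\<lambda>j. matrix_inv (A j)) \<longlongrightarrow> matrix_inv B) \<FF>"
  using uniform_limit_matrix_inv[where S = "{()}" and A = "\<lambda>j _. A j" and B = "\<lambda>_. B" and \<FF> = \<FF>] assms
  by (simp add: uniform_limit_singleton)

lemma continuous_on_matrix_inv:
  fixes f :: "'x::topological_space \<Rightarrow> 'r::finite cmat"
  assumes "continuous_on S f" "\<And>x. x \<in> S \<Longrightarrow> invertible (f x)"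
  shows "continuous_on S (\<lambda>x. matrix_inv (f x))"
  unfolding continuous_on_def
proof
  fix x assume x: "x \<in> S"
  have "\<forall>\<^sub>F y in at x within S. y \<in> S"
    by (auto simp: eventually_at_filter)
  then show "((\<lambda>x. matrix_inv (f x)) \<longlongrightarrow> matrix_inv (f x)) (at x within S)"
    using assms x by (intro tendsto_matrix_inv) (auto simp: continuous_on_def elim: eventually_mono)
qed

text \<open>The same identity writes the difference quotient of the inverse as minus the product of
  the inverse at x + t, the quotient of f, and the inverse at x; continuity of inversion gives the
  limit.\<close>

lemma has_vector_derivative_matrix_inv:
  fixes f :: "real \<Rightarrow> 'r::finite cmat"
  assumes "(f has_vector_derivative f') (at x)" "\<forall>\<^sub>F t in nhds x. invertible (f t)"
  shows "((\<lambda>t. matrix_inv (f t)) has_vector_derivative - (matrix_inv (f x) ** f' ** matrix_inv (f x))) (at x)"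
proof -
  have fx: "invertible (f x)"
    using assms(2) by (rule eventually_nhds_x_imp_x)
  have "isCont f x"
    using assms(1) has_vector_derivative_continuous by blast
  then have "((\<lambda>t. f (x + t)) \<longlongrightarrow> f x) (at 0)"
    by (metis LIM_isCont_iff isCont_def)
  moreover have "filterlim (\<lambda>t. x + t) (nhds x) (at 0)"
    by (rule tendsto_eq_intros | simp)+
  with assms(2) have ev: "\<forall>\<^sub>F t in at 0. invertible (f (x + t))"
    by (rule eventually_compose_filterlim)
  ultimately have 1: "((\<lambda>t. matrix_inv (f (x + t))) \<longlongrightarrow> matrix_inv (f x)) (at 0)"
    using fx by (intro tendsto_matrix_inv)
  have 2: "((\<lambda>t. (f (x + t) - f x) /\<^sub>R t) \<longlongrightarrow> f') (at 0)"
    using assms(1) by (simp add: has_vector_derivative_iff_quotient)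
  have "((\<lambda>t. - (matrix_inv (f (x + t)) ** ((f (x + t) - f x) /\<^sub>R t) ** matrix_inv (f x)))
      \<longlongrightarrow> - (matrix_inv (f x) ** f' ** matrix_inv (f x))) (at 0)"
    by (intro tendsto_minus matrix_mult.tendsto 1 2 tendsto_const)
  moreover have "\<forall>\<^sub>F t in at 0. - (matrix_inv (f (x + t)) ** ((f (x + t) - f x) /\<^sub>R t) ** matrix_inv (f x))
      = (matrix_inv (f (x + t)) - matrix_inv (f x)) /\<^sub>R t"
    using ev
  proof eventually_elim
    case (elim t)
    have "matrix_inv (f (x + t)) ** (f (x + t) - f x) ** matrix_inv (f x)
        = matrix_inv (f x) - matrix_inv (f (x + t))"
      using elim fx
      by (simp add: matrix_mult.diff_left matrix_mult.diff_right matrix_mul_assoc [symmetric])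
    then show ?case
      by (simp only: matrix_mult.scaleR_left matrix_mult.scaleR_right) (simp add: algebra_simps)
  qed
  ultimately show ?thesis
    unfolding has_vector_derivative_iff_quotient by (rule Lim_transform_eventually)
qed

context coord_open
begin

text \<open>A derivative of the inverse is -F^-1 F' F^-1, which contains the inverse itself with one
  order less to control. So the induction closes with f and g fixed.\<close>

lemma clim_matrix_inv:
  fixes f :: "'i \<Rightarrow> real \<Rightarrow> (nat \<Rightarrow> real) \<Rightarrow> 'r::finite cmat"
  assumes "clim n W m f g \<FF>"
    and "\<forall>\<^sub>F j in \<FF>. \<forall>s\<in>{0..1}. \<forall>y\<in>W. invertible (f j s y)"
    and g: "\<And>s y. s \<in> {0..1} \<Longrightarrow> y \<in> W \<Longrightarrow> invertible (g s y)"
  shows "clim n W m (\<lambda>j s y. matrix_inv (f j s y)) (\<lambda>s y. matrix_inv (g s y)) \<FF>"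
  using assms(1)
proof (induction m)
  have jc: "jcont W (\<lambda>s y. matrix_inv (f s y))"
    if "jcont W f" "\<forall>s\<in>{0..1}. \<forall>y\<in>W. invertible (f s y)" for f :: "real \<Rightarrow> (nat \<Rightarrow> real) \<Rightarrow> 'r cmat"
    using continuous_on_matrix_inv[OF that(1)[unfolded jcont_def]] that(2)
    by (force simp: jcont_def case_prod_unfold)
  have lu: "lulim W (\<lambda>j s y. matrix_inv (f j s y)) (\<lambda>s y. matrix_inv (g s y)) \<FF>" if fg: "lulim W f g \<FF>"
    unfolding lulim_def
  proof (intro conjI allI impI)
    from fg have j: "jcont W g" and "\<forall>\<^sub>F j in \<FF>. jcont W (f j)"
      by (auto simp: lulim_def)
    from this(2) assms(2) show "\<forall>\<^sub>F j in \<FF>. jcont W (\<lambda>s y. matrix_inv (f j s y))"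
      by eventually_elim (rule jc)
    show jg: "jcont W (\<lambda>s y. matrix_inv (g s y))"
      using jc j g by blast
    fix K assume K: "compact K" "K \<subseteq> W"
    then have "uniform_limit ({0..1} \<times> K) (\<lambda>j (s, y). f j s y) (\<lambda>(s, y). g s y) \<FF>"
      using fg by (auto simp: lulim_def)
    then have "uniform_limit ({0..1} \<times> K) (\<lambda>j x. matrix_inv (case x of (s, y) \<Rightarrow> f j s y))
        (\<lambda>x. matrix_inv (case x of (s, y) \<Rightarrow> g s y)) \<FF>"
    proof (rule uniform_limit_matrix_inv)
      show "bounded ((\<lambda>x. matrix_inv (case x of (s, y) \<Rightarrow> g s y)) ` ({0..1} \<times> K))"
        using jcont_bounded[OF jg K] by (simp add: case_prod_unfold)
      show "\<forall>\<^sub>F j in \<FF>. \<forall>x\<in>{0..1} \<times> K. invertible (case x of (s, y) \<Rightarrow> f j s y)"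
        using assms(2) by eventually_elim (use K in auto)
    qed (use g K in auto)
    then show "uniform_limit ({0..1} \<times> K) (\<lambda>j (s, y). matrix_inv (f j s y)) (\<lambda>(s, y). matrix_inv (g s y)) \<FF>"
      by (simp add: case_prod_unfold)
  qed
  {
    case 0
    then show ?case using lu by simp
  next
    case (Suc m)
    have pd: "has_pderiv W i (\<lambda>s y. matrix_inv (f s y)) (\<lambda>s y. - (matrix_inv (f s y) ** f' s y ** matrix_inv (f s y)))"
      if "i < n" "has_pderiv W i f f'" "\<forall>s\<in>{0..1}. \<forall>y\<in>W. invertible (f s y)"
      for f f' :: "real \<Rightarrow> (nat \<Rightarrow> real) \<Rightarrow> 'r cmat" and i
      unfolding has_pderiv_def
    proof (intro ballI)
      fix s :: real and y assume sy: "s \<in> {0..1}" "y \<in> W"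
      have "\<forall>\<^sub>F t in nhds (y i). invertible (f s (y(i := t)))"
        using eventually_line_at[OF sy(2) that(1)] by eventually_elim (use that(3) sy in auto)
      from has_vector_derivative_matrix_inv[OF that(2)[unfolded has_pderiv_def, rule_format, OF sy] this]
      show "((\<lambda>t. matrix_inv (f s (y(i := t)))) has_vector_derivative
          - (matrix_inv (f s y) ** f' s y ** matrix_inv (f s y))) (at (y i))"
        by simp
    qed
    have IH: "clim n W m (\<lambda>j s y. matrix_inv (f j s y)) (\<lambda>s y. matrix_inv (g s y)) \<FF>"
      using Suc.IH[OF clim_Suc[OF Suc.prems]] .
    show ?case
      unfolding clim.simps
    proof (intro conjI allI impI lu[OF clim_lulim[OF Suc.prems]])
      fix i assume "i < n"
      then obtain F G where FG: "\<forall>\<^sub>F j in \<FF>. has_pderiv W i (f j) (F j)" "has_pderiv W i g G" "clim n W m F G \<FF>"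
        using Suc.prems unfolding clim.simps by blast
      have "\<forall>\<^sub>F j in \<FF>. has_pderiv W i (\<lambda>s y. matrix_inv (f j s y))
         (\<lambda>s y. - (matrix_inv (f j s y) ** F j s y ** matrix_inv (f j s y)))"
        using FG(1) assms(2) by eventually_elim (rule pd[OF \<open>i < n\<close>])
      moreover have "has_pderiv W i (\<lambda>s y. matrix_inv (g s y))
         (\<lambda>s y. - (matrix_inv (g s y) ** G s y ** matrix_inv (g s y)))"
        using pd[OF \<open>i < n\<close> FG(2)] g by blast
      moreover have "clim n W m (\<lambda>j s y. - (matrix_inv (f j s y) ** F j s y ** matrix_inv (f j s y)))
          (\<lambda>s y. - (matrix_inv (g s y) ** G s y ** matrix_inv (g s y))) \<FF>"
        by (intro clim_linear[OF bounded_linear_minus[OF bounded_linear_ident]]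
            matrix_mult.clim_bilinear[OF coord_open_axioms] IH FG(3))
      ultimately show "\<exists>f' g'. (\<forall>\<^sub>F j in \<FF>. has_pderiv W i (\<lambda>s y. matrix_inv (f j s y)) (f' j)) \<and>
          has_pderiv W i (\<lambda>s y. matrix_inv (g s y)) g' \<and> clim n W m f' g' \<FF>"
        by (intro exI conjI)
    qed
  }
qed

section \<open>Integration over the parameter\<close>

lemma jcont_swap:
  assumes "jcont W f"
  shows "continuous_on (W \<times> cbox 0 1) (\<lambda>(y, s). f s y)"
proof -
  have "continuous_on (W \<times> cbox 0 (1::real)) (\<lambda>p. (snd p, fst p))"
    by (intro continuous_intros)
  from continuous_on_compose2[OF assms[unfolded jcont_def] this] show ?thesis
    by (simp add: case_prod_unfold image_subset_iff)
qed

lemma jcont_fiber: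
  assumes "jcont W f" "y \<in> W"
  shows "continuous_on {0..1} (\<lambda>s. f s y)"
proof -
  have "continuous_on {0..1::real} (\<lambda>s. (s, y))"
    by (intro continuous_intros)
  from continuous_on_compose2[OF assms(1)[unfolded jcont_def] this] show ?thesis
    using assms(2) by (simp add: image_subset_iff)
qed

lemma jcont_no_param: "jcont W (\<lambda>_. u) \<longleftrightarrow> continuous_on W u"
proof
  assume u: "jcont W (\<lambda>_. u)"
  have "continuous_on W (\<lambda>y. (0 :: real, y))"
    by (intro continuous_intros)
  from continuous_on_compose2[OF u[unfolded jcont_def] this] show "continuous_on W u"
    by (simp add: image_subset_iff)
next
  assume u: "continuous_on W u"
  have "continuous_on ({0..1::real} \<times> W) snd"
    by (intro continuous_intros)
  from continuous_on_compose2[OF u this] show "jcont W (\<lambda>_. u)"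
    by (simp add: jcont_def case_prod_unfold image_subset_iff)
qed

text \<open>Uniformity in s carries the limit through the integral, and the Leibniz rule does the
  same for each derivative. The result is constant in s; the parameter is kept as a dummy so that it
  is again of the form \<open>clim\<close> expects.\<close>

lemma clim_integral:
  fixes f :: "'i \<Rightarrow> real \<Rightarrow> (nat \<Rightarrow> real) \<Rightarrow> 'b::banach"
  assumes "clim n W m f g \<FF>"
  shows "clim n W m (\<lambda>j _ y. integral {0..1} (\<lambda>s. f j s y)) (\<lambda>_ y. integral {0..1} (\<lambda>s. g s y)) \<FF>"
  using assms
proof (induction m arbitrary: f g)
  have jc: "jcont W (\<lambda>_ y. integral {0..1} (\<lambda>s. f s y))" if "jcont W f"
    for f :: "real \<Rightarrow> (nat \<Rightarrow> real) \<Rightarrow> 'b"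
    using integral_continuous_on_param[OF jcont_swap[OF that]] by (simp add: jcont_no_param)
  have lu: "lulim W (\<lambda>j _ y. integral {0..1} (\<lambda>s. f j s y)) (\<lambda>_ y. integral {0..1} (\<lambda>s. g s y)) \<FF>"
    if fg: "lulim W f g \<FF>" for f :: "'i \<Rightarrow> real \<Rightarrow> (nat \<Rightarrow> real) \<Rightarrow> 'b" and g
    unfolding lulim_def
  proof (intro conjI allI impI)
    from fg have j: "jcont W g" and ev: "\<forall>\<^sub>F j in \<FF>. jcont W (f j)"
      by (auto simp: lulim_def)
    from ev show "\<forall>\<^sub>F j in \<FF>. jcont W (\<lambda>_ y. integral {0..1} (\<lambda>s. f j s y))"
      by eventually_elim (rule jc)
    show "jcont W (\<lambda>_ y. integral {0..1} (\<lambda>s. g s y))"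
      by (rule jc[OF j])
    fix K assume K: "compact K" "K \<subseteq> W"
    then have u: "uniform_limit ({0..1} \<times> K) (\<lambda>j (s, y). f j s y) (\<lambda>(s, y). g s y) \<FF>"
      using fg by (auto simp: lulim_def)
    show "uniform_limit ({0..1::real} \<times> K) (\<lambda>j (s, y). integral {0..1} (\<lambda>s. f j s y))
        (\<lambda>(s, y). integral {0..1} (\<lambda>s. g s y)) \<FF>"
    proof (rule uniform_limitI)
      fix e :: real assume "e > 0"
      then have "e / 2 > 0" by simp
      from uniform_limitD[OF u this] ev
      show "\<forall>\<^sub>F j in \<FF>. \<forall>x\<in>{0..1::real} \<times> K. dist (case x of (s, y) \<Rightarrow> integral {0..1} (\<lambda>s. f j s y))
          (case x of (s, y) \<Rightarrow> integral {0..1} (\<lambda>s. g s y)) < e"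
      proof eventually_elim
        case (elim j)
        show ?case
        proof
          fix x assume "x \<in> {0..1::real} \<times> K"
          then obtain s y where x: "x = (s, y)" and y: "y \<in> K" "y \<in> W"
            using K by auto
          have c: "continuous_on {0..1} (\<lambda>s. f j s y)" "continuous_on {0..1} (\<lambda>s. g s y)"
            using jcont_fiber elim(2) j y by auto
          have "norm (integral {0..1} (\<lambda>s. f j s y - g s y)) \<le> e / 2 * (1 - 0)"
          proof (rule integral_bound)
            show "continuous_on {0..1} (\<lambda>s. f j s y - g s y)"
              using c by (intro continuous_intros)
            fix t :: real assume "t \<in> {0..1}"
            with elim(1) y(1) show "norm (f j t y - g t y) \<le> e / 2"
              by (force simp: dist_norm)
          qed simp
          also have "integral {0..1} (\<lambda>s. f j s y - g s y)
              = integral {0..1} (\<lambda>s. f j s y) - integral {0..1} (\<lambda>s. g s y)"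
            by (intro Henstock_Kurzweil_Integration.integral_diff integrable_continuous_real c)
          finally show "dist (case x of (s, y) \<Rightarrow> integral {0..1} (\<lambda>s. f j s y))
              (case x of (s, y) \<Rightarrow> integral {0..1} (\<lambda>s. g s y)) < e"
            using \<open>e > 0\<close> by (simp add: x dist_norm)
        qed
      qed
    qed
  qed
  {
    case 0
    then show ?case using lu by simp
  next
    case (Suc m)
    have pd: "has_pderiv W i (\<lambda>_ y. integral {0..1} (\<lambda>s. f s y)) (\<lambda>_ y. integral {0..1} (\<lambda>s. f' s y))"
      if i: "i < n" and f: "has_pderiv W i f f'" and c: "jcont W f" "jcont W f'"
      for f f' :: "real \<Rightarrow> (nat \<Rightarrow> real) \<Rightarrow> 'b" and i
      unfolding has_pderiv_def
    proof (intro ballI)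
      fix s :: real and y assume sy: "s \<in> {0..1}" "y \<in> W"
      \<comment> \<open>The Leibniz rule wants a convex parameter domain: a ball on the coordinate
        line through y that stays inside \<open>W\<close>.\<close>
      obtain e where e: "e > 0" "\<And>t. t \<in> ball (y i) e \<Longrightarrow> y(i := t) \<in> W"
        using eventually_line[OF sy(2) i] by blast
      have "((\<lambda>t. integral (cbox 0 1) (\<lambda>s. f s (y(i := t)))) has_vector_derivative
          integral (cbox 0 1) (\<lambda>s. f' s (y(i := y i)))) (at (y i) within ball (y i) e)"
      proof (rule leibniz_rule_vector_derivative[where fx = "\<lambda>t s. f' s (y(i := t))"])
        fix t s :: real assume t: "t \<in> ball (y i) e" and s: "s \<in> cbox 0 1"
        have "((\<lambda>u. f s ((y(i := t))(i := u))) has_vector_derivative f' s (y(i := t))) (at ((y(i := t)) i))"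
          using f[unfolded has_pderiv_def, rule_format, OF _ e(2)[OF t], of s] s by simp
        then show "((\<lambda>t. f s (y(i := t))) has_vector_derivative f' s (y(i := t))) (at t within ball (y i) e)"
          by (auto intro: has_vector_derivative_at_within)
      next
        fix t assume "t \<in> ball (y i) e"
        then show "(\<lambda>s. f s (y(i := t))) integrable_on cbox 0 1"
          using jcont_fiber[OF c(1) e(2)] by (auto intro: integrable_continuous_real)
      next
        have "continuous_on UNIV (\<lambda>t. y(i := t))"
        proof (rule continuous_on_coordinatewise_then_product)
          fix k show "continuous_on UNIV (\<lambda>t. (y(i := t)) k)"
            by (cases "k = i") auto
        qed
        then have "continuous_on (ball (y i) e \<times> cbox 0 1) (\<lambda>p. y(i := fst p))"
          by (rule continuous_on_compose2) (auto intro!: continuous_intros)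
        then have "continuous_on (ball (y i) e \<times> cbox 0 1) (\<lambda>p. (y(i := fst p), snd p))"
          by (rule continuous_on_Pair[OF _ continuous_on_snd[OF continuous_on_id]])
        then show "continuous_on (ball (y i) e \<times> cbox 0 1) (\<lambda>(t, s). f' s (y(i := t)))"
          using continuous_on_compose2[OF jcont_swap[OF c(2)], where f = "\<lambda>p. (y(i := fst p), snd p)"] e(2)
          by (force simp: case_prod_unfold)
      qed (use e in auto)
      then show "((\<lambda>t. integral {0..1} (\<lambda>s. f s (y(i := t)))) has_vector_derivative
          integral {0..1} (\<lambda>s. f' s y)) (at (y i))"
        using e(1) by (simp add: at_within_open[of "y i" "ball (y i) e"])
    qed
    show ?case
      unfolding clim.simps
    proof (intro conjI allI impI lu[OF clim_lulim[OF Suc.prems]])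
      fix i assume "i < n"
      then obtain F G where FG: "\<forall>\<^sub>F j in \<FF>. has_pderiv W i (f j) (F j)" "has_pderiv W i g G" "clim n W m F G \<FF>"
        using Suc.prems unfolding clim.simps by blast
      have c: "\<forall>\<^sub>F j in \<FF>. jcont W (f j)" "jcont W g" "\<forall>\<^sub>F j in \<FF>. jcont W (F j)" "jcont W G"
        using clim_lulim[OF Suc.prems] clim_lulim[OF FG(3)] by (auto simp: lulim_def)
      have "\<forall>\<^sub>F j in \<FF>. has_pderiv W i (\<lambda>_ y. integral {0..1} (\<lambda>s. f j s y)) (\<lambda>_ y. integral {0..1} (\<lambda>s. F j s y))"
        using FG(1) c(1,3) by eventually_elim (rule pd[OF \<open>i < n\<close>])
      with pd[OF \<open>i < n\<close> FG(2) c(2,4)] Suc.IH[OF FG(3)]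
      show "\<exists>f' g'. (\<forall>\<^sub>F j in \<FF>. has_pderiv W i (\<lambda>_ y. integral {0..1} (\<lambda>s. f j s y)) (f' j)) \<and>
          has_pderiv W i (\<lambda>_ y. integral {0..1} (\<lambda>s. g s y)) g' \<and> clim n W m f' g' \<FF>"
        by (intro exI conjI)
    qed
  }
qed

section \<open>Translation to iterated partial derivatives\<close>

lemma clim_limit: "clim n W m f g \<FF> \<Longrightarrow> clim n W m (\<lambda>_. g) g \<GG>"
proof (induction m arbitrary: f g)
  case 0
  then show ?case
    by (auto simp: lulim_def intro: uniform_limit_const)
next
  case (Suc m)
  show ?case
    unfolding clim.simps
  proof (intro conjI allI impI)
    show "lulim W (\<lambda>_. g) g \<GG>"
      using clim_lulim[OF Suc.prems] by (auto simp: lulim_def intro: uniform_limit_const)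
    fix i assume "i < n"
    then obtain F G where "has_pderiv W i g G" "clim n W m F G \<FF>"
      using Suc.prems unfolding clim.simps by blast
    with Suc.IH show "\<exists>f' g'. (\<forall>\<^sub>F j in \<GG>. has_pderiv W i g (f' j)) \<and> has_pderiv W i g g' \<and> clim n W m f' g' \<GG>"
      by (intro exI[of _ "\<lambda>_. G"] exI[of _ G]) auto
  qed
qed

lemma has_pderiv_partial_deriv:
  "has_pderiv W i (\<lambda>_. u) u' \<Longrightarrow> s \<in> {0..1} \<Longrightarrow> y \<in> W \<Longrightarrow> u' s y = partial_deriv i u y"
  unfolding has_pderiv_def partial_deriv_def by (metis vector_derivative_at)

text \<open>In \<open>clim\<close> the derivatives are only asserted to exist; uniqueness of
  derivatives identifies them on \<open>W\<close> with \<open>partial_deriv\<close>. Each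
  differentiation consumes one order, hence m + length.\<close>

lemma clim_partial_derivs:
  assumes "clim n W (m + length is) (\<lambda>j _. u j) (\<lambda>_. v) \<FF>" "set is \<subseteq> {..<n}"
  shows "clim n W m (\<lambda>j _. partial_derivs is (u j)) (\<lambda>_. partial_derivs is v) \<FF>"
  using assms
proof (induction "is" arbitrary: m)
  case (Cons i is')
  have "clim n W (Suc m) (\<lambda>j _. partial_derivs is' (u j)) (\<lambda>_. partial_derivs is' v) \<FF>"
    by (rule Cons.IH) (use Cons.prems in \<open>auto simp del: clim.simps\<close>)
  then obtain F G where FG: "\<forall>\<^sub>F j in \<FF>. has_pderiv W i (\<lambda>_. partial_derivs is' (u j)) (F j)"
    "has_pderiv W i (\<lambda>_. partial_derivs is' v) G" "clim n W m F G \<FF>"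
    using Cons.prems(2) by auto
  show ?case
  proof (rule clim_cong[OF _ _ FG(3)])
    show "\<forall>\<^sub>F j in \<FF>. \<forall>s\<in>{0..1}. \<forall>y\<in>W. F j s y = partial_derivs (i # is') (u j) y"
      using FG(1) by eventually_elim (simp add: has_pderiv_partial_deriv)
  qed (simp add: has_pderiv_partial_deriv[OF FG(2)])
qed simp

lemma smooth_coord_clim:
  assumes "\<And>m. clim n W m f (\<lambda>_. v) \<FF>"
  shows "smooth_coord n W v"
  unfolding smooth_coord_def
proof (intro allI impI conjI ballI)
  fix "is" assume is': "set is \<subseteq> {..<n}"
  have c: "clim n W m (\<lambda>_ _. partial_derivs is v) (\<lambda>_. partial_derivs is v) \<FF>" for m
    by (rule clim_partial_derivs[OF clim_limit[OF assms] is'])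
  from clim_lulim[OF c[of 0]] show "continuous_on W (partial_derivs is v)"
    by (simp add: lulim_def jcont_no_param)
  fix i x assume "i < n" "x \<in> W"
  with c[of 1] show "(\<lambda>t. partial_derivs is v (x(i := t))) differentiable at (x i)"
    by (force simp: has_pderiv_def intro: differentiableI_vector)
qed

lemma lulim_no_param:
  assumes "\<forall>\<^sub>F j in \<FF>. continuous_on W (u j)" "continuous_on W v"
    and "\<And>K. compact K \<Longrightarrow> K \<subseteq> W \<Longrightarrow> uniform_limit K u v \<FF>"
  shows "lulim W (\<lambda>j _. u j) (\<lambda>_. v) \<FF>"
  unfolding lulim_def
proof (intro conjI allI impI)
  show "\<forall>\<^sub>F j in \<FF>. jcont W (\<lambda>_. u j)" "jcont W (\<lambda>_. v)"
    using assms(1,2) by (simp_all add: jcont_no_param)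
  fix K assume "compact K" "K \<subseteq> W"
  from uniform_limit_compose'[OF assms(3)[OF this], where h = snd and B = "{0..1} \<times> K"]
  show "uniform_limit ({0..1} \<times> K) (\<lambda>j (s, y). u j y) (\<lambda>(s, y). v y) \<FF>"
    by (simp add: case_prod_unfold Pi_iff)
qed

text \<open>The witnesses for the derivatives in \<open>clim\<close> are the functions
  \<open>partial_derivs\<close>, so the induction on the order runs over all index lists at
  once.\<close>

lemma clim_smooth_coord:
  assumes u: "\<forall>\<^sub>F j in \<FF>. smooth_coord n W (u j)" and v: "smooth_coord n W v"
    and lim: "\<And>is K. set is \<subseteq> {..<n} \<Longrightarrow> compact K \<Longrightarrow> K \<subseteq> W \<Longrightarrow>
      uniform_limit K (\<lambda>j. partial_derivs is (u j)) (partial_derivs is v) \<FF>"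
  shows "clim n W m (\<lambda>j _. u j) (\<lambda>_. v) \<FF>"
proof -
  have pd: "has_pderiv W i (\<lambda>_. partial_derivs is w) (\<lambda>_. partial_derivs (i # is) w)"
    if "smooth_coord n W w" "set is \<subseteq> {..<n}" "i < n" for "is" w i
    using that unfolding smooth_coord_def has_pderiv_def partial_derivs.simps partial_deriv_def
    by (simp flip: vector_derivative_works)
  have "clim n W m (\<lambda>j _. partial_derivs is (u j)) (\<lambda>_. partial_derivs is v) \<FF>" if "set is \<subseteq> {..<n}" for "is"
    using that
  proof (induction m arbitrary: "is")
    have lu: "lulim W (\<lambda>j _. partial_derivs is (u j)) (\<lambda>_. partial_derivs is v) \<FF>" if "set is \<subseteq> {..<n}" for "is"
    proof (rule lulim_no_param)
      show "\<forall>\<^sub>F j in \<FF>. continuous_on W (partial_derivs is (u j))"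
        using u by eventually_elim (use that in \<open>auto simp: smooth_coord_def\<close>)
    qed (use v lim that in \<open>auto simp: smooth_coord_def\<close>)
    {
      case 0
      then show ?case using lu by simp
    next
      case (Suc m)
      show ?case
        unfolding clim.simps
      proof (intro conjI allI impI lu[OF Suc.prems])
        fix i assume i: "i < n"
        have "\<forall>\<^sub>F j in \<FF>. has_pderiv W i (\<lambda>_. partial_derivs is (u j)) (\<lambda>_. partial_derivs (i # is) (u j))"
          using u by eventually_elim (rule pd[OF _ Suc.prems i])
        with pd[OF v Suc.prems i] Suc.IH[of "i # is"] Suc.prems i
        show "\<exists>f' g'. (\<forall>\<^sub>F j in \<FF>. has_pderiv W i (\<lambda>_. partial_derivs is (u j)) (f' j)) \<and>
            has_pderiv W i (\<lambda>_. partial_derivs is v) g' \<and> clim n W m f' g' \<FF>"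
          by (intro exI[of _ "\<lambda>j _. partial_derivs (i # is) (u j)"] exI[of _ "\<lambda>_. partial_derivs (i # is) v"]) auto
      qed
    }
  qed
  from this[of "[]"] show ?thesis by simp
qed

lemma clim_uniform_limit:
  assumes "\<And>m. clim n W m (\<lambda>j _. u j) (\<lambda>_. v) \<FF>" "set is \<subseteq> {..<n}" "compact K" "K \<subseteq> W"
  shows "uniform_limit K (\<lambda>j. partial_derivs is (u j)) (partial_derivs is v) \<FF>"
proof -
  have "clim n W 0 (\<lambda>j _. partial_derivs is (u j)) (\<lambda>_. partial_derivs is v) \<FF>"
    by (rule clim_partial_derivs[OF assms(1,2)])
  then have "uniform_limit ({0..1::real} \<times> K) (\<lambda>j (s, y). partial_derivs is (u j) y) (\<lambda>(s, y). partial_derivs is v y) \<FF>"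
    using assms(3,4) by (auto simp: lulim_def)
  from uniform_limit_compose'[OF this, where h = "\<lambda>y. (0, y)" and B = K] show ?thesis
    by auto
qed

end


section \<open>Coefficient matrices of forms\<close>

definition fmat :: "('m, 'v, 'r::finite) vector_bundle \<Rightarrow> ('m \<Rightarrow> 'v \<Rightarrow> complex ^ 'r) \<Rightarrow> 'm \<Rightarrow> ('v \<Rightarrow> 'v \<Rightarrow> complex) \<Rightarrow> 'r cmat" where
  "fmat E \<tau> x v = (\<chi> i j. v (triv_frame E \<tau> i x) (triv_frame E \<tau> j x))"

definition mform :: "('m, 'v, 'r::finite) vector_bundle \<Rightarrow> ('m \<Rightarrow> 'v \<Rightarrow> complex ^ 'r) \<Rightarrow> 'm \<Rightarrow> 'r cmat \<Rightarrow> 'v \<Rightarrow> 'v \<Rightarrow> complex" where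
  "mform E \<tau> x A a b = (if a \<in> fiber E x \<and> b \<in> fiber E x then sesq A (\<tau> x a) (\<tau> x b) else 0)"

lemma fmat_nth: "fmat E \<tau> x v $ i $ j = v (triv_frame E \<tau> i x) (triv_frame E \<tau> j x)"
  by (simp add: fmat_def)

lemma fmat_add: "fmat E \<tau> x (v + w) = fmat E \<tau> x v + fmat E \<tau> x w"
  and fmat_diff: "fmat E \<tau> x (v - w) = fmat E \<tau> x v - fmat E \<tau> x w"
  and fmat_scaleR: "fmat E \<tau> x (r *\<^sub>R v) = r *\<^sub>R fmat E \<tau> x v"
  by (simp_all add: vec_eq_iff fmat_nth)

lemma sesq_axis: "sesq A (axis i 1) (axis j 1) = A $ i $ j"
proof -
  have "sesq A (axis i 1) (axis j 1) = (\<Sum>k\<in>UNIV. \<Sum>l\<in>UNIV. if l = j then if k = i then A $ k $ l else 0 else 0)"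
    unfolding sesq_def by (intro sum.cong) (auto simp: axis_def)
  then show ?thesis
    by simp
qed

lemma homogeneous_additive_expansion:
  fixes u :: "complex ^ 'r::finite \<Rightarrow> complex"
  assumes "\<And>p q. u (p + q) = u p + u q" "\<And>c p. u (c *s p) = c * u p"
  shows "u p = (\<Sum>i\<in>UNIV. p $ i * u (axis i 1))"
proof -
  have "u 0 = 0"
    using assms(2)[of 0 0] by simp
  have "u p = u (\<Sum>i\<in>UNIV. p $ i *s axis i 1)"
    by (simp add: basis_expansion)
  also have "\<dots> = (\<Sum>i\<in>UNIV. u (p $ i *s axis i 1))"
    using sum_comp_morphism[of u "\<lambda>i. p $ i *s axis i 1" UNIV] \<open>u 0 = 0\<close> assms(1) by (simp add: comp_def)
  finally show ?thesis
    by (simp add: assms(2))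
qed

lemma herm_formD:
  assumes "v \<in> herm_form E x"
  shows "a \<in> fiber E x \<Longrightarrow> a' \<in> fiber E x \<Longrightarrow> b \<in> fiber E x \<Longrightarrow> v (a + a') b = v a b + v a' b"
    and "a \<in> fiber E x \<Longrightarrow> b \<in> fiber E x \<Longrightarrow> v (cscale E z a) b = z * v a b"
    and "a \<in> fiber E x \<Longrightarrow> b \<in> fiber E x \<Longrightarrow> v b a = cnj (v a b)"
    and "a \<notin> fiber E x \<or> b \<notin> fiber E x \<Longrightarrow> v a b = 0"
  using assms unfolding herm_form_def mem_Collect_eq by blast+

section \<open>Forms on a single fiber\<close>

locale trivialized =
  fixes E :: "('m, 'v::ab_group_add, 'r::finite) vector_bundle" and \<tau> :: "'m \<Rightarrow> 'v \<Rightarrow> complex ^ 'r" and x :: 'm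
  assumes vs: "vector_space (cscale E)"
    and sub: "module.subspace (cscale E) (fiber E x)"
    and bij: "bij_betw (\<tau> x) (fiber E x) UNIV"
    and add: "\<And>a b. a \<in> fiber E x \<Longrightarrow> b \<in> fiber E x \<Longrightarrow> \<tau> x (a + b) = \<tau> x a + \<tau> x b"
    and scale: "\<And>z a. a \<in> fiber E x \<Longrightarrow> \<tau> x (cscale E z a) = z *s \<tau> x a"
begin

sublocale vector_space "cscale E"
  by (rule vs)

definition \<sigma> :: "complex ^ 'r \<Rightarrow> 'v" where
  "\<sigma> = inv_into (fiber E x) (\<tau> x)"

lemma \<sigma>_fiber [simp]: "\<sigma> p \<in> fiber E x"
  and \<tau>_\<sigma> [simp]: "\<tau> x (\<sigma> p) = p"
  using bij unfolding \<sigma>_def bij_betw_def by (metis UNIV_I inv_into_into, metis UNIV_I f_inv_into_f)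

lemma \<sigma>_\<tau> [simp]: "a \<in> fiber E x \<Longrightarrow> \<sigma> (\<tau> x a) = a"
  using bij unfolding \<sigma>_def by (rule bij_betw_inv_into_left)

lemma triv_frame_eq: "triv_frame E \<tau> i x = \<sigma> (axis i 1)"
  by (simp add: triv_frame_def \<sigma>_def)

lemma fiber_closed:
  "a \<in> fiber E x \<Longrightarrow> b \<in> fiber E x \<Longrightarrow> a + b \<in> fiber E x"
  "a \<in> fiber E x \<Longrightarrow> cscale E z a \<in> fiber E x"
  "0 \<in> fiber E x"
  using sub by (auto intro: subspace_add subspace_scale subspace_0)

lemma \<tau>_inj: "a \<in> fiber E x \<Longrightarrow> b \<in> fiber E x \<Longrightarrow> \<tau> x a = \<tau> x b \<Longrightarrow> a = b"
  using bij by (meson bij_betw_def inj_onD)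

lemma \<sigma>_add: "\<sigma> (p + q) = \<sigma> p + \<sigma> q"
  and \<sigma>_scale: "\<sigma> (c *s p) = cscale E c (\<sigma> p)"
  by (auto intro!: \<tau>_inj simp: fiber_closed add scale)

lemma \<tau>_zero: "\<tau> x 0 = 0"
  using add[OF fiber_closed(3) fiber_closed(3)] by simp

lemma \<tau>_eq_0_iff: "a \<in> fiber E x \<Longrightarrow> \<tau> x a = 0 \<longleftrightarrow> a = 0"
  by (metis \<tau>_inj \<tau>_zero fiber_closed(3))

text \<open>Linearity is available in the first argument only. The second is expanded by exchanging
  the arguments with Hermitian symmetry, which brings in the conjugates.\<close>

lemma herm_form_eq_sesq:
  assumes v: "v \<in> herm_form E x" and ab: "a \<in> fiber E x" "b \<in> fiber E x"
  shows "v a b = sesq (fmat E \<tau> x v) (\<tau> x a) (\<tau> x b)"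
proof -
  have lin: "v (\<sigma> p) b = (\<Sum>i\<in>UNIV. p $ i * v (triv_frame E \<tau> i x) b)" if "b \<in> fiber E x" for p b
    unfolding triv_frame_eq
    by (rule homogeneous_additive_expansion) (simp_all add: herm_formD(1,2)[OF v] that \<sigma>_add \<sigma>_scale)
  note herm = herm_formD(3)[OF v]
  have "v a b = (\<Sum>i\<in>UNIV. \<tau> x a $ i * v (triv_frame E \<tau> i x) b)"
    using lin[OF ab(2), of "\<tau> x a"] ab by simp
  also have "\<dots> = (\<Sum>i\<in>UNIV. \<tau> x a $ i * cnj (v b (triv_frame E \<tau> i x)))"
    by (intro sum.cong refl arg_cong2[of _ _ _ _ "(*)"] herm) (simp_all add: triv_frame_eq ab)
  also have "\<dots> = (\<Sum>i\<in>UNIV. \<tau> x a $ i * cnj (\<Sum>j\<in>UNIV. \<tau> x b $ j * v (triv_frame E \<tau> j x) (triv_frame E \<tau> i x)))"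
    using lin[of "triv_frame E \<tau> _ x" "\<tau> x b"] ab by (simp add: triv_frame_eq)
  also have "\<dots> = (\<Sum>i\<in>UNIV. \<Sum>j\<in>UNIV. \<tau> x a $ i * cnj (\<tau> x b $ j) * cnj (v (triv_frame E \<tau> j x) (triv_frame E \<tau> i x)))"
    by (simp add: sum_distrib_left mult_ac)
  also have "\<dots> = sesq (fmat E \<tau> x v) (\<tau> x a) (\<tau> x b)"
    unfolding sesq_def fmat_nth
    by (intro sum.cong refl arg_cong2[of _ _ _ _ "(*)"] herm [symmetric]) (simp_all add: triv_frame_eq)
  finally show ?thesis .
qed

lemma fmat_hermitian:
  assumes "v \<in> herm_form E x"
  shows "adj (fmat E \<tau> x v) = fmat E \<tau> x v"
  unfolding vec_eq_iff adj_nth fmat_nth triv_frame_eq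
  by (intro allI herm_formD(3)[OF assms, symmetric]) simp_all

lemma mform_herm:
  assumes "adj A = A"
  shows "mform E \<tau> x A \<in> herm_form E x"
proof -
  have herm: "sesq A p q = cnj (sesq A q p)" for p q
    using sesq_adj[of A p q] assms by simp
  show ?thesis
    unfolding herm_form_def mem_Collect_eq
  proof (intro conjI ballI allI impI)
    fix a b assume "a \<in> fiber E x" "b \<in> fiber E x"
    then show "mform E \<tau> x A b a = cnj (mform E \<tau> x A a b)"
      unfolding mform_def using herm[of "\<tau> x b" "\<tau> x a"] by simp
  qed (auto simp: mform_def fiber_closed add scale sesq_add_left sesq_scale_left)
qed

lemma fmat_mform [simp]: "fmat E \<tau> x (mform E \<tau> x A) = A"
  by (simp add: vec_eq_iff fmat_nth mform_def triv_frame_eq sesq_axis)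

lemma mform_fmat:
  assumes "v \<in> herm_form E x"
  shows "mform E \<tau> x (fmat E \<tau> x v) = v"
proof (intro ext)
  fix a b
  show "mform E \<tau> x (fmat E \<tau> x v) a b = v a b"
  proof (cases "a \<in> fiber E x \<and> b \<in> fiber E x")
    case True
    then show ?thesis
      using herm_form_eq_sesq[OF assms] by (simp add: mform_def)
  next
    case False
    then show ?thesis
      using herm_formD(4)[OF assms] by (auto simp: mform_def)
  qed
qed

lemma fmat_inject: "v \<in> herm_form E x \<Longrightarrow> w \<in> herm_form E x \<Longrightarrow> fmat E \<tau> x v = fmat E \<tau> x w \<Longrightarrow> v = w"
  by (metis mform_fmat)

lemma posdef_fmat_iff:
  assumes "v \<in> herm_form E x"
  shows "posdef (fmat E \<tau> x v) \<longleftrightarrow> v \<in> pos_herm_form E x"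
proof
  assume *: "posdef (fmat E \<tau> x v)"
  show "v \<in> pos_herm_form E x"
    unfolding pos_herm_form_def using assms *
    by (auto simp: herm_form_eq_sesq[OF assms] posdef_def \<tau>_eq_0_iff)
next
  assume *: "v \<in> pos_herm_form E x"
  show "posdef (fmat E \<tau> x v)"
    unfolding posdef_def
  proof (intro conjI allI impI fmat_hermitian[OF assms])
    fix p :: "complex ^ 'r" assume "p \<noteq> 0"
    then have "\<sigma> p \<noteq> 0"
      by (metis \<tau>_\<sigma> \<tau>_zero)
    then have "0 < Re (v (\<sigma> p) (\<sigma> p))"
      using * by (simp add: pos_herm_form_def)
    then show "0 < Re (sesq (fmat E \<tau> x v) p p)"
      by (simp add: herm_form_eq_sesq[OF assms])
  qed
qed

text \<open>Since \<open>v(a, b)\<close> is conjugate-linear in \<open>b\<close>, the matrix of the endomorphism \<open>h\<^sup>-\<^sup>1v\<close> is the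
  complex conjugate of \<open>H\<^sup>-\<^sup>1V\<close>.\<close>

lemma inv_mult_eq:
  assumes h: "h x \<in> pos_herm_form E x" and v: "v x \<in> herm_form E x" and b: "b \<in> fiber E x"
  shows "inv_mult E h v x b \<in> fiber E x"
    and "\<tau> x (inv_mult E h v x b) =
      (\<chi> i. \<Sum>j\<in>UNIV. cnj ((matrix_inv (fmat E \<tau> x (h x)) ** fmat E \<tau> x (v x)) $ i $ j) * \<tau> x b $ j)"
proof -
  define H V where "H = fmat E \<tau> x (h x)" and "V = fmat E \<tau> x (v x)"
  have hh: "h x \<in> herm_form E x"
    using h by (simp add: pos_herm_form_def)
  have H: "posdef H"
    using h hh posdef_fmat_iff by (simp add: H_def)
  define q :: "complex ^ 'r" where "q = (\<chi> i. \<Sum>j\<in>UNIV. cnj ((matrix_inv H ** V) $ i $ j) * \<tau> x b $ j)"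
  have key: "sesq H p q = sesq V p (\<tau> x b)" for p
  proof -
    have "sesq H p q = (\<Sum>i\<in>UNIV. \<Sum>k\<in>UNIV. \<Sum>j\<in>UNIV. p $ i * cnj (\<tau> x b $ j) * (H $ i $ k * (matrix_inv H ** V) $ k $ j))"
      by (simp add: sesq_def q_def sum_distrib_left sum_distrib_right mult_ac)
    also have "\<dots> = (\<Sum>i\<in>UNIV. \<Sum>j\<in>UNIV. \<Sum>k\<in>UNIV. p $ i * cnj (\<tau> x b $ j) * (H $ i $ k * (matrix_inv H ** V) $ k $ j))"
      by (rule sum.cong[OF refl], rule sum.swap)
    also have "\<dots> = (\<Sum>i\<in>UNIV. \<Sum>j\<in>UNIV. p $ i * cnj (\<tau> x b $ j) * (H ** (matrix_inv H ** V)) $ i $ j)"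
      by (simp add: sum_distrib_left [symmetric] matrix_matrix_mult_def)
    also have "\<dots> = sesq V p (\<tau> x b)"
      using posdef_invertible[OF H] by (simp add: sesq_def)
    finally show ?thesis .
  qed
  have "inv_mult E h v x b = \<sigma> q"
    unfolding inv_mult_def
  proof (rule the_equality)
    show "\<sigma> q \<in> fiber E x \<and> (\<forall>a\<in>fiber E x. v x a b = h x a (\<sigma> q))"
      using key by (auto simp: herm_form_eq_sesq[OF hh] herm_form_eq_sesq[OF v] b H_def V_def)
    fix c assume c: "c \<in> fiber E x \<and> (\<forall>a\<in>fiber E x. v x a b = h x a c)"
    have "sesq H p (\<tau> x c - q) = 0" for p
    proof -
      have "sesq H p (\<tau> x c) = sesq V p (\<tau> x b)"
        using c herm_form_eq_sesq[OF hh, of "\<sigma> p" c] herm_form_eq_sesq[OF v, of "\<sigma> p" b] b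
        by (simp add: H_def V_def)
      then show ?thesis
        by (simp add: sesq_diff_right key)
    qed
    \<comment> \<open>Uniqueness is definiteness: p is taken to be the difference itself.\<close>
    then have "\<tau> x c - q = 0"
      using H unfolding posdef_def by (metis less_irrefl zero_complex.sel(1))
    then show "c = \<sigma> q"
      using c by (metis \<sigma>_\<tau> eq_iff_diff_eq_0)
  qed
  then show "inv_mult E h v x b \<in> fiber E x" "\<tau> x (inv_mult E h v x b) =
      (\<chi> i. \<Sum>j\<in>UNIV. cnj ((matrix_inv (fmat E \<tau> x (h x)) ** fmat E \<tau> x (v x)) $ i $ j) * \<tau> x b $ j)"
    by (simp_all add: q_def H_def V_def)
qed

text \<open>The basis B behind \<open>fiber_trace\<close> is an unknown choice. Each b in B is
  expanded in the frame; after exchanging the two sums, the B-coordinates of the image of frame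
  vector i reassemble that image, whose i-th coordinate is the diagonal entry of N.\<close>

lemma fiber_trace_eq:
  assumes T: "\<And>b. b \<in> fiber E x \<Longrightarrow> T b \<in> fiber E x"
    and N: "\<And>b. b \<in> fiber E x \<Longrightarrow> \<tau> x (T b) = N *v \<tau> x b"
  shows "fiber_trace E x T = trace N"
proof -
  let ?s = "cscale E"
  define B where "B = (SOME B. \<not> module.dependent ?s B \<and> module.span ?s B = fiber E x)"
  have "\<exists>B. \<not> dependent B \<and> span B = fiber E x"
    using basis_exists[of "fiber E x"] sub by (metis span_minimal subset_antisym)
  then have B: "independent B" "span B = fiber E x"
    unfolding B_def by (metis (mono_tags, lifting) someI_ex)+
  have exp: "a = (\<Sum>i\<in>UNIV. ?s (\<tau> x a $ i) (\<sigma> (axis i 1)))" if a: "a \<in> fiber E x" for a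
  proof -
    have "\<sigma> 0 = 0"
      by (metis \<sigma>_\<tau> \<tau>_zero fiber_closed(3))
    have "a = \<sigma> (\<Sum>i\<in>UNIV. \<tau> x a $ i *s axis i 1)"
      using a by (simp add: basis_expansion)
    also have "\<dots> = (\<Sum>i\<in>UNIV. \<sigma> (\<tau> x a $ i *s axis i 1))"
      using sum_comp_morphism[of \<sigma> "\<lambda>i. \<tau> x a $ i *s axis i 1" UNIV] \<open>\<sigma> 0 = 0\<close> \<sigma>_add by (simp add: comp_def)
    finally show ?thesis
      by (simp add: \<sigma>_scale)
  qed
  have "fiber E x \<subseteq> span (range (\<lambda>i. \<sigma> (axis i 1)))"
  proof
    fix a assume a: "a \<in> fiber E x"
    have "(\<Sum>i\<in>UNIV. ?s (\<tau> x a $ i) (\<sigma> (axis i 1))) \<in> span (range (\<lambda>i. \<sigma> (axis i 1)))"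
      by (intro span_sum span_scale span_base) auto
    then show "a \<in> span (range (\<lambda>i. \<sigma> (axis i 1)))"
      by (subst exp[OF a])
  qed
  then have "B \<subseteq> span (range (\<lambda>i. \<sigma> (axis i 1)))"
    using B(2) span_superset[of B] by simp
  from independent_span_bound[OF _ B(1) this] have "finite B"
    by simp
  have \<tau>sum: "\<tau> x (\<Sum>b\<in>C. ?s (c b) b) = (\<Sum>b\<in>C. c b *s \<tau> x b)" if "finite C" "C \<subseteq> fiber E x" for c C
    using that
  proof (induction C)
    case (insert b C)
    have "(\<Sum>b\<in>C. ?s (c b) b) \<in> fiber E x"
      using insert.prems by (intro subspace_sum[OF sub]) (auto intro: fiber_closed)
    with insert show ?case
      by (simp add: add scale fiber_closed)
  qed (simp add: \<tau>_zero)
  have Bf: "B \<subseteq> fiber E x"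
    using B span_superset by blast
  have rep: "representation B (T b) b = (\<Sum>i\<in>UNIV. \<tau> x b $ i * representation B (T (\<sigma> (axis i 1))) b)"
    if b: "b \<in> B" for b
  proof -
    have "T b = (\<Sum>i\<in>UNIV. ?s (\<tau> x b $ i) (T (\<sigma> (axis i 1))))"
    proof (rule \<tau>_inj)
      have *: "(\<Sum>i\<in>I. ?s (c i) (T (\<sigma> (axis i 1)))) \<in> fiber E x
          \<and> \<tau> x (\<Sum>i\<in>I. ?s (c i) (T (\<sigma> (axis i 1)))) = (\<Sum>i\<in>I. c i *s (N *v axis i 1))" for I :: "'r set" and c
        by (induction I rule: infinite_finite_induct)
          (auto simp: fiber_closed \<tau>_zero add scale T N)
      show "(\<Sum>i\<in>UNIV. ?s (\<tau> x b $ i) (T (\<sigma> (axis i 1)))) \<in> fiber E x"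
        using * by blast
      have "\<tau> x (T b) = N *v (\<Sum>i\<in>UNIV. \<tau> x b $ i *s axis i 1)"
        using N Bf b by (simp add: basis_expansion subset_iff)
      also have "\<dots> = (\<Sum>i\<in>UNIV. \<tau> x b $ i *s (N *v axis i 1))"
        by (simp add: vec.linear_sum[OF matrix_vector_mul_linear_gen] vec.linear_scale[OF matrix_vector_mul_linear_gen])
      finally show "\<tau> x (T b) = \<tau> x (\<Sum>i\<in>UNIV. ?s (\<tau> x b $ i) (T (\<sigma> (axis i 1))))"
        using * by simp
    qed (use T Bf b in blast)
    moreover have "T (\<sigma> (axis i 1)) \<in> span B" for i
      using T B(2) by simp
    ultimately show ?thesis
      using representation_sum[OF B(1), of UNIV "\<lambda>i. ?s (\<tau> x b $ i) (T (\<sigma> (axis i 1)))"]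
        representation_scale[OF B(1)] by (simp add: span_scale)
  qed
  have "fiber_trace E x T = (\<Sum>b\<in>B. representation B (T b) b)"
    by (simp add: fiber_trace_def B_def Let_def)
  also have "\<dots> = (\<Sum>b\<in>B. \<Sum>i\<in>UNIV. \<tau> x b $ i * representation B (T (\<sigma> (axis i 1))) b)"
    by (intro sum.cong rep refl)
  also have "\<dots> = (\<Sum>i\<in>UNIV. \<Sum>b\<in>B. \<tau> x b $ i * representation B (T (\<sigma> (axis i 1))) b)"
    by (rule sum.swap)
  also have "\<dots> = (\<Sum>i\<in>UNIV. \<tau> x (\<Sum>b\<in>B. ?s (representation B (T (\<sigma> (axis i 1))) b) b) $ i)"
    by (simp add: \<tau>sum[OF \<open>finite B\<close> Bf] mult.commute)
  also have "\<dots> = (\<Sum>i\<in>UNIV. \<tau> x (T (\<sigma> (axis i 1))) $ i)"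
    using sum_representation_eq[OF B(1) _ \<open>finite B\<close> subset_refl] T B(2) by simp
  also have "\<dots> = (\<Sum>i\<in>UNIV. (N *v axis i 1) $ i)"
    by (simp add: N)
  also have "\<dots> = trace N"
  proof -
    have "(N *v axis i 1) $ i = (\<Sum>k\<in>UNIV. if k = i then N $ i $ i else 0)" for i
      unfolding matrix_vector_mult_def vec_lambda_beta by (intro sum.cong refl) (auto simp: axis_def)
    then show ?thesis
      by (simp add: trace_def)
  qed
  finally show ?thesis .
qed

end

text \<open>The rows of S are the coordinates of the second frame in the first trivialization.
  Interchanging the roles gives S', and expanding a vector in one frame and then in the other shows
  that S' inverts S.\<close>

lemma fmat_change:
  fixes E :: "('m, 'v::ab_group_add, 'r::finite) vector_bundle"
  assumes "trivialized E \<tau> x" "trivialized E \<tau>' x"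
  obtains S :: "'r cmat" where "invertible S"
    "\<And>v. v \<in> herm_form E x \<Longrightarrow> fmat E \<tau>' x v = S ** fmat E \<tau> x v ** adj S"
proof -
  interpret t: trivialized E \<tau> x by fact
  interpret t': trivialized E \<tau>' x by fact
  define S :: "'r cmat" where "S = (\<chi> i. \<tau> x (triv_frame E \<tau>' i x))"
  define S' :: "'r cmat" where "S' = (\<chi> i. \<tau>' x (triv_frame E \<tau> i x))"
  have ch: "fmat E \<tau>' x v = S ** fmat E \<tau> x v ** adj S" if "v \<in> herm_form E x" for v
    by (simp add: vec_eq_iff mult_adj_nth fmat_nth[of _ \<tau>'] S_def t.herm_form_eq_sesq[OF that] t'.triv_frame_eq)
  have "S' ** S = mat 1"
  proof -
    have "(\<Sum>k\<in>UNIV. \<tau>' x a $ k * \<tau> x (triv_frame E \<tau>' k x) $ j) = \<tau> x a $ j" if a: "a \<in> fiber E x" for a j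
      using homogeneous_additive_expansion[of "\<lambda>p. \<tau> x (t'.\<sigma> p) $ j" "\<tau>' x a"] a
      by (simp add: t'.\<sigma>_add t'.\<sigma>_scale t.add t.scale t'.triv_frame_eq)
    then show ?thesis
      by (auto simp: vec_eq_iff matrix_matrix_mult_def S_def S'_def t.triv_frame_eq mat_one_nth axis_def)
  qed
  then have "S ** S' = mat 1"
    by (simp add: matrix_left_right_inverse)
  then have "invertible S"
    by (rule matrix_inv_eqI)
  with ch show thesis
    by (intro that)
qed

context coord_open
begin

lemma smooth_coord_has_pderiv:
  assumes "smooth_coord n W w" "set is \<subseteq> {..<n}" "i < n"
  shows "has_pderiv W i (\<lambda>_. partial_derivs is w) (\<lambda>_. partial_derivs (i # is) w)"
  using assms unfolding smooth_coord_def has_pderiv_def partial_derivs.simps partial_deriv_def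
  by (simp flip: vector_derivative_works)

lemma partial_derivs_diff:
  assumes u: "smooth_coord n W u" and v: "smooth_coord n W v" and "set is \<subseteq> {..<n}" "y \<in> W"
  shows "partial_derivs is (\<lambda>y. u y - v y) y = partial_derivs is u y - partial_derivs is v y"
  using assms(3,4)
proof (induction "is" arbitrary: y)
  case (Cons i is')
  have "has_pderiv W i (\<lambda>_ y. partial_derivs is' u y - partial_derivs is' v y)
      (\<lambda>_ y. partial_derivs (i # is') u y - partial_derivs (i # is') v y)"
    using smooth_coord_has_pderiv[OF u, of is' i] smooth_coord_has_pderiv[OF v, of is' i] Cons.prems(1)
    unfolding has_pderiv_def by (auto intro!: has_vector_derivative_diff)
  then have "has_pderiv W i (\<lambda>_. partial_derivs is' (\<lambda>y. u y - v y))
      (\<lambda>_ y. partial_derivs (i # is') u y - partial_derivs (i # is') v y)"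
    by (rule has_pderiv_cong[rotated]) (use Cons in auto)
  from has_pderiv_partial_deriv[OF this, of 0 y] Cons.prems(2) show ?case
    by simp
qed simp

lemma clim_matrixI:
  fixes F :: "'i \<Rightarrow> real \<Rightarrow> (nat \<Rightarrow> real) \<Rightarrow> 'r::finite cmat"
  assumes "\<And>i k. clim n W m (\<lambda>j s y. F j s y $ i $ k) (\<lambda>s y. G s y $ i $ k) \<FF>"
  shows "clim n W m F G \<FF>"
proof -
  define L :: "'r \<Rightarrow> 'r \<Rightarrow> complex \<Rightarrow> 'r cmat" where
    "L = (\<lambda>i k z. \<chi> a b. if b = k then if a = i then z else 0 else 0)"
  have L: "bounded_linear (L i k)" for i k
    unfolding linear_conv_bounded_linear [symmetric] by (auto intro!: linearI simp: L_def vec_eq_iff)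
  have "clim n W m (\<lambda>j s y. \<Sum>i\<in>UNIV. \<Sum>k\<in>UNIV. L i k (F j s y $ i $ k))
      (\<lambda>s y. \<Sum>i\<in>UNIV. \<Sum>k\<in>UNIV. L i k (G s y $ i $ k)) \<FF>"
    by (rule clim_sum[OF finite], rule clim_sum[OF finite], rule clim_linear[OF L assms])
  moreover have "(\<Sum>i\<in>UNIV. \<Sum>k\<in>UNIV. L i k (A $ i $ k)) = A" for A
    by (simp add: vec_eq_iff L_def)
  ultimately show ?thesis
    by simp
qed

lemma clim_matrixD:
  fixes F :: "'i \<Rightarrow> real \<Rightarrow> (nat \<Rightarrow> real) \<Rightarrow> 'r::finite cmat"
  assumes "clim n W m F G \<FF>"
  shows "clim n W m (\<lambda>j s y. F j s y $ i $ k) (\<lambda>s y. G s y $ i $ k) \<FF>"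
proof -
  have "bounded_linear (\<lambda>A :: 'r cmat. A $ i $ k)"
    unfolding linear_conv_bounded_linear [symmetric] by (auto intro!: linearI)
  then show ?thesis
    by (rule clim_linear[OF _ assms])
qed

end

text \<open>Eventual membership survives finite intersections and arbitrary unions, so it has to be
  tested on the generating sets only.\<close>

lemma limitin_topology_generated_by:
  "limitin (topology_generated_by B) f l \<FF> \<longleftrightarrow> l \<in> \<Union>B \<and> (\<forall>S\<in>B. l \<in> S \<longrightarrow> (\<forall>\<^sub>F j in \<FF>. f j \<in> S))"
proof
  assume *: "l \<in> \<Union>B \<and> (\<forall>S\<in>B. l \<in> S \<longrightarrow> (\<forall>\<^sub>F j in \<FF>. f j \<in> S))"
  have "\<forall>\<^sub>F j in \<FF>. f j \<in> S" if "generate_topology_on B S" "l \<in> S" for S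
    using that
  proof induction
    case (Int a b)
    then show ?case by (auto intro: eventually_conj)
  next
    case (UN K)
    then obtain k where "k \<in> K" "l \<in> k" by auto
    with UN have "\<forall>\<^sub>F j in \<FF>. f j \<in> k" by auto
    then show ?case
      by eventually_elim (use \<open>k \<in> K\<close> in auto)
  qed (use * in auto)
  with * show "limitin (topology_generated_by B) f l \<FF>"
    by (auto simp: limitin_def openin_topology_generated_by_iff)
qed (auto simp: limitin_def topology_generated_by_Basis)


section \<open>The \<open>C\<^sup>\<infinity>\<close> topology\<close>

definition mrep :: "('m, 'v, 'r::finite) vector_bundle \<Rightarrow> 'm set \<Rightarrow> ('m \<Rightarrow> nat \<Rightarrow> real) \<Rightarrow>
    ('m \<Rightarrow> 'v \<Rightarrow> complex ^ 'r) \<Rightarrow> ('m, 'v) form_section \<Rightarrow> (nat \<Rightarrow> real) \<Rightarrow> 'r cmat" where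
  "mrep E U \<phi> \<tau> v y = fmat E \<tau> (inv_into U \<phi> y) (v (inv_into U \<phi> y))"

lemma mrep_nth: "mrep E U \<phi> \<tau> v y $ i $ k = (form_entry E \<tau> i k v \<circ> inv_into U \<phi>) y"
  by (simp add: mrep_def fmat_nth form_entry_def)

lemma mrep_add: "mrep E U \<phi> \<tau> (v + w) y = mrep E U \<phi> \<tau> v y + mrep E U \<phi> \<tau> w y"
  and mrep_diff: "mrep E U \<phi> \<tau> (v - w) y = mrep E U \<phi> \<tau> v y - mrep E U \<phi> \<tau> w y"
  and mrep_scaleR: "mrep E U \<phi> \<tau> (r *\<^sub>R v) y = r *\<^sub>R mrep E U \<phi> \<tau> v y"
  by (simp_all add: mrep_def fmat_add fmat_diff fmat_scaleR)

lemma herm_form_linear: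
  assumes "vector_space (cscale E)" "module.subspace (cscale E) (fiber E x)"
    and v: "v \<in> herm_form E x" and w: "w \<in> herm_form E x"
  shows "v + w \<in> herm_form E x" "v - w \<in> herm_form E x" "r *\<^sub>R v \<in> herm_form E x" "0 \<in> herm_form E x"
proof -
  note s = herm_formD(1,2)[OF v] herm_formD(1,2)[OF w] herm_formD(4)[OF v] herm_formD(4)[OF w]
  note h = herm_formD(3)[OF v] herm_formD(3)[OF w]
  {
    fix a b assume ab: "a \<in> fiber E x" "b \<in> fiber E x"
    have "(v + w) b a = cnj ((v + w) a b)" "(v - w) b a = cnj ((v - w) a b)" "(r *\<^sub>R v) b a = cnj ((r *\<^sub>R v) a b)"
      unfolding plus_fun_apply fun_diff_def scaleR_fun_apply h(1)[OF ab] h(2)[OF ab] by simp_all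
  } note herm = this
  show "v + w \<in> herm_form E x" "v - w \<in> herm_form E x" "r *\<^sub>R v \<in> herm_form E x" "0 \<in> herm_form E x"
    unfolding herm_form_def mem_Collect_eq
    by (intro conjI ballI allI impI herm; auto simp: s algebra_simps)+
qed

section \<open>Charts, trivializations and smooth sections\<close>

locale herm_bundle =
  fixes M :: "'m::t2_space manifold"
    and E :: "('m, 'v::ab_group_add, 'r::finite) vector_bundle"
  assumes cm: "closed_oriented_manifold M"
    and vb: "complex_vector_bundle M E"
begin

abbreviation "\<Gamma> \<equiv> Herm_sections M E"
abbreviation "\<Gamma>p \<equiv> pos_Herm_sections M E"
abbreviation "\<X> \<equiv> Cinf_topology M E"
abbreviation "n \<equiv> mdim M"

definition patch :: "'m set \<Rightarrow> ('m \<Rightarrow> nat \<Rightarrow> real) \<Rightarrow> 'm set \<Rightarrow> ('m \<Rightarrow> 'v \<Rightarrow> complex ^ 'r) \<Rightarrow> bool" where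
  "patch U \<phi> W \<tau> \<longleftrightarrow> (U, \<phi>) \<in> atlas M \<and> (W, \<tau>) \<in> trivs E"

lemma chart_cover: "\<exists>U \<phi>. (U, \<phi>) \<in> atlas M \<and> x \<in> U"
proof -
  have "x \<in> (\<Union>c\<in>atlas M. fst c)"
    using cm unfolding closed_oriented_manifold_def by simp
  then show ?thesis by auto
qed

lemma triv_cover: "\<exists>W \<tau>. (W, \<tau>) \<in> trivs E \<and> x \<in> W"
proof -
  have "x \<in> (\<Union>(W, \<tau>)\<in>trivs E. W)"
    using vb unfolding complex_vector_bundle_def by simp
  then show ?thesis by auto
qed

lemma patch_cover:
  obtains U \<phi> W \<tau> where "patch U \<phi> W \<tau>" "x \<in> U" "x \<in> W"
  using chart_cover[of x] triv_cover[of x] unfolding patch_def by blast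

lemma trivialized: "(W, \<tau>) \<in> trivs E \<Longrightarrow> x \<in> W \<Longrightarrow> trivialized E \<tau> x"
  using vb unfolding complex_vector_bundle_def trivialized_def by fast

lemma open_triv: "(W, \<tau>) \<in> trivs E \<Longrightarrow> open W"
  using vb unfolding complex_vector_bundle_def by fast

lemma vs: "vector_space (cscale E)" and sub: "module.subspace (cscale E) (fiber E x)"
  using vb unfolding complex_vector_bundle_def by auto

lemmas herm_form_linear = herm_form_linear[OF vs sub]

lemma chart:
  assumes "(U, \<phi>) \<in> atlas M"
  shows "open U" "openin (Euclidean_space n) (\<phi> ` U)" "homeomorphism U (\<phi> ` U) \<phi> (inv_into U \<phi>)"
proof -
  have "is_chart n (U, \<phi>)"
    using cm assms unfolding closed_oriented_manifold_def by blast
  then show "open U" "openin (Euclidean_space n) (\<phi> ` U)" "homeomorphism U (\<phi> ` U) \<phi> (inv_into U \<phi>)"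
    by (auto simp: is_chart_def)
qed

lemma chart_inv:
  assumes "(U, \<phi>) \<in> atlas M"
  shows "x \<in> U \<Longrightarrow> inv_into U \<phi> (\<phi> x) = x"
    and "continuous_on U \<phi>" "continuous_on (\<phi> ` U) (inv_into U \<phi>)"
  using chart(3)[OF assms] by (auto simp: homeomorphism_def)

lemma openin_chart_image:
  assumes "(U, \<phi>) \<in> atlas M" "open S"
  shows "openin (Euclidean_space n) (\<phi> ` (U \<inter> S))"
proof -
  have "\<phi> ` (U \<inter> S) = \<phi> ` U \<inter> inv_into U \<phi> -` S"
    using chart_inv(1)[OF assms(1)] by auto
  moreover have "openin (top_of_set (\<phi> ` U)) (\<phi> ` U \<inter> inv_into U \<phi> -` S)"
    using chart_inv(3)[OF assms(1)] assms(2) by (simp add: continuous_openin_preimage_gen)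
  ultimately have "openin (top_of_set (\<phi> ` U)) (\<phi> ` (U \<inter> S))"
    by simp
  moreover have "openin (top_of_set {x. \<forall>i\<ge>n. x i = 0}) (\<phi> ` U)"
    using chart(2)[OF assms(1)] unfolding Euclidean_space_def euclidean_product_topology .
  ultimately show ?thesis
    unfolding Euclidean_space_def euclidean_product_topology by (rule openin_trans)
qed

lemma patch_open: "patch U \<phi> W \<tau> \<Longrightarrow> coord_open n (\<phi> ` (U \<inter> W))"
  unfolding patch_def coord_open_def using openin_chart_image open_triv by blast

lemma patch_points:
  assumes "patch U \<phi> W \<tau>" "y \<in> \<phi> ` (U \<inter> W)"
  shows "inv_into U \<phi> y \<in> U" "inv_into U \<phi> y \<in> W" "\<phi> (inv_into U \<phi> y) = y"
    "trivialized E \<tau> (inv_into U \<phi> y)"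
  using assms chart_inv(1)[of U \<phi>] trivialized[of W \<tau>] unfolding patch_def by auto

lemma mrep_at:
  assumes "patch U \<phi> W \<tau>" "x \<in> U"
  shows "mrep E U \<phi> \<tau> v (\<phi> x) = fmat E \<tau> x (v x)"
  using chart_inv(1)[of U \<phi> x] assms unfolding mrep_def patch_def by simp

lemma Herm_sections_iff:
  "v \<in> \<Gamma> \<longleftrightarrow> (\<forall>x. v x \<in> herm_form E x) \<and>
    (\<forall>U \<phi> W \<tau> i k. patch U \<phi> W \<tau> \<longrightarrow> smooth_coord n (\<phi> ` (U \<inter> W)) (form_entry E \<tau> i k v \<circ> inv_into U \<phi>))"
proof -
  have "(\<forall>(W, \<tau>)\<in>trivs E. \<forall>i k. \<forall>(U, \<phi>)\<in>atlas M. smooth_coord n (\<phi> ` (W \<inter> U)) (form_entry E \<tau> i k v \<circ> inv_into U \<phi>))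
    \<longleftrightarrow> (\<forall>U \<phi> W \<tau> i k. patch U \<phi> W \<tau> \<longrightarrow> smooth_coord n (\<phi> ` (W \<inter> U)) (form_entry E \<tau> i k v \<circ> inv_into U \<phi>))"
    unfolding patch_def by (simp only: Ball_def split_paired_All case_prod_conv) blast
  then show ?thesis
    unfolding Herm_sections_def smooth_fun_on_def mem_Collect_eq by (simp only: Int_commute)
qed

lemma Herm_sections_clim:
  assumes "v \<in> \<Gamma>" "patch U \<phi> W \<tau>"
  shows "clim n (\<phi> ` (U \<inter> W)) m (\<lambda>_ _. mrep E U \<phi> \<tau> v) (\<lambda>_. mrep E U \<phi> \<tau> v) \<FF>"
proof -
  interpret coord_open n "\<phi> ` (U \<inter> W)"
    by (rule patch_open[OF assms(2)])
  show ?thesis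
  proof (rule clim_matrixI, unfold mrep_nth)
    fix i k
    have "smooth_coord n (\<phi> ` (U \<inter> W)) (\<lambda>y. (form_entry E \<tau> i k v \<circ> inv_into U \<phi>) y)"
      using assms Herm_sections_iff by blast
    then show "clim n (\<phi> ` (U \<inter> W)) m (\<lambda>j s y. (form_entry E \<tau> i k v \<circ> inv_into U \<phi>) y)
        (\<lambda>s y. (form_entry E \<tau> i k v \<circ> inv_into U \<phi>) y) \<FF>"
      by (intro clim_smooth_coord uniform_limit_const always_eventually allI)
  qed
qed

text \<open>The local matrices need only occur as limits in \<open>clim\<close>, to every order, so
  that the closure properties of \<open>clim\<close> double as a proof method for smoothness along
  \<open>M\<close>.\<close>

lemma Herm_sections_climI:
  assumes "\<And>x. v x \<in> herm_form E x"
    and "\<And>U \<phi> W \<tau> m. patch U \<phi> W \<tau> \<Longrightarrow> \<exists>F. clim n (\<phi> ` (U \<inter> W)) m F (\<lambda>_. mrep E U \<phi> \<tau> v) (\<FF> :: 'i filter)"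
  shows "v \<in> \<Gamma>"
  unfolding Herm_sections_iff
proof (intro conjI allI impI assms(1))
  fix U \<phi> W \<tau> i k assume p: "patch U \<phi> W \<tau>"
  interpret coord_open n "\<phi> ` (U \<inter> W)"
    by (rule patch_open[OF p])
  show "smooth_coord n (\<phi> ` (U \<inter> W)) (form_entry E \<tau> i k v \<circ> inv_into U \<phi>)"
  proof (rule smooth_coord_clim)
    fix m
    obtain F where "clim n (\<phi> ` (U \<inter> W)) m F (\<lambda>_. mrep E U \<phi> \<tau> v) \<FF>"
      using assms(2)[OF p] by blast
    from clim_matrixD[OF clim_limit[OF this], of i k]
    show "clim n (\<phi> ` (U \<inter> W)) m (\<lambda>_::unit. \<lambda>_. form_entry E \<tau> i k v \<circ> inv_into U \<phi>)
        (\<lambda>_. form_entry E \<tau> i k v \<circ> inv_into U \<phi>) bot"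
      unfolding mrep_nth comp_def .
  qed
qed

lemma Herm_sections_linear:
  assumes "v \<in> \<Gamma>" "w \<in> \<Gamma>"
  shows "v + w \<in> \<Gamma>" "v - w \<in> \<Gamma>" "r *\<^sub>R v \<in> \<Gamma>"
proof -
  have h: "v x \<in> herm_form E x" "w x \<in> herm_form E x" for x
    using assms by (auto simp: Herm_sections_iff)
  {
    fix U \<phi> W \<tau> m assume p: "patch U \<phi> W \<tau>"
    interpret coord_open n "\<phi> ` (U \<inter> W)"
      by (rule patch_open[OF p])
    note vw = Herm_sections_clim[OF assms(1) p, where \<FF> = "bot :: unit filter"]
      Herm_sections_clim[OF assms(2) p, where \<FF> = "bot :: unit filter"]
    have c1: "\<exists>F. clim n (\<phi> ` (U \<inter> W)) m F (\<lambda>_. mrep E U \<phi> \<tau> (v + w)) (bot :: unit filter)"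
      unfolding mrep_add[abs_def] using clim_add[OF vw] by blast
    have c2: "\<exists>F. clim n (\<phi> ` (U \<inter> W)) m F (\<lambda>_. mrep E U \<phi> \<tau> (r *\<^sub>R v)) (bot :: unit filter)"
      unfolding mrep_scaleR[abs_def] using clim_linear[OF bounded_linear_scaleR_right vw(1)] by blast
    have "\<exists>F. clim n (\<phi> ` (U \<inter> W)) m F (\<lambda>_ y. mrep E U \<phi> \<tau> v y + - 1 *\<^sub>R mrep E U \<phi> \<tau> w y) (bot :: unit filter)"
      using clim_add[OF vw(1) clim_linear[OF bounded_linear_scaleR_right vw(2)]] by blast
    then have c3: "\<exists>F. clim n (\<phi> ` (U \<inter> W)) m F (\<lambda>_. mrep E U \<phi> \<tau> (v - w)) (bot :: unit filter)"
      unfolding mrep_diff[abs_def] by simp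
    note c1 c2 c3
  } note c = this
  show "v + w \<in> \<Gamma>" "v - w \<in> \<Gamma>" "r *\<^sub>R v \<in> \<Gamma>"
    by (rule Herm_sections_climI[OF _ c(1)] Herm_sections_climI[OF _ c(3)] Herm_sections_climI[OF _ c(2)];
        simp add: herm_form_linear[OF h])+
qed

section \<open>Limits in the space of sections\<close>

lemma seminorm_bound:
  assumes "patch U \<phi> W \<tau>" "compact K" "K \<subseteq> U \<inter> W" "set is \<subseteq> {..<n}" "v \<in> \<Gamma>" "x \<in> K"
  shows "norm (partial_derivs is (form_entry E \<tau> i k v \<circ> inv_into U \<phi>) (\<phi> x))
    \<le> (SUP x\<in>K. norm (partial_derivs is (form_entry E \<tau> i k v \<circ> inv_into U \<phi>) (\<phi> x)))"
proof (rule cSUP_upper[OF assms(6)])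
  have "continuous_on (\<phi> ` (U \<inter> W)) (partial_derivs is (form_entry E \<tau> i k v \<circ> inv_into U \<phi>))"
    using assms Herm_sections_iff by (auto simp: smooth_coord_def)
  moreover have "continuous_on K \<phi>"
    using chart_inv(2)[of U \<phi>] assms unfolding patch_def by (meson continuous_on_subset le_inf_iff)
  ultimately have "continuous_on K (\<lambda>x. partial_derivs is (form_entry E \<tau> i k v \<circ> inv_into U \<phi>) (\<phi> x))"
    using assms(3) by (rule continuous_on_compose2[OF _ _ image_mono])
  then have "continuous_on K (\<lambda>x. norm (partial_derivs is (form_entry E \<tau> i k v \<circ> inv_into U \<phi>) (\<phi> x)))"
    by (rule continuous_on_norm)
  then have "compact ((\<lambda>x. norm (partial_derivs is (form_entry E \<tau> i k v \<circ> inv_into U \<phi>) (\<phi> x))) ` K)"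
    using assms(2) by (rule compact_continuous_image)
  \<comment> \<open>A real supremum is an upper bound only for a set that is bounded above;
    compactness of K ensures this.\<close>
  then show "bdd_above ((\<lambda>x. norm (partial_derivs is (form_entry E \<tau> i k v \<circ> inv_into U \<phi>) (\<phi> x))) ` K)"
    by (intro bounded_imp_bdd_above compact_imp_bounded)
qed

lemma partial_derivs_entry_diff:
  assumes "patch U \<phi> W \<tau>" "v \<in> \<Gamma>" "w \<in> \<Gamma>" "set is \<subseteq> {..<n}" "x \<in> U" "x \<in> W"
  shows "partial_derivs is (form_entry E \<tau> i k (v - w) \<circ> inv_into U \<phi>) (\<phi> x)
    = partial_derivs is (form_entry E \<tau> i k v \<circ> inv_into U \<phi>) (\<phi> x)
    - partial_derivs is (form_entry E \<tau> i k w \<circ> inv_into U \<phi>) (\<phi> x)"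
proof -
  interpret coord_open n "\<phi> ` (U \<inter> W)"
    by (rule patch_open[OF assms(1)])
  have eq: "form_entry E \<tau> i k (v - w) \<circ> inv_into U \<phi>
     = (\<lambda>y. (form_entry E \<tau> i k v \<circ> inv_into U \<phi>) y - (form_entry E \<tau> i k w \<circ> inv_into U \<phi>) y)"
    by (auto simp: form_entry_def)
  have "smooth_coord n (\<phi> ` (U \<inter> W)) (form_entry E \<tau> i k v \<circ> inv_into U \<phi>)"
    "smooth_coord n (\<phi> ` (U \<inter> W)) (form_entry E \<tau> i k w \<circ> inv_into U \<phi>)"
    using assms Herm_sections_iff by blast+
  from partial_derivs_diff[OF this assms(4), of "\<phi> x"] show ?thesis
    unfolding eq using assms(5,6) by blast
qed

lemma topspace_Cinf: "topspace \<X> = \<Gamma>"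
proof -
  have "v \<in> \<Union> {{w\<in>\<Gamma>. p (w - v) < \<epsilon>} | v p \<epsilon>. v \<in> \<Gamma> \<and> p \<in> Cinf_seminorms M E \<and> 0 < \<epsilon>}"
    if v: "v \<in> \<Gamma>" for v
  proof -
    obtain U \<phi> W \<tau> x where p: "patch U \<phi> W \<tau>" "x \<in> U" "x \<in> W"
      using patch_cover by metis
    \<comment> \<open>The generating balls cover \<Gamma> only if some seminorm exists; a one-point
      compact set, no derivatives and arbitrary matrix indices give one.\<close>
    define q where "q = (\<lambda>v. SUP x\<in>{x}. norm (partial_derivs [] (form_entry E \<tau> undefined undefined v \<circ> inv_into U \<phi>) (\<phi> x)))"
    have "q \<in> Cinf_seminorms M E"
      unfolding Cinf_seminorms_def mem_Collect_eq q_def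
      using p unfolding patch_def
      by (intro exI[of _ U] exI[of _ \<phi>] exI[of _ W] exI[of _ \<tau>] exI[of _ "{x}"] exI[of _ "[]"] exI conjI refl) auto
    moreover have "q (v - v) < 1"
      by (simp add: q_def form_entry_def)
    ultimately show ?thesis
      using v by (intro UnionI[of "{w\<in>\<Gamma>. q (w - v) < 1}"]) (auto intro!: exI[of _ v] exI[of _ q] exI[of _ "1::real"])
  qed
  then show ?thesis
    unfolding Cinf_topology_def topology_generated_by_topspace by auto
qed

text \<open>Charts match the compact sets of \<open>M\<close> in the seminorms with compact sets of
  coordinates. The generating sets are balls around arbitrary sections v, not only around the limit,
  so the converse direction goes through the triangle inequality.\<close>

lemma limitin_Cinf_iff:
  "limitin \<X> f l \<FF> \<longleftrightarrow> l \<in> \<Gamma> \<and> (\<forall>\<^sub>F j in \<FF>. f j \<in> \<Gamma>) \<and>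
    (\<forall>U \<phi> W \<tau> K is i k. patch U \<phi> W \<tau> \<longrightarrow> compact K \<longrightarrow> K \<subseteq> \<phi> ` (U \<inter> W) \<longrightarrow> set is \<subseteq> {..<n} \<longrightarrow>
      uniform_limit K (\<lambda>j. partial_derivs is (form_entry E \<tau> i k (f j) \<circ> inv_into U \<phi>))
        (partial_derivs is (form_entry E \<tau> i k l \<circ> inv_into U \<phi>)) \<FF>)" (is "?L \<longleftrightarrow> ?R")
proof
  assume L: ?L
  have l: "l \<in> \<Gamma>"
    using limitin_topspace[OF L] unfolding topspace_Cinf .
  have "openin \<X> \<Gamma>"
    using openin_topspace[of \<X>] unfolding topspace_Cinf .
  with L l have ev: "\<forall>\<^sub>F j in \<FF>. f j \<in> \<Gamma>"
    by (auto simp: limitin_def)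
  show ?R
  proof (intro conjI allI impI l ev)
    fix U \<phi> W \<tau> K "is" i k
    assume p: "patch U \<phi> W \<tau>" and K: "compact K" "K \<subseteq> \<phi> ` (U \<inter> W)" and is': "set is \<subseteq> {..<n}"
    define D where "D = (\<lambda>v. partial_derivs is (form_entry E \<tau> i k v \<circ> inv_into U \<phi>))"
    show "uniform_limit K (\<lambda>j. D (f j)) (D l) \<FF>"
    proof (cases "K = {}")
      case False
      define K' where "K' = inv_into U \<phi> ` K"
      have K': "compact K'" "K' \<subseteq> U \<inter> W" "K' \<noteq> {}" "K = \<phi> ` K'"
      proof -
        have "continuous_on K (inv_into U \<phi>)"
          using chart_inv(3)[of U \<phi>] p K(2) unfolding patch_def
          by (meson continuous_on_subset image_mono inf_le1 order_trans)
        then show "compact K'"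
          unfolding K'_def using K(1) by (rule compact_continuous_image)
        show "K' \<subseteq> U \<inter> W" "K' \<noteq> {}" "K = \<phi> ` K'"
          using patch_points[OF p] K(2) False by (auto simp: K'_def image_image subset_iff)
      qed
      define q where "q = (\<lambda>v. SUP x\<in>K'. norm (D v (\<phi> x)))"
      have q: "q \<in> Cinf_seminorms M E"
        unfolding Cinf_seminorms_def mem_Collect_eq q_def D_def
        using p K' is' unfolding patch_def by blast
      have "q (l - l) = 0"
        using partial_derivs_entry_diff[OF p l l is'] K' by (simp add: q_def D_def subset_iff)
      show ?thesis
      proof (rule uniform_limitI)
        fix e :: real assume "e > 0"
        have "openin \<X> {w\<in>\<Gamma>. q (w - l) < e}"
          unfolding Cinf_topology_def
          by (rule topology_generated_by_Basis) (use q l \<open>e > 0\<close> in blast)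
        moreover have "l \<in> {w\<in>\<Gamma>. q (w - l) < e}"
          using l \<open>e > 0\<close> \<open>q (l - l) = 0\<close> by simp
        ultimately have "\<forall>\<^sub>F j in \<FF>. f j \<in> {w\<in>\<Gamma>. q (w - l) < e}"
          using L by (auto simp: limitin_def)
        then show "\<forall>\<^sub>F j in \<FF>. \<forall>y\<in>K. dist (D (f j) y) (D l y) < e"
        proof eventually_elim
          case (elim j)
          show ?case
          proof
            fix y assume "y \<in> K"
            then obtain x where x: "x \<in> K'" "y = \<phi> x"
              using K' by auto
            then have "x \<in> U" "x \<in> W"
              using K' by auto
            then have "dist (D (f j) y) (D l y) = norm (D (f j - l) (\<phi> x))"
              using partial_derivs_entry_diff[OF p _ l is', of "f j" x i k] elim x by (simp add: D_def dist_norm)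
            also have "\<dots> \<le> q (f j - l)"
              unfolding D_def q_def using elim l x K'
              by (intro seminorm_bound[OF p _ _ is']) (auto intro: Herm_sections_linear)
            also have "\<dots> < e"
              using elim by simp
            finally show "dist (D (f j) y) (D l y) < e" .
          qed
        qed
      qed
    qed simp
  qed
next
  assume R: ?R
  then have l: "l \<in> \<Gamma>" and ev: "\<forall>\<^sub>F j in \<FF>. f j \<in> \<Gamma>"
    by auto
  show ?L
    unfolding Cinf_topology_def limitin_topology_generated_by
  proof (intro conjI ballI impI)
    show "l \<in> \<Union> {{w\<in>\<Gamma>. p (w - v) < \<epsilon>} | v p \<epsilon>. v \<in> \<Gamma> \<and> p \<in> Cinf_seminorms M E \<and> 0 < \<epsilon>}"
      using topspace_Cinf l unfolding Cinf_topology_def topology_generated_by_topspace by simp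
    fix S assume "S \<in> {{w\<in>\<Gamma>. p (w - v) < \<epsilon>} | v p \<epsilon>. v \<in> \<Gamma> \<and> p \<in> Cinf_seminorms M E \<and> 0 < \<epsilon>}" and "l \<in> S"
    then obtain v p \<epsilon> where S: "S = {w\<in>\<Gamma>. p (w - v) < \<epsilon>}" "v \<in> \<Gamma>" "p \<in> Cinf_seminorms M E" "p (l - v) < \<epsilon>"
      by auto
    then obtain U \<phi> W \<tau> K "is" i k where pt: "patch U \<phi> W \<tau>"
      and p: "p = (\<lambda>v. SUP x\<in>K. norm (partial_derivs is (form_entry E \<tau> i k v \<circ> inv_into U \<phi>) (\<phi> x)))"
      and K: "compact K" "K \<noteq> {}" "K \<subseteq> U \<inter> W" "set is \<subseteq> {..<n}"
      unfolding Cinf_seminorms_def patch_def by blast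
    define D where "D = (\<lambda>v. partial_derivs is (form_entry E \<tau> i k v \<circ> inv_into U \<phi>))"
    have "compact (\<phi> ` K)"
      using chart_inv(2)[of U \<phi>] pt K unfolding patch_def
      by (meson compact_continuous_image continuous_on_subset le_inf_iff)
    then have lim: "uniform_limit (\<phi> ` K) (\<lambda>j. D (f j)) (D l) \<FF>"
      using R pt K unfolding D_def by (meson image_mono)
    \<comment> \<open>Half of the room between \<open>p (l - v)\<close> and \<epsilon>, so that the
      inequality stays strict after passing to the supremum.\<close>
    define \<delta> where "\<delta> = (\<epsilon> - p (l - v)) / 2"
    have "\<delta> > 0"
      using S by (simp add: \<delta>_def)
    from uniform_limitD[OF lim this] ev
    show "\<forall>\<^sub>F j in \<FF>. f j \<in> S"
    proof eventually_elim
      case (elim j)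
      have "p (f j - v) \<le> \<delta> + p (l - v)"
        unfolding p
      proof (rule cSUP_least[OF K(2)])
        fix x assume x: "x \<in> K"
        then have xU: "x \<in> U" "x \<in> W"
          using K by auto
        have "D (f j - v) (\<phi> x) = (D (f j) (\<phi> x) - D l (\<phi> x)) + D (l - v) (\<phi> x)"
          unfolding D_def using partial_derivs_entry_diff[OF pt _ _ K(4) xU] elim l S(2) by simp
        then have "norm (D (f j - v) (\<phi> x)) \<le> norm (D (f j) (\<phi> x) - D l (\<phi> x)) + norm (D (l - v) (\<phi> x))"
          by (simp add: norm_triangle_ineq)
        moreover have "norm (D (f j) (\<phi> x) - D l (\<phi> x)) < \<delta>"
          using elim(1) x by (simp add: dist_norm)
        moreover have "norm (D (l - v) (\<phi> x)) \<le> (SUP x\<in>K. norm (D (l - v) (\<phi> x)))"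
          unfolding D_def using Herm_sections_linear(2)[OF l S(2)] by (intro seminorm_bound[OF pt K(1,3,4) _ x])
        ultimately show "norm (partial_derivs is (form_entry E \<tau> i k (f j - v) \<circ> inv_into U \<phi>) (\<phi> x))
            \<le> \<delta> + (SUP x\<in>K. norm (partial_derivs is (form_entry E \<tau> i k (l - v) \<circ> inv_into U \<phi>) (\<phi> x)))"
          by (simp add: D_def)
      qed
      also have "\<dots> < \<epsilon>"
        using S(4) by (simp add: \<delta>_def field_simps)
      finally show "f j \<in> S"
        using elim(2) by (simp add: S(1))
    qed
  qed
qed

text \<open>This turns every closure property of \<open>clim\<close> into one of limits of sections:
  matrix entries are assembled by \<open>clim_matrixI\<close> and recovered by
  \<open>clim_matrixD\<close>.\<close>

theorem limitin_Cinf_clim: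
  "limitin \<X> f l \<FF> \<longleftrightarrow> l \<in> \<Gamma> \<and> (\<forall>\<^sub>F j in \<FF>. f j \<in> \<Gamma>) \<and>
    (\<forall>U \<phi> W \<tau> m. patch U \<phi> W \<tau> \<longrightarrow>
      clim n (\<phi> ` (U \<inter> W)) m (\<lambda>j _. mrep E U \<phi> \<tau> (f j)) (\<lambda>_. mrep E U \<phi> \<tau> l) \<FF>)" (is "?L \<longleftrightarrow> ?R")
proof
  assume L: ?L
  show ?R
  proof (intro conjI allI impI)
    show l: "l \<in> \<Gamma>" and ev: "\<forall>\<^sub>F j in \<FF>. f j \<in> \<Gamma>"
      using L by (auto simp: limitin_Cinf_iff)
    fix U \<phi> W \<tau> m assume p: "patch U \<phi> W \<tau>"
    interpret coord_open n "\<phi> ` (U \<inter> W)"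
      by (rule patch_open[OF p])
    show "clim n (\<phi> ` (U \<inter> W)) m (\<lambda>j _. mrep E U \<phi> \<tau> (f j)) (\<lambda>_. mrep E U \<phi> \<tau> l) \<FF>"
    proof (rule clim_matrixI, unfold mrep_nth)
      fix i k
      have "clim n (\<phi> ` (U \<inter> W)) m (\<lambda>j _. form_entry E \<tau> i k (f j) \<circ> inv_into U \<phi>)
          (\<lambda>_. form_entry E \<tau> i k l \<circ> inv_into U \<phi>) \<FF>"
      proof (rule clim_smooth_coord)
        show "\<forall>\<^sub>F j in \<FF>. smooth_coord n (\<phi> ` (U \<inter> W)) (form_entry E \<tau> i k (f j) \<circ> inv_into U \<phi>)"
          using ev by eventually_elim (use p in \<open>auto simp: Herm_sections_iff\<close>)
        show "smooth_coord n (\<phi> ` (U \<inter> W)) (form_entry E \<tau> i k l \<circ> inv_into U \<phi>)"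
          using l p by (auto simp: Herm_sections_iff)
      qed (use L p in \<open>auto simp: limitin_Cinf_iff\<close>)
      then show "clim n (\<phi> ` (U \<inter> W)) m (\<lambda>j _ y. (form_entry E \<tau> i k (f j) \<circ> inv_into U \<phi>) y)
          (\<lambda>_ y. (form_entry E \<tau> i k l \<circ> inv_into U \<phi>) y) \<FF>" .
    qed
  qed
next
  assume R: ?R
  show ?L
    unfolding limitin_Cinf_iff
  proof (intro conjI allI impI)
    show "l \<in> \<Gamma>" "\<forall>\<^sub>F j in \<FF>. f j \<in> \<Gamma>"
      using R by auto
    fix U \<phi> W \<tau> K "is" i k
    assume p: "patch U \<phi> W \<tau>" and K: "compact K" "K \<subseteq> \<phi> ` (U \<inter> W)" "set is \<subseteq> {..<n}"
    interpret coord_open n "\<phi> ` (U \<inter> W)"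
      by (rule patch_open[OF p])
    have "clim n (\<phi> ` (U \<inter> W)) m (\<lambda>j _. form_entry E \<tau> i k (f j) \<circ> inv_into U \<phi>)
        (\<lambda>_. form_entry E \<tau> i k l \<circ> inv_into U \<phi>) \<FF>" for m
      using clim_matrixD[of m "\<lambda>j _. mrep E U \<phi> \<tau> (f j)" "\<lambda>_. mrep E U \<phi> \<tau> l" \<FF> i k] R p
      unfolding mrep_nth comp_def by blast
    then show "uniform_limit K (\<lambda>j. partial_derivs is (form_entry E \<tau> i k (f j) \<circ> inv_into U \<phi>))
        (partial_derivs is (form_entry E \<tau> i k l \<circ> inv_into U \<phi>)) \<FF>"
      by (intro clim_uniform_limit K)
  qed
qed

lemma limitin_Cinf_pointwise:
  assumes "limitin \<X> f l \<FF>" "(W, \<tau>) \<in> trivs E" "x \<in> W"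
  shows "((\<lambda>j. fmat E \<tau> x (f j x)) \<longlongrightarrow> fmat E \<tau> x (l x)) \<FF>"
proof -
  obtain U \<phi> where c: "(U, \<phi>) \<in> atlas M" "x \<in> U"
    using chart_cover by blast
  then have p: "patch U \<phi> W \<tau>"
    using assms(2) by (simp add: patch_def)
  have "clim n (\<phi> ` (U \<inter> W)) 0 (\<lambda>j _. mrep E U \<phi> \<tau> (f j)) (\<lambda>_. mrep E U \<phi> \<tau> l) \<FF>"
    using assms(1) p unfolding limitin_Cinf_clim by blast
  then have "uniform_limit ({0..1::real} \<times> {\<phi> x}) (\<lambda>j (s, y). mrep E U \<phi> \<tau> (f j) y) (\<lambda>(s, y). mrep E U \<phi> \<tau> l y) \<FF>"
    using c assms(3) by (auto simp: lulim_def)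
  from tendsto_uniform_limitI[OF this, of "(0, \<phi> x)"] show ?thesis
    by (simp add: mrep_at[OF p c(2)])
qed

lemma limitin_Cinf_unique:
  assumes "limitin \<X> f l \<FF>" "limitin \<X> f l' \<FF>" "\<FF> \<noteq> bot"
  shows "l = l'"
proof
  fix x
  obtain W \<tau> where W: "(W, \<tau>) \<in> trivs E" "x \<in> W"
    using triv_cover by blast
  interpret trivialized E \<tau> x
    by (rule trivialized[OF W])
  have "fmat E \<tau> x (l x) = fmat E \<tau> x (l' x)"
    using limitin_Cinf_pointwise[OF assms(1) W] limitin_Cinf_pointwise[OF assms(2) W] assms(3)
    by (intro tendsto_unique)
  moreover have "l x \<in> herm_form E x" "l' x \<in> herm_form E x"
    using assms(1,2) by (auto simp: limitin_Cinf_clim Herm_sections_iff)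
  ultimately show "l x = l' x"
    by (rule fmat_inject[rotated 2])
qed

end

lemma (in coord_open) clim_tendsto:
  assumes "(c \<longlongrightarrow> c0) \<FF>"
  shows "clim n W m (\<lambda>j _ _. c j) (\<lambda>_ _. c0) \<FF>"
proof -
  have jc: "jcont W (\<lambda>_ _. a)" for a
    by (simp add: jcont_def)
  have lu: "lulim W (\<lambda>j _ _. c j) (\<lambda>_ _. c0) \<FF>"
    unfolding lulim_def
  proof (intro conjI allI impI always_eventually jc)
    fix K :: "(nat \<Rightarrow> real) set"
    show "uniform_limit ({0..1} \<times> K) (\<lambda>j (s, y). c j) (\<lambda>(s, y). c0) \<FF>"
    proof (rule uniform_limitI)
      fix e :: real assume "e > 0"
      then have "\<forall>\<^sub>F j in \<FF>. dist (c j) c0 < e"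
        using assms by (simp add: tendsto_iff)
      then show "\<forall>\<^sub>F j in \<FF>. \<forall>x\<in>{0..1} \<times> K. dist (case x of (s, y) \<Rightarrow> c j) (case x of (s, y) \<Rightarrow> c0) < e"
        by eventually_elim auto
    qed
  qed
  show ?thesis
  proof (cases m)
    case 0
    with lu show ?thesis by simp
  next
    case (Suc k)
    have "clim n W k (\<lambda>_ _ _. 0 :: 'b) (\<lambda>_ _. 0) \<FF>"
      by (rule clim_const_fun) simp
    moreover have "has_pderiv W i (\<lambda>_ _. a) (\<lambda>_ _. 0)" for i and a :: 'b
      by (simp add: has_pderiv_def)
    ultimately show ?thesis
      unfolding Suc clim.simps
      by (intro conjI allI impI lu exI[of _ "\<lambda>_ _ _. 0"] exI[of _ "\<lambda>_ _. 0"] always_eventually)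
  qed
qed

text \<open>On K and the unit sphere the quadratic form has a positive minimum \<delta>. A
  perturbation of norm below \<delta>/C changes it there by less than \<delta>, where C = r^2 counts
  the terms of \<open>sesq\<close>. Homogeneity carries positivity from the sphere to all nonzero
  vectors.\<close>

lemma posdef_lower_bound_stable:
  fixes A :: "'x::topological_space \<Rightarrow> 'r::finite cmat"
  assumes K: "compact K" and A: "continuous_on K A" "\<And>y. y \<in> K \<Longrightarrow> posdef (A y)"
    and lim: "uniform_limit K F A \<FF>" and herm: "\<forall>\<^sub>F j in \<FF>. \<forall>y\<in>K. adj (F j y) = F j y"
  shows "\<forall>\<^sub>F j in \<FF>. \<forall>y\<in>K. posdef (F j y)"
proof (cases "K = {}")
  case False
  define S where "S = sphere (0 :: complex ^ 'r) 1"
  define q where "q = (\<lambda>(A :: 'r cmat, p). Re (sesq A p p))"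
  have "compact S" "S \<noteq> {}"
    by (simp_all add: S_def)
  have "continuous_on (K \<times> S) (\<lambda>z. q (A (fst z), snd z))"
    unfolding q_def sesq_def case_prod_conv
    by (intro continuous_intros continuous_on_compose2[OF A(1)]) auto
  from continuous_attains_inf[OF compact_Times[OF K \<open>compact S\<close>] _ this]
  obtain y0 p0 where yp: "y0 \<in> K" "p0 \<in> S"
    and min: "\<And>y p. y \<in> K \<Longrightarrow> p \<in> S \<Longrightarrow> q (A y0, p0) \<le> q (A y, p)"
    using False \<open>S \<noteq> {}\<close> by fastforce
  define \<delta> where "\<delta> = q (A y0, p0)"
  have "p0 \<noteq> 0"
    using yp(2) by (auto simp: S_def)
  then have \<delta>: "\<delta> > 0"
    using A(2)[OF yp(1)] by (auto simp: \<delta>_def q_def posdef_def)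
  define C where "C = real CARD('r) * real CARD('r)"
  have C: "C > 0"
    by (simp add: C_def)
  have qb: "\<bar>q (B, p)\<bar> \<le> C * norm B" if "p \<in> S" for B p
  proof -
    have p: "norm (p $ i) \<le> 1" for i
      using Finite_Cartesian_Product.norm_nth_le[of p i] that by (simp add: S_def)
    have B: "norm (B $ i $ j) \<le> norm B" for i j
      using Finite_Cartesian_Product.norm_nth_le[of "B $ i" j] Finite_Cartesian_Product.norm_nth_le[of B i] by linarith
    have "\<bar>q (B, p)\<bar> \<le> norm (sesq B p p)"
      by (simp add: q_def abs_Re_le_cmod)
    also have "\<dots> \<le> (\<Sum>i\<in>UNIV. \<Sum>j\<in>UNIV. norm (p $ i * cnj (p $ j) * B $ i $ j))"
      unfolding sesq_def by (intro sum_norm_le norm_sum)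
    also have "\<dots> \<le> (\<Sum>i\<in>(UNIV :: 'r set). \<Sum>j\<in>(UNIV :: 'r set). norm B)"
    proof (intro sum_mono)
      fix i j
      have "norm (p $ i * cnj (p $ j) * B $ i $ j) \<le> 1 * 1 * norm B"
        unfolding norm_mult using p B by (intro mult_mono) auto
      then show "norm (p $ i * cnj (p $ j) * B $ i $ j) \<le> norm B"
        by simp
    qed
    finally show ?thesis
      by (simp add: C_def)
  qed
  have "\<delta> / C > 0"
    using \<delta> C by simp
  from uniform_limitD[OF lim this] herm show ?thesis
  proof eventually_elim
    case (elim j)
    show ?case
    proof
      fix y assume y: "y \<in> K"
      have "0 < q (F j y, p)" if p: "p \<in> S" for p
      proof -
        have "\<bar>q (F j y - A y, p)\<bar> \<le> C * norm (F j y - A y)"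
          by (rule qb[OF p])
        also have "\<dots> < C * (\<delta> / C)"
          using elim(1) y C by (intro mult_strict_left_mono) (auto simp: dist_norm)
        finally have "\<bar>q (F j y, p) - q (A y, p)\<bar> < \<delta>"
          using C by (simp add: q_def sesq_diff_mat)
        with min[OF y p] show ?thesis
          by (simp add: \<delta>_def)
      qed
      then have pos: "0 < Re (sesq (F j y) p p)" if "p \<in> S" for p
        using that by (simp add: q_def)
      show "posdef (F j y)"
        unfolding posdef_def
      proof (intro conjI allI impI)
        show "adj (F j y) = F j y"
          using elim(2) y by blast
        fix p :: "complex ^ 'r" assume "p \<noteq> 0"
        define u where "u = complex_of_real (1 / norm p) *s p"
        have "norm u = 1"
        proof -
          have "u = (1 / norm p) *\<^sub>R p"
            unfolding u_def by (simp add: vec_eq_iff) (simp add: scaleR_conv_of_real divide_inverse)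
          with \<open>p \<noteq> 0\<close> show ?thesis
            by simp
        qed
        then have "0 < Re (sesq (F j y) u u)"
          by (intro pos) (simp add: S_def)
        also have "sesq (F j y) u u = complex_of_real ((1 / norm p)\<^sup>2) * sesq (F j y) p p"
          by (simp add: u_def sesq_scale_left sesq_scale_right power2_eq_square)
        finally show "0 < Re (sesq (F j y) p p)"
          using \<open>p \<noteq> 0\<close> by (simp add: zero_less_mult_iff del: of_real_power of_real_divide)
      qed
    qed
  qed
qed simp

section \<open>Compactness of the base and openness of positivity\<close>

context herm_bundle
begin

lemma compact_M: "compact (UNIV :: 'm set)"
  using cm by (simp add: closed_oriented_manifold_def)

lemma Hausdorff_M: "Hausdorff_space (euclidean :: 'm topology)"
  unfolding Hausdorff_space_def using hausdorff by (auto simp: disjnt_def)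

text \<open>In the compact Hausdorff space \<open>M\<close> the point x and the complement of S have
  disjoint open neighborhoods U and V; then U lies in the compact complement of V.\<close>

lemma compact_neighborhood:
  fixes x :: 'm
  assumes "open S" "x \<in> S"
  obtains N K where "open N" "compact K" "x \<in> N" "N \<subseteq> K" "K \<subseteq> S"
proof -
  have "closed (- S)"
    using assms(1) by (rule closed_Compl)
  then have "compact (- S)"
    using compact_Int_closed[OF compact_M, of "- S"] by simp
  then obtain U V where UV: "open U" "open V" "x \<in> U" "- S \<subseteq> V" "disjnt U V"
    using Hausdorff_space_compact_separation[OF Hausdorff_M, of "{x}" "- S"] assms(2)
    by (auto simp: compactin_euclidean_iff)
  have "closed (- V)"
    using UV(2) by (rule closed_Compl)
  then have "compact (- V)"
    using compact_Int_closed[OF compact_M, of "- V"] by simp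
  moreover have "U \<subseteq> - V" "- V \<subseteq> S"
    using UV by (auto simp: disjnt_def)
  ultimately show thesis
    using UV that by blast
qed

text \<open>Each point brings a neighborhood with its own eventual property. A finite subcover
  leaves finitely many of them, and these hold together.\<close>

lemma eventually_all_pointsI:
  assumes "\<And>x. \<exists>N. open N \<and> x \<in> N \<and> (\<forall>\<^sub>F j in \<FF>. \<forall>z\<in>N. Q j z)"
  shows "\<forall>\<^sub>F j in \<FF>. \<forall>z::'m. Q j z"
proof -
  define C where "C = {N. open N \<and> (\<forall>\<^sub>F j in \<FF>. \<forall>z\<in>N. Q j z)}"
  have "UNIV \<subseteq> \<Union>C"
    using assms by (auto simp: C_def)
  moreover have "\<And>N. N \<in> C \<Longrightarrow> open N"
    by (simp add: C_def)
  ultimately obtain D where D: "D \<subseteq> C" "finite D" "UNIV \<subseteq> \<Union>D"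
    by (rule compactE[OF compact_M])
  have "\<forall>\<^sub>F j in \<FF>. \<forall>N\<in>D. \<forall>z\<in>N. Q j z"
    using D by (intro eventually_ball_finite) (auto simp: C_def)
  then show ?thesis
    by eventually_elim (use D(3) in blast)
qed

lemma patch_neighborhood:
  obtains U \<phi> W \<tau> N K where "patch U \<phi> W \<tau>" "open N" "compact K" "x \<in> N" "N \<subseteq> K" "K \<subseteq> U \<inter> W"
    "compact (\<phi> ` K)" "\<phi> ` K \<subseteq> \<phi> ` (U \<inter> W)"
proof -
  obtain U \<phi> W \<tau> where p: "patch U \<phi> W \<tau>" "x \<in> U" "x \<in> W"
    using patch_cover by metis
  then have "open (U \<inter> W)"
    using chart(1) open_triv unfolding patch_def by blast
  then obtain N K where NK: "open N" "compact K" "x \<in> N" "N \<subseteq> K" "K \<subseteq> U \<inter> W"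
    using compact_neighborhood[of "U \<inter> W" x] p by blast
  have "continuous_on K \<phi>"
    using chart_inv(2)[of U \<phi>] p NK(5) unfolding patch_def by (meson continuous_on_subset le_inf_iff)
  then have "compact (\<phi> ` K)"
    using NK(2) by (rule compact_continuous_image)
  with p NK show thesis
    by (intro that) auto
qed

lemma limitin_Cinf_uniform:
  assumes "limitin \<X> f l \<FF>" "patch U \<phi> W \<tau>" "compact K" "K \<subseteq> \<phi> ` (U \<inter> W)"
  shows "uniform_limit K (\<lambda>j. mrep E U \<phi> \<tau> (f j)) (mrep E U \<phi> \<tau> l) \<FF>"
proof -
  interpret coord_open n "\<phi> ` (U \<inter> W)"
    by (rule patch_open[OF assms(2)])
  have "clim n (\<phi> ` (U \<inter> W)) m (\<lambda>j _. mrep E U \<phi> \<tau> (f j)) (\<lambda>_. mrep E U \<phi> \<tau> l) \<FF>" for m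
    using assms(1,2) unfolding limitin_Cinf_clim by blast
  from clim_uniform_limit[OF this, of "[]"] show ?thesis
    using assms(3,4) by simp
qed

lemma mrep_continuous:
  assumes "v \<in> \<Gamma>" "patch U \<phi> W \<tau>"
  shows "continuous_on (\<phi> ` (U \<inter> W)) (mrep E U \<phi> \<tau> v)"
proof -
  interpret coord_open n "\<phi> ` (U \<inter> W)"
    by (rule patch_open[OF assms(2)])
  from clim_lulim[OF Herm_sections_clim[OF assms, where \<FF> = "bot :: unit filter" and m = 0]] show ?thesis
    by (simp add: lulim_def jcont_no_param)
qed

lemma pos_Herm_sections_subset: "\<Gamma>p \<subseteq> \<Gamma>"
  by (auto simp: pos_Herm_sections_def)

lemma Herm_sectionsD: "v \<in> \<Gamma> \<Longrightarrow> v x \<in> herm_form E x"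
  by (simp add: Herm_sections_def)

lemma pos_Herm_sectionsD: "h \<in> \<Gamma>p \<Longrightarrow> h x \<in> pos_herm_form E x"
  by (simp add: pos_Herm_sections_def)

lemma mrep_hermitian: "v \<in> \<Gamma> \<Longrightarrow> patch U \<phi> W \<tau> \<Longrightarrow> y \<in> \<phi> ` (U \<inter> W) \<Longrightarrow> adj (mrep E U \<phi> \<tau> v y) = mrep E U \<phi> \<tau> v y"
  unfolding mrep_def by (rule trivialized.fmat_hermitian[OF patch_points(4)]) (auto dest: Herm_sectionsD)

lemma mrep_posdef:
  assumes "h \<in> \<Gamma>p" "patch U \<phi> W \<tau>" "y \<in> \<phi> ` (U \<inter> W)"
  shows "posdef (mrep E U \<phi> \<tau> h y)"
  unfolding mrep_def
  using trivialized.posdef_fmat_iff[OF patch_points(4)[OF assms(2,3)], of "h (inv_into U \<phi> y)"]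
    pos_Herm_sectionsD[OF assms(1)] by (simp add: pos_herm_form_def)

text \<open>Positivity is an open condition because \<open>M\<close> is compact.\<close>

lemma eventually_pos_Herm_sections:
  assumes lim: "limitin \<X> f h \<FF>" and h: "h \<in> \<Gamma>p"
  shows "\<forall>\<^sub>F j in \<FF>. f j \<in> \<Gamma>p"
proof -
  have ev: "\<forall>\<^sub>F j in \<FF>. f j \<in> \<Gamma>"
    using lim by (simp add: limitin_Cinf_clim)
  have "\<forall>\<^sub>F j in \<FF>. \<forall>x. f j \<in> \<Gamma> \<longrightarrow> f j x \<in> pos_herm_form E x"
  proof (rule eventually_all_pointsI)
    fix x
    obtain U \<phi> W \<tau> N K where p: "patch U \<phi> W \<tau>" and N: "open N" "compact K" "x \<in> N" "N \<subseteq> K" "K \<subseteq> U \<inter> W"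
      "compact (\<phi> ` K)" "\<phi> ` K \<subseteq> \<phi> ` (U \<inter> W)"
      by (rule patch_neighborhood)
    have "\<forall>\<^sub>F j in \<FF>. \<forall>y\<in>\<phi> ` K. posdef (mrep E U \<phi> \<tau> (f j) y)"
    proof (rule posdef_lower_bound_stable[OF N(6) _ _ limitin_Cinf_uniform[OF lim p N(6,7)]])
      show "continuous_on (\<phi> ` K) (mrep E U \<phi> \<tau> h)"
        using mrep_continuous[OF _ p] h pos_Herm_sections_subset N(7) continuous_on_subset by blast
      show "posdef (mrep E U \<phi> \<tau> h y)" if "y \<in> \<phi> ` K" for y
        using mrep_posdef[OF h p] that N(7) by blast
      show "\<forall>\<^sub>F j in \<FF>. \<forall>y\<in>\<phi> ` K. adj (mrep E U \<phi> \<tau> (f j) y) = mrep E U \<phi> \<tau> (f j) y"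
        using ev by eventually_elim (use mrep_hermitian[OF _ p] N(7) in blast)
    qed
    then have "\<forall>\<^sub>F j in \<FF>. \<forall>z\<in>N. f j \<in> \<Gamma> \<longrightarrow> f j z \<in> pos_herm_form E z"
    proof eventually_elim
      case (elim j)
      show ?case
      proof (intro ballI impI)
        fix z assume z: "z \<in> N" and fj: "f j \<in> \<Gamma>"
        then have zUW: "z \<in> U" "z \<in> W" "z \<in> K"
          using N by auto
        then have "posdef (fmat E \<tau> z (f j z))"
          using elim mrep_at[OF p zUW(1)] by (metis imageI)
        moreover have "trivialized E \<tau> z"
          using trivialized p zUW unfolding patch_def by blast
        ultimately show "f j z \<in> pos_herm_form E z"
          using trivialized.posdef_fmat_iff[OF _ Herm_sectionsD[OF fj]] by blast
      qed
    qed
    then show "\<exists>N. open N \<and> x \<in> N \<and> (\<forall>\<^sub>F j in \<FF>. \<forall>z\<in>N. f j \<in> \<Gamma> \<longrightarrow> f j z \<in> pos_herm_form E z)"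
      using N(1,3) by blast
  qed
  with ev show ?thesis
    by eventually_elim (auto simp: pos_Herm_sections_def)
qed

lemma limitin_Cinf_add:
  assumes "limitin \<X> f l \<FF>" "limitin \<X> g k \<FF>"
  shows "limitin \<X> (\<lambda>j. f j + g j) (l + k) \<FF>"
  unfolding limitin_Cinf_clim
proof (intro conjI allI impI)
  show "l + k \<in> \<Gamma>"
    using assms by (auto simp: limitin_Cinf_clim intro: Herm_sections_linear)
  have "\<forall>\<^sub>F j in \<FF>. f j \<in> \<Gamma>" "\<forall>\<^sub>F j in \<FF>. g j \<in> \<Gamma>"
    using assms by (auto simp: limitin_Cinf_clim)
  then show "\<forall>\<^sub>F j in \<FF>. f j + g j \<in> \<Gamma>"
    by eventually_elim (rule Herm_sections_linear)
  fix U \<phi> W \<tau> m assume p: "patch U \<phi> W \<tau>"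
  interpret coord_open n "\<phi> ` (U \<inter> W)"
    by (rule patch_open[OF p])
  show "clim n (\<phi> ` (U \<inter> W)) m (\<lambda>j _. mrep E U \<phi> \<tau> (f j + g j)) (\<lambda>_. mrep E U \<phi> \<tau> (l + k)) \<FF>"
    unfolding mrep_add[abs_def] using assms p unfolding limitin_Cinf_clim by (intro clim_add) auto
qed

lemma limitin_Cinf_scaleR:
  assumes "limitin \<X> f l \<FF>" "(c \<longlongrightarrow> c0) \<FF>"
  shows "limitin \<X> (\<lambda>j. c j *\<^sub>R f j) (c0 *\<^sub>R l) \<FF>"
  unfolding limitin_Cinf_clim
proof (intro conjI allI impI)
  show "c0 *\<^sub>R l \<in> \<Gamma>"
    using assms(1) by (auto simp: limitin_Cinf_clim intro: Herm_sections_linear)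
  have "\<forall>\<^sub>F j in \<FF>. f j \<in> \<Gamma>"
    using assms by (auto simp: limitin_Cinf_clim)
  then show "\<forall>\<^sub>F j in \<FF>. c j *\<^sub>R f j \<in> \<Gamma>"
    by eventually_elim (rule Herm_sections_linear)
  fix U \<phi> W \<tau> m assume p: "patch U \<phi> W \<tau>"
  interpret coord_open n "\<phi> ` (U \<inter> W)"
    by (rule patch_open[OF p])
  have "clim n (\<phi> ` (U \<inter> W)) m (\<lambda>j _. mrep E U \<phi> \<tau> (f j)) (\<lambda>_. mrep E U \<phi> \<tau> l) \<FF>"
    using assms(1) p unfolding limitin_Cinf_clim by blast
  from bounded_bilinear.clim_bilinear[OF bounded_bilinear_scaleR coord_open_axioms clim_tendsto[OF assms(2)] this]
  show "clim n (\<phi> ` (U \<inter> W)) m (\<lambda>j _. mrep E U \<phi> \<tau> (c j *\<^sub>R f j)) (\<lambda>_. mrep E U \<phi> \<tau> (c0 *\<^sub>R l)) \<FF>"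
    unfolding mrep_scaleR[abs_def] .
qed

lemma Herm_sections_scaleR: "v \<in> \<Gamma> \<Longrightarrow> r *\<^sub>R v \<in> \<Gamma>"
  by (rule Herm_sections_linear(3))

lemma limitin_Cinf_const: "v \<in> \<Gamma> \<Longrightarrow> limitin \<X> (\<lambda>_. v) v \<FF>"
  using topspace_Cinf by (auto simp: limitin_def)

lemma limitin_Cinf_line:
  assumes "v \<in> \<Gamma>" "w \<in> \<Gamma>"
  shows "limitin \<X> (\<lambda>t. v + t *\<^sub>R w) v (at 0)"
  using limitin_Cinf_add[OF limitin_Cinf_const[OF assms(1)]
      limitin_Cinf_scaleR[OF limitin_Cinf_const[OF assms(2)] tendsto_ident_at[of 0 UNIV]]] by simp

lemma openin_CinfI:
  assumes "S \<subseteq> \<Gamma>" "\<And>v. v \<in> S \<Longrightarrow> \<forall>\<^sub>F w in atin \<X> v. w \<in> S"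
  shows "openin \<X> S"
  unfolding openin_subopen[of \<X> S]
proof
  fix v assume v: "v \<in> S"
  then have "v \<in> topspace \<X>"
    using assms(1) topspace_Cinf by auto
  with assms(2)[OF v] obtain T where "openin \<X> T" "v \<in> T" "\<forall>w\<in>T - {v}. w \<in> S"
    by (auto simp: eventually_atin)
  with v show "\<exists>T. openin \<X> T \<and> v \<in> T \<and> T \<subseteq> S"
    by blast
qed

lemma limitin_Cinf_ident: "v \<in> \<Gamma> \<Longrightarrow> limitin \<X> (\<lambda>w. w) v (atin \<X> v)"
  using continuous_map_atin[of \<X> \<X> "\<lambda>w. w"] topspace_Cinf by auto

lemma openin_Herm_sections: "openin \<X> \<Gamma>"
  using openin_topspace[of \<X>] by (simp add: topspace_Cinf)

lemma openin_pos_Herm_sections: "openin \<X> \<Gamma>p"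
  by (rule openin_CinfI[OF pos_Herm_sections_subset])
    (use eventually_pos_Herm_sections limitin_Cinf_ident pos_Herm_sections_subset in blast)

text \<open>Local limits must be glued to a section, for instance when difference quotients converge
  in every patch. Neither the Hermitian symmetry of G nor its compatibility between patches is
  assumed: both hold for the \<open>f j\<close> and pass to the limit, which is unique since the
  filter is proper.\<close>

theorem Cinf_complete:
  assumes ev: "\<forall>\<^sub>F j in \<FF>. f j \<in> \<Gamma>" and "\<FF> \<noteq> bot"
    and lim: "\<And>U \<phi> W \<tau> m. patch U \<phi> W \<tau> \<Longrightarrow>
      clim n (\<phi> ` (U \<inter> W)) m (\<lambda>j _. mrep E U \<phi> \<tau> (f j)) (\<lambda>_. G U \<phi> W \<tau>) \<FF>"
  obtains l where "limitin \<X> f l \<FF>"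
    "\<And>U \<phi> W \<tau> y. patch U \<phi> W \<tau> \<Longrightarrow> y \<in> \<phi> ` (U \<inter> W) \<Longrightarrow> mrep E U \<phi> \<tau> l y = G U \<phi> W \<tau> y"
proof -
  have pw: "((\<lambda>j. fmat E \<tau> x (f j x)) \<longlongrightarrow> G U \<phi> W \<tau> (\<phi> x)) \<FF>" if p: "patch U \<phi> W \<tau>" "x \<in> U" "x \<in> W" for U \<phi> W \<tau> x
  proof -
    have "uniform_limit ({0..1::real} \<times> {\<phi> x}) (\<lambda>j (s, y). mrep E U \<phi> \<tau> (f j) y) (\<lambda>(s, y). G U \<phi> W \<tau> y) \<FF>"
      using lim[OF p(1), of 0] p by (auto simp: lulim_def)
    from tendsto_uniform_limitI[OF this, of "(0, \<phi> x)"] show ?thesis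
      by (simp add: mrep_at[OF p(1,2)])
  qed
  \<comment> \<open>The limit form at x is read off in one chosen patch; \<open>lG\<close> shows
    that every other patch through x would give the same form.\<close>
  define ch where "ch = (\<lambda>x. SOME (U, \<phi>, W, \<tau>). patch U \<phi> W \<tau> \<and> x \<in> U \<and> x \<in> W)"
  have ch: "case ch x of (U, \<phi>, W, \<tau>) \<Rightarrow> patch U \<phi> W \<tau> \<and> x \<in> U \<and> x \<in> W" for x
  proof -
    obtain U \<phi> W \<tau> where "patch U \<phi> W \<tau>" "x \<in> U" "x \<in> W"
      by (rule patch_cover)
    then show ?thesis
      unfolding ch_def
      by (intro someI[of "\<lambda>(U, \<phi>, W, \<tau>). patch U \<phi> W \<tau> \<and> x \<in> U \<and> x \<in> W" "(U, \<phi>, W, \<tau>)"]) simp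
  qed
  define l where "l = (\<lambda>x. case ch x of (U, \<phi>, W, \<tau>) \<Rightarrow> mform E \<tau> x (G U \<phi> W \<tau> (\<phi> x)))"
  have l: "l x \<in> herm_form E x" and lG: "patch U \<phi> W \<tau> \<Longrightarrow> x \<in> U \<Longrightarrow> x \<in> W \<Longrightarrow> fmat E \<tau> x (l x) = G U \<phi> W \<tau> (\<phi> x)" for x U \<phi> W \<tau>
  proof -
    obtain U' \<phi>' W' \<tau>' where c: "ch x = (U', \<phi>', W', \<tau>')"
      by (metis prod_cases4)
    then have p': "patch U' \<phi>' W' \<tau>'" "x \<in> U'" "x \<in> W'"
      using ch[of x] by auto
    then interpret t': trivialized E \<tau>' x
      using trivialized unfolding patch_def by blast
    let ?A = "G U' \<phi>' W' \<tau>' (\<phi>' x)"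
    have lx: "l x = mform E \<tau>' x ?A"
      by (simp add: l_def c)
    have "((\<lambda>j. adj (fmat E \<tau>' x (f j x))) \<longlongrightarrow> adj ?A) \<FF>"
      unfolding adj_def by (intro tendsto_intros pw[OF p'])
    moreover have "\<forall>\<^sub>F j in \<FF>. adj (fmat E \<tau>' x (f j x)) = fmat E \<tau>' x (f j x)"
      using ev by eventually_elim (auto intro: t'.fmat_hermitian Herm_sectionsD)
    ultimately have "((\<lambda>j. fmat E \<tau>' x (f j x)) \<longlongrightarrow> adj ?A) \<FF>"
      by (rule Lim_transform_eventually)
    then have "adj ?A = ?A"
      using pw[OF p'] \<open>\<FF> \<noteq> bot\<close> by (intro tendsto_unique)
    then show herm: "l x \<in> herm_form E x"
      unfolding lx by (rule t'.mform_herm)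
    assume p: "patch U \<phi> W \<tau>" "x \<in> U" "x \<in> W"
    then have "trivialized E \<tau> x"
      using trivialized unfolding patch_def by blast
    from fmat_change[OF t'.trivialized_axioms this]
    obtain S where S: "\<And>v. v \<in> herm_form E x \<Longrightarrow> fmat E \<tau> x v = S ** fmat E \<tau>' x v ** adj S"
      by metis
    have "((\<lambda>j. S ** fmat E \<tau>' x (f j x) ** adj S) \<longlongrightarrow> S ** ?A ** adj S) \<FF>"
      by (intro matrix_mult.tendsto tendsto_const pw[OF p'])
    moreover have "\<forall>\<^sub>F j in \<FF>. S ** fmat E \<tau>' x (f j x) ** adj S = fmat E \<tau> x (f j x)"
      using ev by eventually_elim (simp add: S Herm_sectionsD)
    ultimately have "((\<lambda>j. fmat E \<tau> x (f j x)) \<longlongrightarrow> S ** ?A ** adj S) \<FF>"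
      by (rule Lim_transform_eventually)
    then have "G U \<phi> W \<tau> (\<phi> x) = S ** ?A ** adj S"
      using pw[OF p] \<open>\<FF> \<noteq> bot\<close> by (intro tendsto_unique)
    moreover have "fmat E \<tau> x (l x) = S ** ?A ** adj S"
      using S[OF herm] by (simp add: lx)
    ultimately show "fmat E \<tau> x (l x) = G U \<phi> W \<tau> (\<phi> x)"
      by simp
  qed
  have mG: "mrep E U \<phi> \<tau> l y = G U \<phi> W \<tau> y" if "patch U \<phi> W \<tau>" "y \<in> \<phi> ` (U \<inter> W)" for U \<phi> W \<tau> y
    using lG[OF that(1)] patch_points[OF that] by (simp add: mrep_def)
  have cl: "clim n (\<phi> ` (U \<inter> W)) m (\<lambda>j _. mrep E U \<phi> \<tau> (f j)) (\<lambda>_. mrep E U \<phi> \<tau> l) \<FF>" if p: "patch U \<phi> W \<tau>" for U \<phi> W \<tau> m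
  proof -
    interpret coord_open n "\<phi> ` (U \<inter> W)"
      by (rule patch_open[OF p])
    show ?thesis
      by (rule clim_cong[OF _ _ lim[OF p]]) (simp_all add: mG[OF p])
  qed
  have "l \<in> \<Gamma>"
    by (rule Herm_sections_climI[OF l]) (use cl in blast)
  then have "limitin \<X> f l \<FF>"
    using ev cl by (simp add: limitin_Cinf_clim)
  then show thesis
    using mG by (rule that)
qed

end


section \<open>Rational expressions and smoothness\<close>

text \<open>
  Noncommutative rational expressions in sections of Hermitian forms, read as expressions in their local
  coefficient matrices: \<open>Pt L\<close> is a linear function of the point at which the map is evaluated and
  \<open>Dir j L\<close> is \<open>L\<close> applied to the \<open>j\<close>-th direction of differentiation; the scalars depend on
  the parameter \<open>s \<in> [0, 1]\<close> over which the expression is integrated in the end.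
\<close>

datatype ('a, 's) ratex =
    Pt "'a \<Rightarrow> 's"
  | Dir nat "'a \<Rightarrow> 's"
  | Sc "real \<Rightarrow> complex"
  | Cst 's
  | Plus "('a, 's) ratex" "('a, 's) ratex"
  | Times "('a, 's) ratex" "('a, 's) ratex"
  | Inv "('a, 's) ratex"

primrec reval :: "('s \<Rightarrow> (nat \<Rightarrow> real) \<Rightarrow> 'r::finite cmat) \<Rightarrow> ('a, 's) ratex \<Rightarrow> 'a \<Rightarrow> (nat \<Rightarrow> 'a) \<Rightarrow>
    real \<Rightarrow> (nat \<Rightarrow> real) \<Rightarrow> 'r cmat" where
  "reval R (Pt L) x \<eta> s y = R (L x) y"
| "reval R (Dir j L) x \<eta> s y = R (L (\<eta> j)) y"
| "reval R (Sc c) x \<eta> s y = mat (c s)"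
| "reval R (Cst k) x \<eta> s y = R k y"
| "reval R (Plus a b) x \<eta> s y = reval R a x \<eta> s y + reval R b x \<eta> s y"
| "reval R (Times a b) x \<eta> s y = reval R a x \<eta> s y ** reval R b x \<eta> s y"
| "reval R (Inv a) x \<eta> s y = matrix_inv (reval R a x \<eta> s y)"

text \<open>Only the base point moves. Directions of earlier differentiations are frozen, so a
  \<open>Dir\<close> atom is a constant, and number k is given to the new direction.\<close>

primrec rderiv :: "nat \<Rightarrow> ('a, 's) ratex \<Rightarrow> ('a, 's) ratex" where
  "rderiv k (Pt L) = Dir k L"
| "rderiv k (Dir j L) = Sc (\<lambda>_. 0)"
| "rderiv k (Sc c) = Sc (\<lambda>_. 0)"
| "rderiv k (Cst v) = Sc (\<lambda>_. 0)"
| "rderiv k (Plus a b) = Plus (rderiv k a) (rderiv k b)"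
| "rderiv k (Times a b) = Plus (Times (rderiv k a) b) (Times a (rderiv k b))"
| "rderiv k (Inv a) = Times (Sc (\<lambda>_. - 1)) (Times (Inv a) (Times (rderiv k a) (Inv a)))"

primrec rderivs :: "nat \<Rightarrow> ('a, 's) ratex \<Rightarrow> ('a, 's) ratex" where
  "rderivs 0 e = e"
| "rderivs (Suc k) e = rderiv k (rderivs k e)"

text \<open>This records that the index k is still fresh when \<open>rderiv k\<close> introduces it,
  so that fixing the k-th direction does not disturb the value of the expression being
  differentiated.\<close>

primrec dirs_below :: "nat \<Rightarrow> ('a, 's) ratex \<Rightarrow> bool" where
  "dirs_below k (Pt L) \<longleftrightarrow> True"
| "dirs_below k (Dir j L) \<longleftrightarrow> j < k"
| "dirs_below k (Sc c) \<longleftrightarrow> True"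
| "dirs_below k (Cst v) \<longleftrightarrow> True"
| "dirs_below k (Plus a b) \<longleftrightarrow> dirs_below k a \<and> dirs_below k b"
| "dirs_below k (Times a b) \<longleftrightarrow> dirs_below k a \<and> dirs_below k b"
| "dirs_below k (Inv a) \<longleftrightarrow> dirs_below k a"

lemma dirs_below_mono: "dirs_below k e \<Longrightarrow> k \<le> k' \<Longrightarrow> dirs_below k' e"
  by (induction e) auto

lemma dirs_below_rderiv: "dirs_below k e \<Longrightarrow> dirs_below (Suc k) (rderiv k e)"
  by (induction e) (auto intro: dirs_below_mono)

lemma dirs_below_rderivs: "dirs_below 0 e \<Longrightarrow> dirs_below k (rderivs k e)"
  by (induction k) (auto intro: dirs_below_rderiv)

lemma reval_cong:
  "dirs_below k e \<Longrightarrow> (\<And>i. i < k \<Longrightarrow> \<eta> i = \<eta>' i) \<Longrightarrow> reval R e x \<eta> s y = reval R e x \<eta>' s y"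
  by (induction e) auto

text \<open>Only segments x + tv and their limit at t = 0 are required of the domain space. The
  machinery thus serves sections (for exp and ln), the real line (for geodesics) and triples of
  sections (for the spray).\<close>

locale smooth_domain = herm_bundle M E
  for M :: "'m::t2_space manifold" and E :: "('m, 'v::ab_group_add, 'r::finite) vector_bundle" +
  fixes T :: "'a::real_vector topology"
  assumes T_line_mem: "\<And>x v t. x \<in> topspace T \<Longrightarrow> v \<in> topspace T \<Longrightarrow> x + t *\<^sub>R v \<in> topspace T"
    and T_line: "\<And>x v. x \<in> topspace T \<Longrightarrow> v \<in> topspace T \<Longrightarrow> limitin T (\<lambda>t. x + t *\<^sub>R v) x (at 0)"
begin

definition linear_atom :: "('a \<Rightarrow> ('m, 'v) form_section) \<Rightarrow> bool" where
  "linear_atom L \<longleftrightarrow> continuous_map T \<X> L \<and>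
     (\<forall>x\<in>topspace T. \<forall>v\<in>topspace T. \<forall>t. L (x + t *\<^sub>R v) = L x + t *\<^sub>R L v)"

primrec wf_ratex :: "('a, ('m, 'v) form_section) ratex \<Rightarrow> bool" where
  "wf_ratex (Pt L) \<longleftrightarrow> linear_atom L"
| "wf_ratex (Dir j L) \<longleftrightarrow> linear_atom L"
| "wf_ratex (Sc c) \<longleftrightarrow> continuous_on {0..1} c"
| "wf_ratex (Cst v) \<longleftrightarrow> v \<in> \<Gamma>"
| "wf_ratex (Plus a b) \<longleftrightarrow> wf_ratex a \<and> wf_ratex b"
| "wf_ratex (Times a b) \<longleftrightarrow> wf_ratex a \<and> wf_ratex b"
| "wf_ratex (Inv a) \<longleftrightarrow> wf_ratex a"

text \<open>Invertibility is demanded for every assignment of directions. This adds no burden,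
  because the derivative of an inverse inverts only the old subterm and the expressions started from
  contain no directions.\<close>

primrec defined_on :: "'a set \<Rightarrow> ('a, ('m, 'v) form_section) ratex \<Rightarrow> bool" where
  "defined_on V (Pt L) \<longleftrightarrow> True"
| "defined_on V (Dir j L) \<longleftrightarrow> True"
| "defined_on V (Sc c) \<longleftrightarrow> True"
| "defined_on V (Cst v) \<longleftrightarrow> True"
| "defined_on V (Plus a b) \<longleftrightarrow> defined_on V a \<and> defined_on V b"
| "defined_on V (Times a b) \<longleftrightarrow> defined_on V a \<and> defined_on V b"
| "defined_on V (Inv a) \<longleftrightarrow> defined_on V a \<and>
     (\<forall>U \<phi> W \<tau> x \<eta> s y. patch U \<phi> W \<tau> \<longrightarrow> x \<in> V \<longrightarrow> s \<in> {0..1} \<longrightarrow> y \<in> \<phi> ` (U \<inter> W) \<longrightarrow>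
       invertible (reval (mrep E U \<phi> \<tau>) a x \<eta> s y))"

lemma wf_ratex_rderivs: "wf_ratex e \<Longrightarrow> wf_ratex (rderivs k e)"
proof (induction k)
  case (Suc k)
  have "wf_ratex (rderiv k e)" if "wf_ratex e" for e
    using that by (induction e) auto
  with Suc show ?case by simp
qed simp

lemma defined_on_rderivs: "defined_on V e \<Longrightarrow> defined_on V (rderivs k e)"
proof (induction k)
  case (Suc k)
  have "defined_on V (rderiv k e)" if "defined_on V e" for e
    using that by (induction e) auto
  with Suc show ?case by simp
qed simp

section \<open>Limits and difference quotients of expressions\<close>

lemma linear_atomD:
  assumes "linear_atom L"
  shows "x \<in> topspace T \<Longrightarrow> L x \<in> \<Gamma>"
    and "limitin T f x \<FF> \<Longrightarrow> limitin \<X> (\<lambda>j. L (f j)) (L x) \<FF>"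
    and "x \<in> topspace T \<Longrightarrow> v \<in> topspace T \<Longrightarrow> L (x + t *\<^sub>R v) = L x + t *\<^sub>R L v"
proof -
  have c: "continuous_map T \<X> L"
    using assms by (simp add: linear_atom_def)
  show "x \<in> topspace T \<Longrightarrow> L x \<in> \<Gamma>"
    using continuous_map_funspace[OF c] by (auto simp: topspace_Cinf)
  show "limitin T f x \<FF> \<Longrightarrow> limitin \<X> (\<lambda>j. L (f j)) (L x) \<FF>"
    using continuous_map_limit[OF c, of f x \<FF>] by (simp add: comp_def)
  show "x \<in> topspace T \<Longrightarrow> v \<in> topspace T \<Longrightarrow> L (x + t *\<^sub>R v) = L x + t *\<^sub>R L v"
    using assms by (simp add: linear_atom_def)
qed

text \<open>Point and directions may move together along any filter, which is the joint continuity
  asked for in \<open>mb_smooth\<close>. Since V is open, the moving point is eventually in V and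
  the inverses exist.\<close>

lemma reval_clim:
  assumes V: "openin T V" and p: "patch U \<phi> W \<tau>"
    and e: "wf_ratex e" "defined_on V e" "dirs_below k e"
    and x: "limitin T x x0 \<FF>" "x0 \<in> V"
    and \<eta>: "\<And>i. i < k \<Longrightarrow> limitin T (\<lambda>j. \<eta> j i) (\<eta>0 i) \<FF>"
  shows "clim n (\<phi> ` (U \<inter> W)) m (\<lambda>j. reval (mrep E U \<phi> \<tau>) e (x j) (\<eta> j)) (reval (mrep E U \<phi> \<tau>) e x0 \<eta>0) \<FF>"
proof -
  interpret coord_open n "\<phi> ` (U \<inter> W)"
    by (rule patch_open[OF p])
  have atom: "clim n (\<phi> ` (U \<inter> W)) m (\<lambda>j s y. mrep E U \<phi> \<tau> (L (f j)) y) (\<lambda>s y. mrep E U \<phi> \<tau> (L l) y) \<FF>"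
    if "linear_atom L" "limitin T f l \<FF>" for L f l
    using linear_atomD(2)[OF that] p unfolding limitin_Cinf_clim by blast
  have evV: "\<forall>\<^sub>F j in \<FF>. x j \<in> V"
    using x V by (auto simp: limitin_def)
  show ?thesis
    using e
  proof (induction e)
    case (Pt L)
    then have "linear_atom L"
      by simp
    from atom[OF this x(1)] show ?case
      by (rule clim_cong[rotated 2]) auto
  next
    case (Dir i L)
    then have "linear_atom L" "i < k"
      by simp_all
    from atom[OF this(1) \<eta>[OF this(2)]] show ?case
      by (rule clim_cong[rotated 2]) auto
  next
    case (Sc c)
    then have "continuous_on {0..1} (\<lambda>s. if i = j then c s else 0)" for i j :: 'r
      by (cases "i = j") auto
    then have "continuous_on {0..1} (\<lambda>s. mat (c s) :: 'r cmat)"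
      unfolding mat_def by (intro continuous_on_vec_lambda)
    then show ?case
      using clim_const_fun by simp
  next
    case (Cst v)
    then show ?case
      using Herm_sections_clim[OF _ p] by simp
  next
    case (Plus a b)
    then show ?case
      using clim_add by simp
  next
    case (Times a b)
    then show ?case
      using matrix_mult.clim_bilinear[OF coord_open_axioms] by simp
  next
    case (Inv a)
    have "\<forall>\<^sub>F j in \<FF>. \<forall>s\<in>{0..1}. \<forall>y\<in>\<phi> ` (U \<inter> W). invertible (reval (mrep E U \<phi> \<tau>) a (x j) (\<eta> j) s y)"
      using evV by eventually_elim (use Inv.prems(2) p in simp)
    moreover have "invertible (reval (mrep E U \<phi> \<tau>) a x0 \<eta>0 s y)" if "s \<in> {0..1}" "y \<in> \<phi> ` (U \<inter> W)" for s y
      using Inv.prems(2) p x(2) that by simp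
    ultimately show ?case
      using clim_matrix_inv[of m "\<lambda>j. reval (mrep E U \<phi> \<tau>) a (x j) (\<eta> j)" "reval (mrep E U \<phi> \<tau>) a x0 \<eta>0" \<FF>] Inv
      by simp
  qed
qed

lemma line_in_open:
  assumes "openin T V" "x \<in> V" "v \<in> topspace T"
  shows "\<forall>\<^sub>F t in at 0. x + t *\<^sub>R v \<in> V"
  using T_line[of x v] assms openin_subset[OF assms(1)] by (auto simp: limitin_def)

lemma topspace_const_limit: "v \<in> topspace T \<Longrightarrow> limitin T (\<lambda>_. v) v \<FF>"
  by (auto simp: limitin_def)

text \<open>Convergence holds with all derivatives along \<open>M\<close> and uniformly in s, so it
  survives integration. Products are split with one factor at the moving and the other at the fixed
  point; for inverses the quotient is rewritten by A^-1 - B^-1 = -A^-1 (A - B) B^-1.\<close>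

lemma reval_difference_quotient:
  assumes V: "openin T V" and p: "patch U \<phi> W \<tau>"
    and e: "wf_ratex e" "defined_on V e" "dirs_below k e"
    and x: "x \<in> V" and v: "v \<in> topspace T" and \<eta>: "\<And>i. i < k \<Longrightarrow> \<eta> i \<in> topspace T" and \<eta>k: "\<eta> k = v"
  shows "clim n (\<phi> ` (U \<inter> W)) m
    (\<lambda>t s y. (reval (mrep E U \<phi> \<tau>) e (x + t *\<^sub>R v) \<eta> s y - reval (mrep E U \<phi> \<tau>) e x \<eta> s y) /\<^sub>R t)
    (reval (mrep E U \<phi> \<tau>) (rderiv k e) x \<eta>) (at 0)"
proof -
  interpret coord_open n "\<phi> ` (U \<inter> W)"
    by (rule patch_open[OF p])
  let ?W = "\<phi> ` (U \<inter> W)"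
  let ?R = "reval (mrep E U \<phi> \<tau>)"
  have xT: "x \<in> topspace T"
    using openin_subset[OF V] x by blast
  have moving: "clim n ?W m (\<lambda>t. ?R a (x + t *\<^sub>R v) \<eta>) (?R a x \<eta>) (at 0)"
    if "wf_ratex a" "defined_on V a" "dirs_below k a" for a
    by (rule reval_clim[OF V p that T_line[OF xT v] x topspace_const_limit[OF \<eta>]])
  have fixed: "clim n ?W m (\<lambda>t. ?R a x \<eta>) (?R a x \<eta>) (at 0)"
    if "wf_ratex a" "defined_on V a" "dirs_below k a" for a
    by (rule reval_clim[OF V p that topspace_const_limit[OF xT] x topspace_const_limit[OF \<eta>]])
  have nz: "\<forall>\<^sub>F t::real in at 0. t \<noteq> 0"
    by (simp add: eventually_at_filter)
  have zero: "clim n ?W m (\<lambda>_ _ _. 0 :: 'r cmat) (\<lambda>_ _. 0) (at (0::real))"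
    by (rule clim_const_fun) simp
  have mat0: "mat 0 = (0 :: 'r cmat)"
    by (simp add: mat_def vec_eq_iff)
  show ?thesis
    using e
  proof (induction e)
    case (Pt L)
    then have L: "linear_atom L" by simp
    have "clim n ?W m (\<lambda>t s y. mrep E U \<phi> \<tau> (L v) y) (\<lambda>s y. mrep E U \<phi> \<tau> (L v) y) (at (0::real))"
      by (rule Herm_sections_clim[OF linear_atomD(1)[OF L v] p])
    then show ?case
    proof (rule clim_cong[rotated 2])
      show "\<forall>\<^sub>F t in at 0. \<forall>s\<in>{0..1}. \<forall>y\<in>?W. mrep E U \<phi> \<tau> (L v) y = (?R (Pt L) (x + t *\<^sub>R v) \<eta> s y - ?R (Pt L) x \<eta> s y) /\<^sub>R t"
        using nz by eventually_elim (simp add: linear_atomD(3)[OF L xT v] mrep_add mrep_scaleR)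
    qed (simp add: \<eta>k)
  next
    case (Dir j L)
    show ?case using zero by (simp add: mat0)
  next
    case (Sc c)
    show ?case using zero by (simp add: mat0)
  next
    case (Cst v)
    show ?case using zero by (simp add: mat0)
  next
    case (Plus a b)
    then show ?case
      using clim_add[of m "\<lambda>t s y. (?R a (x + t *\<^sub>R v) \<eta> s y - ?R a x \<eta> s y) /\<^sub>R t" "?R (rderiv k a) x \<eta>" "at 0"
          "\<lambda>t s y. (?R b (x + t *\<^sub>R v) \<eta> s y - ?R b x \<eta> s y) /\<^sub>R t" "?R (rderiv k b) x \<eta>"]
      by (simp add: algebra_simps)
  next
    case (Times a b)
    let ?D = "\<lambda>a t s y. (?R a (x + t *\<^sub>R v) \<eta> s y - ?R a x \<eta> s y) /\<^sub>R t"
    have "clim n ?W m (\<lambda>t s y. ?D a t s y ** ?R b (x + t *\<^sub>R v) \<eta> s y + ?R a x \<eta> s y ** ?D b t s y)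
        (\<lambda>s y. ?R (rderiv k a) x \<eta> s y ** ?R b x \<eta> s y + ?R a x \<eta> s y ** ?R (rderiv k b) x \<eta> s y) (at 0)"
      using Times by (intro clim_add matrix_mult.clim_bilinear[OF coord_open_axioms] moving fixed) simp_all
    moreover have "?D a t s y ** ?R b (x + t *\<^sub>R v) \<eta> s y + ?R a x \<eta> s y ** ?D b t s y = ?D (Times a b) t s y" for t s y
      by (simp only: matrix_mult.scaleR_left matrix_mult.scaleR_right matrix_mult.diff_left matrix_mult.diff_right
          reval.simps) (simp add: algebra_simps)
    ultimately show ?case
      by simp
  next
    case (Inv a)
    let ?D = "\<lambda>a t s y. (?R a (x + t *\<^sub>R v) \<eta> s y - ?R a x \<eta> s y) /\<^sub>R t"
    have "clim n ?W m (\<lambda>t s y. - (?R (Inv a) (x + t *\<^sub>R v) \<eta> s y ** (?D a t s y ** ?R (Inv a) x \<eta> s y)))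
        (\<lambda>s y. - (?R (Inv a) x \<eta> s y ** (?R (rderiv k a) x \<eta> s y ** ?R (Inv a) x \<eta> s y))) (at 0)"
      using Inv
      by (intro clim_linear[OF bounded_linear_minus[OF bounded_linear_ident]]
          matrix_mult.clim_bilinear[OF coord_open_axioms] moving fixed) simp_all
    then show ?case
    proof (rule clim_cong[rotated 2])
      have "mat (- 1) ** A = - (A :: 'r cmat)" for A
        by (simp add: vec_eq_iff mat_mult_nth)
      then show "- (?R (Inv a) x \<eta> s y ** (?R (rderiv k a) x \<eta> s y ** ?R (Inv a) x \<eta> s y)) = ?R (rderiv k (Inv a)) x \<eta> s y" for s y
        by simp
      show "\<forall>\<^sub>F t in at 0. \<forall>s\<in>{0..1}. \<forall>y\<in>?W.
          - (?R (Inv a) (x + t *\<^sub>R v) \<eta> s y ** (?D a t s y ** ?R (Inv a) x \<eta> s y)) = ?D (Inv a) t s y"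
        using line_in_open[OF V x v]
      proof eventually_elim
        case (elim t)
        show ?case
        proof (intro ballI)
          fix s :: real and y assume sy: "s \<in> {0..1}" "y \<in> ?W"
          let ?A = "?R a (x + t *\<^sub>R v) \<eta> s y" and ?B = "?R a x \<eta> s y"
          have i: "invertible ?A" "invertible ?B"
            using Inv.prems(2) p sy elim x by auto
          have "matrix_inv ?A ** ((?A - ?B) ** matrix_inv ?B) = matrix_inv ?B - matrix_inv ?A"
            using i by (simp add: matrix_mult.diff_left matrix_mult.diff_right)
          then show "- (?R (Inv a) (x + t *\<^sub>R v) \<eta> s y ** (?D a t s y ** ?R (Inv a) x \<eta> s y)) = ?D (Inv a) t s y"
            by (simp only: matrix_mult.scaleR_left matrix_mult.scaleR_right reval.simps) (simp add: algebra_simps)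
        qed
      qed
    qed
  qed
qed

section \<open>Michal-Bastiani derivatives of represented maps\<close>

definition represents :: "'a set \<Rightarrow> ('a, ('m, 'v) form_section) ratex \<Rightarrow> ('a \<Rightarrow> ('m, 'v) form_section) \<Rightarrow> bool" where
  "represents V e f \<longleftrightarrow> openin T V \<and> wf_ratex e \<and> defined_on V e \<and> dirs_below 0 e \<and>
     (\<forall>x\<in>V. f x \<in> \<Gamma> \<and> (\<forall>U \<phi> W \<tau> y. patch U \<phi> W \<tau> \<longrightarrow> y \<in> \<phi> ` (U \<inter> W) \<longrightarrow>
        mrep E U \<phi> \<tau> (f x) y = integral {0..1} (\<lambda>s. reval (mrep E U \<phi> \<tau>) e x (\<lambda>_. 0) s y)))"

text \<open>\<open>mb_iter\<close> puts the newest direction at the head of the list. Reversal gives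
  the j-th differentiation the number j, so that adding a direction leaves the numbers of the old
  ones unchanged.\<close>

definition dirs_env :: "'a list \<Rightarrow> nat \<Rightarrow> 'a" where
  "dirs_env vs j = (if j < length vs then rev vs ! j else 0)"

lemma dirs_env_mem: "set vs \<subseteq> topspace T \<Longrightarrow> j < length vs \<Longrightarrow> dirs_env vs j \<in> topspace T"
  unfolding dirs_env_def by (metis (full_types) length_rev nth_mem set_rev subsetD)

lemma dirs_env_Cons: "dirs_env (v # vs) (length vs) = v" "j < length vs \<Longrightarrow> dirs_env (v # vs) j = dirs_env vs j"
  by (simp_all add: dirs_env_def nth_append)

text \<open>F stands for an iterated derivative of which only the integral formula is known, so that
  the lemma can be iterated. The difference quotients converge in every patch by
  \<open>reval_difference_quotient\<close> and \<open>clim_integral\<close>;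
  \<open>Cinf_complete\<close> turns the local limits into a section.\<close>

lemma expression_derivative:
  assumes V: "openin T V" and e: "wf_ratex e" "defined_on V e" "dirs_below 0 e"
    and vs: "set vs \<subseteq> topspace T" and v: "v \<in> topspace T" and x: "x \<in> V"
    and F: "\<And>x. x \<in> V \<Longrightarrow> F x \<in> \<Gamma>"
    and rep: "\<And>x U \<phi> W \<tau> y. x \<in> V \<Longrightarrow> patch U \<phi> W \<tau> \<Longrightarrow> y \<in> \<phi> ` (U \<inter> W) \<Longrightarrow>
      mrep E U \<phi> \<tau> (F x) y = integral {0..1} (\<lambda>s. reval (mrep E U \<phi> \<tau>) (rderivs (length vs) e) x (dirs_env vs) s y)"
  obtains d where "has_mb_deriv \<X> F x v d"
    "\<And>U \<phi> W \<tau> y. patch U \<phi> W \<tau> \<Longrightarrow> y \<in> \<phi> ` (U \<inter> W) \<Longrightarrow>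
      mrep E U \<phi> \<tau> d y = integral {0..1} (\<lambda>s. reval (mrep E U \<phi> \<tau>) (rderivs (length (v # vs)) e) x (dirs_env (v # vs)) s y)"
proof -
  define k where "k = length vs"
  define e' where "e' = rderivs k e"
  define \<eta> where "\<eta> = dirs_env (v # vs)"
  have e': "wf_ratex e'" "defined_on V e'" "dirs_below k e'"
    using e by (auto simp: e'_def intro: wf_ratex_rderivs defined_on_rderivs dirs_below_rderivs)
  have \<eta>: "\<eta> i \<in> topspace T" if "i < k" for i
    using dirs_env_mem[of "v # vs" i] vs v that by (auto simp: \<eta>_def k_def)
  have \<eta>k: "\<eta> k = v"
    by (simp add: \<eta>_def k_def dirs_env_Cons)
  have rep': "mrep E U \<phi> \<tau> (F z) y = integral {0..1} (\<lambda>s. reval (mrep E U \<phi> \<tau>) e' z \<eta> s y)"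
    if "z \<in> V" "patch U \<phi> W \<tau>" "y \<in> \<phi> ` (U \<inter> W)" for z U \<phi> W \<tau> y
  proof -
    have "reval (mrep E U \<phi> \<tau>) e' z (dirs_env vs) s y = reval (mrep E U \<phi> \<tau>) e' z \<eta> s y" for s
      by (rule reval_cong[OF e'(3)]) (simp add: \<eta>_def k_def dirs_env_Cons)
    then show ?thesis
      using rep[OF that] by (simp add: e'_def k_def)
  qed
  have evV: "\<forall>\<^sub>F t in at 0. x + t *\<^sub>R v \<in> V"
    by (rule line_in_open[OF V x v])
  have ev: "\<forall>\<^sub>F t in at 0. (F (x + t *\<^sub>R v) - F x) /\<^sub>R t \<in> \<Gamma>"
    using evV by eventually_elim (intro Herm_sections_scaleR Herm_sections_linear(2) F x)
  have lim: "clim n (\<phi> ` (U \<inter> W)) m (\<lambda>t _. mrep E U \<phi> \<tau> ((F (x + t *\<^sub>R v) - F x) /\<^sub>R t))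
      (\<lambda>_ y. integral {0..1} (\<lambda>s. reval (mrep E U \<phi> \<tau>) (rderiv k e') x \<eta> s y)) (at 0)"
    if p: "patch U \<phi> W \<tau>" for U \<phi> W \<tau> m
  proof -
    interpret coord_open n "\<phi> ` (U \<inter> W)"
      by (rule patch_open[OF p])
    let ?R = "reval (mrep E U \<phi> \<tau>)"
    have int: "(\<lambda>s. ?R e' z \<eta> s y) integrable_on {0..1}" if "z \<in> V" "y \<in> \<phi> ` (U \<inter> W)" for z y
    proof -
      have "z \<in> topspace T"
        using openin_subset[OF V] that(1) by blast
      then have "clim n (\<phi> ` (U \<inter> W)) 0 (\<lambda>_::unit. ?R e' z \<eta>) (?R e' z \<eta>) bot"
        by (rule reval_clim[OF V p e' topspace_const_limit that(1) topspace_const_limit[OF \<eta>]])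
      then have "jcont (\<phi> ` (U \<inter> W)) (?R e' z \<eta>)"
        by (simp add: lulim_def)
      then show ?thesis
        using jcont_fiber[OF _ that(2)] integrable_continuous_real by blast
    qed
    have "clim n (\<phi> ` (U \<inter> W)) m
        (\<lambda>t _ y. integral {0..1} (\<lambda>s. (?R e' (x + t *\<^sub>R v) \<eta> s y - ?R e' x \<eta> s y) /\<^sub>R t))
        (\<lambda>_ y. integral {0..1} (\<lambda>s. ?R (rderiv k e') x \<eta> s y)) (at 0)"
      by (rule clim_integral[OF reval_difference_quotient[where \<eta> = \<eta> and k = k, OF V p e' x v \<eta> \<eta>k]])
    then show ?thesis
    proof (rule clim_cong[rotated 2])
      show "\<forall>\<^sub>F t in at 0. \<forall>s\<in>{0..1}. \<forall>y\<in>\<phi> ` (U \<inter> W).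
          integral {0..1} (\<lambda>s. (?R e' (x + t *\<^sub>R v) \<eta> s y - ?R e' x \<eta> s y) /\<^sub>R t)
          = mrep E U \<phi> \<tau> ((F (x + t *\<^sub>R v) - F x) /\<^sub>R t) y"
        using evV
      proof eventually_elim
        case (elim t)
        then show ?case
          by (simp add: mrep_diff mrep_scaleR rep'[OF _ p] x int Henstock_Kurzweil_Integration.integral_diff)
      qed
    qed simp
  qed
  obtain d where "limitin \<X> (\<lambda>t. (F (x + t *\<^sub>R v) - F x) /\<^sub>R t) d (at 0)"
    "\<And>U \<phi> W \<tau> y. patch U \<phi> W \<tau> \<Longrightarrow> y \<in> \<phi> ` (U \<inter> W) \<Longrightarrow>
      mrep E U \<phi> \<tau> d y = integral {0..1} (\<lambda>s. reval (mrep E U \<phi> \<tau>) (rderiv k e') x \<eta> s y)"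
  proof (rule Cinf_complete[OF ev at_neq_bot lim], goal_cases)
    case (2 l)
    show ?case
      by (rule 2(1)[OF 2(2,3)])
  qed
  then show thesis
    by (intro that[of d]) (auto simp: has_mb_deriv_def e'_def k_def \<eta>_def)
qed

lemma has_mb_deriv_unique:
  fixes f :: "'b::real_vector \<Rightarrow> ('m, 'v) form_section"
  shows "has_mb_deriv \<X> f x v d \<Longrightarrow> has_mb_deriv \<X> f x v d' \<Longrightarrow> d = d'"
  unfolding has_mb_deriv_def by (rule limitin_Cinf_unique, assumption, assumption, rule at_neq_bot)

lemma mb_deriv_eqI:
  fixes f :: "'b::real_vector \<Rightarrow> ('m, 'v) form_section"
  assumes "has_mb_deriv \<X> f x v d"
  shows "mb_deriv \<X> f x v = d"
  unfolding mb_deriv_def by (rule the_equality[where P = "\<lambda>d. has_mb_deriv \<X> f x v d", OF assms]) (rule has_mb_deriv_unique[OF _ assms])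

lemma represents_mb_iter:
  assumes r: "represents V e f" and "set vs \<subseteq> topspace T"
  shows "\<forall>x\<in>V. mb_iter \<X> f vs x \<in> \<Gamma> \<and> (\<forall>U \<phi> W \<tau> y. patch U \<phi> W \<tau> \<longrightarrow> y \<in> \<phi> ` (U \<inter> W) \<longrightarrow>
    mrep E U \<phi> \<tau> (mb_iter \<X> f vs x) y =
      integral {0..1} (\<lambda>s. reval (mrep E U \<phi> \<tau>) (rderivs (length vs) e) x (dirs_env vs) s y))"
  using assms(2)
proof (induction vs)
  case Nil
  have "dirs_env [] = (\<lambda>_. 0)"
    by (auto simp: dirs_env_def)
  with r show ?case
    by (simp add: represents_def)
next
  case (Cons v vs)
  have V: "openin T V" and e: "wf_ratex e" "defined_on V e" "dirs_below 0 e"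
    using r by (auto simp: represents_def)
  have vs: "set vs \<subseteq> topspace T" and v: "v \<in> topspace T"
    using Cons.prems by auto
  show ?case
  proof
    fix x assume x: "x \<in> V"
    obtain d where d: "has_mb_deriv \<X> (mb_iter \<X> f vs) x v d"
      "\<And>U \<phi> W \<tau> y. patch U \<phi> W \<tau> \<Longrightarrow> y \<in> \<phi> ` (U \<inter> W) \<Longrightarrow>
      mrep E U \<phi> \<tau> d y = integral {0..1} (\<lambda>s. reval (mrep E U \<phi> \<tau>) (rderivs (length (v # vs)) e) x (dirs_env (v # vs)) s y)"
      by (rule expression_derivative[OF V e vs v x, of "mb_iter \<X> f vs"]) (use Cons.IH vs in auto)
    have "mb_iter \<X> f (v # vs) x = d"
      using mb_deriv_eqI[OF d(1)] by simp
    moreover have "d \<in> \<Gamma>"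
      using d(1) by (simp add: has_mb_deriv_def limitin_Cinf_clim)
    ultimately show "mb_iter \<X> f (v # vs) x \<in> \<Gamma> \<and> (\<forall>U \<phi> W \<tau> y. patch U \<phi> W \<tau> \<longrightarrow> y \<in> \<phi> ` (U \<inter> W) \<longrightarrow>
        mrep E U \<phi> \<tau> (mb_iter \<X> f (v # vs) x) y =
          integral {0..1} (\<lambda>s. reval (mrep E U \<phi> \<tau>) (rderivs (length (v # vs)) e) x (dirs_env (v # vs)) s y))"
      using d(2) by simp
  qed
qed

lemma represents_continuous:
  assumes r: "represents V e f" and x: "limitin T x x0 \<FF>" "x0 \<in> V"
    and v: "\<And>i. i < k \<Longrightarrow> limitin T (\<lambda>j. v j i) (v0 i) \<FF>"
    and ev: "\<forall>\<^sub>F j in \<FF>. \<forall>i<k. v j i \<in> topspace T" and v0: "\<And>i. i < k \<Longrightarrow> v0 i \<in> topspace T"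
  shows "limitin \<X> (\<lambda>j. mb_iter \<X> f (map (v j) [0..<k]) (x j)) (mb_iter \<X> f (map v0 [0..<k]) x0) \<FF>"
proof -
  have V: "openin T V" and e: "wf_ratex e" "defined_on V e" "dirs_below 0 e"
    using r by (auto simp: represents_def)
  let ?ev = "\<lambda>w. dirs_env (map w [0..<k])"
  \<comment> \<open>\<open>dirs_env\<close> reverses its list, so number i picks the direction with
    index k - 1 - i.\<close>
  have envd: "?ev w i = w (k - 1 - i)" if "i < k" for w i
    using that by (simp add: dirs_env_def rev_nth)
  have evV: "\<forall>\<^sub>F j in \<FF>. x j \<in> V"
    using x V by (auto simp: limitin_def)
  have rep: "mb_iter \<X> f (map w [0..<k]) z \<in> \<Gamma> \<and> (\<forall>U \<phi> W \<tau> y. patch U \<phi> W \<tau> \<longrightarrow> y \<in> \<phi> ` (U \<inter> W) \<longrightarrow>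
    mrep E U \<phi> \<tau> (mb_iter \<X> f (map w [0..<k]) z) y =
      integral {0..1} (\<lambda>s. reval (mrep E U \<phi> \<tau>) (rderivs k e) z (?ev w) s y))"
    if z: "z \<in> V" and w: "\<forall>i<k. w i \<in> topspace T" for z w
  proof -
    have "set (map w [0..<k]) \<subseteq> topspace T"
      using w by auto
    from represents_mb_iter[OF r this] z show ?thesis
      by simp
  qed
  show ?thesis
    unfolding limitin_Cinf_clim
  proof (intro conjI allI impI)
    show "mb_iter \<X> f (map v0 [0..<k]) x0 \<in> \<Gamma>"
      using rep[OF x(2)] v0 by blast
    show "\<forall>\<^sub>F j in \<FF>. mb_iter \<X> f (map (v j) [0..<k]) (x j) \<in> \<Gamma>"
      using ev evV by eventually_elim (use rep in blast)
    fix U \<phi> W \<tau> m assume p: "patch U \<phi> W \<tau>"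
    interpret coord_open n "\<phi> ` (U \<inter> W)"
      by (rule patch_open[OF p])
    let ?R = "reval (mrep E U \<phi> \<tau>) (rderivs k e)"
    have "clim n (\<phi> ` (U \<inter> W)) m (\<lambda>j. ?R (x j) (?ev (v j))) (?R x0 (?ev v0)) \<FF>"
    proof (rule reval_clim[OF V p _ _ _ x])
      show "dirs_below k (rderivs k e)"
        by (rule dirs_below_rderivs[OF e(3)])
      show "limitin T (\<lambda>j. ?ev (v j) i) (?ev v0 i) \<FF>" if "i < k" for i
        using v[of "k - 1 - i"] that by (simp add: envd)
    qed (use e in \<open>auto intro: wf_ratex_rderivs defined_on_rderivs\<close>)
    from clim_integral[OF this]
    show "clim n (\<phi> ` (U \<inter> W)) m (\<lambda>j _. mrep E U \<phi> \<tau> (mb_iter \<X> f (map (v j) [0..<k]) (x j)))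
        (\<lambda>_. mrep E U \<phi> \<tau> (mb_iter \<X> f (map v0 [0..<k]) x0)) \<FF>"
    proof (rule clim_cong[rotated 2])
      show "\<forall>\<^sub>F j in \<FF>. \<forall>s\<in>{0..1}. \<forall>y\<in>\<phi> ` (U \<inter> W). integral {0..1} (\<lambda>s. ?R (x j) (?ev (v j)) s y)
          = mrep E U \<phi> \<tau> (mb_iter \<X> f (map (v j) [0..<k]) (x j)) y"
        using ev evV by eventually_elim (use rep p in auto)
      show "integral {0..1} (\<lambda>s. ?R x0 (?ev v0) s y) = mrep E U \<phi> \<tau> (mb_iter \<X> f (map v0 [0..<k]) x0) y"
        if "y \<in> \<phi> ` (U \<inter> W)" for y
        using rep[OF x(2)] v0 p that by auto
    qed
  qed
qed

text \<open>Derivatives at a point see the map only on a neighborhood, so the expression and its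
  open domain V may vary from point to point. This matters because the integration circle depends on
  the point.\<close>

theorem mb_smooth_represents:
  assumes U: "U \<subseteq> topspace T" and f: "\<And>x. x \<in> U \<Longrightarrow> f x \<in> \<Gamma>"
    and loc: "\<And>x. x \<in> U \<Longrightarrow> \<exists>V e. x \<in> V \<and> represents V e f"
  shows "mb_smooth T \<X> U f"
  unfolding mb_smooth_def
proof (intro conjI allI impI ballI)
  show "f \<in> U \<rightarrow> topspace \<X>"
    using f by (simp add: topspace_Cinf)
  fix vs x v assume vs: "set vs \<subseteq> topspace T" and x: "x \<in> U" and v: "v \<in> topspace T"
  obtain V e where V: "x \<in> V" and r: "represents V e f"
    using loc[OF x] by blast
  then have "openin T V" "wf_ratex e" "defined_on V e" "dirs_below 0 e"
    by (auto simp: represents_def)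
  then obtain d where "has_mb_deriv \<X> (mb_iter \<X> f vs) x v d"
    by (rule expression_derivative[OF _ _ _ _ vs v V, of e "mb_iter \<X> f vs"])
      (use represents_mb_iter[OF r vs] in auto)
  then show "\<exists>d. has_mb_deriv \<X> (mb_iter \<X> f vs) x v d"
    by blast
next
  fix k :: nat
  let ?P = "prod_topology (subtopology T U) (product_topology (\<lambda>_. T) {..<k})"
  show "continuous_map ?P \<X> (\<lambda>(x, v). mb_iter \<X> f (map v [0..<k]) x)"
    unfolding continuous_map_atin
  proof
    fix z assume z: "z \<in> topspace ?P"
    have PD: "fst p \<in> U \<and> (\<forall>i<k. snd p i \<in> topspace T)" if "p \<in> topspace ?P" for p
      using that unfolding topspace_prod_topology topspace_product_topology mem_Times_iff by (auto simp: PiE_iff)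
    from PD[OF z] have zU: "fst z \<in> U" and zv: "\<And>i. i < k \<Longrightarrow> snd z i \<in> topspace T"
      by blast+
    obtain V e where V: "fst z \<in> V" and r: "represents V e f"
      using loc[OF zU] by blast
    have "continuous_map ?P T fst"
      using continuous_map_fst continuous_map_into_fulltopology by blast
    then have l1: "limitin T fst (fst z) (atin ?P z)"
      using z unfolding continuous_map_atin by blast
    have l2: "limitin T (\<lambda>p. snd p i) (snd z i) (atin ?P z)" if "i < k" for i
    proof -
      have "continuous_map ?P T ((\<lambda>w. w i) \<circ> snd)"
        using that by (intro continuous_map_compose[OF continuous_map_snd continuous_map_product_projection]) auto
      then show ?thesis
        using z unfolding continuous_map_atin comp_def by blast
    qed
    have "\<forall>\<^sub>F p in atin ?P z. p \<in> topspace ?P"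
      unfolding eventually_atin using z openin_topspace[of ?P] by blast
    then have ev: "\<forall>\<^sub>F p in atin ?P z. \<forall>i<k. snd p i \<in> topspace T"
      by eventually_elim (use PD in blast)
    have "limitin \<X> (\<lambda>p. mb_iter \<X> f (map (snd p) [0..<k]) (fst p))
        (mb_iter \<X> f (map (snd z) [0..<k]) (fst z)) (atin ?P z)"
      by (rule represents_continuous[where x = fst and v = snd, OF r l1 V]) (use l2 ev zv in blast)+
    then show "limitin \<X> (\<lambda>(x, v). mb_iter \<X> f (map v [0..<k]) x)
        ((\<lambda>(x, v). mb_iter \<X> f (map v [0..<k]) x) z) (atin ?P z)"
      unfolding case_prod_unfold .
  qed
qed

end

section \<open>Functional calculus on sections\<close>

context herm_bundle
begin

definition triv_at :: "'m \<Rightarrow> 'm \<Rightarrow> 'v \<Rightarrow> complex ^ 'r" where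
  "triv_at x = (SOME \<tau>. \<exists>W. (W, \<tau>) \<in> trivs E \<and> x \<in> W)"

lemma trivialized_triv_at: "trivialized E (triv_at x) x"
proof -
  have "\<exists>\<tau> W. (W, \<tau>) \<in> trivs E \<and> x \<in> W"
    using triv_cover by blast
  then have "\<exists>W. (W, triv_at x) \<in> trivs E \<and> x \<in> W"
    unfolding triv_at_def by (rule someI_ex)
  then show ?thesis
    using trivialized by blast
qed

lemma change_triv_at:
  assumes "(W, \<tau>) \<in> trivs E" "x \<in> W"
  obtains S :: "'r cmat" where "invertible S"
    "\<And>v. v \<in> herm_form E x \<Longrightarrow> fmat E \<tau> x v = S ** fmat E (triv_at x) x v ** adj S"
  using fmat_change[OF trivialized_triv_at trivialized[OF assms]] by metis

text \<open>The trivialization at x is an arbitrary choice with no regularity in x; by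
  \<open>fmat_hsec\<close> any other one gives the same form.\<close>

definition hsec :: "(real \<Rightarrow> real) \<Rightarrow> ('m, 'v) form_section \<Rightarrow> ('m, 'v) form_section \<Rightarrow> ('m, 'v) form_section" where
  "hsec f h k x = mform E (triv_at x) x (hfun f (fmat E (triv_at x) x (h x)) (fmat E (triv_at x) x (k x)))"

lemma fmat_posdef:
  assumes "h \<in> \<Gamma>p" "trivialized E \<tau> x"
  shows "posdef (fmat E \<tau> x (h x))"
  using trivialized.posdef_fmat_iff[OF assms(2)] pos_Herm_sectionsD[OF assms(1)]
  by (metis (no_types, lifting) mem_Collect_eq pos_herm_form_def)

lemma fmat_herm: "v \<in> \<Gamma> \<Longrightarrow> trivialized E \<tau> x \<Longrightarrow> adj (fmat E \<tau> x (v x)) = fmat E \<tau> x (v x)"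
  by (rule trivialized.fmat_hermitian) (auto dest: Herm_sectionsD)

lemma hsec_herm:
  assumes "h \<in> \<Gamma>p" "k \<in> \<Gamma>"
  shows "hsec f h k x \<in> herm_form E x"
  unfolding hsec_def
  by (intro trivialized.mform_herm[OF trivialized_triv_at] hfun_hermitian fmat_posdef fmat_herm trivialized_triv_at assms)

lemma fmat_hsec:
  assumes h: "h \<in> \<Gamma>p" and k: "k \<in> \<Gamma>" and W: "(W, \<tau>) \<in> trivs E" "x \<in> W"
  shows "fmat E \<tau> x (hsec f h k x) = hfun f (fmat E \<tau> x (h x)) (fmat E \<tau> x (k x))"
proof -
  obtain S where S: "invertible S"
    "\<And>v. v \<in> herm_form E x \<Longrightarrow> fmat E \<tau> x v = S ** fmat E (triv_at x) x v ** adj S"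
    using change_triv_at[OF W] by metis
  have "h x \<in> herm_form E x" "k x \<in> herm_form E x"
    using h k Herm_sectionsD pos_Herm_sections_subset by auto
  then have "hfun f (fmat E \<tau> x (h x)) (fmat E \<tau> x (k x)) = S ** fmat E (triv_at x) x (hsec f h k x) ** adj S"
    using hfun_congr[OF fmat_posdef[OF h trivialized_triv_at] fmat_herm[OF k trivialized_triv_at] S(1)]
    by (simp add: S(2) hsec_def trivialized.fmat_mform[OF trivialized_triv_at])
  then show ?thesis
    using S(2)[OF hsec_herm[OF h k]] by simp
qed

lemma mrep_hsec:
  assumes "h \<in> \<Gamma>p" "k \<in> \<Gamma>" and p: "patch U \<phi> W \<tau>" "y \<in> \<phi> ` (U \<inter> W)"
  shows "mrep E U \<phi> \<tau> (hsec f h k) y = hfun f (mrep E U \<phi> \<tau> h y) (mrep E U \<phi> \<tau> k y)"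
  unfolding mrep_def using fmat_hsec[OF assms(1,2)] patch_points[OF p] p unfolding patch_def by blast

lemma pos_Herm_sections_line:
  assumes "h \<in> \<Gamma>p" "v \<in> \<Gamma>"
  shows "\<forall>\<^sub>F t in at 0. h + t *\<^sub>R v \<in> \<Gamma>p"
  using eventually_pos_Herm_sections[OF limitin_Cinf_line[OF _ assms(2)] assms(1)] assms(1) pos_Herm_sections_subset
  by blast

lemma pos_Herm_sections_scaleR:
  assumes "h \<in> \<Gamma>p" "0 < r"
  shows "r *\<^sub>R h \<in> \<Gamma>p"
proof -
  have "r *\<^sub>R h \<in> \<Gamma>"
    using assms(1) pos_Herm_sections_subset by (blast intro: Herm_sections_scaleR)
  moreover have "(r *\<^sub>R h) x \<in> pos_herm_form E x" for x
    using pos_Herm_sectionsD[OF assms(1), of x] Herm_sectionsD[OF \<open>r *\<^sub>R h \<in> \<Gamma>\<close>, of x] assms(2)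
    unfolding pos_herm_form_def by simp
  ultimately show ?thesis
    by (simp add: pos_Herm_sections_def)
qed

text \<open>The whole interval of admissible s is kept, so that two such bounds can be combined by
  their minimum.\<close>

lemma small_line_posdef:
  assumes "h \<in> \<Gamma>p" "v \<in> \<Gamma>"
  obtains t where "0 < t" "t < 1" "\<And>s. 0 < s \<Longrightarrow> s \<le> t \<Longrightarrow> h + s *\<^sub>R v \<in> \<Gamma>p"
proof -
  obtain d where d: "d > 0" "\<And>t. t \<noteq> 0 \<Longrightarrow> dist t 0 < d \<Longrightarrow> h + t *\<^sub>R v \<in> \<Gamma>p"
    using pos_Herm_sections_line[OF assms] unfolding eventually_at by auto
  show thesis
    by (rule that[of "min (d / 2) (1 / 2)"]) (use d in auto)
qed

end

section \<open>Smoothness of the exponential and the logarithm\<close>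

context smooth_domain
begin

lemma T_ident_limit: "x \<in> topspace T \<Longrightarrow> limitin T (\<lambda>z. z) x (atin T x)"
  using continuous_map_atin[of T T "\<lambda>z. z"] by auto

lemma openin_affine_posdef:
  assumes L: "linear_atom L" and a: "a \<in> \<Gamma>"
  shows "openin T {x \<in> topspace T. a + r *\<^sub>R L x \<in> \<Gamma>p}"
proof -
  have "continuous_map T \<X> (\<lambda>x. a + r *\<^sub>R L x)"
    unfolding continuous_map_atin
    by (intro ballI limitin_Cinf_add limitin_Cinf_const a limitin_Cinf_scaleR[OF _ tendsto_const]
        linear_atomD(2)[OF L] T_ident_limit)
  from openin_continuous_map_preimage[OF this openin_pos_Herm_sections] show ?thesis .
qed

text \<open>The expression that controls the dependence on x also gives smoothness along
  \<open>M\<close>: \<open>reval_clim\<close> is used with x held fixed.\<close>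

lemma expression_section:
  assumes V: "openin T V" and e: "wf_ratex e" "defined_on V e" "dirs_below 0 e" and x: "x \<in> V"
    and herm: "\<And>z. v z \<in> herm_form E z"
    and rep: "\<And>U \<phi> W \<tau> y. patch U \<phi> W \<tau> \<Longrightarrow> y \<in> \<phi> ` (U \<inter> W) \<Longrightarrow>
      mrep E U \<phi> \<tau> v y = integral {0..1} (\<lambda>s. reval (mrep E U \<phi> \<tau>) e x (\<lambda>_. 0) s y)"
  shows "v \<in> \<Gamma>"
proof (rule Herm_sections_climI[where \<FF> = "bot :: unit filter", OF herm])
  fix U \<phi> W \<tau> m assume p: "patch U \<phi> W \<tau>"
  interpret coord_open n "\<phi> ` (U \<inter> W)"
    by (rule patch_open[OF p])
  have xT: "x \<in> topspace T"
    using openin_subset[OF V] x by blast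
  have "clim n (\<phi> ` (U \<inter> W)) m (\<lambda>_::unit. reval (mrep E U \<phi> \<tau>) e x (\<lambda>_. 0)) (reval (mrep E U \<phi> \<tau>) e x (\<lambda>_. 0)) bot"
    by (rule reval_clim[OF V p e topspace_const_limit[OF xT] x]) simp
  from clim_integral[OF this]
  have "clim n (\<phi> ` (U \<inter> W)) m (\<lambda>_::unit. \<lambda>_. mrep E U \<phi> \<tau> v) (\<lambda>_. mrep E U \<phi> \<tau> v) bot"
    by (rule clim_cong[rotated 2]) (simp_all add: rep[OF p])
  then show "\<exists>F. clim n (\<phi> ` (U \<inter> W)) m F (\<lambda>_. mrep E U \<phi> \<tau> v) (bot :: unit filter)"
    by blast
qed

lemma representsI:
  assumes "openin T V" "wf_ratex e" "defined_on V e" "dirs_below 0 e"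
    and "\<And>x z. x \<in> V \<Longrightarrow> f x z \<in> herm_form E z"
    and "\<And>x U \<phi> W \<tau> y. x \<in> V \<Longrightarrow> patch U \<phi> W \<tau> \<Longrightarrow> y \<in> \<phi> ` (U \<inter> W) \<Longrightarrow>
      mrep E U \<phi> \<tau> (f x) y = integral {0..1} (\<lambda>s. reval (mrep E U \<phi> \<tau>) e x (\<lambda>_. 0) s y)"
  shows "represents V e f"
  unfolding represents_def using assms expression_section[OF assms(1-4) _ assms(5,6)] by auto

text \<open>By \<open>hfun_circle_integral\<close> the value is the integral over s of F(z) (z - c)
  times h (zh - L x)^-1 h with z on the circle, which is a rational expression in L x. V collects
  the points whose relative spectrum lies inside the circle; two positivity conditions describe it,
  hence it is open.\<close>

lemma represents_hsec:
  assumes L: "linear_atom L" and h: "h \<in> \<Gamma>p" and \<rho>: "0 < \<rho>"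
    and F: "F holomorphic_on S" "open S" "cball (of_real c) \<rho> \<subseteq> S"
    and Ff: "\<And>x. \<bar>x - c\<bar> < \<rho> \<Longrightarrow> F (of_real x) = of_real (f x)"
  defines "V \<equiv> {x \<in> topspace T. (c + \<rho>) *\<^sub>R h - L x \<in> \<Gamma>p \<and> L x - (c - \<rho>) *\<^sub>R h \<in> \<Gamma>p}"
  assumes g: "\<And>x. x \<in> V \<Longrightarrow> g x = hsec f h (L x)"
  obtains e where "represents V e g"
proof -
  let ?z = "circlepath (complex_of_real c) \<rho>"
  define e where "e = Times (Sc (\<lambda>s. F (?z s) * (?z s - of_real c)))
    (Times (Times (Cst h) (Inv (Plus (Times (Sc ?z) (Cst h)) (Times (Sc (\<lambda>_. - 1)) (Pt L))))) (Cst h))"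
  have h\<Gamma>: "h \<in> \<Gamma>"
    using h pos_Herm_sections_subset by blast
  have "V = {x \<in> topspace T. (c + \<rho>) *\<^sub>R h + (- 1) *\<^sub>R L x \<in> \<Gamma>p} \<inter> {x \<in> topspace T. (- (c - \<rho>)) *\<^sub>R h + 1 *\<^sub>R L x \<in> \<Gamma>p}"
    by (auto simp: V_def algebra_simps)
  then have V: "openin T V"
    by (simp only:) (intro openin_Int openin_affine_posdef L Herm_sections_scaleR h\<Gamma>)
  have cz: "continuous_on {0..1} ?z"
    unfolding circlepath by (intro continuous_intros)
  have "norm (?z s - of_real c) = \<rho>" for s
    using \<rho> by (simp add: circlepath norm_mult)
  then have "?z ` {0..1} \<subseteq> S"
    using F(3) by (auto simp: dist_norm norm_minus_commute)
  then have cF: "continuous_on {0..1} (\<lambda>s. F (?z s))"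
    using continuous_on_compose2[OF holomorphic_on_imp_continuous_on[OF F(1)] cz] by blast
  have wf: "wf_ratex e"
    using L h\<Gamma> cz cF by (auto simp: e_def intro!: continuous_intros)
  have neg: "mat (- 1) ** A = - (A :: 'r cmat)" for A
    by (simp add: vec_eq_iff mat_mult_nth)
  have posV: "posdef ((c + \<rho>) *\<^sub>R mrep E U \<phi> \<tau> h y - mrep E U \<phi> \<tau> (L x) y)"
    "posdef (mrep E U \<phi> \<tau> (L x) y - (c - \<rho>) *\<^sub>R mrep E U \<phi> \<tau> h y)"
    if "x \<in> V" "patch U \<phi> W \<tau>" "y \<in> \<phi> ` (U \<inter> W)" for x U \<phi> W \<tau> y
    using mrep_posdef[OF _ that(2,3), of "(c + \<rho>) *\<^sub>R h - L x"] mrep_posdef[OF _ that(2,3), of "L x - (c - \<rho>) *\<^sub>R h"] that(1)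
    by (simp_all add: V_def mrep_diff mrep_scaleR)
  have LG: "L x \<in> \<Gamma>" if "x \<in> V" for x
    using linear_atomD(1)[OF L] that by (simp add: V_def)
  have circ: "invertible (mat (?z s) ** mrep E U \<phi> \<tau> h y - mrep E U \<phi> \<tau> (L x) y)"
    "((\<lambda>s. mat (F (?z s) * (?z s - of_real c)) ** (mrep E U \<phi> \<tau> h y **
      matrix_inv (mat (?z s) ** mrep E U \<phi> \<tau> h y - mrep E U \<phi> \<tau> (L x) y) ** mrep E U \<phi> \<tau> h y))
      has_integral hfun f (mrep E U \<phi> \<tau> h y) (mrep E U \<phi> \<tau> (L x) y)) {0..1}"
    if "x \<in> V" "patch U \<phi> W \<tau>" "y \<in> \<phi> ` (U \<inter> W)" for x U \<phi> W \<tau> y s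
    using hfun_circle_integral[OF mrep_posdef[OF h that(2,3)] mrep_hermitian[OF LG[OF that(1)] that(2,3)] posV[OF that] \<rho> F Ff]
    by blast+
  have def: "defined_on V e"
    using circ(1) by (simp add: e_def neg)
  have "represents V e g"
  proof (rule representsI[OF V wf def])
    show "dirs_below 0 e"
      by (simp add: e_def)
    show "g x z \<in> herm_form E z" if "x \<in> V" for x z
      using hsec_herm[OF h LG[OF that]] g[OF that] by simp
    show "mrep E U \<phi> \<tau> (g x) y = integral {0..1} (\<lambda>s. reval (mrep E U \<phi> \<tau>) e x (\<lambda>_. 0) s y)"
      if "x \<in> V" "patch U \<phi> W \<tau>" "y \<in> \<phi> ` (U \<inter> W)" for x U \<phi> W \<tau> y
      using circ(2)[OF that, THEN integral_unique] g[OF that(1)] mrep_hsec[OF h LG[OF that(1)] that(2,3)]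
      by (simp add: e_def neg)
  qed
  then show thesis
    by (rule that)
qed

text \<open>For small t both h + tv and h - tv are positive. Dividing by t puts v between -(1/t) h
  and (1/t) h on all of \<open>M\<close>.\<close>

lemma exp_domain:
  assumes h: "h \<in> \<Gamma>p" and v: "v \<in> \<Gamma>"
  obtains R where "0 < R" "R *\<^sub>R h - v \<in> \<Gamma>p" "v - (- R) *\<^sub>R h \<in> \<Gamma>p"
proof -
  obtain t1 where t1: "0 < t1" "\<And>s. 0 < s \<Longrightarrow> s \<le> t1 \<Longrightarrow> h + s *\<^sub>R v \<in> \<Gamma>p"
    using small_line_posdef[OF h v] by metis
  obtain t2 where t2: "0 < t2" "\<And>s. 0 < s \<Longrightarrow> s \<le> t2 \<Longrightarrow> h + s *\<^sub>R ((- 1) *\<^sub>R v) \<in> \<Gamma>p"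
    using small_line_posdef[OF h Herm_sections_scaleR[OF v]] by metis
  define t where "t = min t1 t2"
  have t: "0 < t" "h + t *\<^sub>R v \<in> \<Gamma>p" "h + t *\<^sub>R ((- 1) *\<^sub>R v) \<in> \<Gamma>p"
    using t1 t2 by (auto simp: t_def)
  have "(1 / t) *\<^sub>R (h + t *\<^sub>R v) = v - (- (1 / t)) *\<^sub>R h" "(1 / t) *\<^sub>R (h + t *\<^sub>R ((- 1) *\<^sub>R v)) = (1 / t) *\<^sub>R h - v"
    using t(1) by (simp_all add: scaleR_add_right scaleR_diff_right)
  then show thesis
    using that[of "1 / t"] pos_Herm_sections_scaleR[OF t(2), of "1 / t"] pos_Herm_sections_scaleR[OF t(3), of "1 / t"] t(1)
    by simp
qed

text \<open>The circle is centered at 0 with a radius R adapted to the point, which is allowed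
  because exp is entire. The linear atom L covers both the exponential of a section and the curve t
  to exp of tv.\<close>

lemma mb_smooth_hsec_exp:
  assumes L: "linear_atom L" and h: "h \<in> \<Gamma>p" and g: "\<And>x. x \<in> topspace T \<Longrightarrow> g x = hsec exp h (L x)"
  shows "mb_smooth T \<X> (topspace T) g"
proof -
  have *: "\<exists>V e. x \<in> V \<and> represents V e g" if x: "x \<in> topspace T" for x
  proof -
    obtain R where R: "0 < R" "R *\<^sub>R h - L x \<in> \<Gamma>p" "L x - (- R) *\<^sub>R h \<in> \<Gamma>p"
      using exp_domain[OF h linear_atomD(1)[OF L x]] .
    define V where "V = {x \<in> topspace T. (0 + R) *\<^sub>R h - L x \<in> \<Gamma>p \<and> L x - (0 - R) *\<^sub>R h \<in> \<Gamma>p}"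
    obtain e where "represents V e g"
      unfolding V_def
      by (rule represents_hsec[OF L h R(1), of exp UNIV 0 exp g])
        (auto simp: g exp_of_real intro: holomorphic_intros)
    moreover have "x \<in> V"
      using R x by (simp add: V_def)
    ultimately show ?thesis
      by blast
  qed
  show ?thesis
  proof (rule mb_smooth_represents)
    show "g x \<in> \<Gamma>" if "x \<in> topspace T" for x
      using *[OF that] by (auto simp: represents_def)
  qed (use * in auto)
qed

end

lemma (in herm_bundle) smooth_domain_Cinf: "smooth_domain M E \<X>"
  by unfold_locales (auto simp: topspace_Cinf intro: Herm_sections_linear(1) Herm_sections_scaleR limitin_Cinf_line)

lemma (in herm_bundle) smooth_domain_real: "smooth_domain M E euclideanreal"
  by unfold_locales (auto simp: limitin_canonical_iff intro!: tendsto_eq_intros)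

lemma (in herm_bundle) smooth_domain_prod:
  assumes "smooth_domain M E (X1 :: 'b::real_vector topology)" "smooth_domain M E (X2 :: 'c::real_vector topology)"
  shows "smooth_domain M E (prod_topology X1 X2)"
proof -
  interpret s1: smooth_domain M E X1 by fact
  interpret s2: smooth_domain M E X2 by fact
  show ?thesis
    by unfold_locales
      (auto simp: limitin_pairwise comp_def s1.T_line_mem s2.T_line_mem s1.T_line s2.T_line)
qed

context herm_bundle
begin

sublocale sec: smooth_domain M E "\<X>"
  by (rule smooth_domain_Cinf)

sublocale rl: smooth_domain M E euclideanreal
  by (rule smooth_domain_real)

sublocale sec3: smooth_domain M E "prod_topology \<X> (prod_topology \<X> \<X>)"
  by (intro smooth_domain_prod smooth_domain_Cinf)

lemma linear_atom_ident: "sec.linear_atom (\<lambda>v. v)"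
  by (auto simp: sec.linear_atom_def)

lemma linear_atom_line: "v \<in> \<Gamma> \<Longrightarrow> rl.linear_atom (\<lambda>t. t *\<^sub>R v)"
  unfolding rl.linear_atom_def continuous_map_atin using rl.T_ident_limit
  by (auto simp: scaleR_add_left limitin_canonical_iff intro!: limitin_Cinf_scaleR limitin_Cinf_const)

lemma hsec_exp_smooth:
  assumes "h \<in> \<Gamma>p" "\<And>v. v \<in> \<Gamma> \<Longrightarrow> g v = hsec exp h v"
  shows "mb_smooth \<X> \<X> \<Gamma> g"
  using sec.mb_smooth_hsec_exp[OF linear_atom_ident assms(1)] assms(2) by (simp add: topspace_Cinf)

text \<open>For small t both k - th and h - tk are positive, so the eigenvalues of h^-1 k lie
  between t and 1/t. Only the values of g on \<Gamma>p are prescribed, which later admits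
  \<open>inv_into\<close>.\<close>

lemma hsec_ln_smooth:
  assumes h: "h \<in> \<Gamma>p" and g: "\<And>k. k \<in> \<Gamma>p \<Longrightarrow> g k = hsec ln h k"
  shows "mb_smooth \<X> \<X> \<Gamma>p g"
proof -
  have *: "\<exists>V e. k \<in> V \<and> V \<subseteq> \<Gamma>p \<and> sec.represents V e g" if k: "k \<in> \<Gamma>p" for k
  proof -
    have G: "h \<in> \<Gamma>" "k \<in> \<Gamma>"
      using h k pos_Herm_sections_subset by auto
    obtain t1 where t1: "0 < t1" "t1 < 1" "\<And>s. 0 < s \<Longrightarrow> s \<le> t1 \<Longrightarrow> k + s *\<^sub>R ((- 1) *\<^sub>R h) \<in> \<Gamma>p"
      using small_line_posdef[OF k Herm_sections_scaleR[OF G(1)]] by metis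
    obtain t2 where t2: "0 < t2" "\<And>s. 0 < s \<Longrightarrow> s \<le> t2 \<Longrightarrow> h + s *\<^sub>R ((- 1) *\<^sub>R k) \<in> \<Gamma>p"
      using small_line_posdef[OF h Herm_sections_scaleR[OF G(2)]] by metis
    define t where "t = min t1 t2"
    have t: "0 < t" "t < 1" "k + t *\<^sub>R ((- 1) *\<^sub>R h) \<in> \<Gamma>p" "h + t *\<^sub>R ((- 1) *\<^sub>R k) \<in> \<Gamma>p"
      using t1 t2 by (auto simp: t_def)
    \<comment> \<open>The circle has the segment from t to 1/t as a diameter. Its leftmost point t >
      0 keeps the disc away from the slit of \<open>Ln\<close>, and t < 1 makes the radius
      positive.\<close>
    define c \<rho> where "c = (1 / t + t) / 2" and "\<rho> = (1 / t - t) / 2"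
    have cr: "c + \<rho> = 1 / t" "c - \<rho> = t"
      by (simp_all add: c_def \<rho>_def field_simps)
    have "t * t < 1 * 1"
      using t by (intro mult_strict_mono) auto
    then have \<rho>: "0 < \<rho>"
      using t by (simp add: \<rho>_def field_simps)
    define V where "V = {k \<in> topspace \<X>. (c + \<rho>) *\<^sub>R h - k \<in> \<Gamma>p \<and> k - (c - \<rho>) *\<^sub>R h \<in> \<Gamma>p}"
    \<comment> \<open>On V the section w - th is positive, so w is positive too; hence g is known to
      be the logarithm there.\<close>
    have VG: "V \<subseteq> \<Gamma>p"
    proof
      fix w assume w: "w \<in> V"
      then have "w \<in> \<Gamma>" "w - t *\<^sub>R h \<in> \<Gamma>p"
        by (auto simp: V_def cr topspace_Cinf)
      moreover have "w x \<in> pos_herm_form E x" for x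
      proof -
        have "0 < Re (w x a a)" if a: "a \<in> fiber E x" "a \<noteq> 0" for a
        proof -
          have "0 < Re (h x a a)" "0 < Re ((w - t *\<^sub>R h) x a a)"
            using pos_Herm_sectionsD[OF h, of x] pos_Herm_sectionsD[OF \<open>w - t *\<^sub>R h \<in> \<Gamma>p\<close>, of x] a
            by (auto simp: pos_herm_form_def)
          then have "0 < t * Re (h x a a)" "t * Re (h x a a) < Re (w x a a)"
            using t(1) by simp_all
          then show ?thesis
            by linarith
        qed
        then show ?thesis
          using Herm_sectionsD[OF \<open>w \<in> \<Gamma>\<close>, of x] by (simp add: pos_herm_form_def)
      qed
      ultimately show "w \<in> \<Gamma>p"
        by (simp add: pos_Herm_sections_def)
    qed
    have S: "cball (complex_of_real c) \<rho> \<subseteq> - \<real>\<^sub>\<le>\<^sub>0"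
    proof
      fix z assume "z \<in> cball (complex_of_real c) \<rho>"
      then have "c - Re z \<le> \<rho>"
        using abs_Re_le_cmod[of "of_real c - z"] by (simp add: dist_norm)
      then have "t \<le> Re z"
        using cr by linarith
      with t(1) show "z \<in> - \<real>\<^sub>\<le>\<^sub>0"
        by (auto simp: complex_nonpos_Reals_iff)
    qed
    obtain e where "sec.represents V e g"
      unfolding V_def
    proof (rule sec.represents_hsec[OF linear_atom_ident h \<rho>, of Ln "- \<real>\<^sub>\<le>\<^sub>0" c ln g])
      show "Ln holomorphic_on - \<real>\<^sub>\<le>\<^sub>0"
        by (intro holomorphic_intros) auto
      show "Ln (of_real x) = of_real (ln x)" if "\<bar>x - c\<bar> < \<rho>" for x
        using that cr t(1) by (intro Ln_of_real) linarith
      show "g x = hsec ln h x" if "x \<in> {x \<in> topspace \<X>. (c + \<rho>) *\<^sub>R h - x \<in> \<Gamma>p \<and> x - (c - \<rho>) *\<^sub>R h \<in> \<Gamma>p}" for x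
        using g VG that unfolding V_def by blast
    qed (use S in auto)
    moreover have "k \<in> V"
    proof -
      have "(1 / t) *\<^sub>R (h + t *\<^sub>R ((- 1) *\<^sub>R k)) = (1 / t) *\<^sub>R h - k"
        using t(1) by (simp add: scaleR_diff_right)
      then show ?thesis
        using pos_Herm_sections_scaleR[OF t(4), of "1 / t"] t G unfolding V_def cr by (simp add: topspace_Cinf)
    qed
    ultimately show ?thesis
      using VG by blast
  qed
  show ?thesis
  proof (rule sec.mb_smooth_represents)
    show "\<Gamma>p \<subseteq> topspace \<X>"
      using pos_Herm_sections_subset by (simp add: topspace_Cinf)
    show "g k \<in> \<Gamma>" if "k \<in> \<Gamma>p" for k
      using *[OF that] by (auto simp: sec.represents_def)
  qed (use * in blast)
qed

end


section \<open>Geodesics and the metric spray\<close>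

lemma has_vector_derivative_diag:
  assumes "\<And>i. (d i has_real_derivative d' i) (at t)"
  shows "((\<lambda>s. diag (\<lambda>i. d i s) :: 'r::finite cmat) has_vector_derivative diag d') (at t)"
proof -
  define L where "L = (\<lambda>i (z::real). diag (\<lambda>k. if k = i then z else 0) :: 'r cmat)"
  have L: "bounded_linear (L i)" for i
    unfolding linear_conv_bounded_linear [symmetric]
    by (auto intro!: linearI simp: L_def vec_eq_iff diag_nth complex_eq_iff)
  have "((\<lambda>s. L i (d i s)) has_vector_derivative L i (d' i)) (at t)" for i
    using bounded_linear.has_vector_derivative[OF L] assms[of i]
    unfolding has_real_derivative_iff_has_vector_derivative by blast
  then have "((\<lambda>s. \<Sum>i\<in>UNIV. L i (d i s)) has_vector_derivative (\<Sum>i\<in>UNIV. L i (d' i))) (at t)"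
    by (intro has_vector_derivative_sum)
  moreover have "(\<Sum>i\<in>UNIV. L i (f i)) = diag f" for f
    by (auto simp: vec_eq_iff L_def diag_nth simp flip: of_real_sum)
  ultimately show ?thesis
    by simp
qed

text \<open>In the common frame of H and V the curve is diagonal with entries exp(t d i), so the
  geodesic equation and the initial values reduce to identities between scalars.\<close>

lemma matrix_exponential_curve:
  fixes H V :: "'r::finite cmat"
  assumes H: "posdef H" and V: "adj V = V"
  defines "G \<equiv> \<lambda>t. hfun exp H (t *\<^sub>R V)"
  obtains G' G'' where
    "\<And>t. (G has_vector_derivative G' t) (at t)" "\<And>t. (G' has_vector_derivative G'' t) (at t)"
    "\<And>t. G'' t = G' t ** matrix_inv (G t) ** G' t" "\<And>t. G' t = G t ** (matrix_inv H ** V)"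
    "G 0 = H" "G' 0 = V" "\<And>t. invertible (G t)"
proof -
  obtain P :: "'r cmat" and d where P: "diagonalizes P d H V"
    using simultaneous_diagonalization[OF H V] .
  define Q where "Q = matrix_inv P"
  have iP: "invertible P" and PH: "P ** H ** adj P = mat 1" and PV: "P ** V ** adj P = diag d"
    using P by (auto simp: diagonalizes_def)
  have QP: "Q ** P = mat 1" "P ** Q = mat 1" "adj P ** adj Q = mat 1" "adj Q ** adj P = mat 1"
    using iP by (simp_all add: Q_def flip: adj_mult)
  have PX: "Q ** (P ** X ** adj P) ** adj Q = X" for X
  proof -
    have "Q ** (P ** X ** adj P) ** adj Q = (Q ** P) ** X ** (adj P ** adj Q)"
      by (simp only: matrix_mul_assoc)
    then show ?thesis
      by (simp add: QP)
  qed
  \<comment> \<open>\<open>D f\<close> is the form with eigenvalues f relative to H; between two of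
    them, \<open>adj P ** P\<close>, which is the inverse of H, multiplies the eigenvalues.\<close>
  define D where "D = (\<lambda>f. Q ** diag f ** adj Q)"
  have Geq: "G t = D (\<lambda>i. exp (t * d i))" for t
    using hfun_eq[OF diagonalizes_scaleR[OF P, of t], of exp] PX[of "G t"]
    by (simp add: G_def D_def comp_def)
  have DP: "D f ** (adj P ** P) ** D g = D (\<lambda>i. f i * g i)" for f g
  proof -
    have "D f ** (adj P ** P) ** D g = Q ** diag f ** (adj Q ** adj P) ** (P ** Q) ** diag g ** adj Q"
      by (simp only: D_def matrix_mul_assoc)
    also have "\<dots> = Q ** (diag f ** diag g) ** adj Q"
      by (simp add: QP matrix_mul_assoc)
    finally show ?thesis
      by (simp add: D_def diag_mult)
  qed
  have DI: "D (\<lambda>_. 1) = H"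
    using PX[of H] by (simp add: D_def PH diag_one)
  have DV: "D d = V"
    using PX[of V] by (simp add: D_def PV)
  have "D f ** (adj P ** diag (\<lambda>i. 1 / f i) ** P) = mat 1" if "\<And>i. f i \<noteq> 0" for f
  proof -
    have "D f ** (adj P ** diag (\<lambda>i. 1 / f i) ** P) = Q ** diag f ** (adj Q ** adj P) ** diag (\<lambda>i. 1 / f i) ** P"
      by (simp only: D_def matrix_mul_assoc)
    also have "\<dots> = Q ** (diag f ** diag (\<lambda>i. 1 / f i)) ** P"
      by (simp add: QP matrix_mul_assoc)
    finally show ?thesis
      using that by (simp add: diag_mult diag_one QP)
  qed
  note Dinv = matrix_inv_eqI[OF this]
  have Hinv: "matrix_inv H = adj P ** P"
    using Dinv(2)[of "\<lambda>_. 1"] by (simp add: DI diag_one)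
  have Ginv: "matrix_inv (G t) = adj P ** diag (\<lambda>i. 1 / exp (t * d i)) ** P" for t
    using Dinv(2)[of "\<lambda>i. exp (t * d i)"] by (simp add: Geq)
  have DG: "D f ** matrix_inv (G t) ** D g = D (\<lambda>i. f i / exp (t * d i) * g i)" for f g t
  proof -
    have "D f ** matrix_inv (G t) ** D g
      = Q ** diag f ** (adj Q ** adj P) ** diag (\<lambda>i. 1 / exp (t * d i)) ** (P ** Q) ** diag g ** adj Q"
      unfolding Ginv by (simp only: D_def matrix_mul_assoc)
    also have "\<dots> = Q ** (diag f ** diag (\<lambda>i. 1 / exp (t * d i)) ** diag g) ** adj Q"
      by (simp add: QP matrix_mul_assoc)
    finally show ?thesis
      by (simp add: D_def diag_mult)
  qed
  have bl: "bounded_linear (\<lambda>X. Q ** X ** adj Q)"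
    by (rule bounded_linear_compose[OF matrix_mult.bounded_linear_left[of "adj Q"] matrix_mult.bounded_linear_right[of Q]])
  have Dd: "((\<lambda>t. D (\<lambda>i. f i t)) has_vector_derivative D f') (at t)"
    if "\<And>i. (f i has_real_derivative f' i) (at t)" for f f' t
    unfolding D_def by (rule bounded_linear.has_vector_derivative[OF bl has_vector_derivative_diag[OF that]])
  show thesis
  proof (rule that[of "\<lambda>t. D (\<lambda>i. d i * exp (t * d i))" "\<lambda>t. D (\<lambda>i. d i * d i * exp (t * d i))"])
    fix t
    show "(G has_vector_derivative D (\<lambda>i. d i * exp (t * d i))) (at t)"
      unfolding Geq[abs_def] by (rule Dd) (auto intro!: derivative_eq_intros)
    show "((\<lambda>t. D (\<lambda>i. d i * exp (t * d i))) has_vector_derivative D (\<lambda>i. d i * d i * exp (t * d i))) (at t)"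
      by (rule Dd) (auto intro!: derivative_eq_intros)
    show "D (\<lambda>i. d i * d i * exp (t * d i))
        = D (\<lambda>i. d i * exp (t * d i)) ** matrix_inv (G t) ** D (\<lambda>i. d i * exp (t * d i))"
      unfolding DG by (simp add: mult_ac)
    show "D (\<lambda>i. d i * exp (t * d i)) = G t ** (matrix_inv H ** V)"
      using DP[of "\<lambda>i. exp (t * d i)" d] by (simp add: Geq Hinv DV matrix_mul_assoc mult.commute)
    show "invertible (G t)"
      unfolding Geq by (rule Dinv(1)) simp
  qed (simp_all add: Geq DI DV)
qed

lemma vector_derivative_zero_on_interval:
  fixes f :: "real \<Rightarrow> 'b::real_normed_vector"
  assumes d: "\<And>t. t \<in> {0..1} \<Longrightarrow> (f has_vector_derivative 0) (at t)" and t: "t \<in> {0..1}"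
  shows "f t = f 0"
proof (rule has_derivative_zero_unique[of "{0..1}" f])
  show "(f has_derivative (\<lambda>h. 0)) (at x within {0..1})" if "x \<in> {0..1}" for x
    using has_vector_derivative_at_within[OF d[OF that]] by (simp add: has_vector_derivative_def)
qed (use t in auto)

text \<open>The equation makes G^-1 G' constant, so G' = G A with A = H^-1 V. The exponential curve
  S satisfies the same linear equation, hence G S^-1 has derivative zero and keeps its initial value
  1.\<close>

lemma matrix_geodesic_unique:
  fixes G G' :: "real \<Rightarrow> 'r::finite cmat"
  assumes H: "posdef H" and V: "adj V = V"
    and I: "{0..1} \<subseteq> I" "open I"
    and G: "\<And>t. t \<in> I \<Longrightarrow> (G has_vector_derivative G' t) (at t)"
    and G': "\<And>t. t \<in> I \<Longrightarrow> (G' has_vector_derivative G' t ** matrix_inv (G t) ** G' t) (at t)"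
    and inv: "\<And>t. t \<in> I \<Longrightarrow> invertible (G t)"
    and init: "G 0 = H" "G' 0 = V"
  shows "G 1 = hfun exp H V"
proof -
  have evI: "\<forall>\<^sub>F t in nhds t0. invertible (G t)" if "t0 \<in> I" for t0
    using eventually_nhds_in_open[OF I(2) that] by eventually_elim (rule inv)
  have ginv: "((\<lambda>t. matrix_inv (G t)) has_vector_derivative - (matrix_inv (G t) ** G' t ** matrix_inv (G t))) (at t)"
    if "t \<in> I" for t
    by (rule has_vector_derivative_matrix_inv[OF G[OF that] evI[OF that]])
  have "((\<lambda>t. matrix_inv (G t) ** G' t) has_vector_derivative 0) (at t)" if t: "t \<in> {0..1}" for t
    using matrix_mult.has_vector_derivative[OF ginv G', of t] t I(1)
    by (simp add: subset_iff matrix_mult.minus_left matrix_mul_assoc)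
  from vector_derivative_zero_on_interval[of "\<lambda>t. matrix_inv (G t) ** G' t", OF this]
  have A: "matrix_inv (G t) ** G' t = matrix_inv H ** V" if "t \<in> {0..1}" for t
    using that init by simp
  obtain S' where S: "\<And>t. ((\<lambda>t. hfun exp H (t *\<^sub>R V)) has_vector_derivative S' t) (at t)"
    "\<And>t. S' t = hfun exp H (t *\<^sub>R V) ** (matrix_inv H ** V)"
    "hfun exp H (0 *\<^sub>R V) = H" "\<And>t. invertible (hfun exp H (t *\<^sub>R V))"
  proof (rule matrix_exponential_curve[OF H V], goal_cases)
    case (1 G' G'')
    show ?case
      by (rule 1(1)[OF 1(2,5,6,8)])
  qed
  let ?S = "\<lambda>t. hfun exp H (t *\<^sub>R V)"
  have sinv: "((\<lambda>t. matrix_inv (?S t)) has_vector_derivative - (matrix_inv (?S t) ** S' t ** matrix_inv (?S t))) (at t)" for t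
    by (rule has_vector_derivative_matrix_inv[OF S(1)]) (simp add: S(4))
  have "((\<lambda>t. G t ** matrix_inv (?S t)) has_vector_derivative 0) (at t)" if t: "t \<in> {0..1}" for t
  proof -
    have tI: "t \<in> I"
      using t I by blast
    have "G' t = G t ** (matrix_inv H ** V)"
      using A[OF t] inv[OF tI] by (metis matrix_inv_right_mult)
    then have "G t ** - (matrix_inv (?S t) ** S' t ** matrix_inv (?S t)) + G' t ** matrix_inv (?S t) = 0"
      using S(4)[of t] by (simp add: S(2) matrix_mult.minus_right matrix_mul_assoc [symmetric])
    with matrix_mult.has_vector_derivative[OF G[OF tI] sinv[of t]] show ?thesis
      by simp
  qed
  from vector_derivative_zero_on_interval[of "\<lambda>t. G t ** matrix_inv (?S t)", OF this, of 1]
  have "G 1 ** matrix_inv (?S 1) = mat 1"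
    using S(3) init posdef_invertible[OF H] by simp
  then have "G 1 ** matrix_inv (?S 1) ** ?S 1 = ?S 1"
    by simp
  then show ?thesis
    using S(4)[of 1] by (simp add: matrix_mul_assoc [symmetric])
qed

section \<open>Exponential and logarithm of sections are mutually inverse\<close>

context herm_bundle
begin

lemma section_eqI:
  assumes "\<And>x. v x \<in> herm_form E x" "\<And>x. w x \<in> herm_form E x"
    and "\<And>x. fmat E (triv_at x) x (v x) = fmat E (triv_at x) x (w x)"
  shows "v = w"
  using trivialized.fmat_inject[OF trivialized_triv_at] assms by blast

lemma triv_at_mem: "\<exists>W. (W, triv_at x) \<in> trivs E \<and> x \<in> W"
proof -
  have "\<exists>\<tau> W. (W, \<tau>) \<in> trivs E \<and> x \<in> W"
    using triv_cover by blast
  then show ?thesis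
    unfolding triv_at_def by (rule someI_ex)
qed

lemma fmat_hsec_at:
  "h \<in> \<Gamma>p \<Longrightarrow> k \<in> \<Gamma> \<Longrightarrow>
    fmat E (triv_at x) x (hsec f h k x) = hfun f (fmat E (triv_at x) x (h x)) (fmat E (triv_at x) x (k x))"
  using triv_at_mem[of x] fmat_hsec by blast

lemma hsec_exp_mem:
  assumes "h \<in> \<Gamma>p" "v \<in> \<Gamma>"
  shows "hsec exp h v \<in> \<Gamma>p"
proof -
  have "hsec exp h v \<in> \<Gamma>"
    using hsec_exp_smooth[OF assms(1), of "hsec exp h"] assms(2) by (auto simp: mb_smooth_def topspace_Cinf)
  moreover have "posdef (fmat E (triv_at x) x (hsec exp h v x))" for x
    unfolding fmat_hsec_at[OF assms] by (intro posdef_hfun fmat_posdef fmat_herm trivialized_triv_at assms) simp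
  ultimately show ?thesis
    using trivialized.posdef_fmat_iff[OF trivialized_triv_at] by (auto simp: pos_Herm_sections_def Herm_sectionsD)
qed

lemma hsec_ln_mem: "h \<in> \<Gamma>p \<Longrightarrow> k \<in> \<Gamma>p \<Longrightarrow> hsec ln h k \<in> \<Gamma>"
  using hsec_ln_smooth[of h "hsec ln h"] by (auto simp: mb_smooth_def topspace_Cinf)

lemma hsec_ln_exp:
  assumes "h \<in> \<Gamma>p" "v \<in> \<Gamma>"
  shows "hsec ln h (hsec exp h v) = v"
proof (rule section_eqI)
  have e: "hsec exp h v \<in> \<Gamma>"
    using hsec_exp_mem[OF assms] pos_Herm_sections_subset by blast
  show "hsec ln h (hsec exp h v) x \<in> herm_form E x" for x
    by (rule hsec_herm[OF assms(1) e])
  show "v x \<in> herm_form E x" for x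
    by (rule Herm_sectionsD[OF assms(2)])
  fix x
  have "ln \<circ> exp = (\<lambda>x::real. x)"
    by auto
  then show "fmat E (triv_at x) x (hsec ln h (hsec exp h v) x) = fmat E (triv_at x) x (v x)"
    unfolding fmat_hsec_at[OF assms(1) e] fmat_hsec_at[OF assms]
    by (simp add: hfun_hfun hfun_id fmat_posdef fmat_herm trivialized_triv_at assms)
qed

lemma hsec_exp_ln:
  assumes "h \<in> \<Gamma>p" "k \<in> \<Gamma>p"
  shows "hsec exp h (hsec ln h k) = k"
proof (rule section_eqI)
  have k: "k \<in> \<Gamma>"
    using assms pos_Herm_sections_subset by blast
  have e: "hsec ln h k \<in> \<Gamma>"
    by (rule hsec_ln_mem[OF assms])
  show "hsec exp h (hsec ln h k) x \<in> herm_form E x" for x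
    by (rule hsec_herm[OF assms(1) e])
  show "k x \<in> herm_form E x" for x
    by (rule Herm_sectionsD[OF k])
  fix x
  let ?H = "fmat E (triv_at x) x (h x)" and ?K = "fmat E (triv_at x) x (k x)"
  have "hfun (exp \<circ> ln) ?H ?K = hfun (\<lambda>x. x) ?H ?K"
    by (intro hfun_cong_posdef fmat_posdef trivialized_triv_at assms) simp
  then show "fmat E (triv_at x) x (hsec exp h (hsec ln h k) x) = fmat E (triv_at x) x (k x)"
    unfolding fmat_hsec_at[OF assms(1) e] fmat_hsec_at[OF assms(1) k]
    by (simp add: hfun_hfun hfun_id fmat_posdef fmat_herm trivialized_triv_at assms k)
qed

lemma bij_betw_hsec_exp: "h \<in> \<Gamma>p \<Longrightarrow> bij_betw (hsec exp h) \<Gamma> \<Gamma>p"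
  by (rule bij_betwI[where g = "hsec ln h"]) (auto intro: hsec_exp_mem hsec_ln_mem hsec_ln_exp hsec_exp_ln)

lemma has_mb_deriv_pointwise:
  assumes "has_mb_deriv \<X> f t 1 d" "(W, \<tau>) \<in> trivs E" "x \<in> W"
  shows "((\<lambda>u. fmat E \<tau> x (f u x)) has_vector_derivative fmat E \<tau> x (d x)) (at (t::real))"
  using limitin_Cinf_pointwise[OF assms(1)[unfolded has_mb_deriv_def] assms(2,3)]
  by (simp add: has_vector_derivative_iff_quotient fmat_diff fmat_scaleR)

text \<open>The polarization of V H^-1 V; a spray has to be symmetric bilinear, although geodesics
  only see its diagonal.\<close>

definition spray_mat :: "'r cmat \<Rightarrow> 'r cmat \<Rightarrow> 'r cmat \<Rightarrow> 'r cmat" where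
  "spray_mat H V W = (1 / 2) *\<^sub>R (V ** matrix_inv H ** W + W ** matrix_inv H ** V)"

definition spray :: "('m, 'v) form_section \<Rightarrow> ('m, 'v) form_section \<Rightarrow> ('m, 'v) form_section \<Rightarrow> ('m, 'v) form_section" where
  "spray h v w x = mform E (triv_at x) x
     (spray_mat (fmat E (triv_at x) x (h x)) (fmat E (triv_at x) x (v x)) (fmat E (triv_at x) x (w x)))"

lemma spray_mat_congr:
  assumes "invertible S" "invertible H"
  shows "spray_mat (S ** H ** adj S) (S ** V ** adj S) (S ** W ** adj S) = S ** spray_mat H V W ** adj S"
proof -
  have S: "invertible (adj S)"
    using assms by simp
  have i: "matrix_inv (S ** H ** adj S) = matrix_inv (adj S) ** matrix_inv H ** matrix_inv S"
    using assms S by (intro matrix_inv_eqI(2)) (simp add: matrix_mul_assoc [symmetric])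
  have "S ** V ** adj S ** matrix_inv (S ** H ** adj S) ** (S ** W ** adj S)
      = S ** (V ** matrix_inv H ** W) ** adj S" for V W
    using assms S unfolding i by (simp add: matrix_mul_assoc [symmetric])
  then show ?thesis
    by (simp add: spray_mat_def matrix_mult.add_left matrix_mult.add_right matrix_mult.scaleR_left matrix_mult.scaleR_right)
qed

lemma spray_mat_herm:
  assumes "posdef H" "adj V = V" "adj W = W"
  shows "adj (spray_mat H V W) = spray_mat H V W"
proof -
  have "adj (matrix_inv H) = matrix_inv H"
    using adj_matrix_inv[OF posdef_invertible[OF assms(1)]] assms(1) by (simp add: posdef_def)
  moreover have "adj (A + B) = adj A + adj B" "adj (r *\<^sub>R A) = r *\<^sub>R adj A" for A B :: "'r cmat" and r
    by (simp_all add: vec_eq_iff)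
  ultimately show ?thesis
    using assms(2,3) by (simp add: spray_mat_def adj_mult matrix_mul_assoc add.commute)
qed

lemma spray_herm:
  assumes "h \<in> \<Gamma>p" "v \<in> \<Gamma>" "w \<in> \<Gamma>"
  shows "spray h v w x \<in> herm_form E x"
  unfolding spray_def
  by (intro trivialized.mform_herm[OF trivialized_triv_at] spray_mat_herm fmat_posdef fmat_herm trivialized_triv_at assms)

lemma fmat_spray:
  assumes h: "h \<in> \<Gamma>p" and v: "v \<in> \<Gamma>" "w \<in> \<Gamma>" and W: "(W, \<tau>) \<in> trivs E" "x \<in> W"
  shows "fmat E \<tau> x (spray h v w x) = spray_mat (fmat E \<tau> x (h x)) (fmat E \<tau> x (v x)) (fmat E \<tau> x (w x))"
proof -
  obtain S where S: "invertible S"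
    "\<And>v. v \<in> herm_form E x \<Longrightarrow> fmat E \<tau> x v = S ** fmat E (triv_at x) x v ** adj S"
    using change_triv_at[OF W] by metis
  have "h x \<in> herm_form E x" "v x \<in> herm_form E x" "w x \<in> herm_form E x"
    using h v Herm_sectionsD pos_Herm_sections_subset by auto
  then show ?thesis
    using spray_mat_congr[OF S(1) posdef_invertible[OF fmat_posdef[OF h trivialized_triv_at]]] S(2)[OF spray_herm[OF h v]]
    by (simp add: S(2) spray_def trivialized.fmat_mform[OF trivialized_triv_at])
qed

text \<open>The spray is itself a rational expression in h, v and w, with h inverted; it is constant
  in s, so integrating over [0, 1] changes nothing.\<close>

lemma spray_smooth:
  "mb_smooth (prod_topology \<X> (prod_topology \<X> \<X>)) \<X> (\<Gamma>p \<times> \<Gamma> \<times> \<Gamma>) (\<lambda>(h, v, w). spray h v w)"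
proof -
  let ?T = "prod_topology \<X> (prod_topology \<X> \<X>)"
  have atoms: "sec3.linear_atom fst" "sec3.linear_atom (\<lambda>p. fst (snd p))" "sec3.linear_atom (\<lambda>p. snd (snd p))"
  proof -
    have "continuous_map ?T \<X> (fst \<circ> snd)" "continuous_map ?T \<X> (snd \<circ> snd)"
      by (rule continuous_map_compose[OF continuous_map_snd continuous_map_fst]
          continuous_map_compose[OF continuous_map_snd continuous_map_snd])+
    then show "sec3.linear_atom fst" "sec3.linear_atom (\<lambda>p. fst (snd p))" "sec3.linear_atom (\<lambda>p. snd (snd p))"
      by (auto simp: sec3.linear_atom_def continuous_map_fst comp_def)
  qed
  define V where "V = \<Gamma>p \<times> \<Gamma> \<times> \<Gamma>"
  have V: "openin ?T V"
    unfolding V_def by (simp add: openin_prod_Times_iff openin_pos_Herm_sections openin_Herm_sections)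
  define a b c :: "(('m, 'v) form_section \<times> ('m, 'v) form_section \<times> ('m, 'v) form_section, ('m, 'v) form_section) ratex"
    where "a = Pt fst" and "b = Pt (\<lambda>p. fst (snd p))" and "c = Pt (\<lambda>p. snd (snd p))"
  define e where "e = Times (Sc (\<lambda>_. 1 / 2)) (Plus (Times (Times b (Inv a)) c) (Times (Times c (Inv a)) b))"
  have half: "mat (1 / 2) ** A = (1 / 2) *\<^sub>R (A :: 'r cmat)" for A
    by (simp add: vec_eq_iff mat_mult_nth) (simp add: scaleR_conv_of_real)
  have r: "sec3.represents V e (\<lambda>(h, v, w). spray h v w)"
  proof (rule sec3.representsI[OF V])
    show "sec3.wf_ratex e"
      using atoms by (simp add: e_def a_def b_def c_def)
    show "sec3.defined_on V e"
      using mrep_posdef by (auto simp: e_def a_def b_def c_def V_def intro!: posdef_invertible)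
    show "dirs_below 0 e"
      by (simp add: e_def a_def b_def c_def)
    show "(case x of (h, v, w) \<Rightarrow> spray h v w) z \<in> herm_form E z" if "x \<in> V" for x z
      using that spray_herm by (auto simp: V_def)
    show "mrep E U \<phi> \<tau> (case x of (h, v, w) \<Rightarrow> spray h v w) y = integral {0..1} (\<lambda>s. reval (mrep E U \<phi> \<tau>) e x (\<lambda>_. 0) s y)"
      if x: "x \<in> V" and p: "patch U \<phi> W \<tau>" "y \<in> \<phi> ` (U \<inter> W)" for x U \<phi> W \<tau> y
    proof -
      obtain h v w where hvw: "x = (h, v, w)" "h \<in> \<Gamma>p" "v \<in> \<Gamma>" "w \<in> \<Gamma>"
        using x by (auto simp: V_def)
      have "mrep E U \<phi> \<tau> (spray h v w) y = spray_mat (mrep E U \<phi> \<tau> h y) (mrep E U \<phi> \<tau> v y) (mrep E U \<phi> \<tau> w y)"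
        unfolding mrep_def using fmat_spray[OF hvw(2-4)] patch_points[OF p] p unfolding patch_def by blast
      then show ?thesis
        by (simp add: hvw(1) e_def a_def b_def c_def half spray_mat_def)
    qed
  qed
  show ?thesis
  proof (rule sec3.mb_smooth_represents)
    show "\<Gamma>p \<times> \<Gamma> \<times> \<Gamma> \<subseteq> topspace ?T"
      using openin_subset[OF V] by (simp add: V_def)
    show "(case x of (h, v, w) \<Rightarrow> spray h v w) \<in> \<Gamma>" if "x \<in> \<Gamma>p \<times> \<Gamma> \<times> \<Gamma>" for x
      using r that unfolding sec3.represents_def V_def by blast
    show "\<exists>V e. x \<in> V \<and> sec3.represents V e (\<lambda>(h, v, w). spray h v w)" if "x \<in> \<Gamma>p \<times> \<Gamma> \<times> \<Gamma>" for x
      using r that unfolding V_def by (intro exI conjI)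
  qed
qed

lemma spray_mem:
  assumes "h \<in> \<Gamma>p" "v \<in> \<Gamma>" "w \<in> \<Gamma>"
  shows "spray h v w \<in> \<Gamma>"
proof -
  have "(\<lambda>(h, v, w). spray h v w) \<in> \<Gamma>p \<times> \<Gamma> \<times> \<Gamma> \<rightarrow> \<Gamma>"
    using spray_smooth by (simp add: mb_smooth_def topspace_Cinf)
  from funcset_mem[OF this, of "(h, v, w)"] assms show ?thesis
    by simp
qed

lemma spray_bilinear:
  assumes h: "h \<in> \<Gamma>p" and v: "v \<in> \<Gamma>" "v' \<in> \<Gamma>" "w \<in> \<Gamma>"
  shows "spray h v w = spray h w v" "spray h (v + v') w = spray h v w + spray h v' w"
    "spray h (c *\<^sub>R v) w = c *\<^sub>R spray h v w"
proof -
  note l = herm_form_linear[OF spray_herm[OF h v(1,3)] spray_herm[OF h v(2,3)]]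
  have f: "fmat E (triv_at x) x (spray h v w x)
      = spray_mat (fmat E (triv_at x) x (h x)) (fmat E (triv_at x) x (v x)) (fmat E (triv_at x) x (w x))"
    if "v \<in> \<Gamma>" "w \<in> \<Gamma>" for v w x
    using fmat_spray[OF h that] triv_at_mem by blast
  note vl = Herm_sections_linear[OF v(1,2)]
  show "spray h v w = spray h w v"
    by (rule section_eqI) (simp_all add: spray_herm h v f spray_mat_def add.commute)
  show "spray h (v + v') w = spray h v w + spray h v' w"
    by (rule section_eqI)
      (simp_all add: spray_herm h v f vl l fmat_add spray_mat_def matrix_mult.add_left matrix_mult.add_right algebra_simps)
  show "spray h (c *\<^sub>R v) w = c *\<^sub>R spray h v w"
    by (rule section_eqI)
      (simp_all add: spray_herm h v f vl l fmat_scaleR spray_mat_def matrix_mult.scaleR_left matrix_mult.scaleR_right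
        algebra_simps)
qed

lemma spray_mat_diag_eq: "spray_mat H V V = V ** matrix_inv H ** V"
  by (simp add: spray_mat_def scaleR_half_double)

end


section \<open>The volume integral\<close>

lemma sets_lborel_coord [measurable_cong]: "sets (lborel_coord n) = sets borel"
  by (simp add: lborel_coord_def)

lemma space_lborel_coord [simp]: "space (lborel_coord n) = UNIV"
  by (simp add: lborel_coord_def)

lemma measurable_pad [measurable]:
  fixes n :: nat
  shows "(\<lambda>y i. if i < n then y i else 0 :: real) \<in> (\<Pi>\<^sub>M i\<in>{..<n}. lborel) \<rightarrow>\<^sub>M borel"
proof (rule measurable_coordinatewise_then_product)
  fix i
  show "(\<lambda>y. if i < n then y i else 0) \<in> borel_measurable (\<Pi>\<^sub>M i\<in>{..<n}. lborel :: real measure)"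
    by (cases "i < n") auto
qed

lemma emeasure_lborel_coord:
  assumes "S \<in> sets borel"
  shows "emeasure (lborel_coord n) S =
    emeasure (\<Pi>\<^sub>M i\<in>{..<n}. lborel) {y \<in> space (\<Pi>\<^sub>M i\<in>{..<n}. lborel). (\<lambda>i. if i < n then y i else 0) \<in> S}"
  unfolding lborel_coord_def using assms
  by (subst emeasure_distr[OF measurable_pad]) (auto intro!: arg_cong2[of _ _ _ _ emeasure])

interpretation lborel_product: product_sigma_finite "\<lambda>_::nat. lborel :: real measure"
  by standard

text \<open>Compactness bounds each coordinate separately, so K lies in a box, and boxes have finite
  measure.\<close>

lemma emeasure_lborel_coord_compact:
  assumes "compact K"
  shows "emeasure (lborel_coord n) K < \<infinity>"
proof -
  have "\<exists>b. \<forall>y\<in>K. \<bar>y i\<bar> \<le> b" for i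
  proof -
    have "continuous_on K (\<lambda>y. y i)"
      by (rule continuous_on_product_coordinates[THEN continuous_on_subset]) simp
    then have "bounded ((\<lambda>y. y i) ` K)"
      using assms by (intro compact_imp_bounded compact_continuous_image)
    then show ?thesis
      unfolding bounded_iff by auto
  qed
  then obtain b where b: "\<And>i y. y \<in> K \<Longrightarrow> \<bar>y i\<bar> \<le> b i"
    by metis
  have "emeasure (lborel_coord n) K \<le> emeasure (\<Pi>\<^sub>M i\<in>{..<n}. lborel) (\<Pi>\<^sub>E i\<in>{..<n}. {- b i..b i})"
    unfolding emeasure_lborel_coord[OF borel_compact[OF assms]]
  proof (rule emeasure_mono)
    show "{y \<in> space (\<Pi>\<^sub>M i\<in>{..<n}. lborel). (\<lambda>i. if i < n then y i else 0) \<in> K} \<subseteq> (\<Pi>\<^sub>E i\<in>{..<n}. {- b i..b i})"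
    proof
      fix y assume y: "y \<in> {y \<in> space (\<Pi>\<^sub>M i\<in>{..<n}. lborel :: real measure). (\<lambda>i. if i < n then y i else 0) \<in> K}"
      have "y i \<in> {- b i..b i}" if "i < n" for i
        using b[of "\<lambda>i. if i < n then y i else 0" i] y that by auto
      with y show "y \<in> (\<Pi>\<^sub>E i\<in>{..<n}. {- b i..b i})"
        by (auto simp: space_PiM PiE_iff)
    qed
  qed (auto intro!: sets_PiM_I_finite)
  also have "\<dots> = (\<Prod>i<n. emeasure lborel {- b i..b i})"
    by (rule lborel_product.emeasure_PiM) auto
  also have "\<dots> = (\<Prod>i<n. ennreal (if - b i \<le> b i then b i - - b i else 0))"
    by (simp only: emeasure_lborel_Icc_eq)
  also have "\<dots> < \<infinity>"
    by (subst prod_ennreal) auto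
  finally show ?thesis .
qed

text \<open>An open set contains a product of intervals around y0, and padding with 0 agrees with y0
  from n on. The measure of the box is a product of positive lengths, equal to 1 if n = 0.\<close>

lemma emeasure_lborel_coord_open:
  assumes "openin (Euclidean_space n) N" "y0 \<in> N" "N \<in> sets borel"
  shows "0 < emeasure (lborel_coord n) N"
proof -
  have y0: "\<forall>i\<ge>n. y0 i = 0"
    using openin_subset[OF assms(1)] assms(2) by (auto simp: topspace_Euclidean_space)
  obtain O' where O': "open O'" "N = O' \<inter> {x. \<forall>i\<ge>n. x i = 0}"
    using assms(1) unfolding Euclidean_space_def openin_subtopology euclidean_product_topology open_openin [symmetric]
    by blast
  have "openin (product_topology (\<lambda>_. euclidean) UNIV) O'"
    using O'(1) by (simp only: euclidean_product_topology flip: open_openin)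
  moreover have "y0 \<in> O'"
    using assms(2) O'(2) by blast
  ultimately have "\<exists>X. y0 \<in> (\<Pi>\<^sub>E i\<in>UNIV. X i) \<and> (\<forall>i. openin euclidean (X i)) \<and>
      finite {i. X i \<noteq> topspace euclidean} \<and> (\<Pi>\<^sub>E i\<in>UNIV. X i) \<subseteq> O'"
    by (rule product_topology_open_contains_basis)
  then obtain X where X: "y0 \<in> (\<Pi>\<^sub>E i\<in>UNIV. X i)" "\<And>i. open (X i)" "(\<Pi>\<^sub>E i\<in>UNIV. X i) \<subseteq> O'"
    unfolding open_openin [symmetric] by blast
  have "\<exists>e>0. {y0 i - e<..<y0 i + e} \<subseteq> X i" for i
  proof -
    have "y0 i \<in> X i"
      using X(1) by (simp add: PiE_iff)
    then obtain e where "e > 0" "ball (y0 i) e \<subseteq> X i"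
      using X(2)[of i] unfolding open_contains_ball by blast
    then show ?thesis
      by (auto simp: ball_eq_greaterThanLessThan)
  qed
  then obtain e where e: "\<And>i. e i > 0" "\<And>i. {y0 i - e i<..<y0 i + e i} \<subseteq> X i"
    by metis
  have "(\<Pi>\<^sub>E i\<in>{..<n}. {y0 i - e i<..<y0 i + e i})
      \<subseteq> {y \<in> space (\<Pi>\<^sub>M i\<in>{..<n}. lborel). (\<lambda>i. if i < n then y i else 0) \<in> N}"
  proof
    fix y assume y: "y \<in> (\<Pi>\<^sub>E i\<in>{..<n}. {y0 i - e i<..<y0 i + e i})"
    have "(if i < n then y i else 0) \<in> X i" for i
    proof (cases "i < n")
      case True
      then show ?thesis
        using y e(2)[of i] by (auto simp: PiE_iff)
    next
      case False
      then have "(if i < n then y i else 0) = y0 i"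
        using y0 by simp
      then show ?thesis
        using X(1) by (simp add: PiE_iff)
    qed
    then have "(\<lambda>i. if i < n then y i else 0) \<in> O'"
      using X(3) by (auto simp: PiE_iff)
    with y show "y \<in> {y \<in> space (\<Pi>\<^sub>M i\<in>{..<n}. lborel). (\<lambda>i. if i < n then y i else 0) \<in> N}"
      by (auto simp: O'(2) space_PiM PiE_iff)
  qed
  moreover have "{y \<in> space (\<Pi>\<^sub>M i\<in>{..<n}. lborel). (\<lambda>i. if i < n then y i else 0) \<in> N} \<in> sets (\<Pi>\<^sub>M i\<in>{..<n}. lborel)"
    using measurable_sets[OF measurable_pad assms(3)] by (simp add: vimage_def Int_def conj_commute)
  ultimately have "emeasure (\<Pi>\<^sub>M i\<in>{..<n}. lborel) (\<Pi>\<^sub>E i\<in>{..<n}. {y0 i - e i<..<y0 i + e i}) \<le> emeasure (lborel_coord n) N"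
    unfolding emeasure_lborel_coord[OF assms(3)] by (rule emeasure_mono)
  moreover have "emeasure (\<Pi>\<^sub>M i\<in>{..<n}. lborel) (\<Pi>\<^sub>E i\<in>{..<n}. {y0 i - e i<..<y0 i + e i})
      = (\<Prod>i<n. emeasure lborel {y0 i - e i<..<y0 i + e i})"
    by (rule lborel_product.emeasure_PiM) auto
  moreover have "\<dots> = (\<Prod>i<n. ennreal (2 * e i))"
    by (intro prod.cong) (use e(1) in \<open>auto simp: less_imp_le\<close>)
  moreover have "0 < (\<Prod>i<n. ennreal (2 * e i))"
    using e(1) by (simp add: prod_ennreal less_imp_le prod_pos)
  ultimately show ?thesis
    by simp
qed

section \<open>Integrals in one chart\<close>

locale riem_bundle = herm_bundle M E
  for M :: "'m::t2_space manifold" and E :: "('m, 'v::ab_group_add, 'r::finite) vector_bundle" +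
  fixes g :: "'m metric_coeffs"
  assumes rm: "riemannian_metric M g"
begin

definition dens :: "'m chart \<Rightarrow> 'm \<Rightarrow> real" where
  "dens c x = sqrt (det_nat n (g c x))"

lemma dens_pos: "c \<in> atlas M \<Longrightarrow> x \<in> fst c \<Longrightarrow> 0 < dens c x"
proof -
  assume "c \<in> atlas M" "x \<in> fst c"
  then have "\<forall>\<xi>. (\<exists>i<n. \<xi> i \<noteq> 0) \<longrightarrow> 0 < (\<Sum>i<n. \<Sum>j<n. g c x i j * \<xi> i * \<xi> j)"
    using rm unfolding riemannian_metric_def by blast
  then have "0 < det_nat n (g c x)"
    by (intro det_nat_pos) blast
  then show "0 < dens c x"
    by (simp add: dens_def)
qed

lemma dens_continuous:
  assumes c: "c \<in> atlas M"
  shows "continuous_on (snd c ` fst c) (\<lambda>y. dens c (inv_into (fst c) (snd c) y))"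
proof -
  have "continuous_on (snd c ` fst c) (\<lambda>y. g c (inv_into (fst c) (snd c) y) i j)" if "i < n" "j < n" for i j
  proof -
    have "smooth_fun_on M (fst c) (\<lambda>x. g c x i j)"
      using rm c that unfolding riemannian_metric_def by blast
    then have "smooth_coord n (snd c ` (fst c \<inter> fst c)) ((\<lambda>x. g c x i j) \<circ> inv_into (fst c) (snd c))"
      using c unfolding smooth_fun_on_def by (metis (no_types, lifting) case_prodD prod.collapse)
    from this[unfolded smooth_coord_def, rule_format, of "[]"] show ?thesis
      by (simp add: comp_def)
  qed
  moreover have "p i < n" if "p permutes {..<n}" "i < n" for p i
    using permutes_in_image[OF that(1), of i] that(2) by simp
  ultimately show ?thesis
    unfolding dens_def det_nat_def by (intro continuous_intros) auto
qed

definition bump :: "'m chart \<Rightarrow> ('m \<Rightarrow> real) \<Rightarrow> bool" where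
  "bump c \<rho> \<longleftrightarrow> c \<in> atlas M \<and> continuous_on UNIV \<rho> \<and> (\<forall>x. 0 \<le> \<rho> x) \<and> closure {x. \<rho> x \<noteq> 0} \<subseteq> fst c"

definition integrand :: "'m chart \<Rightarrow> ('m \<Rightarrow> real) \<Rightarrow> ('m \<Rightarrow> real) \<Rightarrow> (nat \<Rightarrow> real) \<Rightarrow> real" where
  "integrand c \<rho> f y = indicator (snd c ` fst c) y *
     (\<rho> (inv_into (fst c) (snd c) y) * f (inv_into (fst c) (snd c) y) * dens c (inv_into (fst c) (snd c) y))"

lemma chart_integral_eq: "chart_integral M g c (\<lambda>x. \<rho> x * f x) = (\<integral>y. integrand c \<rho> f y \<partial>lborel_coord n)"
  by (simp add: chart_integral_def set_lebesgue_integral_def integrand_def dens_def Let_def)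

text \<open>The support of \<rho> is closed in \<open>M\<close>, hence compact, and its image K
  under the chart has finite measure. The integrand vanishes off K and is continuous, thus bounded,
  on K.\<close>

lemma integrable_integrand:
  assumes b: "bump c \<rho>" and f: "continuous_on UNIV f"
  shows "integrable (lborel_coord n) (integrand c \<rho> f)"
proof -
  have c: "(fst c, snd c) \<in> atlas M"
    using b by (simp add: bump_def)
  let ?i = "inv_into (fst c) (snd c)"
  define S where "S = closure {x. \<rho> x \<noteq> 0}"
  have S: "compact S" "S \<subseteq> fst c"
    using compact_Int_closed[OF compact_M, of S] b by (auto simp: S_def bump_def)
  define K where "K = snd c ` S"
  have "continuous_on S (snd c)"
    using chart_inv(2)[OF c] S(2) continuous_on_subset by blast
  then have K: "compact K" "K \<subseteq> snd c ` fst c"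
    using S by (auto simp: K_def intro: compact_continuous_image)
  have zero: "integrand c \<rho> f y = 0" if "y \<notin> K" for y
  proof (rule ccontr)
    assume "integrand c \<rho> f y \<noteq> 0"
    then have y: "y \<in> snd c ` fst c" "\<rho> (?i y) \<noteq> 0"
      by (auto simp: integrand_def indicator_def split: if_splits)
    then have "?i y \<in> S"
      using closure_subset[of "{x. \<rho> x \<noteq> 0}"] by (auto simp: S_def)
    moreover have "snd c (?i y) = y"
      using y(1) by (rule f_inv_into_f)
    ultimately show False
      using that unfolding K_def by (metis imageI)
  qed
  define G where "G = (\<lambda>y. \<rho> (?i y) * f (?i y) * dens c (?i y))"
  have ci: "continuous_on K ?i"
    using chart_inv(3)[OF c] K(2) continuous_on_subset by blast
  have "continuous_on UNIV \<rho>"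
    using b by (simp add: bump_def)
  then have G: "continuous_on K G"
    unfolding G_def
    using continuous_on_compose2[OF _ ci] f dens_continuous[of c] c K(2)
    by (intro continuous_on_mult) (auto intro: continuous_on_subset)
  have eq: "integrand c \<rho> f y = indicator K y *\<^sub>R G y" for y
    using zero[of y] K(2) by (auto simp: integrand_def G_def indicator_def)
  have "integrand c \<rho> f \<in> borel_measurable borel"
    unfolding eq[abs_def] by (rule borel_measurable_continuous_on_indicator[OF borel_compact[OF K(1)] G])
  then have meas: "integrand c \<rho> f \<in> borel_measurable (lborel_coord n)"
    by (simp cong: measurable_cong_sets add: sets_lborel_coord)
  obtain B where "\<And>y. y \<in> K \<Longrightarrow> norm (G y) \<le> B"
    using compact_imp_bounded[OF compact_continuous_image[OF G K(1)]] unfolding bounded_iff by auto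
  then have "norm (integrand c \<rho> f y) \<le> B" if "y \<in> K" for y
    using that by (simp add: eq)
  then show ?thesis
    using borel_compact[OF K(1)] emeasure_lborel_coord_compact[OF K(1)] zero
    by (intro integrableI_bounded_set[of K _ _ B] meas) (auto simp: sets_lborel_coord)
qed

definition cint :: "'m chart \<Rightarrow> ('m \<Rightarrow> real) \<Rightarrow> ('m \<Rightarrow> real) \<Rightarrow> real" where
  "cint c \<rho> f = chart_integral M g c (\<lambda>x. \<rho> x * f x)"

lemma cint_linear:
  assumes b: "bump c \<rho>" and "continuous_on UNIV f" "continuous_on UNIV f'"
  shows "cint c \<rho> (\<lambda>x. a * f x + f' x) = a * cint c \<rho> f + cint c \<rho> f'"
proof -
  have "integrand c \<rho> (\<lambda>x. a * f x + f' x) = (\<lambda>y. a * integrand c \<rho> f y + integrand c \<rho> f' y)"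
    by (auto simp: integrand_def algebra_simps)
  then show ?thesis
    using integrable_integrand[OF b assms(2)] integrable_integrand[OF b assms(3)]
    by (simp add: cint_def chart_integral_eq)
qed

lemma cint_mono:
  assumes b: "bump c \<rho>" and f: "continuous_on UNIV f" "continuous_on UNIV f'" and le: "\<And>x. f x \<le> f' x"
  shows "cint c \<rho> f \<le> cint c \<rho> f'"
  unfolding cint_def chart_integral_eq
proof (rule integral_mono)
  fix y
  show "integrand c \<rho> f y \<le> integrand c \<rho> f' y"
  proof (cases "y \<in> snd c ` fst c")
    case True
    then have "inv_into (fst c) (snd c) y \<in> fst c"
      by (rule inv_into_into)
    then have "0 \<le> dens c (inv_into (fst c) (snd c) y)"
      using dens_pos[of c] b by (auto simp: bump_def intro: less_imp_le)
    moreover have "0 \<le> \<rho> (inv_into (fst c) (snd c) y)"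
      using b by (simp add: bump_def)
    ultimately show ?thesis
      unfolding integrand_def by (intro mult_left_mono mult_right_mono le) auto
  qed (simp add: integrand_def)
qed (use integrable_integrand b f in auto)

text \<open>A nonnegative integrand with integral 0 vanishes almost everywhere. But where \<rho> f
  is nonzero it is nonzero as well, since \<open>dens\<close> is positive, and by continuity that
  set is relatively open and has positive measure once it contains x.\<close>

lemma cint_zero_imp:
  assumes b: "bump c \<rho>" and f: "continuous_on UNIV f" and nn: "\<And>x. 0 \<le> f x" and z: "cint c \<rho> f = 0"
    and x: "\<rho> x \<noteq> 0"
  shows "f x = 0"
proof (rule ccontr)
  assume "f x \<noteq> 0"
  have c: "(fst c, snd c) \<in> atlas M"
    using b by (simp add: bump_def)
  let ?i = "inv_into (fst c) (snd c)"
  have cont\<rho>: "continuous_on UNIV \<rho>"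
    using b by (simp add: bump_def)
  define S where "S = {z. \<rho> z * f z \<noteq> 0}"
  have "open S"
    unfolding S_def by (intro open_Collect_neq continuous_intros cont\<rho> f)
  have xU: "x \<in> fst c"
    using b x closure_subset[of "{x. \<rho> x \<noteq> 0}"] by (auto simp: bump_def)
  define N where "N = snd c ` (fst c \<inter> S)"
  have N: "openin (Euclidean_space n) N"
    unfolding N_def by (rule openin_chart_image[OF c \<open>open S\<close>])
  have xN: "snd c x \<in> N"
    using xU x \<open>f x \<noteq> 0\<close> by (auto simp: N_def S_def)
  \<comment> \<open>The measure lives on all sequences, where N need not be open; it is the trace of
    an open set on the closed coordinate subspace, hence Borel.\<close>
  have Nb: "N \<in> sets borel"
  proof -
    obtain O' where O': "open O'" "N = O' \<inter> {x. \<forall>i\<ge>n. x i = 0}"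
      using N unfolding Euclidean_space_def openin_subtopology euclidean_product_topology open_openin [symmetric]
      by blast
    have "closed {x :: nat \<Rightarrow> real. \<forall>i\<ge>n. x i = 0}"
    proof -
      have "{x :: nat \<Rightarrow> real. \<forall>i\<ge>n. x i = 0} = (\<Inter>i\<in>{n..}. {x. x i = 0})"
        by auto
      moreover have "closed {x :: nat \<Rightarrow> real. x i = 0}" for i
        by (intro closed_Collect_eq continuous_on_const continuous_on_product_coordinates)
      ultimately show ?thesis
        by auto
    qed
    then show ?thesis
      unfolding O'(2) using O'(1) by auto
  qed
  have int: "integrable (lborel_coord n) (integrand c \<rho> f)"
    by (rule integrable_integrand[OF b f])
  have dp: "0 < dens c (?i y)" if "y \<in> snd c ` fst c" for y
    using dens_pos[of c] c inv_into_into[OF that] by simp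
  have nonneg: "0 \<le> integrand c \<rho> f y" for y
  proof (cases "y \<in> snd c ` fst c")
    case True
    have "0 \<le> \<rho> (?i y)"
      using b by (simp add: bump_def)
    then show ?thesis
      unfolding integrand_def using nn[of "?i y"] dp[OF True] by (intro mult_nonneg_nonneg) auto
  qed (simp add: integrand_def)
  have "AE y in lborel_coord n. integrand c \<rho> f y = 0"
    using integral_nonneg_eq_0_iff_AE[OF int] nonneg z by (simp add: cint_def chart_integral_eq)
  moreover have "integrand c \<rho> f y \<noteq> 0" if "y \<in> N" for y
  proof -
    obtain z where "y = snd c z" "z \<in> fst c" "z \<in> S"
      using \<open>y \<in> N\<close> unfolding N_def by blast
    then show ?thesis
      using dp[of y] chart_inv(1)[OF c, of z] by (auto simp: integrand_def S_def)
  qed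
  ultimately have "AE y in lborel_coord n. y \<notin> N"
    by (elim eventually_mono) blast
  then have "emeasure (lborel_coord n) N = 0"
    using Nb by (subst (asm) AE_iff_measurable[of N]) (auto simp: sets_lborel_coord)
  then show False
    using emeasure_lborel_coord_open[OF N xN Nb] by simp
qed

section \<open>Partitions of unity and the integral over the manifold\<close>

lemma bump_ex:
  fixes x :: 'm
  obtains c N f where "c \<in> atlas M" "open N" "x \<in> N" "continuous_on UNIV f" "\<And>z. 0 \<le> f z"
    "\<And>z. z \<in> N \<Longrightarrow> f z = (1::real)" "closure {z. f z \<noteq> 0} \<subseteq> fst c"
proof -
  obtain U \<phi> where c: "(U, \<phi>) \<in> atlas M" "x \<in> U"
    using chart_cover by blast
  obtain N K where NK: "open N" "compact K" "x \<in> N" "N \<subseteq> K" "K \<subseteq> U"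
    using compact_neighborhood[OF chart(1)[OF c(1)] c(2)] .
  \<comment> \<open>Two nested neighborhoods: Urysohn's function is 1 on the inner compact set and 0
    off N. Since N lies in the compact set K, the support stays inside the chart.\<close>
  obtain N' K' where NK': "open N'" "compact K'" "x \<in> N'" "N' \<subseteq> K'" "K' \<subseteq> N"
    using compact_neighborhood[OF NK(1,3)] .
  have "normal_space (euclidean :: 'm topology)"
    using compact_Hausdorff_or_regular_imp_normal_space[of "euclidean :: 'm topology"] Hausdorff_M compact_M
    by (simp add: compact_space_def compactin_euclidean_iff)
  moreover have "closedin euclidean (- N)" "closedin euclidean K'"
    using NK(1) compact_imp_closed[OF NK'(2)] by (auto simp: closed_Compl)
  moreover have "disjnt (- N) K'"
    using NK'(5) by (auto simp: disjnt_def)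
  ultimately obtain f where f: "continuous_map euclidean (top_of_set {0..1::real}) f" "f ` (- N) \<subseteq> {0}" "f ` K' \<subseteq> {1}"
    using Urysohn_lemma[of "euclidean :: 'm topology" "- N" K' 0 1] by auto
  have "continuous_on UNIV f" "\<And>z. 0 \<le> f z"
    using f(1) by (auto simp: continuous_map_in_subtopology)
  moreover have "f z = 1" if "z \<in> N'" for z
    using f(3) NK' that by auto
  moreover have "{z. f z \<noteq> 0} \<subseteq> K"
    using f(2) NK(4) by auto
  then have "closure {z. f z \<noteq> 0} \<subseteq> U"
    using closure_minimal[OF _ compact_imp_closed[OF NK(2)]] NK(5) by blast
  ultimately show thesis
    using that[of "(U, \<phi>)" N' f] c(1) NK'(1,3) by auto
qed

text \<open>\<open>vol_integral\<close> refers to some partition of unity, so one must exist for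
  that choice to be meaningful. Finitely many bumps equal to 1 on the sets of a cover have a sum
  that is at least 1 everywhere, and are divided by it.\<close>

lemma partition_of_unity_ex: "\<exists>N c \<rho>. partition_of_unity M N c \<rho>"
proof -
  have "\<forall>x. \<exists>c N f. c \<in> atlas M \<and> open N \<and> x \<in> N \<and> continuous_on UNIV f \<and> (\<forall>z. 0 \<le> f z)
    \<and> (\<forall>z\<in>N. f z = (1::real)) \<and> closure {z. f z \<noteq> 0} \<subseteq> fst c"
  proof
    fix x
    show "\<exists>c N f. c \<in> atlas M \<and> open N \<and> x \<in> N \<and> continuous_on UNIV f \<and> (\<forall>z. 0 \<le> f z)
        \<and> (\<forall>z\<in>N. f z = (1::real)) \<and> closure {z. f z \<noteq> 0} \<subseteq> fst c"
      by (rule bump_ex[of x]) blast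
  qed
  then obtain c N f where B: "\<And>x. c x \<in> atlas M" "\<And>x. open (N x)" "\<And>x. x \<in> N x" "\<And>x. continuous_on UNIV (f x)"
    "\<And>x z. 0 \<le> f x z" "\<And>x z. z \<in> N x \<Longrightarrow> f x z = (1::real)" "\<And>x. closure {z. f x z \<noteq> 0} \<subseteq> fst (c x)"
    by metis
  obtain D where D: "finite D" "UNIV \<subseteq> (\<Union>x\<in>D. N x)"
    by (rule compactE_image[OF compact_M, of UNIV N]) (use B in auto)
  obtain m e where e: "D = e ` {i::nat. i < m}"
    using finite_imp_nat_seg_image_inj_on[OF D(1)] by blast
  define F where "F = (\<lambda>z. \<Sum>k<m. f (e k) z)"
  have F: "1 \<le> F z" for z
  proof -
    obtain k where "k < m" "z \<in> N (e k)"
      using D(2) by (auto simp: e)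
    then have "1 = f (e k) z"
      using B(6) by simp
    also have "\<dots> \<le> F z"
      unfolding F_def using \<open>k < m\<close> by (intro member_le_sum) (auto intro: B(5))
    finally show ?thesis .
  qed
  have Fnz: "F z \<noteq> 0" for z
    using F[of z] by linarith
  have "continuous_on UNIV F"
    unfolding F_def by (intro continuous_intros B(4))
  then have "partition_of_unity M m (\<lambda>k. c (e k)) (\<lambda>k z. f (e k) z / F z)"
    unfolding partition_of_unity_def
  proof (intro conjI allI impI)
    fix x
    have "(\<Sum>k<m. f (e k) x / F x) = (\<Sum>k<m. f (e k) x) / F x"
      by (rule sum_divide_distrib [symmetric])
    also have "\<dots> = F x / F x"
      by (simp only: F_def)
    finally show "(\<Sum>k<m. f (e k) x / F x) = 1"
      using Fnz by simp
  next
    fix k z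
    show "0 \<le> f (e k) z / F z"
      using B(5) F[of z] by (intro divide_nonneg_nonneg) auto
  qed (use B Fnz in \<open>auto intro!: continuous_on_divide\<close>)
  then show ?thesis
    by blast
qed

text \<open>The choice inside \<open>vol_integral\<close> does not depend on f. The integral is
  therefore one fixed finite sum of the functionals \<open>cint\<close> and inherits their
  linearity, monotonicity and definiteness.\<close>

lemma vol_integral_cint:
  obtains N c \<rho> where "partition_of_unity M N c \<rho>" "\<And>k. k < N \<Longrightarrow> bump (c k) (\<rho> k)"
    "\<And>f. vol_integral M g f = (\<Sum>k<N. cint (c k) (\<rho> k) f)"
proof -
  define t where "t = (SOME (N, c, \<rho>). partition_of_unity M N c \<rho>)"
  obtain N c \<rho> where t: "t = (N, c, \<rho>)"
    by (metis prod_cases3)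
  obtain N' c' \<rho>' where "partition_of_unity M N' c' \<rho>'"
    using partition_of_unity_ex by blast
  then have "case t of (N, c, \<rho>) \<Rightarrow> partition_of_unity M N c \<rho>"
    unfolding t_def by (intro someI[of "\<lambda>(N, c, \<rho>). partition_of_unity M N c \<rho>" "(N', c', \<rho>')"]) simp
  then have p: "partition_of_unity M N c \<rho>"
    by (simp add: t)
  moreover have "bump (c k) (\<rho> k)" if "k < N" for k
    using p that by (simp add: partition_of_unity_def bump_def)
  moreover have "vol_integral M g f = (\<Sum>k<N. cint (c k) (\<rho> k) f)" for f
    unfolding vol_integral_def t_def[symmetric] t by (simp add: cint_def)
  ultimately show thesis
    by (rule that)
qed

lemma vol_integral_linear:
  assumes "continuous_on UNIV f" "continuous_on UNIV f'"
  shows "vol_integral M g (\<lambda>x. a * f x + f' x) = a * vol_integral M g f + vol_integral M g f'"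
proof -
  obtain N c \<rho> where "partition_of_unity M N c \<rho>" and b: "\<And>k. k < N \<Longrightarrow> bump (c k) (\<rho> k)"
    and v: "\<And>f. vol_integral M g f = (\<Sum>k<N. cint (c k) (\<rho> k) f)"
    using vol_integral_cint by metis
  have "(\<Sum>k<N. cint (c k) (\<rho> k) (\<lambda>x. a * f x + f' x)) = (\<Sum>k<N. a * cint (c k) (\<rho> k) f + cint (c k) (\<rho> k) f')"
    by (intro sum.cong refl cint_linear[OF b assms]) simp
  then show ?thesis
    by (simp add: v sum.distrib sum_distrib_left)
qed

lemma vol_integral_mono:
  assumes "continuous_on UNIV f" "continuous_on UNIV f'" "\<And>x. f x \<le> f' x"
  shows "vol_integral M g f \<le> vol_integral M g f'"
proof -
  obtain N c \<rho> where "partition_of_unity M N c \<rho>" and b: "\<And>k. k < N \<Longrightarrow> bump (c k) (\<rho> k)"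
    and v: "\<And>f. vol_integral M g f = (\<Sum>k<N. cint (c k) (\<rho> k) f)"
    using vol_integral_cint by metis
  show ?thesis
    unfolding v by (intro sum_mono cint_mono[OF b assms]) simp
qed

lemma vol_integral_zero_imp:
  assumes f: "continuous_on UNIV f" and nn: "\<And>x. 0 \<le> f x" and z: "vol_integral M g f = 0"
  shows "f x = 0"
proof -
  obtain N c \<rho> where p: "partition_of_unity M N c \<rho>" and b: "\<And>k. k < N \<Longrightarrow> bump (c k) (\<rho> k)"
    and v: "\<And>f. vol_integral M g f = (\<Sum>k<N. cint (c k) (\<rho> k) f)"
    using vol_integral_cint by metis
  have "cint (c k) (\<rho> k) f \<ge> 0" if "k < N" for k
  proof -
    have "cint (c k) (\<rho> k) (\<lambda>_. 0) \<le> cint (c k) (\<rho> k) f"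
      by (rule cint_mono[OF b[OF that] _ f nn]) simp
    then show ?thesis
      by (simp add: cint_def chart_integral_def set_lebesgue_integral_def)
  qed
  then have "cint (c k) (\<rho> k) f = 0" if "k < N" for k
    using z that unfolding v by (subst (asm) sum_nonneg_eq_0_iff) auto
  moreover obtain k where "k < N" "\<rho> k x \<noteq> 0"
  proof -
    have "(\<Sum>k<N. \<rho> k x) = 1"
      using p by (simp add: partition_of_unity_def)
    then have "\<exists>k<N. \<rho> k x \<noteq> 0"
      by (metis lessThan_iff sum.neutral zero_neq_one)
    with that show thesis by blast
  qed
  ultimately show ?thesis
    using cint_zero_imp[OF b f nn] by blast
qed

lemma vol_integral_uniform_limit:
  assumes lim: "uniform_limit UNIV f l \<FF>" and f: "\<forall>\<^sub>F j in \<FF>. continuous_on UNIV (f j)" and l: "continuous_on UNIV l"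
  shows "((\<lambda>j. vol_integral M g (f j)) \<longlongrightarrow> vol_integral M g l) \<FF>"
proof (rule tendstoI)
  fix e :: real assume "e > 0"
  define C where "C = vol_integral M g (\<lambda>_. 1)"
  have one: "continuous_on UNIV (\<lambda>_::'m. 1::real)"
    by simp
  have "vol_integral M g (\<lambda>_. 0) = 0"
    using vol_integral_linear[of "\<lambda>_. 0" "\<lambda>_. 0" 1] by simp
  then have "C \<ge> 0"
    using vol_integral_mono[of "\<lambda>_. 0" "\<lambda>_. 1"] by (simp add: C_def)
  \<comment> \<open>C is the volume of \<open>M\<close>, so uniform distance \<delta> changes the
    integral by at most \<delta> C. Adding 1 avoids having to show C > 0.\<close>
  define \<delta> where "\<delta> = e / (C + 1)"
  have \<delta>: "\<delta> > 0" "\<delta> * C < e"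
    using \<open>e > 0\<close> \<open>C \<ge> 0\<close> by (auto simp: \<delta>_def field_simps)
  from uniform_limitD[OF lim \<delta>(1)] f
  show "\<forall>\<^sub>F j in \<FF>. dist (vol_integral M g (f j)) (vol_integral M g l) < e"
  proof eventually_elim
    case (elim j)
    have "\<bar>f j x - l x\<bar> < \<delta>" for x
      using elim(1) by (simp add: dist_real_def)
    then have "f j x \<le> \<delta> * 1 + l x" "l x \<le> \<delta> * 1 + f j x" for x
      by (smt (verit, best))+
    then have "vol_integral M g (f j) \<le> vol_integral M g (\<lambda>x. \<delta> * 1 + l x)"
      "vol_integral M g l \<le> vol_integral M g (\<lambda>x. \<delta> * 1 + f j x)"
      using elim(2) l by (auto intro!: vol_integral_mono continuous_intros)
    then have "vol_integral M g (f j) \<le> \<delta> * C + vol_integral M g l" "vol_integral M g l \<le> \<delta> * C + vol_integral M g (f j)"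
      unfolding C_def using vol_integral_linear[OF one l, of \<delta>] vol_integral_linear[OF one elim(2), of \<delta>] by simp_all
    with \<delta>(2) show ?case
      by (simp add: dist_real_def)
  qed
qed

end


section \<open>The \<open>L\<^sup>2\<close> metric and its exponential map\<close>

definition sform :: "real \<Rightarrow> 'r::finite cmat \<Rightarrow> 'r cmat \<Rightarrow> real" where
  "sform a A B = Re (trace (A ** B)) + a * Re (trace A * trace B)"

lemma trace_scaleR: "trace (r *\<^sub>R A) = r *\<^sub>R trace (A :: 'r::finite cmat)"
  and trace_minus: "trace (- A) = - trace (A :: 'r::finite cmat)"
  by (simp_all add: trace_def scaleR_sum_right sum_negf)

lemma bounded_linear_trace: "bounded_linear (trace :: 'r::finite cmat \<Rightarrow> complex)"
  unfolding linear_conv_bounded_linear [symmetric] by (intro linearI) (auto simp: trace_add trace_scaleR)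

lemma sform_diff_left: "sform a (A - B) C = sform a A C - sform a B C"
  and sform_diff_right: "sform a A (B - C) = sform a A B - sform a A C"
  and sform_scaleR_left: "sform a (r *\<^sub>R A) C = r * sform a A C"
  and sform_scaleR_right: "sform a A (r *\<^sub>R C) = r * sform a A C"
  and sform_minus_left: "sform a (- A) C = - sform a A C"
  and sform_minus_right: "sform a A (- C) = - sform a A C"
  by (simp_all add: sform_def matrix_mult.add_left matrix_mult.diff_left matrix_mult.diff_right trace_add trace_sub
      trace_scaleR trace_minus matrix_mult.scaleR_left matrix_mult.scaleR_right matrix_mult.minus_left
      matrix_mult.minus_right algebra_simps)

text \<open>The spray equation at one point, with A = h^-1 v and L = h^-1 l. Varying h in direction
  l changes h^-1 v by -LA, and the spray corresponds to A ** A. By cyclicity of the trace all cubic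
  traces agree, and the terms with tr A tr(AL) cancel.\<close>

lemma sform_spray:
  "sform a (A ** A) L = 1 / 2 * (sform a (- (L ** A)) A + sform a A (- (L ** A)))
     - (sform a (- (A ** A)) L + sform a A (- (A ** L)))"
proof -
  have "trace (L ** A ** A) = trace (A ** A ** L)" "trace (A ** (L ** A)) = trace (A ** A ** L)"
    "trace (A ** (A ** L)) = trace (A ** A ** L)" "trace (L ** A) = trace (A ** L)"
    by (metis matrix_mul_assoc trace_mul_sym)+
  then show ?thesis
    unfolding sform_minus_left sform_minus_right unfolding sform_def by (simp add: algebra_simps)
qed

text \<open>H^-1 W has real eigenvalues d i, so the value is the sum of their squares plus a times
  the square of their sum. Cauchy-Schwarz bounds the latter square by r times the sum of squares,
  and a > -1/r leaves a positive factor.\<close>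

lemma sform_posdef:
  fixes H W :: "'r::finite cmat"
  assumes H: "posdef H" and W: "adj W = W" and a: "a > - 1 / real CARD('r)"
  shows "0 \<le> sform a (matrix_inv H ** W) (matrix_inv H ** W)"
    and "sform a (matrix_inv H ** W) (matrix_inv H ** W) = 0 \<Longrightarrow> W = 0"
proof -
  obtain P :: "'r cmat" and d where P: "diagonalizes P d H W"
    using simultaneous_diagonalization[OF H W] .
  define Q where "Q = matrix_inv P"
  have iP: "invertible P" and PH: "P ** H ** adj P = mat 1" and PW: "P ** W ** adj P = diag d"
    using P by (auto simp: diagonalizes_def)
  have QP: "Q ** P = mat 1" "P ** Q = mat 1" "adj P ** adj Q = mat 1" "adj Q ** adj P = mat 1"
    using iP by (simp_all add: Q_def flip: adj_mult)
  have "P ** (H ** (adj P ** P)) ** Q = P ** H ** adj P ** (P ** Q)"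
    by (simp only: matrix_mul_assoc)
  also have "\<dots> = mat 1"
    by (simp add: PH QP)
  finally have "Q ** (P ** (H ** (adj P ** P)) ** Q) ** P = Q ** P"
    by simp
  moreover have "Q ** (P ** (H ** (adj P ** P)) ** Q) ** P = (Q ** P) ** (H ** (adj P ** P)) ** (Q ** P)"
    by (simp only: matrix_mul_assoc)
  ultimately have "H ** (adj P ** P) = mat 1"
    by (simp add: QP)
  then have Hi: "matrix_inv H = adj P ** P"
    by (rule matrix_inv_eqI)
  define A where "A = matrix_inv H ** W"
  have A: "A = adj P ** diag d ** adj Q"
  proof -
    have "adj P ** diag d ** adj Q = (adj P ** P) ** W ** (adj P ** adj Q)"
      unfolding PW [symmetric] by (simp only: matrix_mul_assoc)
    then show ?thesis
      by (simp add: A_def Hi QP)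
  qed
  have tr: "trace (adj P ** D ** adj Q) = trace D" for D
  proof -
    have "trace (adj P ** D ** adj Q) = trace (adj Q ** (adj P ** D))"
      by (rule trace_mul_sym)
    also have "\<dots> = trace ((adj Q ** adj P) ** D)"
      by (simp only: matrix_mul_assoc)
    finally show ?thesis
      by (simp add: QP)
  qed
  have AA: "A ** A = adj P ** diag (\<lambda>i. d i * d i) ** adj Q"
  proof -
    have "A ** A = adj P ** diag d ** (adj Q ** adj P) ** diag d ** adj Q"
      unfolding A by (simp only: matrix_mul_assoc)
    also have "\<dots> = adj P ** (diag d ** diag d) ** adj Q"
      by (simp add: QP matrix_mul_assoc)
    finally show ?thesis
      by (simp add: diag_mult)
  qed
  define s2 s1 where "s2 = (\<Sum>i\<in>UNIV. d i * d i)" and "s1 = (\<Sum>i\<in>UNIV. d i)"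
  have "trace (diag e) = complex_of_real (\<Sum>i\<in>UNIV. e i)" for e :: "'r \<Rightarrow> real"
    by (simp add: trace_def diag_nth)
  then have sf: "sform a A A = s2 + a * (s1 * s1)"
    unfolding sform_def AA tr by (simp add: A tr s1_def s2_def del: of_real_sum)
  have cs: "s1 * s1 \<le> real CARD('r) * s2"
  proof -
    have "(\<Sum>i\<in>UNIV. 1 * d i)\<^sup>2 \<le> (\<Sum>i\<in>(UNIV :: 'r set). 1\<^sup>2) * (\<Sum>i\<in>UNIV. (d i)\<^sup>2)"
      by (rule Cauchy_Schwarz_ineq_sum)
    then show ?thesis
      by (simp add: s1_def s2_def power2_eq_square)
  qed
  have s2: "0 \<le> s2"
    unfolding s2_def by (intro sum_nonneg) simp
  \<comment> \<open>Cauchy-Schwarz bounds the square of the sum from above, which helps only under a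
    nonpositive factor; for a > 0 that term is dropped by taking b = 0.\<close>
  define b where "b = min a 0"
  have b: "b \<le> 0" "b \<le> a" "0 < 1 + b * real CARD('r)"
    using a by (auto simp: b_def min_def field_simps)
  have "(1 + b * real CARD('r)) * s2 = s2 + b * (real CARD('r) * s2)"
    by (simp add: algebra_simps)
  also have "\<dots> \<le> s2 + b * (s1 * s1)"
    using b(1) cs by (intro add_left_mono mult_left_mono_neg) auto
  also have "\<dots> \<le> s2 + a * (s1 * s1)"
    using b(2) by (intro add_left_mono mult_right_mono) auto
  finally have ge: "(1 + b * real CARD('r)) * s2 \<le> sform a A A"
    by (simp add: sf)
  with b(3) s2 show "0 \<le> sform a (matrix_inv H ** W) (matrix_inv H ** W)"
    unfolding A_def by (meson mult_nonneg_nonneg less_imp_le order_trans)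
  assume "sform a (matrix_inv H ** W) (matrix_inv H ** W) = 0"
  then have "(1 + b * real CARD('r)) * s2 \<le> 0"
    using ge by (simp add: A_def)
  then have "s2 = 0"
    using b(3) s2 by (simp add: mult_le_0_iff)
  then have "d i * d i = 0" for i
    unfolding s2_def by (subst (asm) sum_nonneg_eq_0_iff) auto
  then have "P ** W ** adj P = P ** 0 ** adj P"
    unfolding PW by (simp add: vec_eq_iff diag_nth matrix_mult.zero_left matrix_mult.zero_right)
  then show "W = 0"
    using invertible_congr_cancel[OF iP] by blast
qed

section \<open>The metric as an integral of a pointwise form\<close>

locale L2_bundle = riem_bundle M E g
  for M :: "'m::t2_space manifold" and E :: "('m, 'v::ab_group_add, 'r::finite) vector_bundle" and g :: "'m metric_coeffs" +
  fixes \<alpha> :: "'m \<Rightarrow> real"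
  assumes \<alpha>_smooth: "smooth_fun_on M UNIV \<alpha>"
    and \<alpha>_bound: "\<forall>x. \<alpha> x > - 1 / real CARD('r)"
begin

lemma \<alpha>_clim:
  assumes p: "patch U \<phi> W \<tau>"
  shows "clim n (\<phi> ` (U \<inter> W)) 0 (\<lambda>_ _ y. \<alpha> (inv_into U \<phi> y)) (\<lambda>_ y. \<alpha> (inv_into U \<phi> y)) \<FF>"
proof -
  interpret coord_open n "\<phi> ` (U \<inter> W)"
    by (rule patch_open[OF p])
  have "smooth_coord n (\<phi> ` (UNIV \<inter> U)) (\<alpha> \<circ> inv_into U \<phi>)"
    using \<alpha>_smooth p unfolding smooth_fun_on_def patch_def by blast
  from this[unfolded smooth_coord_def, rule_format, of "[]"]
  have "continuous_on (\<phi> ` U) (\<lambda>y. \<alpha> (inv_into U \<phi> y))"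
    by (simp add: comp_def)
  then have "continuous_on (\<phi> ` (U \<inter> W)) (\<lambda>y. \<alpha> (inv_into U \<phi> y))"
    by (rule continuous_on_subset) auto
  then show ?thesis
    by (simp add: lulim_const jcont_no_param)
qed

lemma sform_clim:
  assumes p: "patch U \<phi> W \<tau>"
    and A: "clim n (\<phi> ` (U \<inter> W)) 0 A A0 \<FF>" and B: "clim n (\<phi> ` (U \<inter> W)) 0 B B0 \<FF>"
  shows "clim n (\<phi> ` (U \<inter> W)) 0 (\<lambda>j s y. sform (\<alpha> (inv_into U \<phi> y)) (A j s y) (B j s y))
    (\<lambda>s y. sform (\<alpha> (inv_into U \<phi> y)) (A0 s y) (B0 s y)) \<FF>"
proof -
  interpret coord_open n "\<phi> ` (U \<inter> W)"
    by (rule patch_open[OF p])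
  note tr = clim_linear[OF bounded_linear_trace]
  note re = clim_linear[OF bounded_linear_Re]
  show ?thesis
    unfolding sform_def
    by (rule clim_add[OF re[OF tr[OF matrix_mult.clim_bilinear[OF coord_open_axioms A B]]]
          bounded_bilinear.clim_bilinear[OF bounded_bilinear_mult coord_open_axioms \<alpha>_clim[OF p]
            re[OF bounded_bilinear.clim_bilinear[OF bounded_bilinear_mult coord_open_axioms tr[OF A] tr[OF B]]]]])
qed

definition endo :: "('m, 'v) form_section \<Rightarrow> ('m, 'v) form_section \<Rightarrow> 'm \<Rightarrow> ('m \<Rightarrow> 'v \<Rightarrow> complex ^ 'r) \<Rightarrow> 'r cmat" where
  "endo h v x \<tau> = matrix_inv (fmat E \<tau> x (h x)) ** fmat E \<tau> x (v x)"

definition lfun :: "('m, 'v) form_section \<Rightarrow> ('m, 'v) form_section \<Rightarrow> ('m, 'v) form_section \<Rightarrow> 'm \<Rightarrow> real" where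
  "lfun h v w x = sform (\<alpha> x) (endo h v x (triv_at x)) (endo h w x (triv_at x))"

text \<open>The product rule for \<open>lfun\<close> when h moves in direction l: the derivative of
  h^-1 v is -(h^-1 l)(h^-1 v).\<close>

definition dlfun :: "('m, 'v) form_section \<Rightarrow> ('m, 'v) form_section \<Rightarrow> ('m, 'v) form_section \<Rightarrow> ('m, 'v) form_section \<Rightarrow> 'm \<Rightarrow> real" where
  "dlfun h l v w x = sform (\<alpha> x) (- (endo h l x (triv_at x) ** endo h v x (triv_at x))) (endo h w x (triv_at x))
     + sform (\<alpha> x) (endo h v x (triv_at x)) (- (endo h l x (triv_at x) ** endo h w x (triv_at x)))"

lemma endo_change:
  assumes h: "h \<in> \<Gamma>p" and W: "(W, \<tau>) \<in> trivs E" "x \<in> W"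
  obtains R :: "'r cmat" where "invertible R"
    "\<And>v. v \<in> \<Gamma> \<Longrightarrow> endo h v x \<tau> = matrix_inv R ** endo h v x (triv_at x) ** R"
proof -
  obtain S where S: "invertible S"
    "\<And>v. v \<in> herm_form E x \<Longrightarrow> fmat E \<tau> x v = S ** fmat E (triv_at x) x v ** adj S"
    using change_triv_at[OF W] by metis
  let ?H = "fmat E (triv_at x) x (h x)"
  have H: "invertible ?H"
    by (intro posdef_invertible fmat_posdef h trivialized_triv_at)
  have S': "invertible (adj S)"
    using S by simp
  have i: "matrix_inv (S ** ?H ** adj S) = matrix_inv (adj S) ** matrix_inv ?H ** matrix_inv S"
    using S H S' by (intro matrix_inv_eqI(2)) (simp add: matrix_mul_assoc [symmetric])
  have hh: "h x \<in> herm_form E x"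
    using h pos_Herm_sections_subset Herm_sectionsD by blast
  have "endo h v x \<tau> = matrix_inv (adj S) ** endo h v x (triv_at x) ** adj S" if "v \<in> \<Gamma>" for v
    using S(1) unfolding endo_def S(2)[OF hh] S(2)[OF Herm_sectionsD[OF that]] i
    by (simp add: matrix_mul_assoc [symmetric])
  with S' show thesis
    by (rule that)
qed

lemma sform_conj:
  fixes R A B :: "'r cmat"
  assumes "invertible R"
  shows "sform a (matrix_inv R ** A ** R) (matrix_inv R ** B ** R) = sform a A B"
proof -
  have tr: "trace (matrix_inv R ** A ** R) = trace A" for A :: "'r cmat"
  proof -
    have "trace (matrix_inv R ** A ** R) = trace (R ** (matrix_inv R ** A))"
      by (rule trace_mul_sym)
    then show ?thesis
      using assms by simp
  qed
  have "matrix_inv R ** A ** R ** (matrix_inv R ** B ** R) = matrix_inv R ** (A ** B) ** R"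
    using assms by (simp add: matrix_mul_assoc [symmetric])
  then show ?thesis
    by (simp add: sform_def tr)
qed

text \<open>\<open>triv_at\<close> may jump from point to point. Changing the trivialization
  conjugates \<open>endo\<close>, and traces do not notice, so a trivialization that is smooth near
  x can be used for continuity and differentiation.\<close>

lemma lfun_triv:
  assumes h: "h \<in> \<Gamma>p" and v: "v \<in> \<Gamma>" "w \<in> \<Gamma>" "l \<in> \<Gamma>" and W: "(W, \<tau>) \<in> trivs E" "x \<in> W"
  shows "lfun h v w x = sform (\<alpha> x) (endo h v x \<tau>) (endo h w x \<tau>)"
    and "dlfun h l v w x = sform (\<alpha> x) (- (endo h l x \<tau> ** endo h v x \<tau>)) (endo h w x \<tau>)
     + sform (\<alpha> x) (endo h v x \<tau>) (- (endo h l x \<tau> ** endo h w x \<tau>))"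
proof -
  obtain R where R: "invertible R" "\<And>v. v \<in> \<Gamma> \<Longrightarrow> endo h v x \<tau> = matrix_inv R ** endo h v x (triv_at x) ** R"
    using endo_change[OF h W] by metis
  have m: "- (matrix_inv R ** A ** R ** (matrix_inv R ** B ** R)) = matrix_inv R ** (- (A ** B)) ** R" for A B
    using R(1) by (simp add: matrix_mul_assoc [symmetric] matrix_mult.minus_left matrix_mult.minus_right)
  show "lfun h v w x = sform (\<alpha> x) (endo h v x \<tau>) (endo h w x \<tau>)"
    "dlfun h l v w x = sform (\<alpha> x) (- (endo h l x \<tau> ** endo h v x \<tau>)) (endo h w x \<tau>)
     + sform (\<alpha> x) (endo h v x \<tau>) (- (endo h l x \<tau> ** endo h w x \<tau>))"
    unfolding lfun_def dlfun_def R(2)[OF v(1)] R(2)[OF v(2)] R(2)[OF v(3)] m sform_conj[OF R(1)] by simp_all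
qed

text \<open>The matrix of h^-1 v is the entrywise conjugate of \<open>endo\<close>, as forms are
  conjugate-linear in the second argument. Conjugation respects products and conjugates traces,
  which real parts do not see.\<close>

lemma L2_metric_eq:
  assumes h: "h \<in> \<Gamma>p" and v: "v \<in> \<Gamma>" "w \<in> \<Gamma>"
  shows "L2_metric M E g \<alpha> h v w = vol_integral M g (lfun h v w)"
proof -
  have "Re (fiber_trace E x (inv_mult E h v x \<circ> inv_mult E h w x) +
         complex_of_real (\<alpha> x) * fiber_trace E x (inv_mult E h v x) * fiber_trace E x (inv_mult E h w x)) = lfun h v w x" for x
  proof -
    interpret trivialized E "triv_at x" x
      by (rule trivialized_triv_at)
    define C :: "'r cmat \<Rightarrow> 'r cmat" where "C = (\<lambda>A. \<chi> i j. cnj (A $ i $ j))"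
    have C: "C A *v p = (\<chi> i. \<Sum>j\<in>UNIV. cnj (A $ i $ j) * p $ j)" for A p
      by (simp add: C_def matrix_vector_mult_def)
    have im: "inv_mult E h u x b \<in> fiber E x" "triv_at x x (inv_mult E h u x b) = C (endo h u x (triv_at x)) *v triv_at x x b"
      if "u \<in> \<Gamma>" "b \<in> fiber E x" for u b
      using inv_mult_eq[of h u b] pos_Herm_sectionsD[OF h] Herm_sectionsD[OF that(1)] that(2) by (simp_all add: C endo_def)
    have t1: "fiber_trace E x (inv_mult E h u x) = trace (C (endo h u x (triv_at x)))" if "u \<in> \<Gamma>" for u
      by (rule fiber_trace_eq) (use im that in auto)
    have t2: "fiber_trace E x (inv_mult E h v x \<circ> inv_mult E h w x)
        = trace (C (endo h v x (triv_at x)) ** C (endo h w x (triv_at x)))"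
      by (rule fiber_trace_eq) (use im v in \<open>auto simp: matrix_vector_mul_assoc\<close>)
    have "C A ** C B = C (A ** B)" "trace (C A) = cnj (trace A)" for A B
      by (simp_all add: C_def vec_eq_iff matrix_matrix_mult_def trace_def)
    then show ?thesis
      using v by (simp add: t1 t2 lfun_def sform_def mult.assoc)
  qed
  then show ?thesis
    by (simp add: L2_metric_def)
qed

lemma endo_clim:
  assumes h: "h \<in> \<Gamma>p" and v: "v \<in> \<Gamma>" and p: "patch U \<phi> W \<tau>"
  shows "clim n (\<phi> ` (U \<inter> W)) 0 (\<lambda>_ _ y. endo h v (inv_into U \<phi> y) \<tau>) (\<lambda>_ y. endo h v (inv_into U \<phi> y) \<tau>) \<FF>"
proof -
  interpret coord_open n "\<phi> ` (U \<inter> W)"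
    by (rule patch_open[OF p])
  have h\<Gamma>: "h \<in> \<Gamma>"
    using h pos_Herm_sections_subset by blast
  have inv: "invertible (mrep E U \<phi> \<tau> h y)" if "y \<in> \<phi> ` (U \<inter> W)" for y
    by (rule posdef_invertible[OF mrep_posdef[OF h p that]])
  have "clim n (\<phi> ` (U \<inter> W)) 0 (\<lambda>_ _ y. matrix_inv (mrep E U \<phi> \<tau> h y)) (\<lambda>_ y. matrix_inv (mrep E U \<phi> \<tau> h y)) \<FF>"
    by (rule clim_matrix_inv[OF Herm_sections_clim[OF h\<Gamma> p]]) (use inv in auto)
  from matrix_mult.clim_bilinear[OF coord_open_axioms this Herm_sections_clim[OF v p]] show ?thesis
    by (simp only: endo_def mrep_def)
qed

lemma continuous_from_patches:
  fixes f :: "'m \<Rightarrow> real"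
  assumes "\<And>U \<phi> W \<tau>. patch U \<phi> W \<tau> \<Longrightarrow> continuous_on (\<phi> ` (U \<inter> W)) (\<lambda>y. f (inv_into U \<phi> y))"
  shows "continuous_on UNIV f"
  unfolding continuous_on_eq_continuous_at[OF open_UNIV]
proof
  fix x :: 'm
  obtain U \<phi> W \<tau> where p: "patch U \<phi> W \<tau>" "x \<in> U" "x \<in> W"
    by (rule patch_cover)
  then have c: "(U, \<phi>) \<in> atlas M"
    by (simp add: patch_def)
  have o: "open (U \<inter> W)"
    using chart(1)[OF c] open_triv p(1) unfolding patch_def by blast
  have "continuous_on (U \<inter> W) \<phi>"
    using chart_inv(2)[OF c] by (rule continuous_on_subset) auto
  from continuous_on_compose2[OF assms[OF p(1)] this]
  have "continuous_on (U \<inter> W) (\<lambda>x. f (inv_into U \<phi> (\<phi> x)))"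
    by blast
  then have "continuous_on (U \<inter> W) f"
    by (rule continuous_on_eq) (simp add: chart_inv(1)[OF c])
  then show "isCont f x"
    using o p by (simp add: continuous_on_eq_continuous_at)
qed

lemma lfun_continuous:
  assumes h: "h \<in> \<Gamma>p" and v: "v \<in> \<Gamma>" "w \<in> \<Gamma>" "l \<in> \<Gamma>"
  shows "continuous_on UNIV (lfun h v w)" "continuous_on UNIV (dlfun h l v w)"
proof -
  {
    fix U \<phi> W \<tau> assume p: "patch U \<phi> W \<tau>"
    interpret coord_open n "\<phi> ` (U \<inter> W)"
      by (rule patch_open[OF p])
    note e = endo_clim[OF h _ p, where \<FF> = "bot :: unit filter"]
    note eq = lfun_triv[OF h v] p[unfolded patch_def]
    have jc: "continuous_on (\<phi> ` (U \<inter> W)) u" if "clim n (\<phi> ` (U \<inter> W)) 0 f (\<lambda>_. u) (bot :: unit filter)"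
      for f and u :: "(nat \<Rightarrow> real) \<Rightarrow> real"
      using that by (simp add: lulim_def jcont_no_param)
    have "continuous_on (\<phi> ` (U \<inter> W)) (\<lambda>y. sform (\<alpha> (inv_into U \<phi> y)) (endo h v (inv_into U \<phi> y) \<tau>) (endo h w (inv_into U \<phi> y) \<tau>))"
      by (rule jc[OF sform_clim[OF p e[OF v(1)] e[OF v(2)]]])
    then have "continuous_on (\<phi> ` (U \<inter> W)) (\<lambda>y. lfun h v w (inv_into U \<phi> y))"
      by (rule continuous_on_eq) (use lfun_triv(1)[OF h v] p patch_points[OF p] in \<open>auto simp: patch_def\<close>)
    note c1 = this
    have "continuous_on (\<phi> ` (U \<inter> W)) (\<lambda>y. sform (\<alpha> (inv_into U \<phi> y))
        (- (endo h l (inv_into U \<phi> y) \<tau> ** endo h v (inv_into U \<phi> y) \<tau>)) (endo h w (inv_into U \<phi> y) \<tau>)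
       + sform (\<alpha> (inv_into U \<phi> y)) (endo h v (inv_into U \<phi> y) \<tau>)
        (- (endo h l (inv_into U \<phi> y) \<tau> ** endo h w (inv_into U \<phi> y) \<tau>)))"
      by (rule jc[OF clim_add[OF
            sform_clim[OF p clim_linear[OF bounded_linear_minus[OF bounded_linear_ident]
              matrix_mult.clim_bilinear[OF coord_open_axioms e[OF v(3)] e[OF v(1)]]] e[OF v(2)]]
            sform_clim[OF p e[OF v(1)] clim_linear[OF bounded_linear_minus[OF bounded_linear_ident]
              matrix_mult.clim_bilinear[OF coord_open_axioms e[OF v(3)] e[OF v(2)]]]]]])
    then have "continuous_on (\<phi> ` (U \<inter> W)) (\<lambda>y. dlfun h l v w (inv_into U \<phi> y))"
      by (rule continuous_on_eq) (use lfun_triv(2)[OF h v] p patch_points[OF p] in \<open>auto simp: patch_def\<close>)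
    note c1 this
  } note c = this
  show "continuous_on UNIV (lfun h v w)" "continuous_on UNIV (dlfun h l v w)"
    by (rule continuous_from_patches, rule c, assumption)+
qed

text \<open>Convergence must be uniform on \<open>M\<close> to pass under the integral. It is proved
  on compact neighborhoods in single patches and assembled by \<open>eventually_all_pointsI\<close>;
  order 0 of \<open>clim\<close> suffices.\<close>

lemma lfun_difference_quotient:
  assumes h: "h \<in> \<Gamma>p" and v: "v \<in> \<Gamma>" "w \<in> \<Gamma>" "l \<in> \<Gamma>"
  shows "uniform_limit UNIV (\<lambda>t x. (lfun (h + t *\<^sub>R l) v w x - lfun h v w x) / t) (dlfun h l v w) (at 0)"
proof (rule uniform_limitI)
  fix \<epsilon> :: real assume "\<epsilon> > 0"
  have h\<Gamma>: "h \<in> \<Gamma>"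
    using h pos_Herm_sections_subset by blast
  have ev: "\<forall>\<^sub>F t in at 0. h + t *\<^sub>R l \<in> \<Gamma>p"
    by (rule pos_Herm_sections_line[OF h v(3)])
  have "\<forall>\<^sub>F t in at 0. \<forall>x. dist ((lfun (h + t *\<^sub>R l) v w x - lfun h v w x) / t) (dlfun h l v w x) < \<epsilon>"
  proof (rule eventually_all_pointsI)
    fix x
    obtain U \<phi> W \<tau> N K where p: "patch U \<phi> W \<tau>" and N: "open N" "compact K" "x \<in> N" "N \<subseteq> K" "K \<subseteq> U \<inter> W"
      "compact (\<phi> ` K)" "\<phi> ` K \<subseteq> \<phi> ` (U \<inter> W)"
      by (rule patch_neighborhood)
    interpret coord_open n "\<phi> ` (U \<inter> W)"
      by (rule patch_open[OF p])
    let ?W = "\<phi> ` (U \<inter> W)" and ?i = "inv_into U \<phi>"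
    note e = endo_clim[OF h _ p]
    \<comment> \<open>k^-1 v as a rational expression in the moving metric k, so that the limits of
      expressions proved for sections apply.\<close>
    define ex where "ex = (\<lambda>v. Times (Inv (Pt (\<lambda>k. k))) (Cst v) :: (('m, 'v) form_section, ('m, 'v) form_section) ratex)"
    have R: "reval (mrep E U \<phi> \<tau>) (ex u) k \<eta> s y = endo k u (?i y) \<tau>" for u k \<eta> s y
      by (simp add: ex_def endo_def mrep_def)
    have wf: "sec.wf_ratex (ex u)" "sec.defined_on \<Gamma>p (ex u)" "dirs_below 0 (ex u)" if "u \<in> \<Gamma>" for u
      using that linear_atom_ident mrep_posdef by (auto simp: ex_def intro!: posdef_invertible)
    have l: "l \<in> topspace \<X>" "h \<in> topspace \<X>"
      using v h\<Gamma> by (simp_all add: topspace_Cinf)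
    have mv: "clim n ?W 0 (\<lambda>t s y. endo (h + t *\<^sub>R l) u (?i y) \<tau>) (\<lambda>s y. endo h u (?i y) \<tau>) (at 0)" if "u \<in> \<Gamma>" for u
      using sec.reval_clim[OF openin_pos_Herm_sections p wf[OF that] limitin_Cinf_line[OF h\<Gamma> v(3)] h, where m = 0 and \<eta> = "\<lambda>_ _. 0" and \<eta>0 = "\<lambda>_. 0"]
      by (simp add: R[abs_def])
    have dq: "clim n ?W 0 (\<lambda>t s y. (endo (h + t *\<^sub>R l) u (?i y) \<tau> - endo h u (?i y) \<tau>) /\<^sub>R t)
        (\<lambda>s y. - (endo h l (?i y) \<tau> ** endo h u (?i y) \<tau>)) (at 0)" if u: "u \<in> \<Gamma>" for u
    proof -
      have neg: "mat (- 1) ** A = - (A :: 'r cmat)" for A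
        by (simp add: vec_eq_iff mat_mult_nth)
      have "mat 0 = (0 :: 'r cmat)"
        by (simp add: mat_def vec_eq_iff)
      then have d: "reval (mrep E U \<phi> \<tau>) (rderiv 0 (ex u)) h (\<lambda>_. l) s y = - (endo h l (?i y) \<tau> ** endo h u (?i y) \<tau>)" for s y
        by (simp add: ex_def endo_def mrep_def neg matrix_mult.minus_left matrix_mul_assoc matrix_mult.zero_right)
      show ?thesis
        using sec.reval_difference_quotient[where \<eta> = "\<lambda>_. l" and k = 0 and m = 0, OF openin_pos_Herm_sections p wf[OF u] h l(1)]
        unfolding R[abs_def] d[abs_def] by simp
    qed
    \<comment> \<open>The difference quotient of the bilinear \<open>sform\<close>: the first term
      keeps its second factor at the moving metric, the second term keeps its first factor at
      h.\<close>
    let ?q = "\<lambda>t s y. sform (\<alpha> (?i y)) ((endo (h + t *\<^sub>R l) v (?i y) \<tau> - endo h v (?i y) \<tau>) /\<^sub>R t) (endo (h + t *\<^sub>R l) w (?i y) \<tau>)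
      + sform (\<alpha> (?i y)) (endo h v (?i y) \<tau>) ((endo (h + t *\<^sub>R l) w (?i y) \<tau> - endo h w (?i y) \<tau>) /\<^sub>R t)"
    let ?d = "\<lambda>y. sform (\<alpha> (?i y)) (- (endo h l (?i y) \<tau> ** endo h v (?i y) \<tau>)) (endo h w (?i y) \<tau>)
       + sform (\<alpha> (?i y)) (endo h v (?i y) \<tau>) (- (endo h l (?i y) \<tau> ** endo h w (?i y) \<tau>))"
    have "clim n ?W 0 ?q (\<lambda>_. ?d) (at (0::real))"
      by (rule clim_add[OF sform_clim[OF p dq[OF v(1)] mv[OF v(2)]] sform_clim[OF p e[OF v(1)] dq[OF v(2)]]])
    then have "uniform_limit ({0..1::real} \<times> \<phi> ` K) (\<lambda>t (s, y). ?q t s y) (\<lambda>(s, y). ?d y) (at (0::real))"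
      using N(6,7) by (simp add: lulim_def)
    from uniform_limitD[OF this \<open>\<epsilon> > 0\<close>] ev
    have "\<forall>\<^sub>F t in at 0. \<forall>z\<in>N. dist ((lfun (h + t *\<^sub>R l) v w z - lfun h v w z) / t) (dlfun h l v w z) < \<epsilon>"
    proof eventually_elim
      case (elim t)
      show ?case
      proof
        fix z assume "z \<in> N"
        then have z: "z \<in> U" "z \<in> W" "z \<in> K"
          using N by auto
        have iz: "?i (\<phi> z) = z"
          using chart_inv(1)[of U \<phi> z] p z(1) unfolding patch_def by blast
        have W: "(W, \<tau>) \<in> trivs E"
          using p by (simp add: patch_def)
        have "dist (?q t 0 (\<phi> z)) (?d (\<phi> z)) < \<epsilon>"
          using elim(1) z(3) by force
        moreover have "?q t 0 (\<phi> z) = (lfun (h + t *\<^sub>R l) v w z - lfun h v w z) / t"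
          unfolding iz lfun_triv(1)[OF elim(2) v W z(2)] lfun_triv(1)[OF h v W z(2)]
          by (simp add: sform_diff_left sform_diff_right sform_scaleR_left sform_scaleR_right divide_inverse algebra_simps)
        moreover have "?d (\<phi> z) = dlfun h l v w z"
          unfolding iz lfun_triv(2)[OF h v W z(2)] ..
        ultimately show "dist ((lfun (h + t *\<^sub>R l) v w z - lfun h v w z) / t) (dlfun h l v w z) < \<epsilon>"
          by simp
      qed
    qed
    then show "\<exists>N. open N \<and> x \<in> N \<and> (\<forall>\<^sub>F t in at 0. \<forall>z\<in>N.
        dist ((lfun (h + t *\<^sub>R l) v w z - lfun h v w z) / t) (dlfun h l v w z) < \<epsilon>)"
      using N(1,3) by blast
  qed
  then show "\<forall>\<^sub>F t in at 0. \<forall>x\<in>UNIV. dist ((lfun (h + t *\<^sub>R l) v w x - lfun h v w x) / t) (dlfun h l v w x) < \<epsilon>"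
    by simp
qed

section \<open>Derivative of the metric and the spray equation\<close>

lemma vol_integral_lin2:
  assumes "continuous_on UNIV f" "continuous_on UNIV f'"
  shows "vol_integral M g (\<lambda>x. a * f x - b * f' x) = a * vol_integral M g f - b * vol_integral M g f'"
proof -
  have "vol_integral M g (\<lambda>x. a * f x + (- b) * f' x) = a * vol_integral M g f + vol_integral M g (\<lambda>x. (- b) * f' x)"
    by (rule vol_integral_linear[OF assms(1)]) (intro continuous_intros assms(2))
  also have "vol_integral M g (\<lambda>x. (- b) * f' x) = (- b) * vol_integral M g f'"
    using vol_integral_linear[OF assms(2) continuous_on_const, of "- b" 0]
      vol_integral_linear[OF continuous_on_const continuous_on_const, of 1 0 0] by simp
  finally show ?thesis
    by simp
qed

text \<open>The metric is controlled only at positive forms, but h + tl is positive for small t.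
  Uniform convergence of the integrands then gives the derivative, and uniqueness of real limits
  identifies \<open>mb_deriv\<close>.\<close>

lemma L2_metric_deriv:
  assumes h: "h \<in> \<Gamma>p" and v: "v \<in> \<Gamma>" "w \<in> \<Gamma>" "l \<in> \<Gamma>"
  shows "mb_deriv euclideanreal (\<lambda>k. L2_metric M E g \<alpha> k v w) h l = vol_integral M g (dlfun h l v w)"
proof -
  have ev: "\<forall>\<^sub>F t in at 0. h + t *\<^sub>R l \<in> \<Gamma>p"
    by (rule pos_Herm_sections_line[OF h v(3)])
  have cq: "continuous_on UNIV (\<lambda>x. (lfun (h + t *\<^sub>R l) v w x - lfun h v w x) / t)" if "h + t *\<^sub>R l \<in> \<Gamma>p" for t
    unfolding divide_inverse by (intro continuous_intros lfun_continuous(1)[OF that v] lfun_continuous(1)[OF h v])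
  have "\<forall>\<^sub>F t in at 0. continuous_on UNIV (\<lambda>x. (lfun (h + t *\<^sub>R l) v w x - lfun h v w x) / t)"
    using ev by eventually_elim (rule cq)
  then have "((\<lambda>t. vol_integral M g (\<lambda>x. (lfun (h + t *\<^sub>R l) v w x - lfun h v w x) / t))
      \<longlongrightarrow> vol_integral M g (dlfun h l v w)) (at 0)"
    by (rule vol_integral_uniform_limit[OF lfun_difference_quotient[OF h v] _ lfun_continuous(2)[OF h v]])
  moreover have "\<forall>\<^sub>F t in at 0. vol_integral M g (\<lambda>x. (lfun (h + t *\<^sub>R l) v w x - lfun h v w x) / t)
      = (L2_metric M E g \<alpha> (h + t *\<^sub>R l) v w - L2_metric M E g \<alpha> h v w) /\<^sub>R t"
    using ev
  proof eventually_elim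
    case (elim t)
    have "(\<lambda>x. (lfun (h + t *\<^sub>R l) v w x - lfun h v w x) / t) = (\<lambda>x. (1 / t) * lfun (h + t *\<^sub>R l) v w x - (1 / t) * lfun h v w x)"
      by (simp add: diff_divide_distrib)
    then show ?case
      by (simp only: vol_integral_lin2[OF lfun_continuous(1)[OF elim v] lfun_continuous(1)[OF h v]]
          L2_metric_eq[OF elim v(1,2)] L2_metric_eq[OF h v(1,2)]) (simp add: divide_inverse algebra_simps)
  qed
  ultimately have "((\<lambda>t. (L2_metric M E g \<alpha> (h + t *\<^sub>R l) v w - L2_metric M E g \<alpha> h v w) /\<^sub>R t)
      \<longlongrightarrow> vol_integral M g (dlfun h l v w)) (at 0)"
    by (rule Lim_transform_eventually)
  then have d: "has_mb_deriv euclideanreal (\<lambda>k. L2_metric M E g \<alpha> k v w) h l (vol_integral M g (dlfun h l v w))"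
    by (simp add: has_mb_deriv_def limitin_canonical_iff)
  show ?thesis
    unfolding mb_deriv_def
  proof (rule the_equality[where P = "\<lambda>d. has_mb_deriv euclideanreal (\<lambda>k. L2_metric M E g \<alpha> k v w) h l d", OF d])
    fix d' assume "has_mb_deriv euclideanreal (\<lambda>k. L2_metric M E g \<alpha> k v w) h l d'"
    with d show "d' = vol_integral M g (dlfun h l v w)"
      unfolding has_mb_deriv_def limitin_canonical_iff by (rule tendsto_unique[OF at_neq_bot, rotated])
  qed
qed

lemma endo_spray:
  assumes "h \<in> \<Gamma>p" "v \<in> \<Gamma>"
  shows "endo h (spray h v v) x (triv_at x) = endo h v x (triv_at x) ** endo h v x (triv_at x)"
proof -
  have "fmat E (triv_at x) x (spray h v v x) = spray_mat (fmat E (triv_at x) x (h x)) (fmat E (triv_at x) x (v x)) (fmat E (triv_at x) x (v x))"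
    using fmat_spray[OF assms assms(2)] triv_at_mem by blast
  then show ?thesis
    by (simp add: endo_def spray_mat_diag_eq matrix_mul_assoc)
qed

text \<open>The two sides already agree under the integral: at each point the equality is
  \<open>sform_spray\<close>.\<close>

theorem spray_equation:
  assumes h: "h \<in> \<Gamma>p" and v: "v \<in> \<Gamma>" and l: "l \<in> \<Gamma>"
  shows "L2_metric M E g \<alpha> h (spray h v v) l =
    1 / 2 * mb_deriv euclideanreal (\<lambda>k. L2_metric M E g \<alpha> k v v) h l
    - mb_deriv euclideanreal (\<lambda>k. L2_metric M E g \<alpha> k v l) h v"
proof -
  have "lfun h (spray h v v) l = (\<lambda>x. 1 / 2 * dlfun h l v v x - 1 * dlfun h v v l x)"
    unfolding lfun_def dlfun_def endo_spray[OF h v] by (rule ext, subst sform_spray) simp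
  then show ?thesis
    unfolding L2_metric_deriv[OF h v v l] L2_metric_deriv[OF h v l v] L2_metric_eq[OF h spray_mem[OF h v v] l]
    using vol_integral_lin2[OF lfun_continuous(2)[OF h v v l] lfun_continuous(2)[OF h v l v], of "1 / 2" 1] by simp
qed

lemma metric_spray_spray: "is_metric_spray M E g \<alpha> spray"
  unfolding is_metric_spray_def Let_def
  by (intro conjI ballI allI spray_smooth spray_equation spray_bilinear(2) spray_bilinear(3)[where v' = v for v]
      spray_bilinear(1)[where v' = v for v])

lemma endo_diff: "endo h (v - w) x \<tau> = endo h v x \<tau> - endo h w x \<tau>"
  by (simp add: endo_def fmat_diff matrix_mult.diff_right)

text \<open>The weak metric is nondegenerate because \<open>\<alpha> > - 1 / r\<close>, hence the spray is unique on the diagonal.\<close>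

theorem metric_spray_unique:
  assumes B: "is_metric_spray M E g \<alpha> B" and h: "h \<in> \<Gamma>p" and v: "v \<in> \<Gamma>"
  shows "B h v v = spray h v v"
proof -
  have "(\<lambda>(h, v, w). B h v w) \<in> \<Gamma>p \<times> \<Gamma> \<times> \<Gamma> \<rightarrow> \<Gamma>"
    using B by (simp add: is_metric_spray_def Let_def mb_smooth_def topspace_Cinf)
  from funcset_mem[OF this, of "(h, v, v)"] have B\<Gamma>: "B h v v \<in> \<Gamma>"
    using h v by simp
  have s\<Gamma>: "spray h v v \<in> \<Gamma>"
    by (rule spray_mem[OF h v v])
  \<comment> \<open>The difference of the two sprays is also taken as the test direction, which
    yields the squared norm of u.\<close>
  define u where "u = B h v v - spray h v v"
  have u: "u \<in> \<Gamma>"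
    unfolding u_def by (rule Herm_sections_linear(2)[OF B\<Gamma> s\<Gamma>])
  have "L2_metric M E g \<alpha> h (B h v v) u = L2_metric M E g \<alpha> h (spray h v v) u"
    using B h v u spray_equation[OF h v u] by (simp add: is_metric_spray_def Let_def)
  then have "1 * vol_integral M g (lfun h (B h v v) u) - 1 * vol_integral M g (lfun h (spray h v v) u) = 0"
    by (simp add: L2_metric_eq h B\<Gamma> s\<Gamma> u)
  then have "vol_integral M g (\<lambda>x. 1 * lfun h (B h v v) u x - 1 * lfun h (spray h v v) u x) = 0"
    by (simp only: vol_integral_lin2[OF lfun_continuous(1)[OF h B\<Gamma> u u] lfun_continuous(1)[OF h s\<Gamma> u u]])
  moreover have "(\<lambda>x. 1 * lfun h (B h v v) u x - 1 * lfun h (spray h v v) u x) = lfun h u u"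
    by (rule ext) (simp add: lfun_def u_def endo_diff sform_diff_left)
  ultimately have z: "vol_integral M g (lfun h u u) = 0"
    by simp
  have pos: "0 \<le> lfun h u u x" and def: "lfun h u u x = 0 \<Longrightarrow> fmat E (triv_at x) x (u x) = 0" for x
    unfolding lfun_def endo_def
    using sform_posdef[OF fmat_posdef[OF h trivialized_triv_at] fmat_herm[OF u trivialized_triv_at]] \<alpha>_bound by blast+
  have "fmat E (triv_at x) x (u x) = 0" for x
    by (rule def, rule vol_integral_zero_imp[OF lfun_continuous(1)[OF h u u u] pos z])
  then show ?thesis
    by (intro section_eqI Herm_sectionsD[OF B\<Gamma>] Herm_sectionsD[OF s\<Gamma>]) (simp add: u_def fmat_diff)
qed

section \<open>Geodesics of the metric and the exponential map\<close>

lemma hsec_exp_geodesic: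
  assumes h: "h \<in> \<Gamma>p" and v: "v \<in> \<Gamma>"
  shows "geodesic_endpoint M E g \<alpha> h v (hsec exp h v)"
proof -
  define \<gamma> where "\<gamma> = (\<lambda>t::real. hsec exp h (t *\<^sub>R v))"
  define \<gamma>' where "\<gamma>' = (\<lambda>t. mb_deriv \<X> \<gamma> t 1)"
  have tv: "t *\<^sub>R v \<in> \<Gamma>" for t
    by (rule Herm_sections_scaleR[OF v])
  have pos: "\<gamma> t \<in> \<Gamma>p" for t
    unfolding \<gamma>_def by (rule hsec_exp_mem[OF h tv])
  \<comment> \<open>Smoothness over the real line provides both derivatives as limits in the space
    of sections; their values are then identified fiber by fiber with those of the matrix
    curve.\<close>
  have "mb_smooth euclideanreal \<X> (topspace euclideanreal) \<gamma>"
    by (rule rl.mb_smooth_hsec_exp[OF linear_atom_line[OF v] h]) (simp add: \<gamma>_def)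
  then have ex: "\<exists>d. has_mb_deriv \<X> (mb_iter \<X> \<gamma> vs) t 1 d" for vs t
    unfolding mb_smooth_def by simp
  have d1: "has_mb_deriv \<X> \<gamma> t 1 (\<gamma>' t)" for t
    using ex[of "[]" t] sec.mb_deriv_eqI unfolding \<gamma>'_def by auto
  have "mb_iter \<X> \<gamma> [1] = \<gamma>'"
    by (simp add: \<gamma>'_def)
  with ex[of "[1]"] obtain \<gamma>'' where d2: "\<And>t. has_mb_deriv \<X> \<gamma>' t 1 (\<gamma>'' t)"
    by metis
  have mem: "\<gamma>' t \<in> \<Gamma>" "\<gamma>'' t \<in> \<Gamma>" for t
    using d1 d2 by (auto simp: has_mb_deriv_def limitin_Cinf_clim)
  have pw: "fmat E (triv_at x) x (\<gamma>'' t x) = fmat E (triv_at x) x (\<gamma>' t x) ** matrix_inv (fmat E (triv_at x) x (\<gamma> t x)) ** fmat E (triv_at x) x (\<gamma>' t x)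
      \<and> fmat E (triv_at x) x (\<gamma> 0 x) = fmat E (triv_at x) x (h x) \<and> fmat E (triv_at x) x (\<gamma>' 0 x) = fmat E (triv_at x) x (v x)"
    for t x
  proof -
    let ?F = "\<lambda>v. fmat E (triv_at x) x (v x)"
    obtain W where W: "(W, triv_at x) \<in> trivs E" "x \<in> W"
      using triv_at_mem by blast
    have G: "?F (\<gamma> t) = hfun exp (?F h) (t *\<^sub>R ?F v)" for t
      unfolding \<gamma>_def fmat_hsec_at[OF h tv] by (simp add: fmat_scaleR)
    have hd: "((\<lambda>t. ?F (\<gamma> t)) has_vector_derivative ?F (\<gamma>' t)) (at t)"
      "((\<lambda>t. ?F (\<gamma>' t)) has_vector_derivative ?F (\<gamma>'' t)) (at t)" for t
      using has_mb_deriv_pointwise[OF d1 W] has_mb_deriv_pointwise[OF d2 W] by auto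
    show ?thesis
    proof (rule matrix_exponential_curve[OF fmat_posdef[OF h trivialized_triv_at] fmat_herm[OF v trivialized_triv_at]])
      fix G' G''
      assume a: "\<And>t. ((\<lambda>t. hfun exp (?F h) (t *\<^sub>R ?F v)) has_vector_derivative G' t) (at t)"
        "\<And>t. (G' has_vector_derivative G'' t) (at t)"
        "\<And>t. G'' t = G' t ** matrix_inv (hfun exp (?F h) (t *\<^sub>R ?F v)) ** G' t"
        "hfun exp (?F h) (0 *\<^sub>R ?F v) = ?F h" "G' 0 = ?F v"
      have G': "?F (\<gamma>' t) = G' t" for t
        using hd(1)[of t] a(1)[of t] unfolding G by (rule vector_derivative_unique_at)
      have "?F (\<gamma>'' t) = G'' t" for t
        using hd(2)[of t] a(2)[of t] unfolding G' by (rule vector_derivative_unique_at)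
      then show ?thesis
        using a(3-5) by (simp add: G G' del: scaleR_zero_left)
    qed
  qed
  have "\<gamma>'' t = spray (\<gamma> t) (\<gamma>' t) (\<gamma>' t)" for t
  proof (rule section_eqI[OF Herm_sectionsD[OF mem(2)] spray_herm[OF pos mem(1) mem(1)]])
    fix x
    obtain W where W: "(W, triv_at x) \<in> trivs E" "x \<in> W"
      using triv_at_mem by blast
    show "fmat E (triv_at x) x (\<gamma>'' t x) = fmat E (triv_at x) x (spray (\<gamma> t) (\<gamma>' t) (\<gamma>' t) x)"
      unfolding fmat_spray[OF pos mem(1) mem(1) W] spray_mat_diag_eq using pw by blast
  qed
  then have "is_geodesic M E g \<alpha> UNIV \<gamma>"
    unfolding is_geodesic_def
    using metric_spray_spray d1 d2 pos by (intro conjI exI[of _ spray] exI[of _ \<gamma>'] ballI) simp_all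
  moreover have "\<gamma> 0 = h" "\<gamma>' 0 = v"
    using pw h pos_Herm_sections_subset pos mem v by (auto intro!: section_eqI Herm_sectionsD)
  moreover have "\<gamma> 1 = hsec exp h v"
    by (simp add: \<gamma>_def)
  ultimately show ?thesis
    unfolding geodesic_endpoint_def using d1[of 0] by (intro exI[of _ UNIV] exI[of _ \<gamma>]) simp
qed

text \<open>The spray B of a geodesic is an arbitrary metric spray, but the equation evaluates it on
  the diagonal only, where \<open>metric_spray_unique\<close> applies. Evaluation at x gives a
  matrix geodesic, whose endpoint is known.\<close>

lemma geodesic_endpoint_unique:
  assumes h: "h \<in> \<Gamma>p" and v: "v \<in> \<Gamma>" and k: "geodesic_endpoint M E g \<alpha> h v k"
  shows "k = hsec exp h v"
proof -
  obtain I :: "real set" and \<gamma> B \<gamma>' where I: "{0..1} \<subseteq> I" "open I" and pos: "\<And>t. t \<in> I \<Longrightarrow> \<gamma> t \<in> \<Gamma>p"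
    and B: "is_metric_spray M E g \<alpha> B"
    and d1: "\<And>t. t \<in> I \<Longrightarrow> has_mb_deriv \<X> \<gamma> t 1 (\<gamma>' t)"
    and d2: "\<And>t. t \<in> I \<Longrightarrow> has_mb_deriv \<X> \<gamma>' t 1 (B (\<gamma> t) (\<gamma>' t) (\<gamma>' t))"
    and init: "\<gamma> 0 = h" "has_mb_deriv \<X> \<gamma> 0 1 v" "\<gamma> 1 = k"
  proof -
    obtain I \<gamma> where I: "{0..1} \<subseteq> I" "is_geodesic M E g \<alpha> I \<gamma>" "\<gamma> 0 = h" "has_mb_deriv \<X> \<gamma> 0 1 v" "\<gamma> 1 = k"
      using k unfolding geodesic_endpoint_def by blast
    from I(2) obtain B \<gamma>' where B: "is_metric_spray M E g \<alpha> B" "open I" "\<And>t. t \<in> I \<Longrightarrow> \<gamma> t \<in> \<Gamma>p"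
      "\<And>t. t \<in> I \<Longrightarrow> has_mb_deriv \<X> \<gamma> t 1 (\<gamma>' t)"
      "\<And>t. t \<in> I \<Longrightarrow> has_mb_deriv \<X> \<gamma>' t 1 (B (\<gamma> t) (\<gamma>' t) (\<gamma>' t))"
      unfolding is_geodesic_def by blast
    show thesis
      by (rule that[of I \<gamma> B \<gamma>']) (fact I B)+
  qed
  have mem: "\<gamma>' t \<in> \<Gamma>" if "t \<in> I" for t
    using d1[OF that] by (simp add: has_mb_deriv_def limitin_Cinf_clim)
  have I01: "0 \<in> I" "1 \<in> I"
    using I(1) by auto
  have v0: "\<gamma>' 0 = v"
    by (rule sec.has_mb_deriv_unique[OF d1[OF I01(1)] init(2)])
  have k\<Gamma>: "k \<in> \<Gamma>"
    using pos[OF I01(2)] init(3) pos_Herm_sections_subset by blast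
  show ?thesis
  proof (rule section_eqI[OF Herm_sectionsD[OF k\<Gamma>] hsec_herm[OF h v]])
    fix x
    let ?F = "\<lambda>v. fmat E (triv_at x) x (v x)"
    obtain W where W: "(W, triv_at x) \<in> trivs E" "x \<in> W"
      using triv_at_mem by blast
    have "?F (\<gamma> 1) = hfun exp (?F h) (?F v)"
    proof (rule matrix_geodesic_unique[where G = "\<lambda>t. ?F (\<gamma> t)" and G' = "\<lambda>t. ?F (\<gamma>' t)", OF
          fmat_posdef[OF h trivialized_triv_at] fmat_herm[OF v trivialized_triv_at] I])
      fix t assume t: "t \<in> I"
      show "((\<lambda>t. ?F (\<gamma> t)) has_vector_derivative ?F (\<gamma>' t)) (at t)"
        by (rule has_mb_deriv_pointwise[OF d1[OF t] W])
      have "?F (B (\<gamma> t) (\<gamma>' t) (\<gamma>' t)) = ?F (\<gamma>' t) ** matrix_inv (?F (\<gamma> t)) ** ?F (\<gamma>' t)"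
        unfolding metric_spray_unique[OF B pos[OF t] mem[OF t]] fmat_spray[OF pos[OF t] mem[OF t] mem[OF t] W] spray_mat_diag_eq ..
      with has_mb_deriv_pointwise[OF d2[OF t] W]
      show "((\<lambda>t. ?F (\<gamma>' t)) has_vector_derivative ?F (\<gamma>' t) ** matrix_inv (?F (\<gamma> t)) ** ?F (\<gamma>' t)) (at t)"
        by simp
      show "invertible (?F (\<gamma> t))"
        by (intro posdef_invertible fmat_posdef pos[OF t] trivialized_triv_at)
    qed (simp_all add: init v0)
    then show "?F k = ?F (hsec exp h v)"
      by (simp add: init(3) fmat_hsec_at[OF h v])
  qed
qed

lemma L2_exp_eq:
  assumes "h \<in> \<Gamma>p" "v \<in> \<Gamma>"
  shows "L2_exp M E g \<alpha> h v = hsec exp h v"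
  unfolding L2_exp_def
  by (rule the_equality[where P = "geodesic_endpoint M E g \<alpha> h v"])
    (use hsec_exp_geodesic geodesic_endpoint_unique assms in auto)

lemma L2_exp_diffeomorphism:
  assumes h: "h \<in> \<Gamma>p"
  shows "L2_exp_domain M E g \<alpha> h = \<Gamma> \<and> mb_diffeomorphism \<X> \<X> \<Gamma> \<Gamma>p (L2_exp M E g \<alpha> h)"
proof
  show "L2_exp_domain M E g \<alpha> h = \<Gamma>"
    unfolding L2_exp_domain_def using hsec_exp_geodesic[OF h] geodesic_endpoint_unique[OF h] by blast
  have bij: "bij_betw (L2_exp M E g \<alpha> h) \<Gamma> \<Gamma>p"
    using bij_betw_hsec_exp[OF h] bij_betw_cong[of \<Gamma> "L2_exp M E g \<alpha> h" "hsec exp h" \<Gamma>p] L2_exp_eq[OF h] by blast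
  \<comment> \<open>The inverse in \<open>mb_diffeomorphism\<close> is \<open>inv_into\<close>; its
    agreement with the logarithm on \<Gamma>p is all that \<open>hsec_ln_smooth\<close> asks
    for.\<close>
  have "inv_into \<Gamma> (L2_exp M E g \<alpha> h) k = hsec ln h k" if k: "k \<in> \<Gamma>p" for k
  proof (rule inv_into_f_eq)
    show "inj_on (L2_exp M E g \<alpha> h) \<Gamma>"
      using bij by (simp add: bij_betw_def)
    show "hsec ln h k \<in> \<Gamma>"
      by (rule hsec_ln_mem[OF h k])
    then show "L2_exp M E g \<alpha> h (hsec ln h k) = k"
      by (simp add: L2_exp_eq[OF h] hsec_exp_ln[OF h k])
  qed
  then show "mb_diffeomorphism \<X> \<X> \<Gamma> \<Gamma>p (L2_exp M E g \<alpha> h)"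
    unfolding mb_diffeomorphism_def
    using bij hsec_exp_smooth[OF h, of "L2_exp M E g \<alpha> h"] hsec_ln_smooth[OF h, of "inv_into \<Gamma> (L2_exp M E g \<alpha> h)"]
      L2_exp_eq[OF h] openin_Herm_sections openin_pos_Herm_sections by simp
qed

end

theorem theorem3p8:
  fixes M :: "'m::t2_space manifold"
    and E :: "('m, 'v::ab_group_add, 'r::finite) vector_bundle"
    and g :: "'m metric_coeffs"
    and \<alpha> :: "'m \<Rightarrow> real"
    and h :: "('m, 'v) form_section"
  assumes "closed_oriented_manifold M"
    and "complex_vector_bundle M E"
    and "riemannian_metric M g"
    and "smooth_fun_on M UNIV \<alpha>"
    and "\<forall>x. \<alpha> x > - 1 / real CARD('r)"
    and "h \<in> pos_Herm_sections M E"
  shows "L2_exp_domain M E g \<alpha> h = Herm_sections M E \<and>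
    mb_diffeomorphism (Cinf_topology M E) (Cinf_topology M E)
      (Herm_sections M E) (pos_Herm_sections M E) (L2_exp M E g \<alpha> h)"
proof -
  interpret L2_bundle M E g \<alpha>
    by unfold_locales (use assms in auto)
  show ?thesis
    by (rule L2_exp_diffeomorphism[OF assms(6)])
qed

end
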